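(* Let $\mathcal I=(-1,1)$ and let $\mathcal B\subset L^2(\mathcal I,\mathbb R^{q})$, $q=m+p$, be a controllable linear differential behavior with McMillan degree $\mathfrak n(\mathcal B)$ and lag $\mathfrak l=\mathfrak l(\mathcal B)$. Let $L=\mathfrak l+1$ and let $\operatorname{col}(\overline u,\overline y)\in\mathcal B$ be such that $\overline u$ is persistently exciting of order $L+\mathfrak n(\mathcal B)$. Partition the rows of the Gramian as $$\Gamma_{L,L}(\overline u,\overline y)=\operatorname{col}\bigl(\Gamma_{u^{(0)}},\dots,\Gamma_{u^{(L-1)}},\Gamma_{y^{(0)}},\dots,\Gamma_{y^{(L-1)}}\bigr),\quad \Gamma_{u^{(j)}}\in\mathbb R^{m\times Lq},\ \Gamma_{y^{(j)}}\in\mathbb R^{p\times Lq}.$$ Let $\xi^0\in\mathbb R^{\mathfrak l q}$ and $N\in\mathbb N$. Consider the polynomially restricted problem $$(\mathrm P_N)\quad \operatorname*{minimize}_{w=\operatorname{col}(u,y)\in\mathcal B\cap\operatorname{im}P_N}\ \|y\|^2+\|u^{(\mathfrak l)}\|^2\quad\text{s.t. }\Lambda_{\mathfrak l}(w)(-1)=\xi^0$$ and the data-driven problem $$(\mathrm D_N)\quad \operatorname*{minimize}_{\hat g\in\ell^2(\mathbb N,\mathbb R^{Lq})}\ \sum_{i<N}\bigl(\|\Gamma_{y^{(0)}}\hat g_i\|_2^2+\|\Gamma_{u^{(\mathfrak l)}}\hat g_i\|_2^2\bigr)\|\pi_i\|^2$$ subject to $$\hat g_i=0\ (i\ge N),\qquad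 \mathcal D(\Gamma_{u^{(k-1)}}\hat g)=\Gamma_{u^{(k)}}\hat g,\quad \mathcal D(\Gamma_{y^{(k-1)}}\hat g)=\Gamma_{y^{(k)}}\hat g\quad(k=1,\dots,\mathfrak l),$$ $$\xi^0=\sum_{i<N}(-1)^i\operatorname{col}\bigl(\Gamma_{u^{(0)}},\Gamma_{y^{(0)}},\dots,\Gamma_{u^{(\mathfrak l-1)}},\Gamma_{y^{(\mathfrak l-1)}}\bigr)\hat g_i .$$ Then $(\mathrm P_N)$ and $(\mathrm D_N)$ are equivalent in the following sense: $w=\operatorname{col}(u,y)$ solves $(\mathrm P_N)$ if and only if there is a solution $\hat g$ of $(\mathrm D_N)$ such that $$u^{(k)}=\sum_{i<N}(\Gamma_{u^{(k)}}\hat g_i)\pi_i,\qquad y^{(k)}=\sum_{i<N}(\Gamma_{y^{(k)}}\hat g_i)\pi_i,\qquad k=0,\dots,\mathfrak l .$$ In particular, the optimal values of the two problems coincide.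
   Context: $\mathbb N$ includes $0$; $\mathcal I=(-1,1)$; $\|\cdot\|$ is the $L^2(\mathcal I)$-norm and $\|\cdot\|_2$ the Euclidean norm. $\pi_i$, $i\in\mathbb N$, is the Legendre polynomial of degree $i$ normalized by $\pi_i(1)=1$ (so $\pi_i(-1)=(-1)^i$). $\operatorname{im}P_N$ is the space of $\mathbb R^{q}$-valued polynomial functions on $\mathcal I$ of degree at most $N-1$. Matrices act on sequences entrywise: $(\Gamma\hat g)_i=\Gamma\hat g_i$. The operator $\mathcal D$ on sequences, representing $\frac{d}{dt}$ in Legendre coefficients, is $(\mathcal D\hat f)_i=(2i+1)\sum_{j\ge i+1,\ i+j\text{ odd}}\hat f_j$, $i\in\mathbb N$ (only applied here to finitely supported sequences). For $f\in H^{k-1}(\mathcal I,\mathbb R^d)$, $\Lambda_k(f)=\operatorname{col}(f,f^{(1)},\dots,f^{(k-1)})$ (vertical stacking; for $k=0$ it is empty and the corresponding initial condition is void). $\Lambda_{L,K}(u,y)=\operatorname{col}(\Lambda_L(u),\Lambda_K(y))$ and $\Gamma_{L,K}(u,y)=\int_{\mathcal I}\Lambda_{L,K}(u,y)\Lambda_{L,K}(u,y)^\top dt$. A function $f:\mathcal I\to\mathbb R^d$ is persistently exciting of order $L\ge1$ if $f\in H^{L-1}(\mathcal I,\mathbb R^d)$ and $\int_{\mathcal I}\Lambda_L(f)\Lambda_L(f)^\top dt$ is positive definite. A linear differential behavior is a set $\mathcal B=\{w\in L^2(\mathcal I,\mathbb R^q)\mid R(\frac{d}{dt})w=0\}$ with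 $R(s)=R_0+\dots+R_rs^r\in\mathbb R^{g\times q}[s]$, where $R(\frac{d}{dt})w=0$ is meant weakly: $\sum_{i=0}^r(-1)^i\int_{\mathcal I}w^\top R_i^\top\phi^{(i)}\,dt=0$ for all $\phi\in C_c^\infty(\mathcal I,\mathbb R^g)$. Trajectories are partitioned as $w=\operatorname{col}(u,y)$ with input $u$ ($m$ components) and output $y$ ($p$ components) such that $\mathcal B$ admits an input-state-output representation: matrices $A\in\mathbb R^{n\times n}$, $B\in\mathbb R^{n\times m}$, $C\in\mathbb R^{p\times n}$, $D\in\mathbb R^{p\times m}$ such that $w=\operatorname{col}(u,y)\in C^\infty(\overline{\mathcal I},\mathbb R^q)$ belongs to $\mathcal B$ if and only if there is $x\in C^\infty(\overline{\mathcal I},\mathbb R^n)$ with $\frac{d}{dt}x=Ax+Bu$, $y=Cx+Du$. The McMillan degree $\mathfrak n(\mathcal B)$ is the minimal state dimension $n$ among all such representations. With $\mathcal O_k=\operatorname{col}(C,CA,\dots,CA^k)$ (and $\mathcal O_{-1}$ the empty matrix, of rank $0$), the lag is $\mathfrak l(\mathcal B)=\min\{k\in\mathbb N\mid \operatorname{rank}\mathcal O_k=\operatorname{rank}\mathcal O_{k-1}\}$; it does not depend on the chosen representation. $\mathcal B$ is controllable if for all $w_0,w_1\in\mathcal B$ there are $t_1\in(0,1)$ and $w\in\mathcal B$ with $w(t)=w_0(t)$ for (a.e.) $t\in(-1,0]$ and $w(t)=w_1(t-t_1)$ for (a.e.) $t\in[t_1,1)$. *)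

theory Defs
  imports "HOL-Analysis.Analysis" "Jordan_Normal_Form.DL_Rank"
begin

hide_type (open) Finite_Cartesian_Product.vec
hide_const (open) Finite_Cartesian_Product.vec Finite_Cartesian_Product.mat
  Finite_Cartesian_Product.row Cartesian_Space.rank
unbundle no vec_syntax and no inner_syntax


section \<open>Square integrable signals and weak derivatives\<close>

text \<open>A signal is a total function whose values outside \<open>(-1,1)\<close> are irrelevant. Elements of
  \<open>L\<^sup>2\<close> are represented by functions; all notions below are invariant under modification on null
  sets, and equality in \<open>L\<^sup>2\<close> is stated as equality almost everywhere.\<close>

abbreviation unit_ivl :: "real set" where
  "unit_ivl \<equiv> {-1<..<1}"

abbreviation leb_I :: "real measure" where
  "leb_I \<equiv> lebesgue_on unit_ivl"

definition L2 :: "(real \<Rightarrow> real) set" where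
  "L2 = {f \<in> borel_measurable leb_I. integrable leb_I (\<lambda>t. (f t)\<^sup>2)}"

definition L2v :: "nat \<Rightarrow> (real \<Rightarrow> real vec) set" where
  "L2v d = {f \<in> unit_ivl \<rightarrow> carrier_vec d. \<forall>i<d. (\<lambda>t. f t $ i) \<in> L2}"

definition L2_norm :: "(real \<Rightarrow> real) \<Rightarrow> real" where
  "L2_norm f = sqrt (\<integral>t. (f t)\<^sup>2 \<partial>leb_I)"

definition L2v_norm :: "(real \<Rightarrow> real vec) \<Rightarrow> real" where
  "L2v_norm f = sqrt (\<integral>t. f t \<bullet> f t \<partial>leb_I)"

definition test_fun :: "(real \<Rightarrow> real) set" where
  "test_fun = {\<phi>. (\<forall>k t. (deriv ^^ k) \<phi> field_differentiable at t) \<and>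
                  (\<exists>K. compact K \<and> K \<subseteq> unit_ivl \<and> (\<forall>t. t \<notin> K \<longrightarrow> \<phi> t = 0))}"

definition test_funv :: "nat \<Rightarrow> (real \<Rightarrow> real vec) set" where
  "test_funv d = {\<phi>. (\<forall>t. \<phi> t \<in> carrier_vec d) \<and> (\<forall>i<d. (\<lambda>t. \<phi> t $ i) \<in> test_fun)}"

definition derivv :: "nat \<Rightarrow> nat \<Rightarrow> (real \<Rightarrow> real vec) \<Rightarrow> real \<Rightarrow> real vec" where
  "derivv d k \<phi> t = vec d (\<lambda>i. (deriv ^^ k) (\<lambda>s. \<phi> s $ i) t)"

definition has_weak_deriv :: "nat \<Rightarrow> (real \<Rightarrow> real) \<Rightarrow> (real \<Rightarrow> real) \<Rightarrow> bool" where
  "has_weak_deriv k f g \<longleftrightarrow> g \<in> L2 \<and>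
     (\<forall>\<phi>\<in>test_fun. (\<integral>t. f t * (deriv ^^ k) \<phi> t \<partial>leb_I) = (-1) ^ k * (\<integral>t. g t * \<phi> t \<partial>leb_I))"

text \<open>The weak derivative is determined up to null sets only; a representative is chosen.\<close>

definition weak_deriv :: "nat \<Rightarrow> (real \<Rightarrow> real) \<Rightarrow> real \<Rightarrow> real" where
  "weak_deriv k f = (SOME g. has_weak_deriv k f g)"

definition weak_derivv :: "nat \<Rightarrow> nat \<Rightarrow> (real \<Rightarrow> real vec) \<Rightarrow> real \<Rightarrow> real vec" where
  "weak_derivv d k f t = vec d (\<lambda>i. weak_deriv k (\<lambda>s. f s $ i) t)"

definition sobolev :: "nat \<Rightarrow> nat \<Rightarrow> (real \<Rightarrow> real vec) set" where
  "sobolev d k = {f \<in> L2v d. \<forall>i<d. \<forall>j\<le>k. \<exists>g. has_weak_deriv j (\<lambda>s. f s $ i) g}"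

text \<open>The value at \<open>-1\<close> of a signal is that of its continuous representative on \<open>[-1,1]\<close>.\<close>

definition has_left_value :: "nat \<Rightarrow> (real \<Rightarrow> real vec) \<Rightarrow> real vec \<Rightarrow> bool" where
  "has_left_value d f v \<longleftrightarrow>
     (\<exists>g. (\<forall>t\<in>{-1..1}. g t \<in> carrier_vec d) \<and> (\<forall>i<d. continuous_on {-1..1} (\<lambda>t. g t $ i)) \<and>
          (AE t in leb_I. f t = g t) \<and> g (-1) = v)"


section \<open>Stacking, Gramians and persistency of excitation\<close>

primrec stack_vec :: "(nat \<Rightarrow> real vec) \<Rightarrow> nat \<Rightarrow> real vec" where
  "stack_vec f 0 = vNil"
| "stack_vec f (Suc k) = stack_vec f k @\<^sub>v f k"

primrec stack_mat :: "nat \<Rightarrow> (nat \<Rightarrow> real mat) \<Rightarrow> nat \<Rightarrow> real mat" where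
  "stack_mat nc M 0 = 0\<^sub>m 0 nc"
| "stack_mat nc M (Suc k) = stack_mat nc M k @\<^sub>r M k"

definition row_block :: "real mat \<Rightarrow> nat \<Rightarrow> nat \<Rightarrow> real mat" where
  "row_block M s k = mat k (dim_col M) (\<lambda>(i, j). M $$ (s + i, j))"

definition Lam :: "nat \<Rightarrow> nat \<Rightarrow> (real \<Rightarrow> real vec) \<Rightarrow> real \<Rightarrow> real vec" where
  "Lam d k f t = stack_vec (\<lambda>j. weak_derivv d j f t) k"

definition Lam2 :: "nat \<Rightarrow> nat \<Rightarrow> nat \<Rightarrow> nat \<Rightarrow> (real \<Rightarrow> real vec) \<Rightarrow> (real \<Rightarrow> real vec) \<Rightarrow> real \<Rightarrow> real vec" where
  "Lam2 m p L K u y t = Lam m L u t @\<^sub>v Lam p K y t"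

definition gram :: "nat \<Rightarrow> (real \<Rightarrow> real vec) \<Rightarrow> real mat" where
  "gram d f = mat d d (\<lambda>(i, j). \<integral>t. f t $ i * f t $ j \<partial>leb_I)"

definition Gramian :: "nat \<Rightarrow> nat \<Rightarrow> nat \<Rightarrow> nat \<Rightarrow> (real \<Rightarrow> real vec) \<Rightarrow> (real \<Rightarrow> real vec) \<Rightarrow> real mat" where
  "Gramian m p L K u y = gram (L * m + K * p) (Lam2 m p L K u y)"

definition Gram_u :: "nat \<Rightarrow> real mat \<Rightarrow> nat \<Rightarrow> real mat" where
  "Gram_u m G j = row_block G (j * m) m"

definition Gram_y :: "nat \<Rightarrow> nat \<Rightarrow> nat \<Rightarrow> real mat \<Rightarrow> nat \<Rightarrow> real mat" where
  "Gram_y m p L G j = row_block G (L * m + j * p) p"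

definition positive_definite :: "nat \<Rightarrow> real mat \<Rightarrow> bool" where
  "positive_definite d M \<longleftrightarrow> M \<in> carrier_mat d d \<and> transpose_mat M = M \<and>
     (\<forall>v\<in>carrier_vec d. v \<noteq> 0\<^sub>v d \<longrightarrow> v \<bullet> (M *\<^sub>v v) > 0)"

definition persistently_exciting :: "nat \<Rightarrow> nat \<Rightarrow> (real \<Rightarrow> real vec) \<Rightarrow> bool" where
  "persistently_exciting d L f \<longleftrightarrow>
     L \<ge> 1 \<and> f \<in> sobolev d (L - 1) \<and> positive_definite (L * d) (gram (L * d) (Lam d L f))"


section \<open>Linear differential behaviors\<close>

definition kernel_behavior :: "nat \<Rightarrow> nat \<Rightarrow> nat \<Rightarrow> (nat \<Rightarrow> real mat) \<Rightarrow> (real \<Rightarrow> real vec) set" where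
  "kernel_behavior q g r R =
     {w \<in> L2v q. \<forall>\<phi>\<in>test_funv g.
        (\<Sum>i\<le>r. (-1) ^ i * (\<integral>t. w t \<bullet> (transpose_mat (R i) *\<^sub>v derivv g i \<phi> t) \<partial>leb_I)) = 0}"

definition linear_differential_behavior :: "nat \<Rightarrow> (real \<Rightarrow> real vec) set \<Rightarrow> bool" where
  "linear_differential_behavior q \<B> \<longleftrightarrow>
     (\<exists>g r R. (\<forall>i\<le>r. R i \<in> carrier_mat g q) \<and> \<B> = kernel_behavior q g r R)"

definition controllable :: "(real \<Rightarrow> real vec) set \<Rightarrow> bool" where
  "controllable \<B> \<longleftrightarrow>
     (\<forall>w0\<in>\<B>. \<forall>w1\<in>\<B>. \<exists>t1\<in>{0<..<1}. \<exists>w\<in>\<B>.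
        (AE t in lebesgue_on {-1<..0}. w t = w0 t) \<and>
        (AE t in lebesgue_on {t1..<1}. w t = w1 (t - t1)))"

definition input_part :: "nat \<Rightarrow> (real \<Rightarrow> real vec) \<Rightarrow> real \<Rightarrow> real vec" where
  "input_part m w t = vec_first (w t) m"

definition output_part :: "nat \<Rightarrow> (real \<Rightarrow> real vec) \<Rightarrow> real \<Rightarrow> real vec" where
  "output_part p w t = vec_last (w t) p"

text \<open>Smoothness on the closed interval: derivatives of all orders exist on \<open>[-1,1]\<close>, one-sided at
  the end points.\<close>

definition smooth_closed :: "(real \<Rightarrow> real) \<Rightarrow> bool" where
  "smooth_closed f \<longleftrightarrow>
     (\<exists>F. F 0 = f \<and>
          (\<forall>k. \<forall>t\<in>{-1..1}. (F k has_real_derivative F (Suc k) t) (at t within {-1..1})))"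

definition smoothv :: "nat \<Rightarrow> (real \<Rightarrow> real vec) set" where
  "smoothv d = {f \<in> {-1..1} \<rightarrow> carrier_vec d. \<forall>i<d. smooth_closed (\<lambda>t. f t $ i)}"

definition iso_representation ::
  "nat \<Rightarrow> nat \<Rightarrow> (real \<Rightarrow> real vec) set \<Rightarrow> nat \<Rightarrow> real mat \<Rightarrow> real mat \<Rightarrow> real mat \<Rightarrow> real mat \<Rightarrow> bool" where
  "iso_representation m p \<B> n A B C D \<longleftrightarrow>
     A \<in> carrier_mat n n \<and> B \<in> carrier_mat n m \<and> C \<in> carrier_mat p n \<and> D \<in> carrier_mat p m \<and>
     (\<forall>w\<in>smoothv (m + p).
        w \<in> \<B> \<longleftrightarrow>
        (\<exists>x\<in>smoothv n. \<forall>t\<in>{-1..1}.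
           (\<forall>i<n. ((\<lambda>s. x s $ i) has_real_derivative
              (A *\<^sub>v x t + B *\<^sub>v input_part m w t) $ i) (at t within {-1..1})) \<and>
           output_part p w t = C *\<^sub>v x t + D *\<^sub>v input_part m w t))"

definition McMillan_degree :: "nat \<Rightarrow> nat \<Rightarrow> (real \<Rightarrow> real vec) set \<Rightarrow> nat" where
  "McMillan_degree m p \<B> = (LEAST n. \<exists>A B C D. iso_representation m p \<B> n A B C D)"

abbreviation mat_rank :: "real mat \<Rightarrow> nat" where
  "mat_rank M \<equiv> vec_space.rank (dim_row M) M"

text \<open>\<open>obs_mat n A C k\<close> has the \<open>k\<close> block rows \<open>C, CA, \<dots>, CA\<^sup>k\<^sup>-\<^sup>1\<close>. The index is thus shifted by
  one against \<open>\<O>\<^sub>k = col(C, \<dots>, CA\<^sup>k)\<close>, so that \<open>\<O>\<close> with index \<open>-1\<close> becomes \<open>k = 0\<close>.\<close>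

definition obs_mat :: "nat \<Rightarrow> real mat \<Rightarrow> real mat \<Rightarrow> nat \<Rightarrow> real mat" where
  "obs_mat n A C k = stack_mat n (\<lambda>j. C * A ^\<^sub>m j) k"

definition lag_of_pair :: "nat \<Rightarrow> real mat \<Rightarrow> real mat \<Rightarrow> nat" where
  "lag_of_pair n A C = (LEAST k. mat_rank (obs_mat n A C (k + 1)) = mat_rank (obs_mat n A C k))"

text \<open>The lag is the common value over all representations.\<close>

definition lag :: "nat \<Rightarrow> nat \<Rightarrow> (real \<Rightarrow> real vec) set \<Rightarrow> nat" where
  "lag m p \<B> = (THE l. \<exists>n A B C D. iso_representation m p \<B> n A B C D \<and> l = lag_of_pair n A C)"


section \<open>Legendre polynomials and coefficient sequences\<close>

text \<open>Rodrigues' formula.\<close>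

definition legendre :: "nat \<Rightarrow> real poly" where
  "legendre n = Polynomial.smult (1 / (2 ^ n * fact n)) ((pderiv ^^ n) ([:-1, 0, 1:] ^ n))"

definition legendre_D :: "nat \<Rightarrow> (nat \<Rightarrow> real vec) \<Rightarrow> nat \<Rightarrow> real vec" where
  "legendre_D d f i = vec d (\<lambda>r. real (2 * i + 1) * (\<Sum>\<^sub>\<infinity>j | j \<ge> i + 1 \<and> odd (i + j). f j $ r))"

definition ell2 :: "nat \<Rightarrow> (nat \<Rightarrow> real vec) set" where
  "ell2 d = {g. (\<forall>i. g i \<in> carrier_vec d) \<and> summable (\<lambda>i. g i \<bullet> g i)}"

definition vec_norm2 :: "real vec \<Rightarrow> real" where
  "vec_norm2 v = sqrt (v \<bullet> v)"

text \<open>Polynomials of degree at most \<open>N - 1\<close>, i.e. only zero for \<open>N = 0\<close>.\<close>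

definition poly_signals :: "nat \<Rightarrow> nat \<Rightarrow> (real \<Rightarrow> real vec) set" where
  "poly_signals q N =
     {w \<in> L2v q. \<exists>P :: nat \<Rightarrow> real poly. (\<forall>i<q. \<forall>j\<ge>N. coeff (P i) j = 0) \<and>
        (AE t in leb_I. w t = vec q (\<lambda>i. poly (P i) t))}"


section \<open>The two optimization problems\<close>

definition PN_feasible ::
  "nat \<Rightarrow> nat \<Rightarrow> (real \<Rightarrow> real vec) set \<Rightarrow> nat \<Rightarrow> real vec \<Rightarrow> nat \<Rightarrow> (real \<Rightarrow> real vec) set" where
  "PN_feasible m p \<B> l \<xi> N =
     {w \<in> \<B> \<inter> poly_signals (m + p) N. has_left_value (l * (m + p)) (Lam (m + p) l w) \<xi>}"

definition PN_cost :: "nat \<Rightarrow> nat \<Rightarrow> nat \<Rightarrow> (real \<Rightarrow> real vec) \<Rightarrow> real" where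
  "PN_cost m p l w =
     (L2v_norm (output_part p w))\<^sup>2 + (L2v_norm (weak_derivv m l (input_part m w)))\<^sup>2"

definition PN_solution ::
  "nat \<Rightarrow> nat \<Rightarrow> (real \<Rightarrow> real vec) set \<Rightarrow> nat \<Rightarrow> real vec \<Rightarrow> nat \<Rightarrow> (real \<Rightarrow> real vec) \<Rightarrow> bool" where
  "PN_solution m p \<B> l \<xi> N w \<longleftrightarrow>
     is_arg_min (PN_cost m p l) (\<lambda>w. w \<in> PN_feasible m p \<B> l \<xi> N) w"

text \<open>In the data-driven problem, \<open>G\<close> is the Gramian with \<open>L = l + 1\<close> derivative blocks.\<close>

definition DN_feasible ::
  "nat \<Rightarrow> nat \<Rightarrow> real mat \<Rightarrow> nat \<Rightarrow> real vec \<Rightarrow> nat \<Rightarrow> (nat \<Rightarrow> real vec) set" where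
  "DN_feasible m p G l \<xi> N =
     {g \<in> ell2 ((l + 1) * (m + p)).
        (\<forall>i\<ge>N. g i = 0\<^sub>v ((l + 1) * (m + p))) \<and>
        (\<forall>k\<in>{1..l}.
           legendre_D m (\<lambda>i. Gram_u m G (k - 1) *\<^sub>v g i) = (\<lambda>i. Gram_u m G k *\<^sub>v g i) \<and>
           legendre_D p (\<lambda>i. Gram_y m p (l + 1) G (k - 1) *\<^sub>v g i) =
             (\<lambda>i. Gram_y m p (l + 1) G k *\<^sub>v g i)) \<and>
        \<xi> = finsum_vec TYPE(real) (l * (m + p))
              (\<lambda>i. (-1) ^ i \<cdot>\<^sub>v
                 (stack_mat ((l + 1) * (m + p)) (\<lambda>k. Gram_u m G k @\<^sub>r Gram_y m p (l + 1) G k) l *\<^sub>v g i))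
              {..<N}}"

definition DN_cost :: "nat \<Rightarrow> nat \<Rightarrow> real mat \<Rightarrow> nat \<Rightarrow> nat \<Rightarrow> (nat \<Rightarrow> real vec) \<Rightarrow> real" where
  "DN_cost m p G l N g =
     (\<Sum>i<N. ((vec_norm2 (Gram_y m p (l + 1) G 0 *\<^sub>v g i))\<^sup>2 + (vec_norm2 (Gram_u m G l *\<^sub>v g i))\<^sup>2)
             * (L2_norm (poly (legendre i)))\<^sup>2)"

definition DN_solution ::
  "nat \<Rightarrow> nat \<Rightarrow> real mat \<Rightarrow> nat \<Rightarrow> real vec \<Rightarrow> nat \<Rightarrow> (nat \<Rightarrow> real vec) \<Rightarrow> bool" where
  "DN_solution m p G l \<xi> N g \<longleftrightarrow>
     is_arg_min (DN_cost m p G l N) (\<lambda>g. g \<in> DN_feasible m p G l \<xi> N) g"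

end

theory Submission
  imports Defs
begin

text \<open>Along a trajectory with state \<open>x\<close>, the derivatives of \<open>y\<close> up to order \<open>l\<close> are fixed linear
  expressions (\<open>resp\<close>) in the derivatives of \<open>u\<close> up to order \<open>l\<close> and \<open>x\<close>. Suppose a linear form annihilates
  the data jets. Differentiating it at most \<open>n\<close> times and eliminating the state by a linear dependency of
  the rows \<open>\<zeta> A\<^sup>k\<close> gives a relation among derivatives of \<open>u\<close> only, which is trivial by persistency of
  excitation; controllability then kills the remaining row \<open>\<zeta>\<close>. Hence the image of the symmetric matrix
  \<open>\<Gamma>\<close> is exactly the space of jets compatible with the state equations.

  Integrating a polynomial trajectory against Legendre polynomials therefore produces coefficients of
  the form \<open>\<Gamma> g\<^sub>i\<close>, and the constraints with \<open>\<D>\<close> say that the polynomials with coefficients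
  \<open>\<Gamma> g\<^sub>i\<close> are successive derivatives. Conversely, such polynomials satisfy the output equations with
  some polynomial in place of the state, which need not solve the state equation. The output defect
  against the solution of the state equation with the same initial value and its first \<open>l - 1\<close> derivatives
  solve a homogeneous linear system, because \<open>C A\<^sup>l\<close> depends linearly on \<open>C, \<dots>, C A\<^sup>l\<^sup>-\<^sup>1\<close> by the
  definition of the lag. So the defect vanishes. The costs agree by Parseval's identity.\<close>

section \<open>Smooth functions and test functions\<close>

text \<open>The representation hypothesis speaks only about trajectories that are smooth on the
  closed interval, whereas the data, the behavior and the concatenations supplied by controllability
  are merely square integrable and solve the equations weakly. The analytic obstacle is to give
  every weak trajectory a continuous state. By linearity the zero-state response can be subtracted;
  it is a weak trajectory by duality with the adjoint equation. The remaining output belongs to zero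
  input, and each of its components solves a scalar equation with constant coefficients: otherwise
  the kernel equations would admit exponential outputs for too many exponents to come from a
  finite-dimensional state. Weak solutions of scalar equations are smooth, so the hypothesis becomes
  applicable. The dichotomy used there, membership up to a nonzero factor or a separating
  functional, is proved once over integral domains: over real polynomials it eliminates outputs,
  over the reals it yields the image of \<open>\<Gamma>\<close> and the dependence of rows that
  expresses the lag.\<close>

definition smooth_on :: "real set \<Rightarrow> (real \<Rightarrow> real) \<Rightarrow> bool" where
  "smooth_on S f \<longleftrightarrow>
     (\<exists>F. F 0 = f \<and> (\<forall>k. \<forall>t\<in>S. (F k has_real_derivative F (Suc k) t) (at t within S)))"

lemma smooth_closed_iff: "smooth_closed f \<longleftrightarrow> smooth_on {-1..1} f"
  by (simp add: smooth_closed_def smooth_on_def)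

text \<open>Iterating a choice of derivatives inside \<open>X\<close> produces the whole witness
  sequence, so smoothness follows from a single closure property and no formula for higher
  derivatives has to be written down. Derivatives are relative to \<open>S\<close>; the same
  argument covers the real line and the closed interval with one-sided derivatives.\<close>

lemma smooth_on_coinduct:
  assumes "f \<in> X"
    and step: "\<And>g. g \<in> X \<Longrightarrow> \<exists>g'\<in>X. \<forall>t\<in>S. (g has_real_derivative g' t) (at t within S)"
  shows "smooth_on S f"
proof -
  obtain d where d: "\<And>g. g \<in> X \<Longrightarrow> d g \<in> X"
    "\<And>g t. g \<in> X \<Longrightarrow> t \<in> S \<Longrightarrow> (g has_real_derivative d g t) (at t within S)"
    using step by metis
  have X: "(d ^^ k) f \<in> X" for k
    by (induction k) (auto simp: assms d)
  show ?thesis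
    unfolding smooth_on_def
    by (rule exI[of _ "\<lambda>k. (d ^^ k) f"]) (auto simp: d X)
qed

lemma smooth_on_deriv:
  assumes "smooth_on S f"
  obtains f' where "smooth_on S f'" "\<And>t. t \<in> S \<Longrightarrow> (f has_real_derivative f' t) (at t within S)"
proof -
  obtain F where F: "F 0 = f" "\<And>k t. t \<in> S \<Longrightarrow> (F k has_real_derivative F (Suc k) t) (at t within S)"
    using assms unfolding smooth_on_def by blast
  have "smooth_on S (F 1)"
    unfolding smooth_on_def by (rule exI[of _ "\<lambda>k. F (Suc k)"]) (auto simp: F)
  then show thesis
    using that F(2)[of _ 0] F(1) by (metis One_nat_def)
qed

lemma smooth_on_subset:
  assumes "smooth_on T f" "S \<subseteq> T"
  shows "smooth_on S f"
proof -
  obtain F where "F 0 = f" "\<And>k t. t \<in> T \<Longrightarrow> (F k has_real_derivative F (Suc k) t) (at t within T)"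
    using assms unfolding smooth_on_def by blast
  then show ?thesis
    using assms(2) unfolding smooth_on_def by (intro exI[of _ F]) (auto intro: DERIV_subset)
qed

lemma smooth_on_continuous:
  assumes "smooth_on S f"
  shows "continuous_on S f"
  using smooth_on_deriv[OF assms] by (metis (no_types, lifting) DERIV_continuous_on)

lemma smooth_on_const [simp, intro]: "smooth_on S (\<lambda>t. c)"
  by (rule smooth_on_coinduct[of _ "range (\<lambda>c t. c)"]) (auto intro!: exI[of _ 0] derivative_eq_intros)

lemma smooth_on_add [intro]:
  assumes "smooth_on S f" "smooth_on S g"
  shows "smooth_on S (\<lambda>t. f t + g t)"
proof (rule smooth_on_coinduct[of _ "{\<lambda>t. f t + g t |f g. smooth_on S f \<and> smooth_on S g}"])
  fix h assume "h \<in> {\<lambda>t. f t + g t |f g. smooth_on S f \<and> smooth_on S g}"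
  then obtain f g where h: "h = (\<lambda>t. f t + g t)" and fg: "smooth_on S f" "smooth_on S g" by auto
  obtain f' where f': "smooth_on S f'" "\<And>t. t \<in> S \<Longrightarrow> (f has_real_derivative f' t) (at t within S)"
    using smooth_on_deriv[OF fg(1)] by metis
  obtain g' where g': "smooth_on S g'" "\<And>t. t \<in> S \<Longrightarrow> (g has_real_derivative g' t) (at t within S)"
    using smooth_on_deriv[OF fg(2)] by metis
  show "\<exists>h'\<in>{\<lambda>t. f t + g t |f g. smooth_on S f \<and> smooth_on S g}.
      \<forall>t\<in>S. (h has_real_derivative h' t) (at t within S)"
    using f' g' by (intro bexI[of _ "\<lambda>t. f' t + g' t"]) (auto simp: h intro!: derivative_intros)
qed (use assms in auto)

lemma smooth_on_sum [intro]:
  assumes "\<And>i. i \<in> I \<Longrightarrow> smooth_on S (f i)"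
  shows "smooth_on S (\<lambda>t. \<Sum>i\<in>I. f i t)"
  using assms by (induction I rule: infinite_finite_induct) auto

text \<open>The derivative of a product is a sum of products; closing under sums gives a set of
  functions that is stable under differentiation, as coinduction requires.\<close>

inductive_set prod_span :: "real set \<Rightarrow> (real \<Rightarrow> real) set" for S where
  prod: "smooth_on S f \<Longrightarrow> smooth_on S g \<Longrightarrow> (\<lambda>t. f t * g t) \<in> prod_span S"
| add: "f \<in> prod_span S \<Longrightarrow> g \<in> prod_span S \<Longrightarrow> (\<lambda>t. f t + g t) \<in> prod_span S"

lemma prod_span_deriv:
  assumes "h \<in> prod_span S"
  shows "\<exists>h'\<in>prod_span S. \<forall>t\<in>S. (h has_real_derivative h' t) (at t within S)"
  using assms
proof induction
  case (prod f g)
  obtain f' where f': "smooth_on S f'" "\<And>t. t \<in> S \<Longrightarrow> (f has_real_derivative f' t) (at t within S)"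
    using smooth_on_deriv[OF prod(1)] by metis
  obtain g' where g': "smooth_on S g'" "\<And>t. t \<in> S \<Longrightarrow> (g has_real_derivative g' t) (at t within S)"
    using smooth_on_deriv[OF prod(2)] by metis
  have "(\<lambda>t. f' t * g t + g' t * f t) \<in> prod_span S"
    using prod f' g' by (intro prod_span.intros)
  then show ?case
    using f'(2) g'(2) by (intro bexI) (auto intro!: DERIV_mult)
next
  case (add f g)
  then obtain f' g' where "f' \<in> prod_span S" "\<forall>t\<in>S. (f has_real_derivative f' t) (at t within S)"
    "g' \<in> prod_span S" "\<forall>t\<in>S. (g has_real_derivative g' t) (at t within S)" by blast
  then show ?case
    by (intro bexI[of _ "\<lambda>t. f' t + g' t"]) (auto intro!: derivative_intros prod_span.add)
qed

lemma smooth_on_mult [intro]: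
  assumes "smooth_on S f" "smooth_on S g"
  shows "smooth_on S (\<lambda>t. f t * g t)"
  by (rule smooth_on_coinduct[of _ "prod_span S"]) (auto intro: assms prod_span_deriv prod_span.prod)

lemma smooth_on_poly [intro]: "smooth_on S (poly P)"
  by (rule smooth_on_coinduct[of _ "range poly"])
    (auto intro!: DERIV_subset[OF poly_DERIV])

lemma smooth_on_exp [intro]: "smooth_on S (\<lambda>t. exp (c * t))"
proof (rule smooth_on_coinduct[of _ "range (\<lambda>a t. a * exp (c * t))"])
  show "(\<lambda>t. exp (c * t)) \<in> range (\<lambda>a t. a * exp (c * t))"
    by (rule range_eqI[of _ _ 1]) auto
next
  fix g assume "g \<in> range (\<lambda>a t. a * exp (c * t))"
  then obtain a where g: "g = (\<lambda>t. a * exp (c * t))" by auto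
  have "\<forall>t\<in>S. (g has_real_derivative (a * c) * exp (c * t)) (at t within S)"
    by (auto simp: g intro!: derivative_eq_intros)
  then show "\<exists>g'\<in>range (\<lambda>a t. a * exp (c * t)). \<forall>t\<in>S. (g has_real_derivative g' t) (at t within S)"
    by (intro bexI[of _ "\<lambda>t. (a * c) * exp (c * t)"]) auto
qed

lemma smooth_on_affine:
  assumes "smooth_on UNIV f"
  shows "smooth_on UNIV (\<lambda>t. f (a * t + b))"
proof (rule smooth_on_coinduct[of _ "{\<lambda>t. c * f (a * t + b) |f c. smooth_on UNIV f}"])
  show "(\<lambda>t. f (a * t + b)) \<in> {\<lambda>t. c * f (a * t + b) |f c. smooth_on UNIV f}"
    using assms by (auto intro!: exI[of _ f] exI[of _ 1])
next
  fix h assume "h \<in> {\<lambda>t. c * f (a * t + b) |f c. smooth_on UNIV f}"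
  then obtain f c where h: "h = (\<lambda>t. c * f (a * t + b))" and f: "smooth_on UNIV f" by auto
  obtain f' where f': "smooth_on UNIV f'" "\<And>t. (f has_real_derivative f' t) (at t)"
    using smooth_on_deriv[OF f] by auto
  have "(h has_real_derivative (c * a) * f' (a * t + b)) (at t)" for t
    unfolding h by (rule derivative_eq_intros DERIV_chain2[OF f'(2)] refl | simp)+
  then show "\<exists>h'\<in>{\<lambda>t. c * f (a * t + b) |f c. smooth_on UNIV f}.
      \<forall>t\<in>UNIV. (h has_real_derivative h' t) (at t)"
    using f'(1) by (intro bexI[of _ "\<lambda>t. (c * a) * f' (a * t + b)"]) auto
qed

text \<open>The classical flat function exp(-1/x), with a polynomial in 1/x as an additional factor:
  the enlarged family is closed under differentiation.\<close>

definition flat_exp :: "real poly \<Rightarrow> real \<Rightarrow> real" where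
  "flat_exp P x = (if x > 0 then poly P (1 / x) * exp (- (1 / x)) else 0)"

lemma tendsto_poly_exp_neg: "((\<lambda>x. poly P x * exp (- x)) \<longlongrightarrow> 0) (at_top :: real filter)"
proof -
  have "((\<lambda>x. coeff P i * (x ^ i / exp x)) \<longlongrightarrow> coeff P i * 0) (at_top :: real filter)" for i
    by (intro tendsto_intros tendsto_power_div_exp_0)
  then have "((\<lambda>x. \<Sum>i\<le>degree P. coeff P i * (x ^ i / exp x)) \<longlongrightarrow> (\<Sum>i\<le>degree P. coeff P i * 0))
      (at_top :: real filter)"
    by (intro tendsto_sum)
  then show ?thesis
    by (simp add: poly_altdef sum_distrib_right exp_minus divide_inverse mult.assoc)
qed

lemma flat_exp_tendsto_0: "(flat_exp P \<longlongrightarrow> 0) (at 0)"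
proof -
  have "((\<lambda>x. poly P (inverse x) * exp (- inverse x)) \<longlongrightarrow> 0) (at_right (0::real))"
    using tendsto_poly_exp_neg[of P] by (rule filterlim_compose[OF _ filterlim_inverse_at_top_right])
  then have "(flat_exp P \<longlongrightarrow> 0) (at_right 0)"
    by (rule Lim_transform_eventually)
      (auto simp: flat_exp_def divide_inverse eventually_at_right_field intro!: exI[of _ 1])
  moreover have "(flat_exp P \<longlongrightarrow> 0) (at_left 0)"
    by (rule Lim_transform_eventually[OF tendsto_const])
      (auto simp: flat_exp_def eventually_at_left_field intro!: exI[of _ "-1"])
  ultimately show ?thesis
    by (simp add: filterlim_split_at)
qed

text \<open>With s = 1/x the derivative by x is -s^2 times the derivative by s, so P(s) exp(-s)
  becomes s^2 (P - P')(s) exp(-s). At 0 the difference quotient is again a flat function, with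
  polynomial s P(s), and tends to 0.\<close>

lemma flat_exp_deriv:
  "(flat_exp P has_real_derivative flat_exp ((P - pderiv P) * [:0, 0, 1:]) x) (at x)"
proof -
  consider "x > 0" | "x < 0" | "x = 0" by linarith
  then show ?thesis
  proof cases
    case 1
    have "((\<lambda>x. poly P (1 / x) * exp (- (1 / x))) has_real_derivative
       flat_exp ((P - pderiv P) * [:0, 0, 1:]) x) (at x)"
      using 1 by (auto intro!: derivative_eq_intros DERIV_chain2[OF poly_DERIV]
          simp: flat_exp_def field_simps power2_eq_square)
    then show ?thesis
      by (rule has_field_derivative_transform_within_open[of _ _ _ "{0<..}"])
        (use 1 in \<open>auto simp: flat_exp_def\<close>)
  next
    case 2
    have "((\<lambda>x. 0) has_real_derivative flat_exp ((P - pderiv P) * [:0, 0, 1:]) x) (at x)"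
      using 2 by (auto simp: flat_exp_def)
    then show ?thesis
      by (rule has_field_derivative_transform_within_open[of _ _ _ "{..<0}"])
        (use 2 in \<open>auto simp: flat_exp_def\<close>)
  next
    case 3
    have "((\<lambda>h. flat_exp (P * [:0, 1:]) h) \<longlongrightarrow> 0) (at 0)"
      by (rule flat_exp_tendsto_0)
    then have "((\<lambda>h. (flat_exp P (0 + h) - flat_exp P 0) / h) \<longlongrightarrow> 0) (at 0)"
      by (rule Lim_transform_eventually) (auto simp: flat_exp_def eventually_at_filter)
    then show ?thesis
      using 3 by (simp add: DERIV_def flat_exp_def)
  qed
qed

lemma smooth_on_flat_exp: "smooth_on UNIV (flat_exp P)"
  by (rule smooth_on_coinduct[of _ "range flat_exp"]) (auto intro: flat_exp_deriv)

section \<open>Closure properties of test functions\<close>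

lemma deriv_funpow_eq:
  assumes "\<And>k t. (F k has_real_derivative F (Suc k) t) (at t)"
  shows "(deriv ^^ k) (F 0) = F k"
proof (induction k)
  case (Suc k)
  have "deriv (F k) = F (Suc k)"
    by (rule ext) (rule DERIV_imp_deriv[OF assms])
  then show ?case using Suc by simp
qed simp

text \<open>Test functions are defined through iterates of \<open>deriv\<close>, while constructions
  provide explicit families of derivatives; uniqueness of derivatives identifies the two.\<close>

lemma smooth_on_UNIV_iff: "smooth_on UNIV f \<longleftrightarrow> (\<forall>k t. (deriv ^^ k) f field_differentiable at t)"
proof
  assume "smooth_on UNIV f"
  then obtain F where F: "F 0 = f" "\<And>k t. (F k has_real_derivative F (Suc k) t) (at t)"
    unfolding smooth_on_def by auto
  show "\<forall>k t. (deriv ^^ k) f field_differentiable at t"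
    using deriv_funpow_eq[of F, OF F(2)] F field_differentiable_def by metis
next
  assume *: "\<forall>k t. (deriv ^^ k) f field_differentiable at t"
  show "smooth_on UNIV f"
    unfolding smooth_on_def
    by (rule exI[of _ "\<lambda>k. (deriv ^^ k) f"])
      (use * in \<open>auto simp: field_differentiable_derivI\<close>)
qed

lemma test_fun_iff:
  "\<phi> \<in> test_fun \<longleftrightarrow> smooth_on UNIV \<phi> \<and> (\<exists>K. compact K \<and> K \<subseteq> unit_ivl \<and> (\<forall>t. t \<notin> K \<longrightarrow> \<phi> t = 0))"
  by (simp add: test_fun_def smooth_on_UNIV_iff)

lemma test_fun_smooth: "\<phi> \<in> test_fun \<Longrightarrow> smooth_on S \<phi>"
  by (meson smooth_on_subset subset_UNIV test_fun_iff)

lemma test_fun_DERIV: "\<phi> \<in> test_fun \<Longrightarrow> ((deriv ^^ k) \<phi> has_real_derivative (deriv ^^ Suc k) \<phi> t) (at t)"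
  by (simp add: test_fun_def field_differentiable_derivI)

lemma test_fun_zero [simp]: "(\<lambda>t. 0) \<in> test_fun"
  unfolding test_fun_iff by (auto intro!: exI[of _ "{}"])

lemma test_fun_add [intro]:
  assumes "\<phi> \<in> test_fun" "\<psi> \<in> test_fun"
  shows "(\<lambda>t. \<phi> t + \<psi> t) \<in> test_fun"
proof -
  obtain K L where "compact K" "K \<subseteq> unit_ivl" "\<forall>t. t \<notin> K \<longrightarrow> \<phi> t = 0"
    "compact L" "L \<subseteq> unit_ivl" "\<forall>t. t \<notin> L \<longrightarrow> \<psi> t = 0"
    using assms unfolding test_fun_iff by blast
  then show ?thesis
    using assms unfolding test_fun_iff
    by (auto intro!: exI[of _ "K \<union> L"] compact_Un)
qed

lemma test_fun_mult [intro]: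
  assumes "smooth_on UNIV f" "\<phi> \<in> test_fun"
  shows "(\<lambda>t. f t * \<phi> t) \<in> test_fun"
proof -
  obtain K where "compact K" "K \<subseteq> unit_ivl" "\<forall>t. t \<notin> K \<longrightarrow> \<phi> t = 0"
    using assms(2) unfolding test_fun_iff by blast
  then show ?thesis
    using assms unfolding test_fun_iff by (auto intro!: exI[of _ K])
qed

lemma test_fun_cmult [intro]: "\<phi> \<in> test_fun \<Longrightarrow> (\<lambda>t. c * \<phi> t) \<in> test_fun"
  by (rule test_fun_mult) auto

lemma test_fun_sum [intro]:
  assumes "\<And>i. i \<in> I \<Longrightarrow> f i \<in> test_fun"
  shows "(\<lambda>t. \<Sum>i\<in>I. f i t) \<in> test_fun"
  using assms by (induction I rule: infinite_finite_induct) auto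

lemma test_fun_deriv [intro]:
  assumes "\<phi> \<in> test_fun"
  shows "deriv \<phi> \<in> test_fun"
proof -
  obtain K where K: "compact K" "K \<subseteq> unit_ivl" "\<forall>t. t \<notin> K \<longrightarrow> \<phi> t = 0"
    using assms unfolding test_fun_iff by blast
  have "deriv \<phi> t = 0" if "t \<notin> K" for t
  proof (rule DERIV_imp_deriv)
    show "(\<phi> has_real_derivative 0) (at t)"
      by (rule has_field_derivative_transform_within_open[of "\<lambda>t. 0" _ _ "- K"])
        (use K that in \<open>auto simp: compact_imp_closed open_Compl\<close>)
  qed
  moreover have "(deriv ^^ k) (deriv \<phi>) field_differentiable at t" for k t
    using assms unfolding test_fun_def by (metis (mono_tags, lifting) funpow_Suc_right comp_apply mem_Collect_eq)
  ultimately show ?thesis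
    using K unfolding test_fun_def by blast
qed

lemma test_fun_deriv_funpow [intro]: "\<phi> \<in> test_fun \<Longrightarrow> (deriv ^^ k) \<phi> \<in> test_fun"
  by (induction k) auto

text \<open>The bound lies midway between 1 and the largest modulus that occurs in the compact set,
  which leaves a gap to both end points.\<close>

lemma test_fun_support:
  assumes "\<phi> \<in> test_fun"
  obtains a where "0 < a" "a < 1" "\<And>t. t \<notin> {-a..a} \<Longrightarrow> \<phi> t = 0"
proof -
  obtain K where K: "compact K" "K \<subseteq> unit_ivl" "\<forall>t. t \<notin> K \<longrightarrow> \<phi> t = 0"
    using assms unfolding test_fun_iff by blast
  show thesis
  proof (cases "K = {}")
    case True
    then show thesis using K that[of "1/2"] by auto
  next
    case False
    have "compact (abs ` K)"
      using K by (intro compact_continuous_image continuous_intros)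
    then obtain s where s: "s \<in> K" "\<And>t. t \<in> K \<Longrightarrow> \<bar>t\<bar> \<le> \<bar>s\<bar>"
      using compact_attains_sup[of "abs ` K"] False by fastforce
    have "s \<in> unit_ivl" using s(1) K(2) by blast
    then have "\<bar>s\<bar> < 1" by auto
    show thesis
    proof (rule that[of "(\<bar>s\<bar> + 1) / 2"])
      fix t :: real assume "t \<notin> {- ((\<bar>s\<bar> + 1) / 2)..(\<bar>s\<bar> + 1) / 2}"
      then have "\<bar>t\<bar> > (\<bar>s\<bar> + 1) / 2"
        unfolding atLeastAtMost_iff by linarith
      then have "\<bar>t\<bar> > \<bar>s\<bar>" using \<open>\<bar>s\<bar> < 1\<close> by auto
      then have "t \<notin> K" using s(2)[of t] by auto
      then show "\<phi> t = 0" using K by blast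
    qed (use \<open>\<bar>s\<bar> < 1\<close> in auto)
  qed
qed

text \<open>The factor \<open>k\<close> steepens the flanks: as it grows, the bumps converge
  pointwise, bounded by 1, to the indicator of the open interval from \<open>a\<close> to
  \<open>b\<close>.\<close>

definition bump :: "real \<Rightarrow> real \<Rightarrow> real \<Rightarrow> real \<Rightarrow> real" where
  "bump k a b x = flat_exp 1 (k * (x - a)) * flat_exp 1 (k * (b - x))"

lemma smooth_on_bump: "smooth_on UNIV (bump k a b)"
proof -
  have "smooth_on UNIV (\<lambda>x. flat_exp 1 (k * x + (- (k * a))) * flat_exp 1 ((- k) * x + k * b))"
    by (intro smooth_on_mult smooth_on_affine smooth_on_flat_exp)
  then show ?thesis
    by (simp add: bump_def[abs_def] algebra_simps)
qed

lemma bump_eq_0: "k > 0 \<Longrightarrow> x \<notin> {a<..<b} \<Longrightarrow> bump k a b x = 0"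
  by (auto simp: bump_def flat_exp_def zero_less_mult_iff)

lemma bump_pos: "k > 0 \<Longrightarrow> x \<in> {a<..<b} \<Longrightarrow> bump k a b x > 0"
  by (auto simp: bump_def flat_exp_def)

lemma flat_exp_1_bounds: "0 \<le> flat_exp 1 x" "flat_exp 1 x \<le> 1"
  by (auto simp: flat_exp_def)

lemma bump_bounds: "0 \<le> bump k a b x" "bump k a b x \<le> 1"
  using flat_exp_1_bounds by (auto simp: bump_def mult_le_one)

lemma bump_test_fun:
  assumes "-1 < a" "b < 1" "k > 0"
  shows "bump k a b \<in> test_fun"
  unfolding test_fun_iff using assms
  by (auto intro!: smooth_on_bump exI[of _ "{a..b}"] bump_eq_0)

lemma bump_tendsto:
  "(\<lambda>k. bump (real (Suc k)) a b x) \<longlonglongrightarrow> indicator {a<..<b} x"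
proof (cases "x \<in> {a<..<b}")
  case True
  have "(\<lambda>k. flat_exp 1 (real (Suc k) * c)) \<longlonglongrightarrow> 1" if "c > 0" for c :: real
  proof -
    have "(\<lambda>k. exp (- (inverse (real (Suc k)) * inverse c))) \<longlonglongrightarrow> exp (- (0 * inverse c))"
      by (intro tendsto_intros LIMSEQ_inverse_real_of_nat)
    then show ?thesis
      using that by (simp add: flat_exp_def divide_inverse zero_less_mult_iff del: of_nat_Suc)
  qed
  from tendsto_mult[OF this[of "x - a"] this[of "b - x"]]
  show ?thesis using True by (simp add: bump_def del: of_nat_Suc)
next
  case False
  then show ?thesis by (simp add: bump_eq_0 del: of_nat_Suc)
qed

section \<open>Integration over the open unit interval\<close>

lemma unit_ivl_sets [simp]: "unit_ivl \<in> sets lebesgue"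
  by simp

interpretation leb_I: finite_measure leb_I
  by (rule finite_measure_lebesgue_on) simp

lemma continuous_measurable_I: 
  assumes "continuous_on {-1..1} (f :: real \<Rightarrow> real)"
  shows "f \<in> borel_measurable leb_I"
  by (rule continuous_imp_measurable_on_sets_lebesgue)
    (use assms in \<open>auto intro: continuous_on_subset\<close>)

lemma continuous_bounded_I:
  assumes "continuous_on {-1..1} (f :: real \<Rightarrow> real)"
  obtains b where "\<And>t. t \<in> {-1..1} \<Longrightarrow> \<bar>f t\<bar> \<le> b"
proof -
  have "bounded (f ` {-1..1})"
    by (rule compact_imp_bounded) (use assms in \<open>auto intro: compact_continuous_image\<close>)
  then obtain b where "\<forall>x\<in>f ` {-1..1}. norm x \<le> b" unfolding bounded_iff by blast
  then show thesis by (intro that[of b]) auto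
qed

lemma integrable_mult_continuous:
  fixes f c :: "real \<Rightarrow> real"
  assumes "integrable leb_I f" "continuous_on {-1..1} c"
  shows "integrable leb_I (\<lambda>t. f t * c t)"
proof -
  obtain b where b: "\<And>t. t \<in> {-1..1} \<Longrightarrow> \<bar>c t\<bar> \<le> b"
    using continuous_bounded_I[OF assms(2)] by blast
  show ?thesis
  proof (rule Bochner_Integration.integrable_bound[of _ "\<lambda>t. b * f t"])
    have [measurable]: "c \<in> borel_measurable leb_I"
      using assms(2) by (rule continuous_measurable_I)
    show "(\<lambda>t. f t * c t) \<in> borel_measurable leb_I"
      using assms(1) by measurable
    have "\<bar>f t * c t\<bar> \<le> \<bar>b * f t\<bar>" if "t \<in> unit_ivl" for t
    proof -
      have "\<bar>c t\<bar> \<le> \<bar>b\<bar>" using b[of t] that by auto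
      then show ?thesis by (simp add: abs_mult mult.commute mult_mono)
    qed
    then show "AE t in leb_I. norm (f t * c t) \<le> norm (b * f t)"
      by (intro AE_I2) auto
  qed (use assms(1) in auto)
qed

lemma continuous_integrable_I:
  assumes "continuous_on {-1..1} f"
  shows "integrable leb_I (f :: real \<Rightarrow> real)"
  using integrable_mult_continuous[OF _ assms, of "\<lambda>t. 1"] by simp

section \<open>Square integrable functions\<close>

lemma continuous_L2:
  assumes "continuous_on {-1..1} f"
  shows "f \<in> L2"
  using assms unfolding L2_def
  by (auto intro!: continuous_measurable_I continuous_integrable_I continuous_intros)

lemma smooth_L2: "smooth_on {-1..1} f \<Longrightarrow> f \<in> L2"
  by (intro continuous_L2 smooth_on_continuous)

lemma L2_measurable [measurable_dest]: "f \<in> L2 \<Longrightarrow> f \<in> borel_measurable leb_I"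
  by (simp add: L2_def)

lemma L2_mult_integrable:
  assumes "f \<in> L2" "g \<in> L2"
  shows "integrable leb_I (\<lambda>t. f t * g t)"
proof (rule Bochner_Integration.integrable_bound[of _ "\<lambda>t. (f t)\<^sup>2 + (g t)\<^sup>2"])
  show "integrable leb_I (\<lambda>t. (f t)\<^sup>2 + (g t)\<^sup>2)"
    using assms by (auto simp: L2_def)
  show "(\<lambda>t. f t * g t) \<in> borel_measurable leb_I"
    using assms by (auto simp: L2_def)
  have "\<bar>a * b\<bar> \<le> a\<^sup>2 + b\<^sup>2" for a b :: real
  proof -
    have "0 \<le> (\<bar>a\<bar> - \<bar>b\<bar>)\<^sup>2" by simp
    then have "2 * \<bar>a * b\<bar> \<le> a\<^sup>2 + b\<^sup>2"
      by (simp add: power2_diff abs_mult)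
    then show ?thesis using zero_le_power2[of a] zero_le_power2[of b] by linarith
  qed
  then show "AE t in leb_I. norm (f t * g t) \<le> norm ((f t)\<^sup>2 + (g t)\<^sup>2)"
    by (intro AE_I2) auto
qed

lemma L2_integrable: "f \<in> L2 \<Longrightarrow> integrable leb_I f"
  using L2_mult_integrable[of f "\<lambda>t. 1"] by (simp add: continuous_L2)

lemma L2_zero [simp]: "(\<lambda>t. 0) \<in> L2"
  by (simp add: continuous_L2)

lemma L2_add [intro]:
  assumes "f \<in> L2" "g \<in> L2"
  shows "(\<lambda>t. f t + g t) \<in> L2"
proof -
  have "integrable leb_I (\<lambda>t. (f t)\<^sup>2 + (g t)\<^sup>2 + 2 * (f t * g t))"
    using assms L2_mult_integrable[OF assms] by (auto simp: L2_def)
  moreover have "(\<lambda>t. (f t)\<^sup>2 + (g t)\<^sup>2 + 2 * (f t * g t)) = (\<lambda>t. (f t + g t)\<^sup>2)"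
    by (auto simp: power2_sum)
  ultimately show ?thesis using assms by (auto simp: L2_def)
qed

lemma L2_cmult [intro]: "f \<in> L2 \<Longrightarrow> (\<lambda>t. c * f t) \<in> L2"
  by (auto simp: L2_def power_mult_distrib)

lemma L2_diff [intro]:
  assumes "f \<in> L2" "g \<in> L2"
  shows "(\<lambda>t. f t - g t) \<in> L2"
  using L2_add[OF assms(1) L2_cmult[OF assms(2), of "-1"]] by simp

lemma L2_sum [intro]:
  assumes "\<And>i. i \<in> I \<Longrightarrow> f i \<in> L2"
  shows "(\<lambda>t. \<Sum>i\<in>I. f i t) \<in> L2"
  using assms by (induction I rule: infinite_finite_induct) auto

lemma test_fun_L2: "\<phi> \<in> test_fun \<Longrightarrow> \<phi> \<in> L2"
  by (intro smooth_L2 test_fun_smooth)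

lemma L2_test_integrable: "f \<in> L2 \<Longrightarrow> \<phi> \<in> test_fun \<Longrightarrow> integrable leb_I (\<lambda>t. f t * \<phi> t)"
  by (rule L2_mult_integrable) (auto intro: test_fun_L2)

lemma integral_HK_I:
  fixes f :: "real \<Rightarrow> real"
  assumes "integrable leb_I f"
  shows "(\<integral>t. f t \<partial>leb_I) = integral {-1..1} f"
  using lebesgue_integral_eq_integral[OF assms] integral_open_interval_real[of "-1" 1 f] by simp

text \<open>The integral from -1 to t, written with an indicator over a fixed measure space so that
  Fubini's theorem applies directly.\<close>

definition primitive :: "(real \<Rightarrow> real) \<Rightarrow> real \<Rightarrow> real" where
  "primitive g t = (\<integral>s. indicator {..t} s * g s \<partial>leb_I)"

lemma indicator_integrable_I:
  fixes g :: "real \<Rightarrow> real"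
  assumes "integrable leb_I g"
  shows "integrable leb_I (\<lambda>s. indicator {..t} s * g s)"
proof (rule Bochner_Integration.integrable_bound[of _ g])
  have [measurable]: "{..t} \<inter> unit_ivl \<in> sets leb_I" by (auto simp: sets_restrict_space)
  have "(\<lambda>s. indicator ({..t} \<inter> unit_ivl) s * g s) \<in> borel_measurable leb_I"
    using assms by measurable
  then show "(\<lambda>s. indicator {..t} s * g s) \<in> borel_measurable leb_I"
    by (subst measurable_lebesgue_cong[of _ _ "\<lambda>s. indicator ({..t} \<inter> unit_ivl) s * g s"])
      (auto simp: indicator_def)
qed (use assms in \<open>auto simp: indicator_def\<close>)

lemma HK_integrable_I:
  fixes g :: "real \<Rightarrow> real"
  assumes "integrable leb_I g"
  shows "g integrable_on {-1..1}"
  using integrable_on_lebesgue_on[OF assms] by (simp add: integrable_on_open_interval_real)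

lemma primitive_eq_integral:
  assumes "integrable leb_I g" "t \<in> {-1..1}"
  shows "primitive g t = integral {-1..t} g"
proof -
  have "primitive g t = integral {-1..1} (\<lambda>s. indicator {..t} s * g s)"
    unfolding primitive_def by (rule integral_HK_I[OF indicator_integrable_I[OF assms(1)]])
  also have "\<dots> = integral {-1..1} (\<lambda>s. if s \<in> {..t} then g s else 0)"
    by (intro integral_cong) (auto simp: indicator_def)
  also have "\<dots> = integral ({..t} \<inter> {-1..1}) g"
    by (rule integral_restrict_Int)
  also have "{..t} \<inter> {-1..1} = {-1..t}"
    using assms(2) by auto
  finally show ?thesis .
qed

lemma primitive_lower [simp]: "primitive g (-1) = 0"
proof -
  have "primitive g (-1) = (\<integral>s. 0 \<partial>leb_I)"
    unfolding primitive_def by (rule Bochner_Integration.integral_cong) (auto simp: indicator_def)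
  then show ?thesis by simp
qed

lemma primitive_upper: "primitive g 1 = (\<integral>s. g s \<partial>leb_I)"
  unfolding primitive_def by (rule Bochner_Integration.integral_cong) (auto simp: indicator_def)

lemma primitive_continuous:
  assumes "integrable leb_I g"
  shows "continuous_on {-1..1} (primitive g)"
  using indefinite_integral_continuous_1[OF HK_integrable_I[OF assms]]
  by (rule continuous_on_eq) (simp add: primitive_eq_integral assms)

lemma primitive_deriv:
  assumes "continuous_on {-1..1} g" "t \<in> {-1..1}"
  shows "(primitive g has_real_derivative g t) (at t within {-1..1})"
proof -
  have "((\<lambda>u. integral {-1..u} g) has_real_derivative g t) (at t within {-1..1})"
    using integral_has_real_derivative[OF assms] .
  then show ?thesis
    by (rule has_field_derivative_transform_within[of _ _ _ _ 1])
      (use assms in \<open>auto simp: primitive_eq_integral continuous_integrable_I\<close>)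
qed

lemma primitive_of_deriv:
  assumes "\<And>s. s \<in> {-1..1} \<Longrightarrow> (f has_real_derivative f' s) (at s within {-1..1})"
    and "integrable leb_I f'" and t: "t \<in> {-1..1}"
  shows "primitive f' t = f t - f (-1)"
proof -
  have "(f' has_integral (f t - f (-1))) {-1..t}"
    using t by (intro fundamental_theorem_of_calculus)
      (auto simp flip: has_real_derivative_iff_has_vector_derivative intro!: DERIV_subset[OF assms(1)])
  then show ?thesis
    using primitive_eq_integral[OF assms(2) t] by (simp add: integral_unique)
qed

lemma primitive_cong_AE:
  assumes "AE t in leb_I. f t = g t" "f \<in> borel_measurable leb_I" "g \<in> borel_measurable leb_I"
  shows "primitive f t = primitive g t"
proof -
  have "primitive h t = (\<integral>s. indicator ({..t} \<inter> unit_ivl) s * h s \<partial>leb_I)" for h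
    unfolding primitive_def by (rule Bochner_Integration.integral_cong) (auto simp: indicator_def)
  moreover have [measurable]: "{..t} \<inter> unit_ivl \<in> sets leb_I" by (auto simp: sets_restrict_space)
  have "(\<integral>s. indicator ({..t} \<inter> unit_ivl) s * f s \<partial>leb_I) =
        (\<integral>s. indicator ({..t} \<inter> unit_ivl) s * g s \<partial>leb_I)"
    by (rule integral_cong_AE) (use assms in \<open>auto\<close>)
  ultimately show ?thesis by simp
qed

lemma primitive_cong:
  assumes "\<And>t. t \<in> unit_ivl \<Longrightarrow> f t = g t"
  shows "primitive f t = primitive g t"
  unfolding primitive_def by (rule Bochner_Integration.integral_cong) (auto simp: assms)

lemma primitive_add:
  assumes "integrable leb_I f" "integrable leb_I g"
  shows "primitive (\<lambda>s. f s + g s) t = primitive f t + primitive g t"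
  unfolding primitive_def distrib_left
  by (rule Bochner_Integration.integral_add) (intro indicator_integrable_I assms)+

lemma primitive_cmult: "primitive (\<lambda>s. c * f s) t = c * primitive f t"
  unfolding primitive_def by (subst mult.left_commute) simp

lemma primitive_sum:
  assumes "\<And>i. i \<in> J \<Longrightarrow> integrable leb_I (f i)"
  shows "primitive (\<lambda>s. \<Sum>i\<in>J. f i s) t = (\<Sum>i\<in>J. primitive (f i) t)"
  using assms
proof (induction J rule: infinite_finite_induct)
  case (insert x F)
  then show ?case by (simp add: primitive_add)
qed (simp_all add: primitive_def)

lemma indicator_le_measurable [measurable]:
  "(\<lambda>(s, t). indicator {..t} s :: real) \<in> borel_measurable (leb_I \<Otimes>\<^sub>M leb_I)"
proof -
  have id: "(\<lambda>s. s) \<in> borel_measurable leb_I"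
    using id_borel_measurable_lebesgue_on[of unit_ivl] by (simp add: id_def)
  have "{p \<in> space (leb_I \<Otimes>\<^sub>M leb_I). fst p \<le> snd p} \<in> sets (leb_I \<Otimes>\<^sub>M leb_I)"
    using measurable_compose[OF measurable_fst id] measurable_compose[OF measurable_snd id]
    by (rule borel_measurable_le)
  then have "(\<lambda>p. if fst p \<le> snd p then 1 else (0::real)) \<in> borel_measurable (leb_I \<Otimes>\<^sub>M leb_I)"
    by (rule measurable_If[OF measurable_const measurable_const, rotated -1]) simp_all
  moreover have "(\<lambda>p. if fst p \<le> snd p then 1 else (0::real)) = (\<lambda>(s, t). indicator {..t} s)"
    by (auto simp: indicator_def fun_eq_iff)
  ultimately show ?thesis by (rule subst[rotated])
qed

text \<open>Integration by parts for integrable functions is Fubini's theorem on the square: the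
  first integral of g(s) h(t) covers the triangle s \<le> t, the second one the triangle t \<le> s,
  and together they cover the square up to a null set.\<close>

lemma primitive_parts_upper:
  assumes g: "integrable leb_I g" and h: "integrable leb_I h"
  shows "(\<integral>t. primitive g t * h t \<partial>leb_I) + (\<integral>t. g t * primitive h t \<partial>leb_I) =
    (\<integral>t. g t \<partial>leb_I) * (\<integral>t. h t \<partial>leb_I)"
proof -
  interpret pair_sigma_finite leb_I leb_I ..
  have [measurable]: "g \<in> borel_measurable leb_I" "h \<in> borel_measurable leb_I"
    using g h by auto
  define k where "k = (\<lambda>(s, t). indicator {..t} s * (g s * h t))"
  define k' where "k' = (\<lambda>(s, t). (1 - indicator {..t} s) * (g s * h t))"
  have gh: "integrable (leb_I \<Otimes>\<^sub>M leb_I) (\<lambda>(s, t). g s * h t)"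
  proof (rule Fubini_integrable)
    have "integrable leb_I (\<lambda>s. norm (g s) * (\<integral>t. norm (h t) \<partial>leb_I))"
      using g by auto
    then show "integrable leb_I (\<lambda>s. \<integral>t. norm (case (s, t) of (s, t) \<Rightarrow> g s * h t) \<partial>leb_I)"
      by (simp add: abs_mult)
    show "AE s in leb_I. integrable leb_I (\<lambda>t. case (s, t) of (s, t) \<Rightarrow> g s * h t)"
      using h by auto
  qed measurable
  have k: "integrable (leb_I \<Otimes>\<^sub>M leb_I) k"
  proof (rule Bochner_Integration.integrable_bound[OF gh])
    have "(\<lambda>p. (case p of (s, t) \<Rightarrow> indicator {..t} s) * (case p of (s, t) \<Rightarrow> g s * h t))
        \<in> borel_measurable (leb_I \<Otimes>\<^sub>M leb_I)"
      using gh by (intro borel_measurable_times indicator_le_measurable) auto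
    moreover have "(\<lambda>p. (case p of (s, t) \<Rightarrow> indicator {..t} s) * (case p of (s, t) \<Rightarrow> g s * h t)) = k"
      by (auto simp: k_def fun_eq_iff)
    ultimately show "k \<in> borel_measurable (leb_I \<Otimes>\<^sub>M leb_I)" by (rule subst[rotated])
  qed (auto simp: k_def indicator_def)
  have k': "integrable (leb_I \<Otimes>\<^sub>M leb_I) k'"
    using Bochner_Integration.integrable_diff[OF gh k] by (simp add: k_def k'_def split_beta' algebra_simps)
  have "(\<integral>t. primitive g t * h t \<partial>leb_I) = (\<integral>t. \<integral>s. k (s, t) \<partial>leb_I \<partial>leb_I)"
    unfolding primitive_def k_def by (simp add: mult.assoc flip: integral_mult_left_zero)
  also have "\<dots> = integral\<^sup>L (leb_I \<Otimes>\<^sub>M leb_I) k"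
    using integral_snd[of "\<lambda>s t. k (s, t)"] k by simp
  finally have 1: "(\<integral>t. primitive g t * h t \<partial>leb_I) = integral\<^sup>L (leb_I \<Otimes>\<^sub>M leb_I) k" .
  \<comment> \<open>The complement of the first triangle is t < s, the second one is t \<le> s; for
    fixed s they differ in a single point.\<close>
  have null: "(\<integral>t. (1 - indicator {..t} s) * (g s * h t) \<partial>leb_I) =
      (\<integral>t. g s * (indicator {..s} t * h t) \<partial>leb_I)" for s
  proof (rule integral_cong_AE)
    have "AE t in lebesgue. t \<noteq> s"
      by (intro AE_completion AE_lborel_singleton)
    then have "AE t in lebesgue. t \<in> unit_ivl \<longrightarrow> t \<noteq> s"
      by eventually_elim auto
    then have "AE t in leb_I. t \<noteq> s"
      by (subst AE_restrict_space_iff) simp_all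
    then show "AE t in leb_I. (1 - indicator {..t} s) * (g s * h t) = g s * (indicator {..s} t * h t)"
      by eventually_elim (auto simp: indicator_def)
    have [measurable]: "(\<lambda>t. t) \<in> borel_measurable leb_I"
      using id_borel_measurable_lebesgue_on[of unit_ivl] by (simp add: id_def)
    have "(\<lambda>t. (if s \<le> t then 0 else g s * h t)) \<in> borel_measurable leb_I"
      by measurable
    then show "(\<lambda>t. (1 - indicator {..t} s) * (g s * h t)) \<in> borel_measurable leb_I"
      by (rule measurable_cong[THEN iffD1, rotated]) (auto simp: indicator_def)
    show "(\<lambda>t. g s * (indicator {..s} t * h t)) \<in> borel_measurable leb_I"
      using indicator_integrable_I[OF h, of s] by auto
  qed
  have "(\<integral>t. g t * primitive h t \<partial>leb_I) = (\<integral>s. \<integral>t. k' (s, t) \<partial>leb_I \<partial>leb_I)"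
    unfolding k'_def prod.case null by (simp add: primitive_def)
  also have "\<dots> = integral\<^sup>L (leb_I \<Otimes>\<^sub>M leb_I) k'"
    using integral_fst[of "\<lambda>s t. k' (s, t)"] k' by simp
  finally have 2: "(\<integral>t. g t * primitive h t \<partial>leb_I) = integral\<^sup>L (leb_I \<Otimes>\<^sub>M leb_I) k'" .
  have "integral\<^sup>L (leb_I \<Otimes>\<^sub>M leb_I) k + integral\<^sup>L (leb_I \<Otimes>\<^sub>M leb_I) k' =
      integral\<^sup>L (leb_I \<Otimes>\<^sub>M leb_I) (\<lambda>p. k p + k' p)"
    using k k' by simp
  also have "(\<lambda>p. k p + k' p) = (\<lambda>(s, t). g s * h t)"
    by (auto simp: k_def k'_def fun_eq_iff algebra_simps)
  also have "integral\<^sup>L (leb_I \<Otimes>\<^sub>M leb_I) (\<lambda>(s, t). g s * h t) = (\<integral>s. \<integral>t. g s * h t \<partial>leb_I \<partial>leb_I)"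
    using integral_fst[of "\<lambda>s t. g s * h t"] gh by simp
  finally show ?thesis using 1 2 by simp
qed

text \<open>Cutting both functions off at t reduces the product rule to integration by parts over
  the whole interval.\<close>

lemma primitive_mult:
  assumes g: "integrable leb_I g" and h: "integrable leb_I h" and t: "t \<in> {-1..1}"
  shows "primitive g t * primitive h t = primitive (\<lambda>s. g s * primitive h s + primitive g s * h s) t"
proof -
  let ?cut = "\<lambda>f s. indicator {..t} s * f s :: real"
  have int: "integrable leb_I (?cut g)" "integrable leb_I (?cut h)"
    using g h by (auto intro: indicator_integrable_I)
  have c: "primitive (?cut f) s = primitive f s" if "s \<le> t" for f s
    unfolding primitive_def using that
    by (intro Bochner_Integration.integral_cong) (auto simp: indicator_def)
  have gh: "integrable leb_I (\<lambda>s. g s * primitive h s)" "integrable leb_I (\<lambda>s. primitive g s * h s)"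
    using integrable_mult_continuous[OF g primitive_continuous[OF h]]
      integrable_mult_continuous[OF h primitive_continuous[OF g]]
    by (auto simp: mult.commute)
  have "primitive g t * primitive h t = (\<integral>s. ?cut g s \<partial>leb_I) * (\<integral>s. ?cut h s \<partial>leb_I)"
    by (simp add: primitive_def)
  also have "\<dots> = (\<integral>s. primitive (?cut g) s * ?cut h s \<partial>leb_I) + (\<integral>s. ?cut g s * primitive (?cut h) s \<partial>leb_I)"
    by (rule primitive_parts_upper[OF int, symmetric])
  also have "(\<integral>s. primitive (?cut g) s * ?cut h s \<partial>leb_I) = primitive (\<lambda>s. primitive g s * h s) t"
    unfolding primitive_def[of "\<lambda>s. primitive g s * h s"]
  proof (intro Bochner_Integration.integral_cong refl)
    show "primitive (?cut g) s * ?cut h s = indicator {..t} s * (primitive g s * h s)" for s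
      by (cases "s \<in> {..t}") (auto simp: c)
  qed
  also have "(\<integral>s. ?cut g s * primitive (?cut h) s \<partial>leb_I) = primitive (\<lambda>s. g s * primitive h s) t"
    unfolding primitive_def[of "\<lambda>s. g s * primitive h s"]
  proof (intro Bochner_Integration.integral_cong refl)
    show "?cut g s * primitive (?cut h) s = indicator {..t} s * (g s * primitive h s)" for s
      by (cases "s \<in> {..t}") (auto simp: c)
  qed
  finally show ?thesis by (simp add: primitive_add gh)
qed

section \<open>The fundamental lemma of the calculus of variations\<close>

lemma test_fun_integral_deriv:
  assumes f: "integrable leb_I f" and \<phi>: "\<phi> \<in> test_fun"
  shows "(\<integral>t. primitive f t * deriv \<phi> t \<partial>leb_I) = - (\<integral>t. f t * \<phi> t \<partial>leb_I)"
proof -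
  obtain a where a: "0 < a" "a < 1" "\<And>t. t \<notin> {-a..a} \<Longrightarrow> \<phi> t = 0"
    using test_fun_support[OF \<phi>] by blast
  have 0: "\<phi> (-1) = 0" "\<phi> 1 = 0" using a by auto
  have int: "integrable leb_I (deriv \<phi>)"
    by (intro L2_integrable test_fun_L2 test_fun_deriv \<phi>)
  have d: "(\<phi> has_real_derivative deriv \<phi> t) (at t within {-1..1})" for t
    using test_fun_DERIV[OF \<phi>, of 0 t] by (auto intro: DERIV_subset)
  have p: "primitive (deriv \<phi>) t = \<phi> t" if "t \<in> {-1..1}" for t
    using primitive_of_deriv[OF d int that] 0 by simp
  have "(\<integral>t. f t * primitive (deriv \<phi>) t \<partial>leb_I) = (\<integral>t. f t * \<phi> t \<partial>leb_I)"
    by (intro Bochner_Integration.integral_cong) (auto simp: p)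
  moreover have "(\<integral>t. deriv \<phi> t \<partial>leb_I) = 0"
    using p[of 1] 0 by (simp add: primitive_upper)
  ultimately show ?thesis
    using primitive_parts_upper[OF f int] by simp
qed

text \<open>Bumps approximate indicators, so by dominated convergence f has integral zero over every
  interval inside the open unit interval; Lebesgue's differentiation theorem then recovers f almost
  everywhere from these integrals.\<close>

lemma du_Bois_Reymond:
  assumes f: "integrable leb_I f" and 0: "\<And>\<phi>. \<phi> \<in> test_fun \<Longrightarrow> (\<integral>t. f t * \<phi> t \<partial>leb_I) = 0"
  shows "AE t in leb_I. f t = 0"
proof -
  have ivl0: "(\<integral>t. f t * indicator {a<..<b} t \<partial>leb_I) = 0" if "-1 < a" "b < 1" for a b
  proof -
    have [measurable]: "f \<in> borel_measurable leb_I" using f by auto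
    have bm: "bump (real (Suc k)) a b \<in> borel_measurable leb_I" for k
      by (intro continuous_measurable_I smooth_on_continuous smooth_on_subset[OF smooth_on_bump]) auto
    have "(\<lambda>k. \<integral>t. f t * bump (real (Suc k)) a b t \<partial>leb_I) \<longlonglongrightarrow> (\<integral>t. f t * indicator {a<..<b} t \<partial>leb_I)"
    proof (rule integral_dominated_convergence[where w="\<lambda>t. norm (f t)"])
      have meas: "{a<..<b} \<in> sets leb_I" using that by (auto simp: sets_restrict_space)
      show "(\<lambda>t. f t * indicator {a<..<b} t) \<in> borel_measurable leb_I"
        using meas by measurable
      show "(\<lambda>t. f t * bump (real (Suc k)) a b t) \<in> borel_measurable leb_I" for k
        using bm[of k] by measurable
      show "AE t in leb_I. (\<lambda>k. f t * bump (real (Suc k)) a b t) \<longlonglongrightarrow> f t * indicator {a<..<b} t"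
        by (intro AE_I2 tendsto_intros bump_tendsto)
      show "AE t in leb_I. norm (f t * bump (real (Suc k)) a b t) \<le> norm (f t)" for k
        using bump_bounds[of "real (Suc k)" a b]
        by (intro AE_I2) (simp add: abs_mult mult_left_le del: of_nat_Suc)
    qed (use f in auto)
    moreover have "(\<integral>t. f t * bump (real (Suc k)) a b t \<partial>leb_I) = 0" for k
      by (intro 0 bump_test_fun) (use that in auto)
    ultimately show ?thesis
      using LIMSEQ_unique by (simp add: LIMSEQ_const_iff)
  qed
  define F where "F t = (if t \<in> unit_ivl then f t else 0)" for t
  have intF: "integrable lebesgue F"
    unfolding F_def by (rule Lebesgue_Measure.integrable_restrict_UNIV[THEN iffD2]) (use f in auto)
  then have "F integrable_on cbox a b" for a b
    by (intro integrable_on_subcbox[OF _ subset_UNIV] integrable_on_lebesgue)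
  \<comment> \<open>Outside the null set \<open>N\<close> the averages of \<open>F\<close> over
    [x, x + h] converge to F(x) as h tends to 0.\<close>
  then obtain N where N: "negligible N"
    "\<And>x e. x \<notin> N \<Longrightarrow> 0 < e \<Longrightarrow> \<exists>d>0. \<forall>h. 0 < h \<and> h < d \<longrightarrow>
        norm (integral (cbox x (x + h *\<^sub>R One)) F /\<^sub>R h ^ DIM(real) - F x) < e"
    using integrable_ccontinuous_explicit[of F] by blast
  have small: "integral {x..x + h} F = 0" if "-1 < x" "0 < h" "x + h < 1" for x h
  proof -
    have "integrable leb_I (\<lambda>t. f t * indicator {x<..<x+h} t)"
    proof (rule Bochner_Integration.integrable_bound[OF f])
      have "{x<..<x+h} \<in> sets leb_I" using that by (auto simp: sets_restrict_space)
      then show "(\<lambda>t. f t * indicator {x<..<x + h} t) \<in> borel_measurable leb_I"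
        using f by measurable
    qed (auto simp: indicator_def)
    then have "integral unit_ivl (\<lambda>t. f t * indicator {x<..<x+h} t) =
        (\<integral>t. f t * indicator {x<..<x+h} t \<partial>leb_I)"
      by (rule lebesgue_integral_eq_integral[OF _ unit_ivl_sets, symmetric])
    then have "(\<integral>t. f t * indicator {x<..<x+h} t \<partial>leb_I) = integral unit_ivl (\<lambda>t. f t * indicator {x<..<x+h} t)"
      by (rule sym)
    also have "integral unit_ivl (\<lambda>t. f t * indicator {x<..<x+h} t) =
        integral unit_ivl (\<lambda>t. if t \<in> {x<..<x+h} then F t else 0)"
      by (intro integral_cong) (auto simp: F_def indicator_def)
    also have "\<dots> = integral ({x<..<x+h} \<inter> unit_ivl) F"
      by (rule integral_restrict_Int)
    also have "{x<..<x+h} \<inter> unit_ivl = {x<..<x+h}" using that by auto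
    finally show ?thesis
      using ivl0[of x "x + h"] that by (simp add: integral_open_interval_real)
  qed
  have "F x = 0" if x: "x \<notin> N" "x \<in> unit_ivl" for x
  proof (rule ccontr)
    assume "F x \<noteq> 0"
    then obtain d where d: "d > 0" "\<And>h. 0 < h \<Longrightarrow> h < d \<Longrightarrow> norm (integral {x..x+h} F /\<^sub>R h - F x) < \<bar>F x\<bar>"
      using N(2)[OF x(1), of "\<bar>F x\<bar>"] by auto
    \<comment> \<open>Small enough for the differentiation estimate and for x + h to stay below
      1.\<close>
    define h where "h = min d (1 - x) / 2"
    have "0 < h" "h < d" "x + h < 1" using d(1) x by (auto simp: h_def min_def field_simps)
    then show False using d(2)[of h] small[of x h] x by auto
  qed
  then have "{x \<in> unit_ivl. f x \<noteq> 0} \<subseteq> N" by (auto simp: F_def)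
  moreover have "N \<in> null_sets lebesgue" using N(1) by (simp add: negligible_iff_null_sets)
  ultimately have "AE x in lebesgue. x \<in> unit_ivl \<longrightarrow> f x = 0"
    by (intro AE_I'[of N]) auto
  then show ?thesis by (subst AE_restrict_space_iff) simp_all
qed

text \<open>The antiderivative starting at -2, left of the support, vanishes before the support;
  beyond the support it equals the total integral, which is zero.\<close>

lemma test_fun_primitive:
  assumes \<phi>: "\<phi> \<in> test_fun" and 0: "(\<integral>t. \<phi> t \<partial>leb_I) = 0"
  shows "\<exists>\<psi>\<in>test_fun. deriv \<psi> = \<phi>"
proof -
  obtain a where a: "0 < a" "a < 1" "\<And>t. t \<notin> {-a..a} \<Longrightarrow> \<phi> t = 0"
    using test_fun_support[OF \<phi>] by blast
  have cont: "continuous_on S \<phi>" for S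
    using smooth_on_continuous[OF test_fun_smooth[OF \<phi>]] .
  define \<psi> where "\<psi> t = integral {-2..t} \<phi>" for t
  have d0: "(\<psi> has_real_derivative \<phi> t) (at t)" if "t > -2" for t
  proof -
    have "(\<psi> has_real_derivative \<phi> t) (at t within {-2..t+1})"
      unfolding \<psi>_def using that by (intro integral_has_real_derivative cont) auto
    then show ?thesis
      using that by (simp add: at_within_Icc_at)
  qed
  have z: "integral {x..y} \<phi> = 0" if "\<And>t. t \<in> {x..y} \<Longrightarrow> t \<notin> {-a..a}" for x y
  proof -
    have "integral {x..y} \<phi> = integral {x..y} (\<lambda>_. 0)"
      by (intro integral_cong a(3) that)
    then show ?thesis by simp
  qed
  have lo: "\<psi> t = 0" if "t < -a" for t
    unfolding \<psi>_def by (rule z) (use that in auto)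
  have io: "\<phi> integrable_on {x..y}" for x y
    by (intro integrable_continuous_real cont)
  have "integral {-2..a} \<phi> = integral {-2..-1} \<phi> + integral {-1..a} \<phi>"
    using a by (intro Henstock_Kurzweil_Integration.integral_combine[symmetric] io) auto
  moreover have "integral {-1..1} \<phi> = integral {-1..a} \<phi> + integral {a..1} \<phi>"
    using a by (intro Henstock_Kurzweil_Integration.integral_combine[symmetric] io) auto
  moreover have "integral {-2..-1} \<phi> = 0"
    by (rule z) (use a in auto)
  moreover have za: "integral {a..y} \<phi> = 0" for y
  proof -
    have "integral {a..y} \<phi> = integral {a<..<y} \<phi>" by (simp add: integral_open_interval_real)
    also have "\<dots> = integral {a<..<y} (\<lambda>_. 0)"
      by (intro integral_cong a(3)) auto
    finally show ?thesis by simp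
  qed
  moreover have "integral {-1..1} \<phi> = 0"
    using integral_HK_I[OF L2_integrable[OF test_fun_L2[OF \<phi>]]] 0 by simp
  ultimately have a0: "integral {-2..a} \<phi> = 0" by simp
  have hi: "\<psi> t = 0" if "t > a" for t
  proof -
    have "integral {-2..t} \<phi> = integral {-2..a} \<phi> + integral {a..t} \<phi>"
      using that a by (intro Henstock_Kurzweil_Integration.integral_combine[symmetric] io) auto
    then show ?thesis using a0 za by (simp add: \<psi>_def)
  qed
  have d: "(\<psi> has_real_derivative \<phi> t) (at t)" for t
  proof (cases "t > -2")
    case False
    then have "t < -a" using a by auto
    have "(\<psi> has_real_derivative 0) (at t)"
      by (rule has_field_derivative_transform_within_open[of "\<lambda>t. 0" _ _ "{..<-a}"])
        (use \<open>t < -a\<close> lo in auto)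
    moreover have "\<phi> t = 0" using \<open>t < -a\<close> by (intro a(3)) auto
    ultimately show ?thesis by simp
  qed (rule d0)
  have "smooth_on UNIV \<psi>"
  proof (rule smooth_on_coinduct[of _ "insert \<psi> {f. smooth_on UNIV f}"])
    fix g assume "g \<in> insert \<psi> {f. smooth_on UNIV f}"
    then consider "g = \<psi>" | "smooth_on UNIV g" by blast
    then show "\<exists>g'\<in>insert \<psi> {f. smooth_on UNIV f}. \<forall>t\<in>UNIV. (g has_real_derivative g' t) (at t)"
    proof cases
      case 1
      then show ?thesis using d test_fun_smooth[OF \<phi>] by blast
    next
      case 2
      then obtain g' where "smooth_on UNIV g'" "\<And>t. (g has_real_derivative g' t) (at t)"
        by (metis smooth_on_deriv UNIV_I)
      then show ?thesis by blast
    qed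
  qed simp
  then have "\<psi> \<in> test_fun"
    unfolding test_fun_iff using lo hi a by (auto intro!: exI[of _ "{-a..a}"])
  moreover have "deriv \<psi> = \<phi>" using d DERIV_imp_deriv by blast
  ultimately show ?thesis by blast
qed

section \<open>Integration by parts against test functions\<close>

lemma deriv_pow_Suc: "(deriv ^^ k) (deriv \<phi>) = (deriv ^^ Suc k) (\<phi> :: real \<Rightarrow> real)"
  by (simp only: funpow_Suc_right comp_apply)

lemma test_fun_continuous: "\<phi> \<in> test_fun \<Longrightarrow> continuous_on S \<phi>"
  by (intro smooth_on_continuous test_fun_smooth)

lemma test_fun_integrable: "\<phi> \<in> test_fun \<Longrightarrow> integrable leb_I \<phi>"
  by (intro L2_integrable test_fun_L2)

lemma integral_deriv_test_fun: "\<phi> \<in> test_fun \<Longrightarrow> (\<integral>t. deriv \<phi> t \<partial>leb_I) = 0"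
proof -
  assume \<phi>: "\<phi> \<in> test_fun"
  obtain a where a: "0 < a" "a < 1" "\<And>t. t \<notin> {-a..a} \<Longrightarrow> \<phi> t = 0"
    using test_fun_support[OF \<phi>] by blast
  have "primitive (deriv \<phi>) 1 = \<phi> 1 - \<phi> (-1)"
    by (rule primitive_of_deriv)
      (use test_fun_DERIV[OF \<phi>, of 0] in \<open>auto intro: DERIV_subset test_fun_integrable test_fun_deriv \<phi>\<close>)
  then show ?thesis using a by (simp add: primitive_upper)
qed

lemma parts_test_fun:
  assumes f: "\<And>t. t \<in> {-1..1} \<Longrightarrow> f t = c + primitive f' t" and f': "integrable leb_I f'" and \<phi>: "\<phi> \<in> test_fun"
  shows "(\<integral>t. f t * deriv \<phi> t \<partial>leb_I) = - (\<integral>t. f' t * \<phi> t \<partial>leb_I)"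
proof -
  have d: "deriv \<phi> \<in> test_fun" using \<phi> by auto
  have "(\<integral>t. f t * deriv \<phi> t \<partial>leb_I) = (\<integral>t. c * deriv \<phi> t + primitive f' t * deriv \<phi> t \<partial>leb_I)"
    by (intro Bochner_Integration.integral_cong) (auto simp: f algebra_simps)
  also have "\<dots> = (\<integral>t. c * deriv \<phi> t \<partial>leb_I) + (\<integral>t. primitive f' t * deriv \<phi> t \<partial>leb_I)"
    using d test_fun_integrable[OF d]
    by (intro Bochner_Integration.integral_add L2_test_integrable continuous_L2 primitive_continuous f') auto
  finally show ?thesis
    using test_fun_integral_deriv[OF f' \<phi>] integral_deriv_test_fun[OF \<phi>] by simp
qed

lemma parts_test_fun_C1:
  assumes "\<And>t. t \<in> {-1..1} \<Longrightarrow> (f has_real_derivative f' t) (at t within {-1..1})"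
    and "continuous_on {-1..1} f'" and \<phi>: "\<phi> \<in> test_fun"
  shows "(\<integral>t. f t * deriv \<phi> t \<partial>leb_I) = - (\<integral>t. f' t * \<phi> t \<partial>leb_I)"
proof (rule parts_test_fun[OF _ _ \<phi>])
  show int: "integrable leb_I f'" using assms(2) by (rule continuous_integrable_I)
  show "f t = f (-1) + primitive f' t" if "t \<in> {-1..1}" for t
    using primitive_of_deriv[OF assms(1) int that] by simp
qed

lemma parts_test_fun_poly:
  assumes \<phi>: "\<phi> \<in> test_fun"
  shows "(\<integral>t. poly Q t * (deriv ^^ r) \<phi> t \<partial>leb_I) = (-1) ^ r * (\<integral>t. poly ((pderiv ^^ r) Q) t * \<phi> t \<partial>leb_I)"
proof (induction r arbitrary: Q)
  case (Suc r)
  have "(\<integral>t. poly Q t * (deriv ^^ Suc r) \<phi> t \<partial>leb_I) = - (\<integral>t. poly (pderiv Q) t * (deriv ^^ r) \<phi> t \<partial>leb_I)"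
    using parts_test_fun_C1[of "poly Q" "poly (pderiv Q)" "(deriv ^^ r) \<phi>"] \<phi>
    by (simp add: test_fun_deriv_funpow DERIV_subset[OF poly_DERIV] continuous_intros)
  moreover have "(pderiv ^^ Suc r) Q = (pderiv ^^ r) (pderiv Q)"
    by (simp only: funpow_Suc_right comp_apply)
  ultimately show ?case using Suc[of "pderiv Q"] by simp
qed simp

lemma deriv_pow_lincomb:
  assumes "\<phi> \<in> test_fun" "\<psi> \<in> test_fun"
  shows "(deriv ^^ r) (\<lambda>t. \<phi> t + c * \<psi> t) = (\<lambda>t. (deriv ^^ r) \<phi> t + c * (deriv ^^ r) \<psi> t)"
  by (rule deriv_funpow_eq[of "\<lambda>r t. (deriv ^^ r) \<phi> t + c * (deriv ^^ r) \<psi> t", simplified])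
    (use assms in \<open>auto intro!: derivative_eq_intros test_fun_DERIV[simplified]\<close>)

lemma pderiv_pow_monom: "(pderiv ^^ r) (monom a r) = [:fact r * (a::real):]"
proof (induction r arbitrary: a)
  case (Suc r)
  have "(pderiv ^^ Suc r) (monom a (Suc r)) = (pderiv ^^ r) (monom (of_nat (Suc r) * a) r)"
    by (simp only: funpow_Suc_right comp_apply pderiv_monom diff_Suc_1)
  also have "\<dots> = [:fact r * (of_nat (Suc r) * a):]" by (rule Suc)
  finally show ?case by (simp add: algebra_simps)
qed (simp add: monom_0)

text \<open>Induction on the order r. Subtracting from a test function \<psi> a multiple of a fixed
  bump with nonzero integral leaves integral zero, hence the derivative of a test function.
  Therefore f tested against the r-th derivative of \<psi> is a constant times the integral of
  \<psi>. A suitable monomial of degree r behaves in the same way, and subtracting it from f lowers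
  the order by one.\<close>

lemma du_Bois_Reymond_poly:
  assumes f: "integrable leb_I f"
    and 0: "\<And>\<phi>. \<phi> \<in> test_fun \<Longrightarrow> (\<integral>t. f t * (deriv ^^ r) \<phi> t \<partial>leb_I) = 0"
  shows "\<exists>Q. AE t in leb_I. f t = poly Q t"
  using assms
proof (induction r arbitrary: f)
  case 0
  then show ?case using du_Bois_Reymond[of f] by (intro exI[of _ 0]) auto
next
  case (Suc r)
  let ?\<rho> = "bump 1 (-1/2) (1/2)"
  have \<rho>: "?\<rho> \<in> test_fun" by (rule bump_test_fun) auto
  define c where "c = (\<integral>t. ?\<rho> t \<partial>leb_I)"
  have "c \<noteq> 0"
  proof
    assume "c = 0"
    have "AE t in leb_I. ?\<rho> t = 0"
      using integral_nonneg_eq_0_iff_AE[OF test_fun_integrable[OF \<rho>]] \<open>c = 0\<close> bump_bounds(1)[of 1 "-1/2" "1/2"]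
      unfolding c_def by auto
    then have "AE t in leb_I. t \<notin> {-1/2<..<1/2}"
      by eventually_elim (use bump_pos[of 1 _ "-1/2" "1/2"] in force)
    then have "AE t in lebesgue. t \<notin> {-1/2<..<(1/2::real)}"
      by (subst (asm) AE_restrict_space_iff) (auto elim!: eventually_mono)
    then have "AE t in lborel. t \<notin> {-1/2<..<(1/2::real)}"
      by (simp add: AE_completion_iff)
    then have "emeasure lborel {-1/2<..<(1/2::real)} = 0"
      by (subst (asm) AE_iff_measurable[of "{-1/2<..<(1/2::real)}"]) auto
    then show False by simp
  qed
  define \<kappa> where "\<kappa> = (\<integral>t. f t * (deriv ^^ r) ?\<rho> t \<partial>leb_I) / c"
  have f\<phi>: "integrable leb_I (\<lambda>t. f t * (deriv ^^ r) \<phi> t)" if "\<phi> \<in> test_fun" for \<phi>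
    using that Suc.prems(1) by (intro integrable_mult_continuous test_fun_continuous) auto
  have eq: "(\<integral>t. f t * (deriv ^^ r) \<psi> t \<partial>leb_I) = \<kappa> * (\<integral>t. \<psi> t \<partial>leb_I)" if \<psi>: "\<psi> \<in> test_fun" for \<psi>
  proof -
    define d where "d = - ((\<integral>t. \<psi> t \<partial>leb_I) / c)"
    let ?h = "\<lambda>t. \<psi> t + d * ?\<rho> t"
    have h: "?h \<in> test_fun" using \<psi> \<rho> by auto
    have "(\<integral>t. ?h t \<partial>leb_I) = (\<integral>t. \<psi> t \<partial>leb_I) + d * c"
      unfolding c_def using \<psi> \<rho> by (simp add: test_fun_integrable)
    also have "\<dots> = 0" using \<open>c \<noteq> 0\<close> by (simp add: d_def)
    finally obtain \<chi> where \<chi>: "\<chi> \<in> test_fun" "deriv \<chi> = ?h"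
      using test_fun_primitive[OF h] by blast
    have "0 = (\<integral>t. f t * (deriv ^^ Suc r) \<chi> t \<partial>leb_I)"
      using Suc.prems(2)[OF \<chi>(1)] by simp
    also have "(deriv ^^ Suc r) \<chi> = (\<lambda>t. (deriv ^^ r) \<psi> t + d * (deriv ^^ r) ?\<rho> t)"
      using deriv_pow_lincomb[OF \<psi> \<rho>, of r d] by (simp only: funpow_Suc_right comp_apply \<chi>(2))
    also have "(\<integral>t. f t * ((deriv ^^ r) \<psi> t + d * (deriv ^^ r) ?\<rho> t) \<partial>leb_I) =
        (\<integral>t. f t * (deriv ^^ r) \<psi> t + d * (f t * (deriv ^^ r) ?\<rho> t) \<partial>leb_I)"
      by (simp add: algebra_simps)
    also have "\<dots> = (\<integral>t. f t * (deriv ^^ r) \<psi> t \<partial>leb_I) + d * (\<kappa> * c)"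
      using \<psi> \<rho> \<open>c \<noteq> 0\<close> by (simp add: f\<phi> \<kappa>_def)
    finally show ?thesis using \<open>c \<noteq> 0\<close> by (simp add: d_def)
  qed
  \<comment> \<open>The r-th derivative of \<open>Q\<close> is the constant (-1)^r \<kappa>; its
    sign cancels the one from integrating by parts r times.\<close>
  define Q where "Q = monom ((-1) ^ r * \<kappa> / fact r) r"
  have Q: "(\<integral>t. poly Q t * (deriv ^^ r) \<psi> t \<partial>leb_I) = \<kappa> * (\<integral>t. \<psi> t \<partial>leb_I)" if \<psi>: "\<psi> \<in> test_fun" for \<psi>
    by (subst parts_test_fun_poly[OF \<psi>]) (simp add: Q_def pderiv_pow_monom flip: power_mult_distrib)
  have intQ: "integrable leb_I (poly Q)"
    by (intro continuous_integrable_I continuous_intros)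
  have "\<exists>Q'. AE t in leb_I. f t - poly Q t = poly Q' t"
  proof (rule Suc.IH)
    show "integrable leb_I (\<lambda>t. f t - poly Q t)"
      using Suc.prems(1) intQ by simp
    fix \<phi> assume \<phi>: "\<phi> \<in> test_fun"
    have "integrable leb_I (\<lambda>t. poly Q t * (deriv ^^ r) \<phi> t)"
      using \<phi> intQ by (intro integrable_mult_continuous test_fun_continuous) auto
    then show "(\<integral>t. (f t - poly Q t) * (deriv ^^ r) \<phi> t \<partial>leb_I) = 0"
      using f\<phi>[OF \<phi>] eq[OF \<phi>] Q[OF \<phi>] by (simp add: left_diff_distrib)
  qed
  then obtain Q' where "AE t in leb_I. f t - poly Q t = poly Q' t" by blast
  then have "AE t in leb_I. f t = poly (Q + Q') t" by eventually_elim auto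
  then show ?case by blast
qed

section \<open>Polynomial differential operators on test functions\<close>

text \<open>\<open>pdo P\<close> is \<open>P(-d/dt)\<close>, the formal adjoint of \<open>P(d/dt)\<close>.\<close>

definition pdo :: "real poly \<Rightarrow> (real \<Rightarrow> real) \<Rightarrow> real \<Rightarrow> real" where
  "pdo P \<phi> t = (\<Sum>i\<le>degree P. coeff P i * ((-1) ^ i * (deriv ^^ i) \<phi> t))"

lemma pdo_bound:
  assumes "degree P \<le> n"
  shows "pdo P \<phi> t = (\<Sum>i\<le>n. coeff P i * ((-1) ^ i * (deriv ^^ i) \<phi> t))"
  unfolding pdo_def using assms
  by (intro sum.mono_neutral_left) (auto simp: coeff_eq_0)

lemma pdo_test_fun [intro]: "\<phi> \<in> test_fun \<Longrightarrow> pdo P \<phi> \<in> test_fun"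
  unfolding pdo_def[abs_def] by (intro test_fun_sum test_fun_cmult test_fun_deriv_funpow)

lemma pdo_0 [simp]: "pdo 0 \<phi> = (\<lambda>t. 0)"
  by (auto simp: pdo_def)

lemma pdo_add: "pdo (P + Q) \<phi> t = pdo P \<phi> t + pdo Q \<phi> t"
  by (simp add: pdo_bound[of _ "max (degree P) (degree Q)"] degree_add_le_max distrib_right sum.distrib)

lemma pdo_smult: "pdo (Polynomial.smult a P) \<phi> t = a * pdo P \<phi> t"
  by (simp add: pdo_bound[of _ "degree P"] degree_smult_le sum_distrib_left mult.assoc)

lemma pdo_sum: "pdo (\<Sum>i\<in>I. P i) \<phi> t = (\<Sum>i\<in>I. pdo (P i) \<phi> t)"
  by (induction I rule: infinite_finite_induct) (auto simp: pdo_add)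

lemma pdo_pCons: "pdo (pCons a P) \<phi> t = a * \<phi> t - pdo P (deriv \<phi>) t"
proof -
  have "pdo (pCons a P) \<phi> t = (\<Sum>i\<le>Suc (degree P). coeff (pCons a P) i * ((-1) ^ i * (deriv ^^ i) \<phi> t))"
    by (rule pdo_bound) (simp add: degree_pCons_le)
  also have "\<dots> = a * \<phi> t + (\<Sum>i\<le>degree P. coeff P i * ((-1) ^ Suc i * (deriv ^^ Suc i) \<phi> t))"
    by (subst sum.atMost_Suc_shift) simp
  also have "\<dots> = a * \<phi> t - pdo P (deriv \<phi>) t"
    unfolding pdo_def deriv_pow_Suc by (simp add: sum_negf)
  finally show ?thesis .
qed

lemma pdo_monom: "pdo (monom a i) \<phi> t = a * ((-1) ^ i * (deriv ^^ i) \<phi> t)"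
proof (cases "a = 0")
  case False
  then have "pdo (monom a i) \<phi> t = (\<Sum>j\<le>i. if j = i then a * ((-1) ^ i * (deriv ^^ i) \<phi> t) else 0)"
    unfolding pdo_def by (intro sum.cong) (auto simp: degree_monom_eq)
  then show ?thesis by simp
qed simp

lemma deriv_pdo:
  assumes "\<phi> \<in> test_fun"
  shows "deriv (pdo P \<phi>) = pdo P (deriv \<phi>)"
proof
  fix t
  have "(pdo P \<phi> has_real_derivative (\<Sum>i\<le>degree P. coeff P i * ((-1) ^ i * (deriv ^^ Suc i) \<phi> t))) (at t)"
    unfolding pdo_def[abs_def]
    by (intro DERIV_sum DERIV_cmult test_fun_DERIV[OF assms])
  then show "deriv (pdo P \<phi>) t = pdo P (deriv \<phi>) t"
    by (simp add: pdo_def deriv_pow_Suc DERIV_imp_deriv)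
qed

text \<open>Evaluating polynomials at -d/dt is multiplicative; the induction on the first factor
  closes because \<open>deriv\<close> commutes with every operator \<open>pdo Q\<close>.\<close>

lemma pdo_mult:
  assumes "\<phi> \<in> test_fun"
  shows "pdo (P * Q) \<phi> t = pdo P (pdo Q \<phi>) t"
  using assms
proof (induction P arbitrary: \<phi> t)
  case (pCons a P)
  have "pdo (pCons a P * Q) \<phi> t = a * pdo Q \<phi> t - pdo (P * Q) (deriv \<phi>) t"
    by (simp add: pdo_add pdo_smult pdo_pCons)
  also have "pdo (P * Q) (deriv \<phi>) t = pdo P (pdo Q (deriv \<phi>)) t"
    using pCons by auto
  finally show ?case
    using pCons.prems by (simp add: pdo_pCons deriv_pdo)
qed simp

section \<open>Linear ordinary differential equations\<close>

text \<open>Linear combinations of the unknowns plus a smooth function are mapped by the equations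
  to functions of the same form, so this set is stable under differentiation.\<close>

lemma smooth_on_linear_ode:
  assumes J: "finite J" and i: "i \<in> J"
    and x: "\<And>i t. i \<in> J \<Longrightarrow> t \<in> S \<Longrightarrow>
      (x i has_real_derivative (\<Sum>j\<in>J. a i j * x j t) + f i t) (at t within S)"
    and f: "\<And>i. i \<in> J \<Longrightarrow> smooth_on S (f i)"
  shows "smooth_on S (x i)"
proof (rule smooth_on_coinduct[of _ "{\<lambda>t. (\<Sum>j\<in>J. c j * x j t) + \<phi> t |c \<phi>. smooth_on S \<phi>}"])
  have "x i = (\<lambda>t. (\<Sum>j\<in>J. (if j = i then 1 else 0) * x j t) + 0)"
    using J i by (auto simp: if_distrib[of "\<lambda>c. c * _"] cong: if_cong)
  then show "x i \<in> {\<lambda>t. (\<Sum>j\<in>J. c j * x j t) + \<phi> t |c \<phi>. smooth_on S \<phi>}"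
    by (intro CollectI exI[of _ "\<lambda>j. if j = i then 1 else 0"] exI[of _ "\<lambda>t. 0"] conjI smooth_on_const)
next
  fix g assume "g \<in> {\<lambda>t. (\<Sum>j\<in>J. c j * x j t) + \<phi> t |c \<phi>. smooth_on S \<phi>}"
  then obtain c \<phi> where g: "g = (\<lambda>t. (\<Sum>j\<in>J. c j * x j t) + \<phi> t)" and \<phi>: "smooth_on S \<phi>" by blast
  obtain \<phi>' where \<phi>': "smooth_on S \<phi>'" "\<And>t. t \<in> S \<Longrightarrow> (\<phi> has_real_derivative \<phi>' t) (at t within S)"
    using smooth_on_deriv[OF \<phi>] by metis
  define g' where "g' t = (\<Sum>k\<in>J. (\<Sum>j\<in>J. c j * a j k) * x k t) + ((\<Sum>j\<in>J. c j * f j t) + \<phi>' t)" for t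
  have "(g has_real_derivative g' t) (at t within S)" if t: "t \<in> S" for t
  proof -
    have "(g has_real_derivative (\<Sum>j\<in>J. c j * ((\<Sum>k\<in>J. a j k * x k t) + f j t)) + \<phi>' t) (at t within S)"
      unfolding g by (intro DERIV_add DERIV_sum DERIV_cmult x t \<phi>') 
    moreover have "(\<Sum>j\<in>J. c j * ((\<Sum>k\<in>J. a j k * x k t) + f j t)) + \<phi>' t = g' t"
      unfolding g'_def sum_distrib_right
      by (subst sum.swap) (simp add: distrib_left sum.distrib sum_distrib_left mult.assoc)
    ultimately show ?thesis by simp
  qed
  moreover have "g' \<in> {\<lambda>t. (\<Sum>j\<in>J. c j * x j t) + \<phi> t |c \<phi>. smooth_on S \<phi>}"
    unfolding g'_def[abs_def]
    by (intro CollectI exI[of _ "\<lambda>k. \<Sum>j\<in>J. c j * a j k"] exI[of _ "\<lambda>t. (\<Sum>j\<in>J. c j * f j t) + \<phi>' t"]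
      conjI refl smooth_on_add smooth_on_sum smooth_on_mult smooth_on_const f \<phi>')
  ultimately show "\<exists>g'\<in>{\<lambda>t. (\<Sum>j\<in>J. c j * x j t) + \<phi> t |c \<phi>. smooth_on S \<phi>}.
      \<forall>t\<in>S. (g has_real_derivative g' t) (at t within S)" by (intro bexI[of _ g'] ballI)
qed

text \<open>Gronwall's argument for the sum of squares S: from \<bar>S'\<bar> \<le> c S it follows
  that S exp(-c t) is nonincreasing and S exp(c t) nondecreasing. Since S vanishes at
  \<open>t0\<close>, the former settles the times after \<open>t0\<close>, the latter the times
  before.\<close>

lemma linear_ode_zero:
  fixes x :: "'i \<Rightarrow> real \<Rightarrow> real"
  assumes J: "finite J"
    and x: "\<And>i t. i \<in> J \<Longrightarrow> t \<in> {a..b} \<Longrightarrow>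
      (x i has_real_derivative (\<Sum>j\<in>J. M i j * x j t)) (at t within {a..b})"
    and t0: "t0 \<in> {a..b}" "\<And>i. i \<in> J \<Longrightarrow> x i t0 = 0"
    and i: "i \<in> J" and t: "t \<in> {a..b}"
  shows "x i t = 0"
proof -
  define m where "m = (\<Sum>i\<in>J. \<Sum>j\<in>J. \<bar>M i j\<bar>)"
  have m: "\<bar>M i j\<bar> \<le> m" if "i \<in> J" "j \<in> J" for i j
  proof -
    have "\<bar>M i j\<bar> \<le> (\<Sum>j\<in>J. \<bar>M i j\<bar>)"
      using that J by (intro member_le_sum) auto
    also have "\<dots> \<le> m"
      unfolding m_def using that J by (intro member_le_sum[of i J "\<lambda>i. \<Sum>j\<in>J. \<bar>M i j\<bar>"]) (auto intro: sum_nonneg)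
    finally show ?thesis .
  qed
  have m0: "m \<ge> 0" unfolding m_def by (intro sum_nonneg) auto
  \<comment> \<open>Each term of S' is at most m (x_i^2 + x_j^2) in modulus; summation over both
    indices counts every square 2 card(J) times.\<close>
  define c where "c = 2 * (m * real (card J))"
  define S where "S t = (\<Sum>i\<in>J. (x i t)\<^sup>2)" for t
  define S' where "S' t = (\<Sum>i\<in>J. 2 * (x i t * (\<Sum>j\<in>J. M i j * x j t)))" for t
  have S: "(S has_real_derivative S' t) (at t within {a..b})" if "t \<in> {a..b}" for t
    unfolding S_def[abs_def] S'_def
    by (rule DERIV_sum) (use x[OF _ that] in \<open>auto intro!: derivative_eq_intros simp: algebra_simps\<close>)
  have S0: "S t \<ge> 0" for t unfolding S_def by (intro sum_nonneg) auto
  have bound: "\<bar>S' t\<bar> \<le> c * S t" for t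
  proof -
    have "\<bar>S' t\<bar> \<le> (\<Sum>i\<in>J. \<Sum>j\<in>J. m * ((x i t)\<^sup>2 + (x j t)\<^sup>2))"
      unfolding S'_def sum_distrib_left
    proof (intro order_trans[OF sum_abs] sum_mono)
      fix i j assume ij: "i \<in> J" "j \<in> J"
      have "0 \<le> (\<bar>x i t\<bar> - \<bar>x j t\<bar>)\<^sup>2" by simp
      then have *: "2 * (\<bar>x i t\<bar> * \<bar>x j t\<bar>) \<le> (x i t)\<^sup>2 + (x j t)\<^sup>2"
        by (simp add: power2_diff)
      have "\<bar>2 * (x i t * (M i j * x j t))\<bar> = \<bar>M i j\<bar> * (2 * (\<bar>x i t\<bar> * \<bar>x j t\<bar>))"
        by (simp add: abs_mult)
      also have "\<dots> \<le> m * ((x i t)\<^sup>2 + (x j t)\<^sup>2)"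
        using m[OF ij] * m0 by (intro mult_mono) auto
      finally show "\<bar>2 * (x i t * (M i j * x j t))\<bar> \<le> m * ((x i t)\<^sup>2 + (x j t)\<^sup>2)" .
    qed
    also have "\<dots> = c * S t"
      by (simp add: sum.distrib S_def c_def algebra_simps flip: sum_distrib_left)
    finally show ?thesis .
  qed
  have cont: "continuous_on {a..b} S"
    using S by (rule DERIV_continuous_on)
  have Sat: "(S has_real_derivative S' u) (at u)" if "a < u" "u < b" for u
    using S[of u] that by (simp add: at_within_Icc_at)
  have "S t \<le> 0"
  proof (cases "t0 \<le> t")
    case True
    have "S t * exp (- c * t) \<le> S t0 * exp (- c * t0)"
    proof (rule DERIV_nonpos_imp_decreasing_open[OF True, of "\<lambda>u. S u * exp (- c * u)"])
      fix u assume u: "t0 < u" "u < t"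
      have "((\<lambda>u. S u * exp (- c * u)) has_real_derivative (S' u - c * S u) * exp (- c * u)) (at u)"
        using Sat[of u] u t t0 by (auto intro!: derivative_eq_intros simp: algebra_simps)
      moreover have "(S' u - c * S u) * exp (- c * u) \<le> 0"
        using bound[of u] by (simp add: mult_le_0_iff abs_le_iff)
      ultimately show "\<exists>y. ((\<lambda>u. S u * exp (- c * u)) has_real_derivative y) (at u) \<and> y \<le> 0" by blast
    next
      show "continuous_on {t0..t} (\<lambda>u. S u * exp (- c * u))"
        using t t0 by (intro continuous_intros continuous_on_subset[OF cont]) auto
    qed
    moreover have "S t0 = 0" using t0 by (simp add: S_def)
    ultimately show ?thesis by (simp add: mult_le_0_iff)
  next
    case False
    then have "t \<le> t0" by simp
    have "S t * exp (c * t) \<le> S t0 * exp (c * t0)"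
    proof (rule DERIV_nonneg_imp_increasing_open[OF \<open>t \<le> t0\<close>, of "\<lambda>u. S u * exp (c * u)"])
      fix u assume u: "t < u" "u < t0"
      have "((\<lambda>u. S u * exp (c * u)) has_real_derivative (S' u + c * S u) * exp (c * u)) (at u)"
        using Sat[of u] u t t0 by (auto intro!: derivative_eq_intros simp: algebra_simps)
      moreover have "(S' u + c * S u) * exp (c * u) \<ge> 0"
        using bound[of u] by (auto simp: zero_le_mult_iff abs_le_iff)
      ultimately show "\<exists>y. ((\<lambda>u. S u * exp (c * u)) has_real_derivative y) (at u) \<and> y \<ge> 0" by blast
    next
      show "continuous_on {t..t0} (\<lambda>u. S u * exp (c * u))"
        using t t0 by (intro continuous_intros continuous_on_subset[OF cont]) auto
    qed
    moreover have "S t0 = 0" using t0 by (simp add: S_def)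
    ultimately show ?thesis by (simp add: mult_le_0_iff)
  qed
  then have "S t = 0" using S0[of t] by simp
  then show ?thesis
    using J i by (simp add: S_def sum_nonneg_eq_0_iff)
qed

section \<open>The matrix exponential\<close>

fun mpow :: "nat \<Rightarrow> (nat \<Rightarrow> nat \<Rightarrow> real) \<Rightarrow> nat \<Rightarrow> nat \<Rightarrow> nat \<Rightarrow> real" where
  "mpow n A 0 i j = (if i = j then 1 else 0)"
| "mpow n A (Suc k) i j = (\<Sum>l<n. A i l * mpow n A k l j)"

lemma mpow_Suc_right:
  assumes "i < n" "j < n"
  shows "mpow n A (Suc k) i j = (\<Sum>l<n. mpow n A k i l * A l j)"
  using assms
proof (induction k arbitrary: i)
  case 0
  then show ?case by (simp add: if_distrib[of "\<lambda>c. c * _"] if_distrib[of "\<lambda>c. _ * c"] cong: if_cong)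
next
  case (Suc k)
  have "mpow n A (Suc (Suc k)) i j = (\<Sum>l<n. A i l * (\<Sum>r<n. mpow n A k l r * A r j))"
    unfolding mpow.simps(2)[of n A "Suc k"] using Suc by (intro sum.cong refl) (simp del: mpow.simps)
  also have "\<dots> = (\<Sum>r<n. (\<Sum>l<n. A i l * mpow n A k l r) * A r j)"
    unfolding sum_distrib_left sum_distrib_right by (subst sum.swap) (simp add: mult.assoc)
  finally show ?case by simp
qed

definition mexp :: "nat \<Rightarrow> (nat \<Rightarrow> nat \<Rightarrow> real) \<Rightarrow> nat \<Rightarrow> nat \<Rightarrow> real \<Rightarrow> real" where
  "mexp n A i j t = (\<Sum>k. mpow n A k i j / fact k * t ^ k)"

text \<open>With c the sum of the moduli of all entries, the entries of the k-th power are bounded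
  by c^k, and the exponential series of c \<bar>t\<bar> dominates.\<close>

lemma mexp_summable:
  assumes "i < n" "j < n"
  shows "summable (\<lambda>k. mpow n A k i j / fact k * t ^ k)"
proof -
  define c where "c = (\<Sum>i<n. \<Sum>l<n. \<bar>A i l\<bar>)"
  have c: "(\<Sum>l<n. \<bar>A i l\<bar>) \<le> c" if "i < n" for i
    unfolding c_def using that by (intro member_le_sum[of i _ "\<lambda>i. \<Sum>l<n. \<bar>A i l\<bar>"]) (auto intro: sum_nonneg)
  have c0: "c \<ge> 0" unfolding c_def by (intro sum_nonneg) auto
  have bound: "\<bar>mpow n A k i j\<bar> \<le> c ^ k" if "i < n" for k i
    using that
  proof (induction k arbitrary: i)
    case (Suc k)
    have "\<bar>mpow n A (Suc k) i j\<bar> \<le> (\<Sum>l<n. \<bar>A i l\<bar> * \<bar>mpow n A k l j\<bar>)"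
      by (simp add: flip: abs_mult)
    also have "\<dots> \<le> (\<Sum>l<n. \<bar>A i l\<bar> * c ^ k)"
      using Suc by (intro sum_mono mult_left_mono) auto
    also have "\<dots> \<le> c * c ^ k"
      unfolding sum_distrib_right[symmetric] using c[OF Suc.prems] c0 by (intro mult_right_mono) auto
    finally show ?case by simp
  qed auto
  show ?thesis
  proof (rule summable_comparison_test[OF _ summable_exp[of "c * \<bar>t\<bar>"]], intro exI allI impI)
    fix k
    have "norm (mpow n A k i j / fact k * t ^ k) = \<bar>mpow n A k i j\<bar> * (\<bar>t\<bar> ^ k / fact k)"
      by (simp add: abs_mult power_abs)
    also have "\<dots> \<le> c ^ k * (\<bar>t\<bar> ^ k / fact k)"
      using bound[OF assms(1)] by (intro mult_right_mono) auto
    finally show "norm (mpow n A k i j / fact k * t ^ k) \<le> inverse (fact k) * (c * \<bar>t\<bar>) ^ k"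
      by (simp add: power_mult_distrib field_simps)
  qed
qed

lemma mexp_0: "mexp n A i j 0 = (if i = j then 1 else 0)"
  by (simp only: mexp_def powser_zero mpow.simps(1) fact_0 div_by_1)

lemma mexp_deriv_aux:
  assumes "i < n" "j < n"
  shows "(mexp n A i j has_real_derivative (\<Sum>k. mpow n A (Suc k) i j / fact k * t ^ k)) (at t)"
proof -
  have "((\<lambda>t. \<Sum>k. mpow n A k i j / fact k * t ^ k) has_real_derivative
      (\<Sum>k. diffs (\<lambda>k. mpow n A k i j / fact k) k * t ^ k)) (at t)"
    by (rule termdiffs_strong_converges_everywhere) (rule mexp_summable[OF assms])
  moreover have "diffs (\<lambda>k. mpow n A k i j / fact k) = (\<lambda>k. mpow n A (Suc k) i j / fact k)"
    by (auto simp: diffs_def fun_eq_iff field_simps simp del: mpow.simps of_nat_Suc)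
  ultimately show ?thesis by (simp add: mexp_def[abs_def] del: mpow.simps)
qed

lemma mexp_deriv:
  assumes "i < n" "j < n"
  shows "(mexp n A i j has_real_derivative (\<Sum>l<n. A i l * mexp n A l j t)) (at t)"
proof -
  have "(\<Sum>k. mpow n A (Suc k) i j / fact k * t ^ k) = (\<Sum>k. \<Sum>l<n. A i l * (mpow n A k l j / fact k * t ^ k))"
    by (simp add: sum_divide_distrib sum_distrib_right mult.assoc)
  also have "\<dots> = (\<Sum>l<n. \<Sum>k. A i l * (mpow n A k l j / fact k * t ^ k))"
    using assms by (intro suminf_sum summable_mult mexp_summable) simp_all
  also have "\<dots> = (\<Sum>l<n. A i l * mexp n A l j t)"
    unfolding mexp_def using assms by (intro sum.cong refl suminf_mult mexp_summable) simp_all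
  finally show ?thesis using mexp_deriv_aux[OF assms, of A t] by simp
qed

lemma mexp_deriv_right:
  assumes "i < n" "j < n"
  shows "(mexp n A i j has_real_derivative (\<Sum>l<n. mexp n A i l t * A l j)) (at t)"
proof -
  have "(\<Sum>k. mpow n A (Suc k) i j / fact k * t ^ k) = (\<Sum>k. \<Sum>l<n. A l j * (mpow n A k i l / fact k * t ^ k))"
    by (simp add: mpow_Suc_right[OF assms] sum_divide_distrib sum_distrib_right sum_distrib_left mult_ac
        del: mpow.simps)
  also have "\<dots> = (\<Sum>l<n. \<Sum>k. A l j * (mpow n A k i l / fact k * t ^ k))"
    using assms by (intro suminf_sum summable_mult mexp_summable) simp_all
  also have "\<dots> = (\<Sum>l<n. A l j * mexp n A i l t)"
    unfolding mexp_def using assms by (intro sum.cong refl suminf_mult mexp_summable) simp_all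
  finally show ?thesis using mexp_deriv_aux[OF assms, of A t] by (simp add: mult.commute del: mpow.simps)
qed

lemma mexp_continuous: "i < n \<Longrightarrow> j < n \<Longrightarrow> continuous_on S (mexp n A i j)"
  by (rule DERIV_continuous_on) (rule DERIV_subset[OF mexp_deriv subset_UNIV])

text \<open>The derivative of exp(tA) exp(-tA) is exp(tA) A exp(-tA) - exp(tA) A exp(-tA) = 0 if A
  is placed on the right in the first factor and on the left in the second; both forms of the
  derivative of the exponential enter here.\<close>

lemma mexp_inverse:
  assumes "i < n" "j < n"
  shows "(\<Sum>l<n. mexp n A i l t * mexp n A l j (- t)) = (if i = j then 1 else 0)"
proof -
  let ?G = "\<lambda>t. \<Sum>l<n. mexp n A i l t * mexp n A l j (- t)"
  have "(?G has_real_derivative 0) (at t)" for t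
  proof -
    have d: "((\<lambda>t. mexp n A l j (- t)) has_real_derivative - (\<Sum>r<n. A l r * mexp n A r j (- t))) (at t)"
      if "l < n" for l
    proof -
      have "(uminus has_real_derivative -1) (at t)"
        by (auto intro!: derivative_eq_intros)
      from DERIV_chain2[OF mexp_deriv[OF that assms(2)] this] show ?thesis by simp
    qed
    have "(?G has_real_derivative (\<Sum>l<n. (\<Sum>r<n. mexp n A i r t * A r l) * mexp n A l j (- t) +
        (- (\<Sum>r<n. A l r * mexp n A r j (- t))) * mexp n A i l t)) (at t)"
      using assms by (intro DERIV_sum DERIV_mult mexp_deriv_right d) auto
    moreover have "(\<Sum>l<n. (\<Sum>r<n. mexp n A i r t * A r l) * mexp n A l j (- t)) =
      (\<Sum>l<n. (\<Sum>r<n. A l r * mexp n A r j (- t)) * mexp n A i l t)"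
      unfolding sum_distrib_right by (subst sum.swap) (simp add: algebra_simps)
    ultimately show ?thesis by (simp add: sum.distrib sum_negf sum_subtractf)
  qed
  then have "?G t = ?G 0"
    using DERIV_isconst_all[of ?G t 0] by blast
  also have "?G 0 = (if i = j then 1 else 0)"
    using assms by (simp add: mexp_0 if_distrib cong: if_cong)
  finally show ?thesis .
qed

text \<open>The product rule for absolutely continuous functions, which are represented as a
  constant plus a primitive.\<close>

lemma primitive_mult_const:
  assumes F: "\<And>t. t \<in> {-1..1} \<Longrightarrow> F t = a + primitive g t" and H: "\<And>t. t \<in> {-1..1} \<Longrightarrow> H t = b + primitive h t"
    and g: "integrable leb_I g" and h: "integrable leb_I h" and t: "t \<in> {-1..1}"
  shows "F t * H t = a * b + primitive (\<lambda>s. g s * H s + F s * h s) t"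
proof -
  have i: "integrable leb_I (\<lambda>s. g s * primitive h s)" "integrable leb_I (\<lambda>s. primitive g s * h s)"
    using integrable_mult_continuous[OF g primitive_continuous[OF h]]
      integrable_mult_continuous[OF h primitive_continuous[OF g]]
    by (auto simp: mult.commute)
  have "F t * H t = a * b + (b * primitive g t + a * primitive h t + primitive g t * primitive h t)"
    using F[OF t] H[OF t] by (simp add: algebra_simps)
  also have "b * primitive g t + a * primitive h t + primitive g t * primitive h t =
      primitive (\<lambda>s. (b * g s + a * h s) + (g s * primitive h s + primitive g s * h s)) t"
    using g h i by (simp add: primitive_add primitive_cmult primitive_mult[OF g h t])
  also have "\<dots> = primitive (\<lambda>s. g s * H s + F s * h s) t"
    by (intro primitive_cong) (simp add: F H algebra_simps)
  finally show ?thesis .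
qed

text \<open>Variation of constants.\<close>

lemma linear_ode_exists:
  fixes n :: nat
  assumes f: "\<And>i. i < n \<Longrightarrow> integrable leb_I (f i)"
  obtains x where "\<And>i. i < n \<Longrightarrow> continuous_on {-1..1} (x i)"
    "\<And>i t. i < n \<Longrightarrow> t \<in> {-1..1} \<Longrightarrow>
      x i t = x0 i + primitive (\<lambda>s. (\<Sum>j<n. A i j * x j s) + f i s) t"
proof -
  let ?E = "mexp n A"
  define h where "h j s = (\<Sum>k<n. ?E j k (- s) * f k s)" for j s
  \<comment> \<open>The factor exp(A) undoes exp(-A) at the initial time -1, where \<open>x\<close>
    has to take the value \<open>x0\<close>.\<close>
  define v where "v j t = (\<Sum>k<n. ?E j k 1 * x0 k) + primitive (h j) t" for j t
  define x where "x i t = (\<Sum>j<n. ?E i j t * v j t)" for i t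
  have E: "continuous_on S (\<lambda>s. ?E j k (- s))" if "j < n" "k < n" for j k S
    using that by (intro continuous_on_compose2[OF mexp_continuous[of _ _ _ UNIV]] continuous_intros) auto
  have h: "integrable leb_I (h j)" if "j < n" for j
    unfolding h_def[abs_def]
    using integrable_mult_continuous[OF f E, of _ j] that
    by (intro Bochner_Integration.integrable_sum) (auto simp: mult.commute)
  have x: "continuous_on {-1..1} (x i)" if "i < n" for i
    unfolding x_def[abs_def] v_def using that
    by (intro continuous_intros mexp_continuous primitive_continuous h) auto
  show thesis
  proof (rule that[of x])
    fix i t assume i: "i < n" and t: "t \<in> {-1..(1::real)}"
    define g where "g j s = (\<Sum>l<n. A i l * ?E l j s)" for j s
    have g: "integrable leb_I (g j)" if "j < n" for j
      unfolding g_def[abs_def] using that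
      by (intro continuous_integrable_I continuous_intros mexp_continuous) auto
    have P: "?E i j t * v j t = ?E i j (-1) * (\<Sum>k<n. ?E j k 1 * x0 k) +
        primitive (\<lambda>s. g j s * v j s + ?E i j s * h j s) t" if j: "j < n" for j
    proof (rule primitive_mult_const[OF _ _ g[OF j] h[OF j] t])
      show "?E i j t = ?E i j (-1) + primitive (g j) t" if "t \<in> {-1..1}" for t
      proof -
        have "(?E i j has_real_derivative g j s) (at s within {-1..1})" for s
          unfolding g_def using mexp_deriv[OF i j, of A s] by (rule DERIV_subset) simp
        from primitive_of_deriv[OF this g[OF j] that] show ?thesis by simp
      qed
      show "v j t = (\<Sum>k<n. ?E j k 1 * x0 k) + primitive (h j) t" for t
        by (simp add: v_def)
    qed
    have vc: "continuous_on {-1..1} (v j)" if "j < n" for j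
      unfolding v_def[abs_def] using that by (intro continuous_intros primitive_continuous h)
    have "x i t = (\<Sum>j<n. ?E i j (-1) * (\<Sum>k<n. ?E j k 1 * x0 k)) +
        (\<Sum>j<n. primitive (\<lambda>s. g j s * v j s + ?E i j s * h j s) t)"
      unfolding x_def by (simp add: P sum.distrib)
    also have "(\<Sum>j<n. ?E i j (-1) * (\<Sum>k<n. ?E j k 1 * x0 k)) = (\<Sum>k<n. (\<Sum>j<n. ?E i j (-1) * ?E j k (- (-1))) * x0 k)"
      unfolding sum_distrib_left sum_distrib_right by (subst sum.swap) (simp add: mult.assoc)
    also have "\<dots> = (\<Sum>k<n. (if i = k then 1 else 0) * x0 k)"
      using i by (intro sum.cong refl) (simp only: mexp_inverse lessThan_iff)
    also have "\<dots> = x0 i"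
      using i by (simp add: if_distrib[of "\<lambda>c. c * _"] cong: if_cong)
    also have "(\<Sum>j<n. primitive (\<lambda>s. g j s * v j s + ?E i j s * h j s) t) =
        primitive (\<lambda>s. \<Sum>j<n. g j s * v j s + ?E i j s * h j s) t"
    proof (rule primitive_sum[symmetric])
      fix j assume "j \<in> {..<n}"
      then have j: "j < n" by simp
      have "integrable leb_I (\<lambda>s. g j s * v j s)" "integrable leb_I (\<lambda>s. h j s * ?E i j s)"
        using i j by (auto intro!: integrable_mult_continuous g h vc mexp_continuous)
      then show "integrable leb_I (\<lambda>s. g j s * v j s + ?E i j s * h j s)"
        by (simp add: mult.commute)
    qed
    also have "\<dots> = primitive (\<lambda>s. (\<Sum>j<n. A i j * x j s) + f i s) t"
    proof (rule primitive_cong)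
      fix s
      have "(\<Sum>j<n. g j s * v j s) = (\<Sum>l<n. A i l * x l s)"
        unfolding g_def x_def sum_distrib_left sum_distrib_right
        by (subst sum.swap) (simp add: mult.assoc)
      moreover have "(\<Sum>j<n. ?E i j s * h j s) = (\<Sum>k<n. (\<Sum>j<n. ?E i j s * ?E j k (- s)) * f k s)"
        unfolding h_def sum_distrib_left sum_distrib_right
        by (subst sum.swap) (simp add: mult.assoc)
      moreover have "\<dots> = f i s"
        using i by (simp add: mexp_inverse if_distrib[of "\<lambda>c. c * _"] cong: if_cong)
      ultimately show "(\<Sum>j<n. g j s * v j s + ?E i j s * h j s) = (\<Sum>j<n. A i j * x j s) + f i s"
        by (simp add: sum.distrib)
    qed
    finally show "x i t = x0 i + primitive (\<lambda>s. (\<Sum>j<n. A i j * x j s) + f i s) t" .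
  qed (rule x)
qed

lemma linear_ode_smooth_exists:
  fixes n :: nat
  assumes f: "\<And>i. i < n \<Longrightarrow> smooth_on {-1..1} (f i)"
  obtains x where "\<And>i. i < n \<Longrightarrow> smooth_on {-1..1} (x i)" "\<And>i. i < n \<Longrightarrow> x i (-1) = x0 i"
    "\<And>i t. i < n \<Longrightarrow> t \<in> {-1..1} \<Longrightarrow>
      (x i has_real_derivative (\<Sum>j<n. A i j * x j t) + f i t) (at t within {-1..1})"
proof -
  have fc: "continuous_on {-1..1} (f i)" if "i < n" for i
    using f that smooth_on_continuous by blast
  obtain x where x: "\<And>i. i < n \<Longrightarrow> continuous_on {-1..1} (x i)"
    "\<And>i t. i < n \<Longrightarrow> t \<in> {-1..1} \<Longrightarrow>
      x i t = x0 i + primitive (\<lambda>s. (\<Sum>j<n. A i j * x j s) + f i s) t"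
    using linear_ode_exists[of n f x0 A] fc continuous_integrable_I by blast
  have d: "(x i has_real_derivative (\<Sum>j<n. A i j * x j t) + f i t) (at t within {-1..1})"
    if i: "i < n" and t: "t \<in> {-1..1}" for i t
  proof -
    have "continuous_on {-1..1} (\<lambda>s. (\<Sum>j<n. A i j * x j s) + f i s)"
      using i by (intro continuous_intros x fc) auto
    then have "((\<lambda>t. x0 i + primitive (\<lambda>s. (\<Sum>j<n. A i j * x j s) + f i s) t) has_real_derivative
        (\<Sum>j<n. A i j * x j t) + f i t) (at t within {-1..1})"
      using primitive_deriv t by (auto intro!: derivative_eq_intros)
    then show ?thesis
      by (rule has_field_derivative_transform_within[of _ _ _ _ 1]) (use i t x(2) in auto)
  qed
  show thesis
  proof (rule that[of x])
    show "smooth_on {-1..1} (x i)" if "i < n" for i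
      by (rule smooth_on_linear_ode[of "{..<n}" i _ x A f]) (use that d f in auto)
    show "x i (-1) = x0 i" if "i < n" for i
      using x(2)[OF that, of "-1"] by simp
  qed (use d in auto)
qed

section \<open>Weak solutions of scalar equations\<close>

lemma primitive_pow_integrable:
  assumes "integrable leb_I e"
  shows "integrable leb_I ((primitive ^^ k) e)"
  using assms by (induction k) (auto intro: continuous_integrable_I primitive_continuous)

lemma parts_primitive_pow:
  assumes e: "integrable leb_I e" and \<phi>: "\<phi> \<in> test_fun"
  shows "(\<integral>t. e t * \<phi> t \<partial>leb_I) = (-1) ^ k * (\<integral>t. (primitive ^^ k) e t * (deriv ^^ k) \<phi> t \<partial>leb_I)"
proof (induction k)
  case (Suc k)
  have "(\<integral>t. (primitive ^^ Suc k) e t * (deriv ^^ Suc k) \<phi> t \<partial>leb_I) =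
      - (\<integral>t. (primitive ^^ k) e t * (deriv ^^ k) \<phi> t \<partial>leb_I)"
    using test_fun_integral_deriv[OF primitive_pow_integrable[OF e, of k] test_fun_deriv_funpow[OF \<phi>, of k]]
    by simp
  then show ?case using Suc by simp
qed simp

text \<open>Integrating by parts until all test functions carry r derivatives shows that a
  combination of iterated primitives of e has vanishing r-th weak derivative, hence is a polynomial.
  Solving it for e leaves a polynomial and continuous primitives of e, so e has a continuous
  representative; a first-order system then gives smoothness.\<close>

lemma weak_ode_smooth:
  assumes e: "e \<in> L2" and d: "d \<noteq> 0"
    and 0: "\<And>\<psi>. \<psi> \<in> test_fun \<Longrightarrow> (\<integral>t. e t * pdo d \<psi> t \<partial>leb_I) = 0"
  shows "\<exists>f. smooth_on {-1..1} f \<and> (AE t in leb_I. e t = f t)"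
proof -
  define r where "r = degree d"
  have ei: "integrable leb_I e" using e by (rule L2_integrable)
  let ?J = "\<lambda>k. (primitive ^^ k) e"
  \<comment> \<open>Formally the r-fold primitive of the differential expression: the j-th
    derivative of \<open>e\<close> is replaced by its (r - j)-fold primitive.\<close>
  define F where "F t = (\<Sum>j\<le>r. coeff d j * ?J (r - j) t)" for t
  have Ji: "integrable leb_I (\<lambda>t. ?J k t * (deriv ^^ r) \<phi> t)" if "\<phi> \<in> test_fun" for k \<phi>
    using that by (intro integrable_mult_continuous primitive_pow_integrable ei test_fun_continuous) auto
  have "\<exists>Q. AE t in leb_I. F t = poly Q t"
  proof (rule du_Bois_Reymond_poly)
    show "integrable leb_I F"
      unfolding F_def[abs_def]
      by (intro Bochner_Integration.integrable_sum integrable_mult_right primitive_pow_integrable ei)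
    fix \<phi> assume \<phi>: "\<phi> \<in> test_fun"
    have ji: "integrable leb_I (\<lambda>t. e t * (deriv ^^ j) \<phi> t)" for j
      using \<phi> e by (intro L2_test_integrable) auto
    have sign: "c * s2 * X = s * (c * Y)" if "X = s1 * Y" "s2 * s1 = s" for c s s1 s2 X Y :: real
      using that by (auto simp: mult_ac)
    have "(\<integral>t. F t * (deriv ^^ r) \<phi> t \<partial>leb_I) =
        (\<integral>t. (\<Sum>j\<le>r. coeff d j * (?J (r - j) t * (deriv ^^ r) \<phi> t)) \<partial>leb_I)"
      by (simp only: F_def sum_distrib_right mult.assoc)
    also have "\<dots> = (\<Sum>j\<le>r. \<integral>t. coeff d j * (?J (r - j) t * (deriv ^^ r) \<phi> t) \<partial>leb_I)"
      by (intro Bochner_Integration.integral_sum integrable_mult_right Ji \<phi>)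
    also have "\<dots> = (\<Sum>j\<le>r. coeff d j * (\<integral>t. ?J (r - j) t * (deriv ^^ r) \<phi> t \<partial>leb_I))"
      by (simp only: integral_mult_right_zero)
    finally have F\<phi>: "(\<integral>t. F t * (deriv ^^ r) \<phi> t \<partial>leb_I) =
        (\<Sum>j\<le>r. coeff d j * (\<integral>t. ?J (r - j) t * (deriv ^^ r) \<phi> t \<partial>leb_I))" .
    have "0 = (\<integral>t. e t * pdo d \<phi> t \<partial>leb_I)" using 0[OF \<phi>] by simp
    also have "\<dots> = (\<integral>t. (\<Sum>j\<le>r. coeff d j * (-1) ^ j * (e t * (deriv ^^ j) \<phi> t)) \<partial>leb_I)"
      by (simp add: pdo_def r_def sum_distrib_left algebra_simps)
    also have "\<dots> = (\<Sum>j\<le>r. coeff d j * (-1) ^ j * (\<integral>t. e t * (deriv ^^ j) \<phi> t \<partial>leb_I))"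
      using ji by (subst Bochner_Integration.integral_sum) auto
    also have "\<dots> = (\<Sum>j\<le>r. (-1) ^ r * (coeff d j * (\<integral>t. ?J (r - j) t * (deriv ^^ r) \<phi> t \<partial>leb_I)))"
    proof (intro sum.cong refl)
      fix j assume "j \<in> {..r}"
      then have j: "r - j + j = r" by simp
      have dj: "(deriv ^^ (r - j)) ((deriv ^^ j) \<phi>) = (deriv ^^ r) \<phi>"
      proof -
        have "((deriv :: (real \<Rightarrow> real) \<Rightarrow> _) ^^ (r - j + j)) = (deriv ^^ (r - j)) \<circ> (deriv ^^ j)"
          by (rule funpow_add)
        then show ?thesis unfolding j by simp
      qed
      have "(\<integral>t. e t * (deriv ^^ j) \<phi> t \<partial>leb_I) = (-1) ^ (r - j) * (\<integral>t. ?J (r - j) t * (deriv ^^ r) \<phi> t \<partial>leb_I)"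
        using parts_primitive_pow[OF ei test_fun_deriv_funpow[OF \<phi>, of j], of "r - j"]
        unfolding dj .
      moreover have "(-1 :: real) ^ j * (-1) ^ (r - j) = (-1) ^ r"
        using power_add[of "-1 :: real" "r - j" j] j by (simp add: mult.commute)
      ultimately show "coeff d j * (-1) ^ j * (\<integral>t. e t * (deriv ^^ j) \<phi> t \<partial>leb_I) =
          (-1) ^ r * (coeff d j * (\<integral>t. ?J (r - j) t * (deriv ^^ r) \<phi> t \<partial>leb_I))"
        by (rule sign)
    qed
    also have "\<dots> = (-1) ^ r * (\<integral>t. F t * (deriv ^^ r) \<phi> t \<partial>leb_I)"
      by (simp only: F\<phi> sum_distrib_left)
    finally show "(\<integral>t. F t * (deriv ^^ r) \<phi> t \<partial>leb_I) = 0" by simp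
  qed
  then obtain Q where Q: "AE t in leb_I. F t = poly Q t" by blast
  define a where "a = coeff d r"
  have a: "a \<noteq> 0" using d by (simp add: a_def r_def)
  \<comment> \<open>The term j = r of \<open>F\<close> is a multiple of \<open>e\<close> itself. All
    other terms are primitives of order at least 1, hence continuous.\<close>
  define f where "f t = (poly Q t - (\<Sum>j<r. coeff d j * ?J (r - j) t)) / a" for t
  have "AE t in leb_I. e t = f t"
    using Q
  proof eventually_elim
    case (elim t)
    have "F t = (\<Sum>j<r. coeff d j * ?J (r - j) t) + a * e t"
      by (simp add: F_def a_def flip: lessThan_Suc_atMost)
    then show ?case using elim a by (simp add: f_def field_simps)
  qed
  have J1: "continuous_on {-1..1} (?J (Suc k))" for k
    by (simp add: primitive_continuous primitive_pow_integrable ei)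
  have fc: "continuous_on {-1..1} f"
    unfolding f_def[abs_def]
  proof (intro continuous_intros)
    fix j assume "j \<in> {..<r}"
    then have "r - j = Suc (r - j - 1)" by simp
    then show "continuous_on {-1..1} (?J (r - j))" using J1 by metis
  qed (use a in auto)
  have ef: "primitive e t = primitive f t" for t
    using \<open>AE t in leb_I. e t = f t\<close>
    by (rule primitive_cong_AE) (use e fc in \<open>auto intro: continuous_measurable_I L2_measurable\<close>)
  \<comment> \<open>The iterated primitives of \<open>e\<close> form a first-order linear system with polynomial forcing.\<close>
  define x where "x k = (if k = 0 then f else ?J k)" for k
  have dx: "(x (Suc k) has_real_derivative x k t) (at t within {-1..1})" if "t \<in> {-1..1}" for k t
  proof (cases "k = 0")
    case True
    have "(primitive f has_real_derivative f t) (at t within {-1..1})"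
      by (rule primitive_deriv[OF fc that])
    moreover have "primitive e = primitive f" using ef by auto
    ultimately show ?thesis using True by (simp add: x_def)
  next
    case False
    then obtain k' where k': "k = Suc k'" by (cases k) auto
    show ?thesis using primitive_deriv[OF J1[of k'] that] by (simp add: x_def k')
  qed
  have f_alt: "f t = poly (Polynomial.smult (1/a) Q) t + (\<Sum>j<r. (- coeff d j / a) * x (r - j) t)" for t
    using a by (simp add: f_def x_def diff_divide_distrib sum_divide_distrib sum_negf)
  have dx0: "(x 0 has_real_derivative (\<Sum>j<r. (- coeff d j / a) * x (r - j - 1) t) + poly (pderiv (Polynomial.smult (1/a) Q)) t)
      (at t within {-1..1})" if t: "t \<in> {-1..1}" for t
  proof -
    have x0: "x 0 = (\<lambda>t. (\<Sum>j<r. (- coeff d j / a) * x (r - j) t) + poly (Polynomial.smult (1/a) Q) t)"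
      using f_alt by (auto simp: x_def)
    show ?thesis unfolding x0
    proof (intro DERIV_add DERIV_sum DERIV_cmult DERIV_subset[OF poly_DERIV])
      fix j assume "j \<in> {..<r}"
      then have "r - j = Suc (r - j - 1)" by simp
      then show "(x (r - j) has_real_derivative x (r - j - 1) t) (at t within {-1..1})"
        using dx[OF t, of "r - j - 1"] by metis
    qed auto
  qed
  have "smooth_on {-1..1} f"
  proof (cases "r = 0")
    case True
    then have "f = poly (Polynomial.smult (1/a) Q)" using f_alt by auto
    then show ?thesis by (simp add: smooth_on_poly)
  next
    case False
    \<comment> \<open>Companion matrix for the vector of f and its primitives of order 1 to r - 1:
      row 0 is the differentiated equation for f, every other row says that a primitive has its
      predecessor as derivative.\<close>
    define M where "M i j = (if i = 0 then - coeff d (r - 1 - j) / a else if j = i - 1 then 1 else 0)" for i j :: nat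
    have "smooth_on {-1..1} (x 0)"
    proof (rule smooth_on_linear_ode[of "{..<r}" 0 _ x M
          "\<lambda>i t. if i = 0 then poly (pderiv (Polynomial.smult (1/a) Q)) t else 0"])
      fix i t assume i: "i \<in> {..<r}" and t: "t \<in> {-1..(1::real)}"
      show "(x i has_real_derivative (\<Sum>j\<in>{..<r}. M i j * x j t) +
          (if i = 0 then poly (pderiv (Polynomial.smult (1/a) Q)) t else 0)) (at t within {-1..1})"
      proof (cases "i = 0")
        case True
        have "(\<Sum>j<r. M 0 j * x j t) = (\<Sum>j<r. (- coeff d j / a) * x (r - j - 1) t)"
          by (rule sum.reindex_bij_witness[of _ "\<lambda>j. r - 1 - j" "\<lambda>j. r - 1 - j"]) (auto simp: M_def)
        then show ?thesis using dx0[OF t] True by simp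
      next
        case False
        then obtain i' where i': "i = Suc i'" by (cases i) auto
        have "(\<Sum>j<r. M i j * x j t) = (\<Sum>j<r. if j = i' then x j t else 0)"
          by (intro sum.cong) (auto simp: M_def i')
        also have "\<dots> = x i' t" using i i' by simp
        finally show ?thesis using dx[OF t, of i'] i' by simp
      qed
    next
      fix i show "smooth_on {-1..1} (\<lambda>t. if i = 0 then poly (pderiv (Polynomial.smult (1/a) Q)) t else 0)"
        by (cases "i = 0") (auto intro: smooth_on_poly)
    qed (use False in auto)
    then show ?thesis by (simp add: x_def)
  qed
  then show ?thesis using \<open>AE t in leb_I. e t = f t\<close> by blast
qed

section \<open>Elimination over integral domains\<close>

text \<open>Fraction-free elimination of the last coordinate. If some b in N has a nonzero last
  coordinate, v is replaced by \<open>b q * v i - v q * b i\<close>, whose last coordinate is zero,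
  and the elements of N with last coordinate zero are considered. If all elements of N have last
  coordinate zero but v does not, the last coordinate itself separates. Over a field this says that
  v lies in the subspace N or is separated from it.\<close>

lemma submodule_separation:
  fixes v :: "nat \<Rightarrow> 'a :: idom"
  assumes "(\<lambda>i. 0) \<in> N"
    and "\<And>a b r s. a \<in> N \<Longrightarrow> b \<in> N \<Longrightarrow> (\<lambda>i. r * a i + s * b i) \<in> N"
  shows "(\<exists>d. d \<noteq> 0 \<and> (\<exists>a\<in>N. \<forall>i<q. d * v i = a i)) \<or>
    (\<exists>k. (\<forall>a\<in>N. (\<Sum>i<q. a i * k i) = 0) \<and> (\<Sum>i<q. v i * k i) \<noteq> 0)"
  using assms
proof (induction q arbitrary: N v)
  case 0
  then show ?case by (auto intro!: exI[of _ 1])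
next
  case (Suc q)
  show ?case
  proof (cases "\<exists>b\<in>N. b q \<noteq> 0")
    case True
    then obtain b where b: "b \<in> N" "b q \<noteq> 0" by blast
    define N' where "N' = {a \<in> N. a q = 0}"
    define v' where "v' i = b q * v i - v q * b i" for i
    have "(\<exists>d. d \<noteq> 0 \<and> (\<exists>a\<in>N'. \<forall>i<q. d * v' i = a i)) \<or>
      (\<exists>k. (\<forall>a\<in>N'. (\<Sum>i<q. a i * k i) = 0) \<and> (\<Sum>i<q. v' i * k i) \<noteq> 0)"
      by (rule Suc.IH) (auto simp: N'_def Suc.prems)
    then show ?thesis
    proof (elim disjE exE conjE bexE)
      fix d a assume d: "d \<noteq> 0" and a: "a \<in> N'" "\<forall>i<q. d * v' i = a i"
      have aN: "a \<in> N" "a q = 0" using a by (auto simp: N'_def)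
      have A: "(\<lambda>i. 1 * a i + (d * v q) * b i) \<in> N"
        by (rule Suc.prems(2)[OF aN(1) b(1)])
      have B: "\<forall>i<Suc q. (d * b q) * v i = 1 * a i + (d * v q) * b i"
      proof (intro allI impI)
        fix i assume "i < Suc q"
        then have "d * v' i = a i" using a aN by (cases "i = q") (auto simp: v'_def)
        then show "(d * b q) * v i = 1 * a i + (d * v q) * b i"
          by (simp add: v'_def algebra_simps)
      qed
      have "d * b q \<noteq> 0" using d b by simp
      then show ?thesis by (intro disjI1 exI[of _ "d * b q"] conjI bexI[OF _ A] B)
    next
      fix k assume k: "\<forall>a\<in>N'. (\<Sum>i<q. a i * k i) = 0" "(\<Sum>i<q. v' i * k i) \<noteq> 0"
      \<comment> \<open>Scaling by the pivot \<open>b q\<close> avoids division; the last coordinate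
        is chosen such that the extended functional vanishes on \<open>b\<close>.\<close>
      define k' where "k' i = (if i < q then b q * k i else - (\<Sum>i<q. b i * k i))" for i
      have k': "(\<Sum>i<Suc q. a i * k' i) = (\<Sum>i<q. (b q * a i - a q * b i) * k i)" for a
      proof -
        have "(\<Sum>i<q. a i * k' i) = (\<Sum>i<q. a i * (b q * k i))"
          by (rule sum.cong) (simp_all add: k'_def)
        moreover have "k' q = - (\<Sum>i<q. b i * k i)"
          by (simp add: k'_def)
        ultimately have "(\<Sum>i<Suc q. a i * k' i) = (\<Sum>i<q. a i * (b q * k i)) - a q * (\<Sum>i<q. b i * k i)"
          by (simp only: sum.lessThan_Suc mult_minus_right add_uminus_conv_diff)
        also have "\<dots> = (\<Sum>i<q. a i * (b q * k i) - a q * (b i * k i))"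
          by (simp only: sum_distrib_left sum_subtractf)
        also have "\<dots> = (\<Sum>i<q. (b q * a i - a q * b i) * k i)"
          by (intro sum.cong refl) (simp add: algebra_simps)
        finally show ?thesis .
      qed
      have "(\<Sum>i<Suc q. a i * k' i) = 0" if a: "a \<in> N" for a
      proof -
        have "(\<lambda>i. b q * a i + (- a q) * b i) \<in> N" by (rule Suc.prems(2)[OF a b(1)])
        then have "(\<lambda>i. b q * a i - a q * b i) \<in> N'"
          by (auto simp: N'_def)
        then show ?thesis unfolding k' using bspec[OF k(1)] by blast
      qed
      moreover have "(\<Sum>i<Suc q. v i * k' i) \<noteq> 0"
        unfolding k' using k(2) by (simp add: v'_def)
      ultimately show ?thesis by blast
    qed
  next
    case False
    show ?thesis
    proof (cases "v q = 0")
      case True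
      have "(\<exists>d. d \<noteq> 0 \<and> (\<exists>a\<in>N. \<forall>i<q. d * v i = a i)) \<or>
        (\<exists>k. (\<forall>a\<in>N. (\<Sum>i<q. a i * k i) = 0) \<and> (\<Sum>i<q. v i * k i) \<noteq> 0)"
        by (rule Suc.IH) (auto simp: Suc.prems)
      then show ?thesis
      proof (elim disjE exE conjE bexE)
        fix d a assume "d \<noteq> 0" "a \<in> N" "\<forall>i<q. d * v i = a i"
        then show ?thesis using True False by (intro disjI1 exI[of _ d] conjI bexI[of _ a]) (auto simp: less_Suc_eq)
      next
        fix k assume "\<forall>a\<in>N. (\<Sum>i<q. a i * k i) = 0" "(\<Sum>i<q. v i * k i) \<noteq> 0"
        then show ?thesis using True False by (intro disjI2 exI[of _ k]) auto
      qed
    next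
      case v: False
      show ?thesis
        using v False
        by (intro disjI2 exI[of _ "\<lambda>i. if i = q then 1 else 0"])
          (auto simp: if_distrib[of "\<lambda>c. _ * c"] cong: if_cong)
    qed
  qed
qed

section \<open>Linear dependence of real vectors\<close>

lemma more_vectors_dependent:
  fixes V :: "nat \<Rightarrow> nat \<Rightarrow> real"
  assumes "finite K" "card K = Suc n"
  shows "\<exists>\<beta>. (\<exists>k\<in>K. \<beta> k \<noteq> 0) \<and> (\<forall>j<n. (\<Sum>k\<in>K. \<beta> k * V k j) = 0)"
  using assms
proof (induction n arbitrary: K V)
  case 0
  then show ?case by (intro exI[of _ "\<lambda>_. 1"]) (auto simp: card_Suc_eq)
next
  case (Suc n)
  show ?case
  proof (cases "\<forall>k\<in>K. V k n = 0")
    case True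
    obtain k0 where k0: "k0 \<in> K" using Suc.prems by fastforce
    then obtain \<beta> where \<beta>: "\<exists>k\<in>K - {k0}. \<beta> k \<noteq> 0" "\<forall>j<n. (\<Sum>k\<in>K - {k0}. \<beta> k * V k j) = 0"
      using Suc.IH[of "K - {k0}" V] Suc.prems by auto
    let ?b = "\<beta>(k0 := 0)"
    have "(\<Sum>k\<in>K. ?b k * V k j) = (\<Sum>k\<in>K - {k0}. \<beta> k * V k j)" for j
      using k0 Suc.prems by (subst sum.remove[of K k0]) (auto intro!: sum.cong)
    then show ?thesis
      using \<beta> True by (intro exI[of _ ?b]) (auto simp: less_Suc_eq)
  next
    case False
    then obtain k0 where k0: "k0 \<in> K" "V k0 n \<noteq> 0" by blast
    define r where "r k = V k n / V k0 n" for k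
    define V' where "V' k j = V k j - r k * V k0 j" for k j
    obtain \<beta> where \<beta>: "\<exists>k\<in>K - {k0}. \<beta> k \<noteq> 0" "\<forall>j<n. (\<Sum>k\<in>K - {k0}. \<beta> k * V' k j) = 0"
      using Suc.IH[of "K - {k0}" V'] Suc.prems k0 by auto
    let ?b = "\<beta>(k0 := - (\<Sum>k\<in>K - {k0}. \<beta> k * r k))"
    have eq: "(\<Sum>k\<in>K. ?b k * V k j) = (\<Sum>k\<in>K - {k0}. \<beta> k * V' k j)" for j
    proof -
      have "(\<Sum>k\<in>K. ?b k * V k j) = ?b k0 * V k0 j + (\<Sum>k\<in>K - {k0}. ?b k * V k j)"
        using k0 Suc.prems by (subst sum.remove[of K k0]) auto
      also have "(\<Sum>k\<in>K - {k0}. ?b k * V k j) = (\<Sum>k\<in>K - {k0}. \<beta> k * V k j)"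
        by (intro sum.cong) auto
      finally show ?thesis
        by (simp add: V'_def right_diff_distrib sum_subtractf sum_distrib_left sum_distrib_right mult_ac)
    qed
    have "(\<Sum>k\<in>K. ?b k * V k j) = 0" if "j < Suc n" for j
    proof (cases "j = n")
      case True
      then show ?thesis unfolding eq using k0 by (simp add: V'_def r_def)
    next
      case False
      then show ?thesis unfolding eq using \<beta> that by auto
    qed
    then show ?thesis using \<beta>(1) by (intro exI[of _ ?b]) auto
  qed
qed

text \<open>Any n + 1 vectors with n coordinates are dependent; d is the largest index with a
  nonzero coefficient. Applied to the rows \<zeta> A^k, this takes the place of the Cayley-Hamilton
  theorem and bounds the number of differentiations by n.\<close>

lemma first_dependent_vector:
  fixes V :: "nat \<Rightarrow> nat \<Rightarrow> real"
  shows "\<exists>d\<le>n. \<exists>\<beta>. \<forall>j<n. V d j = (\<Sum>k<d. \<beta> k * V k j)"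
proof -
  obtain \<beta> where \<beta>: "\<exists>k\<in>{..n}. \<beta> k \<noteq> 0" "\<forall>j<n. (\<Sum>k\<in>{..n}. \<beta> k * V k j) = 0"
    using more_vectors_dependent[of "{..n}" n V] by auto
  define d where "d = Max {k \<in> {..n}. \<beta> k \<noteq> 0}"
  have fin: "finite {k \<in> {..n}. \<beta> k \<noteq> 0}" and ne: "{k \<in> {..n}. \<beta> k \<noteq> 0} \<noteq> {}" using \<beta> by auto
  have d: "d \<le> n" "\<beta> d \<noteq> 0" using Max_in[OF fin ne] by (auto simp: d_def)
  have z: "\<beta> k = 0" if "k > d" "k \<le> n" for k
  proof (rule ccontr)
    assume "\<beta> k \<noteq> 0"
    then have "k \<le> d" unfolding d_def using that fin by (intro Max_ge) auto
    then show False using that by simp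
  qed
  have "V d j = (\<Sum>k<d. (- \<beta> k / \<beta> d) * V k j)" if "j < n" for j
  proof -
    have "0 = (\<Sum>k\<le>n. \<beta> k * V k j)" using \<beta> that by simp
    also have "\<dots> = (\<Sum>k\<le>d. \<beta> k * V k j)"
      using z d by (intro sum.mono_neutral_right) auto
    also have "\<dots> = (\<Sum>k<d. \<beta> k * V k j) + \<beta> d * V d j"
      by (simp flip: lessThan_Suc_atMost)
    finally have "V d j = - (\<Sum>k<d. \<beta> k * V k j) / \<beta> d"
      using d by (simp add: field_simps)
    then show ?thesis by (simp add: sum_divide_distrib sum_negf)
  qed
  then show ?thesis
    using d by (intro exI[of _ d] exI[of _ "\<lambda>k. - \<beta> k / \<beta> d"] conjI) auto
qed

text \<open>The row vector \<zeta> A^k; along solutions of x' = A x it yields the k-th derivative of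
  \<zeta> x.\<close>

fun row_pow :: "nat \<Rightarrow> (nat \<Rightarrow> nat \<Rightarrow> real) \<Rightarrow> (nat \<Rightarrow> real) \<Rightarrow> nat \<Rightarrow> nat \<Rightarrow> real" where
  "row_pow n A \<zeta> 0 j = \<zeta> j"
| "row_pow n A \<zeta> (Suc k) j = (\<Sum>l<n. row_pow n A \<zeta> k l * A l j)"

lemma row_pow_state: "(\<Sum>j<n. row_pow n A \<zeta> (Suc k) j * x j) = (\<Sum>l<n. row_pow n A \<zeta> k l * (\<Sum>j<n. A l j * x j))"
  by (simp add: sum_distrib_left sum_distrib_right mult.assoc) (rule sum.swap)

section \<open>States of weak trajectories\<close>

text \<open>The kernel equations row by row, tested with scalar functions. Columns of
  \<open>R\<close> below m belong to inputs, those from m on to outputs.\<close>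

definition weak_sol :: "nat \<Rightarrow> nat \<Rightarrow> nat \<Rightarrow> (nat \<Rightarrow> nat \<Rightarrow> real poly) \<Rightarrow> (nat \<Rightarrow> real \<Rightarrow> real) \<Rightarrow> (nat \<Rightarrow> real \<Rightarrow> real) \<Rightarrow> bool" where
  "weak_sol m p g R u y \<longleftrightarrow> (\<forall>i<m. u i \<in> L2) \<and> (\<forall>i<p. y i \<in> L2) \<and>
     (\<forall>k<g. \<forall>\<psi>\<in>test_fun. (\<Sum>c<m. \<integral>t. u c t * pdo (R k c) \<psi> t \<partial>leb_I) +
        (\<Sum>c<p. \<integral>t. y c t * pdo (R k (m + c)) \<psi> t \<partial>leb_I) = 0)"

text \<open>For a merely square integrable input the state is absolutely continuous but in general
  not differentiable everywhere; the state equation is therefore integrated and the output equation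
  required almost everywhere.\<close>

definition state_sol :: "nat \<Rightarrow> nat \<Rightarrow> nat \<Rightarrow> (nat \<Rightarrow> nat \<Rightarrow> real) \<Rightarrow> (nat \<Rightarrow> nat \<Rightarrow> real) \<Rightarrow>
    (nat \<Rightarrow> nat \<Rightarrow> real) \<Rightarrow> (nat \<Rightarrow> nat \<Rightarrow> real) \<Rightarrow> (nat \<Rightarrow> real \<Rightarrow> real) \<Rightarrow> (nat \<Rightarrow> real \<Rightarrow> real) \<Rightarrow>
    (nat \<Rightarrow> real \<Rightarrow> real) \<Rightarrow> bool" where
  "state_sol m p n A B C D u y x \<longleftrightarrow> (\<forall>i<n. continuous_on {-1..1} (x i)) \<and>
     (\<forall>i<n. \<forall>t\<in>{-1..1}. x i t = x i (-1) +
        primitive (\<lambda>s. (\<Sum>j<n. A i j * x j s) + (\<Sum>j<m. B i j * u j s)) t) \<and>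
     (\<forall>i<p. AE t in leb_I. y i t = (\<Sum>j<n. C i j * x j t) + (\<Sum>j<m. D i j * u j t))"

definition smooth_state_sol :: "nat \<Rightarrow> nat \<Rightarrow> nat \<Rightarrow> (nat \<Rightarrow> nat \<Rightarrow> real) \<Rightarrow> (nat \<Rightarrow> nat \<Rightarrow> real) \<Rightarrow>
    (nat \<Rightarrow> nat \<Rightarrow> real) \<Rightarrow> (nat \<Rightarrow> nat \<Rightarrow> real) \<Rightarrow> (nat \<Rightarrow> real \<Rightarrow> real) \<Rightarrow> (nat \<Rightarrow> real \<Rightarrow> real) \<Rightarrow>
    (nat \<Rightarrow> real \<Rightarrow> real) \<Rightarrow> bool" where
  "smooth_state_sol m p n A B C D u y x \<longleftrightarrow> (\<forall>i<n. smooth_on {-1..1} (x i)) \<and>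
     (\<forall>t\<in>{-1..1}. (\<forall>i<n. (x i has_real_derivative
        (\<Sum>j<n. A i j * x j t) + (\<Sum>j<m. B i j * u j t)) (at t within {-1..1})) \<and>
        (\<forall>i<p. y i t = (\<Sum>j<n. C i j * x j t) + (\<Sum>j<m. D i j * u j t)))"

lemma weak_sol_cong_AE:
  assumes W: "weak_sol m p g R u y"
    and u: "\<And>i. i < m \<Longrightarrow> u' i \<in> L2 \<and> (AE t in leb_I. u i t = u' i t)"
    and y: "\<And>i. i < p \<Longrightarrow> y' i \<in> L2 \<and> (AE t in leb_I. y i t = y' i t)"
  shows "weak_sol m p g R u' y'"
proof -
  have eq: "(\<integral>t. f t * \<psi> t \<partial>leb_I) = (\<integral>t. f' t * \<psi> t \<partial>leb_I)"
    if "f \<in> L2" "f' \<in> L2" "AE t in leb_I. f t = f' t" "\<psi> \<in> test_fun" for f f' \<psi>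
  proof (rule integral_cong_AE)
    show "AE t in leb_I. f t * \<psi> t = f' t * \<psi> t" using that(3) by eventually_elim auto
  qed (use that test_fun_L2 in \<open>auto intro!: borel_measurable_times dest: L2_measurable\<close>)
  show ?thesis
    unfolding weak_sol_def
  proof (intro conjI allI impI ballI)
    fix k \<psi> assume k: "k < g" and \<psi>: "\<psi> \<in> test_fun"
    have "(\<Sum>c<m. \<integral>t. u' c t * pdo (R k c) \<psi> t \<partial>leb_I) = (\<Sum>c<m. \<integral>t. u c t * pdo (R k c) \<psi> t \<partial>leb_I)"
      using W u \<psi> by (intro sum.cong refl eq[symmetric]) (auto simp: weak_sol_def)
    moreover have "(\<Sum>c<p. \<integral>t. y' c t * pdo (R k (m + c)) \<psi> t \<partial>leb_I) =
        (\<Sum>c<p. \<integral>t. y c t * pdo (R k (m + c)) \<psi> t \<partial>leb_I)"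
      using W y \<psi> by (intro sum.cong refl eq[symmetric]) (auto simp: weak_sol_def)
    ultimately show "(\<Sum>c<m. \<integral>t. u' c t * pdo (R k c) \<psi> t \<partial>leb_I) +
        (\<Sum>c<p. \<integral>t. y' c t * pdo (R k (m + c)) \<psi> t \<partial>leb_I) = 0"
      using W k \<psi> by (simp add: weak_sol_def)
  qed (use u y in auto)
qed

lemma weak_sol_diff:
  assumes W: "weak_sol m p g R u y" "weak_sol m p g R u' y'"
  shows "weak_sol m p g R (\<lambda>i t. u i t - u' i t) (\<lambda>i t. y i t - y' i t)"
  unfolding weak_sol_def
proof (intro conjI allI impI ballI)
  fix k \<psi> assume k: "k < g" and \<psi>: "\<psi> \<in> test_fun"
  have eq: "(\<integral>t. (f t - f' t) * pdo P \<psi> t \<partial>leb_I) = (\<integral>t. f t * pdo P \<psi> t \<partial>leb_I) - (\<integral>t. f' t * pdo P \<psi> t \<partial>leb_I)"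
    if "f \<in> L2" "f' \<in> L2" for f f' P
    unfolding left_diff_distrib
    by (intro Bochner_Integration.integral_diff L2_test_integrable that pdo_test_fun \<psi>)
  have "(\<Sum>c<m. \<integral>t. (u c t - u' c t) * pdo (R k c) \<psi> t \<partial>leb_I) =
      (\<Sum>c<m. \<integral>t. u c t * pdo (R k c) \<psi> t \<partial>leb_I) - (\<Sum>c<m. \<integral>t. u' c t * pdo (R k c) \<psi> t \<partial>leb_I)"
    unfolding sum_subtractf[symmetric] using W by (intro sum.cong refl eq) (auto simp: weak_sol_def)
  moreover have "(\<Sum>c<p. \<integral>t. (y c t - y' c t) * pdo (R k (m + c)) \<psi> t \<partial>leb_I) =
      (\<Sum>c<p. \<integral>t. y c t * pdo (R k (m + c)) \<psi> t \<partial>leb_I) - (\<Sum>c<p. \<integral>t. y' c t * pdo (R k (m + c)) \<psi> t \<partial>leb_I)"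
    unfolding sum_subtractf[symmetric] using W by (intro sum.cong refl eq) (auto simp: weak_sol_def)
  moreover have "(\<Sum>c<m. \<integral>t. u c t * pdo (R k c) \<psi> t \<partial>leb_I) +
        (\<Sum>c<p. \<integral>t. y c t * pdo (R k (m + c)) \<psi> t \<partial>leb_I) = 0"
    "(\<Sum>c<m. \<integral>t. u' c t * pdo (R k c) \<psi> t \<partial>leb_I) +
        (\<Sum>c<p. \<integral>t. y' c t * pdo (R k (m + c)) \<psi> t \<partial>leb_I) = 0"
    using W k \<psi> by (auto simp: weak_sol_def)
  ultimately show "(\<Sum>c<m. \<integral>t. (u c t - u' c t) * pdo (R k c) \<psi> t \<partial>leb_I) +
        (\<Sum>c<p. \<integral>t. (y c t - y' c t) * pdo (R k (m + c)) \<psi> t \<partial>leb_I) = 0" by argo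
qed (use W in \<open>auto simp: weak_sol_def\<close>)

text \<open>Integration by parts turns P(-d/dt) on the test function into P(d/dt) on the
  exponential, an eigenfunction with eigenvalue P(s).\<close>

lemma integral_exp_pdo:
  assumes "\<psi> \<in> test_fun"
  shows "(\<integral>t. exp (s * t) * pdo P \<psi> t \<partial>leb_I) = poly P s * (\<integral>t. exp (s * t) * \<psi> t \<partial>leb_I)"
  using assms
proof (induction P arbitrary: \<psi>)
  case (pCons a P)
  have ex: "(\<lambda>t. exp (s * t)) \<in> L2" by (intro smooth_L2 smooth_on_exp)
  have i: "integrable leb_I (\<lambda>t. exp (s * t) * \<phi> t)" if "\<phi> \<in> test_fun" for \<phi>
    by (rule L2_test_integrable[OF ex that])
  have d: "deriv \<psi> \<in> test_fun" using pCons.prems by auto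
  have "(\<integral>t. exp (s * t) * pdo (pCons a P) \<psi> t \<partial>leb_I) =
      (\<integral>t. a * (exp (s * t) * \<psi> t) - exp (s * t) * pdo P (deriv \<psi>) t \<partial>leb_I)"
    by (simp add: pdo_pCons algebra_simps)
  also have "\<dots> = (\<integral>t. a * (exp (s * t) * \<psi> t) \<partial>leb_I) - (\<integral>t. exp (s * t) * pdo P (deriv \<psi>) t \<partial>leb_I)"
    by (intro Bochner_Integration.integral_diff integrable_mult_right i pCons.prems pdo_test_fun d)
  also have "(\<integral>t. exp (s * t) * pdo P (deriv \<psi>) t \<partial>leb_I) = poly P s * (\<integral>t. exp (s * t) * deriv \<psi> t \<partial>leb_I)"
    by (rule pCons.IH[OF d])
  also have "(\<integral>t. exp (s * t) * deriv \<psi> t \<partial>leb_I) = - (\<integral>t. (s * exp (s * t)) * \<psi> t \<partial>leb_I)"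
    by (rule parts_test_fun_C1) (use pCons.prems in \<open>auto intro!: derivative_eq_intros continuous_intros\<close>)
  finally show ?case
    by (simp add: mult.assoc algebra_simps)
qed simp

text \<open>The representation in coordinates, with trajectories restricted to smooth ones.
  Everything about weak trajectories has to be derived from this equivalence.\<close>

locale iso_system =
  fixes m p g n :: nat and R :: "nat \<Rightarrow> nat \<Rightarrow> real poly" and A B C D :: "nat \<Rightarrow> nat \<Rightarrow> real"
  assumes iso: "\<And>u y. (\<And>i. i < m \<Longrightarrow> smooth_on {-1..1} (u i)) \<Longrightarrow> (\<And>i. i < p \<Longrightarrow> smooth_on {-1..1} (y i)) \<Longrightarrow>
    weak_sol m p g R u y \<longleftrightarrow> (\<exists>x. smooth_state_sol m p n A B C D u y x)"
begin

abbreviation "vf x u i s \<equiv> (\<Sum>j<n. A i j * x j s) + (\<Sum>j<m. B i j * u j s)"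
abbreviation "out x u i s \<equiv> (\<Sum>j<n. C i j * x j s) + (\<Sum>j<m. D i j * u j s)"

lemma vf_integrable:
  assumes "\<And>j. j < m \<Longrightarrow> u j \<in> L2" "\<And>j. j < n \<Longrightarrow> continuous_on {-1..1} (x j)"
  shows "integrable leb_I (vf x u i)"
  using assms
  by (intro Bochner_Integration.integrable_add Bochner_Integration.integrable_sum integrable_mult_right)
    (auto intro: continuous_integrable_I L2_integrable)

lemma out_L2:
  assumes "\<And>j. j < m \<Longrightarrow> u j \<in> L2" "\<And>j. j < n \<Longrightarrow> continuous_on {-1..1} (x j)"
  shows "out x u i \<in> L2"
  using assms by (intro L2_add L2_sum L2_cmult) (auto intro: continuous_L2)

text \<open>The adjoint state turns the weak equation for the zero-state response to \<open>u\<close> into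
  orthogonality of \<open>u\<close> to a fixed smooth function.\<close>

lemma adjoint_functional:
  assumes \<alpha>: "\<And>c. \<alpha> c \<in> test_fun"
  obtains \<psi> where "\<And>k. k < m \<Longrightarrow> smooth_on {-1..1} (\<psi> k)"
    "\<And>u x. (\<And>j. j < m \<Longrightarrow> u j \<in> L2) \<Longrightarrow> (\<And>j. j < n \<Longrightarrow> continuous_on {-1..1} (x j)) \<Longrightarrow>
      (\<And>i t. i < n \<Longrightarrow> t \<in> {-1..1} \<Longrightarrow> x i t = primitive (vf x u i) t) \<Longrightarrow>
      (\<Sum>c<m. \<integral>t. u c t * \<alpha> c t \<partial>leb_I) + (\<Sum>c<p. \<integral>t. out x u c t * \<alpha> (m + c) t \<partial>leb_I) =
      (\<Sum>k<m. \<integral>t. u k t * \<psi> k t \<partial>leb_I)"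
proof -
  define b where "b j t = (\<Sum>i<p. C i j * \<alpha> (m + i) t)" for j t
  have bs: "smooth_on UNIV (b j)" for j
    unfolding b_def[abs_def]
    by (intro smooth_on_sum smooth_on_mult smooth_on_const test_fun_smooth \<alpha>)
  \<comment> \<open>The adjoint state has to vanish at the end point 1, while the existence lemma
    prescribes values at -1: the adjoint equation is solved in reversed time.\<close>
  have "smooth_on {-1..1} (\<lambda>t. b j (-1 * t + 0))" for j
    by (rule smooth_on_subset[OF smooth_on_affine[OF bs]]) simp
  then obtain \<mu> where \<mu>: "\<And>i. i < n \<Longrightarrow> smooth_on {-1..1} (\<mu> i)" "\<And>i. i < n \<Longrightarrow> \<mu> i (-1) = 0"
    "\<And>i t. i < n \<Longrightarrow> t \<in> {-1..1} \<Longrightarrow>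
      (\<mu> i has_real_derivative (\<Sum>j<n. A j i * \<mu> j t) + b i (-1 * t + 0)) (at t within {-1..1})"
    using linear_ode_smooth_exists[of n "\<lambda>j t. b j (-1 * t + 0)" "\<lambda>_. 0" "\<lambda>i j. A j i"] by blast
  define lam where "lam i t = \<mu> i (- t)" for i t
  define lam' where "lam' i t = - ((\<Sum>j<n. A j i * lam j t) + b i t)" for i t
  have dlam: "(lam i has_real_derivative lam' i t) (at t within {-1..1})" if i: "i < n" and t: "t \<in> {-1..1}" for i t
  proof -
    have 1: "(\<mu> i has_real_derivative (\<Sum>j<n. A j i * \<mu> j (- t)) + b i t) (at (- t) within uminus ` {-1..1})"
      using \<mu>(3)[OF i, of "- t"] t by simp
    have 2: "(uminus has_real_derivative -1) (at t within {-1..1})"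
      by (auto intro!: derivative_eq_intros)
    show ?thesis
      using DERIV_image_chain[OF 1 2]
      by (simp add: lam_def[abs_def] lam'_def comp_def algebra_simps)
  qed
  have lam1: "lam i 1 = 0" if "i < n" for i using \<mu>(2)[OF that] by (simp add: lam_def)
  have slam: "smooth_on {-1..1} (lam i)" if i: "i < n" for i
    by (rule smooth_on_linear_ode[of "{..<n}" i _ lam "\<lambda>i j. - A j i" "\<lambda>i t. - 1 * b i t"])
      (use dlam i smooth_on_mult[OF smooth_on_const[of _ "-1"] smooth_on_subset[OF bs subset_UNIV]] in
        \<open>auto simp: lam'_def sum_negf\<close>)
  have clam: "continuous_on {-1..1} (lam i)" if "i < n" for i
    by (rule smooth_on_continuous[OF slam[OF that]])
  have clam': "continuous_on {-1..1} (lam' i)" if "i < n" for i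
    unfolding lam'_def[abs_def]
    by (intro continuous_intros clam smooth_on_continuous smooth_on_subset[OF bs]) auto
  define \<psi> where "\<psi> k t = \<alpha> k t + (\<Sum>i<p. D i k * \<alpha> (m + i) t) + (\<Sum>j<n. B j k * lam j t)" for k t
  show thesis
  proof (rule that[of \<psi>])
    show "smooth_on {-1..1} (\<psi> k)" for k
      unfolding \<psi>_def[abs_def]
      by (intro smooth_on_add smooth_on_sum smooth_on_mult smooth_on_const test_fun_smooth \<alpha> slam) auto
  next
    fix u x
    assume u: "\<And>j. j < m \<Longrightarrow> u j \<in> L2" and xc: "\<And>j. j < n \<Longrightarrow> continuous_on {-1..1} (x j)"
      and x: "\<And>i t. i < n \<Longrightarrow> t \<in> {-1..1} \<Longrightarrow> x i t = primitive (vf x u i) t"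
    have h: "integrable leb_I (vf x u i)" for i by (rule vf_integrable[OF u xc])
    have i1: "integrable leb_I (\<lambda>s. vf x u j s * lam j s + x j s * lam' j s)" if j: "j < n" for j
      using integrable_mult_continuous[OF h clam[OF j], of j]
        integrable_mult_continuous[OF continuous_integrable_I[OF xc[OF j]] clam'[OF j]]
      by (rule Bochner_Integration.integrable_add)
    \<comment> \<open>The integrand is the derivative of the product of state and adjoint state; the
      state vanishes at -1, the adjoint state at 1.\<close>
    have zero: "(\<integral>s. vf x u j s * lam j s + x j s * lam' j s \<partial>leb_I) = 0" if j: "j < n" for j
    proof -
      have li: "integrable leb_I (lam' j)" by (rule continuous_integrable_I[OF clam'[OF j]])
      have "x j 1 * lam j 1 = 0 * lam j (-1) + primitive (\<lambda>s. vf x u j s * lam j s + x j s * lam' j s) 1"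
      proof (rule primitive_mult_const[OF _ _ h li])
        show "lam j t = lam j (-1) + primitive (lam' j) t" if "t \<in> {-1..1}" for t
          using primitive_of_deriv[OF dlam[OF j] li that] by simp
      qed (use x[OF j] in auto)
      then show ?thesis using lam1[OF j] by (simp add: primitive_upper)
    qed
    have G: "(\<Sum>c<m. u c t * \<alpha> c t) + (\<Sum>c<p. out x u c t * \<alpha> (m + c) t) =
        (\<Sum>k<m. u k t * \<psi> k t) - (\<Sum>j<n. vf x u j t * lam j t + x j t * lam' j t)" for t
    proof -
      have 1: "(\<Sum>c<p. (\<Sum>j<n. C c j * x j t) * \<alpha> (m + c) t) = (\<Sum>j<n. x j t * b j t)"
        unfolding b_def sum_distrib_left sum_distrib_right by (subst sum.swap) (simp add: mult_ac)
      have 2: "(\<Sum>c<p. (\<Sum>j<m. D c j * u j t) * \<alpha> (m + c) t) = (\<Sum>k<m. u k t * (\<Sum>i<p. D i k * \<alpha> (m + i) t))"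
        unfolding sum_distrib_left sum_distrib_right by (subst sum.swap) (simp add: mult_ac)
      have 3: "(\<Sum>j<n. (\<Sum>k<m. B j k * u k t) * lam j t) = (\<Sum>k<m. u k t * (\<Sum>j<n. B j k * lam j t))"
        unfolding sum_distrib_left sum_distrib_right by (subst sum.swap) (simp add: mult_ac)
      have 4: "(\<Sum>j<n. (\<Sum>k<n. A j k * x k t) * lam j t) = (\<Sum>k<n. x k t * (\<Sum>j<n. A j k * lam j t))"
        unfolding sum_distrib_left sum_distrib_right by (subst sum.swap) (simp add: mult_ac)
      show ?thesis
        unfolding \<psi>_def lam'_def
        by (simp add: distrib_left distrib_right sum.distrib 1 2 3 4 sum_negf sum_subtractf right_diff_distrib)
    qed
    have u\<alpha>: "integrable leb_I (\<lambda>t. u c t * \<phi> t)" if "c < m" "continuous_on {-1..1} \<phi>" for c \<phi>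
      by (intro integrable_mult_continuous L2_integrable u that)
    have \<psi>c: "continuous_on {-1..1} (\<psi> k)" for k
      unfolding \<psi>_def[abs_def]
      by (intro continuous_intros test_fun_continuous \<alpha> clam) auto
    have i2: "integrable leb_I (\<lambda>t. u c t * \<alpha> c t)" if "c < m" for c
      by (rule u\<alpha>[OF that test_fun_continuous[OF \<alpha>]])
    have i3: "integrable leb_I (\<lambda>t. out x u c t * \<alpha> (m + c) t)" for c
      by (rule L2_test_integrable[OF out_L2[OF u xc] \<alpha>])
    have "(\<Sum>c<m. \<integral>t. u c t * \<alpha> c t \<partial>leb_I) + (\<Sum>c<p. \<integral>t. out x u c t * \<alpha> (m + c) t \<partial>leb_I) =
       (\<integral>t. (\<Sum>c<m. u c t * \<alpha> c t) \<partial>leb_I) + (\<integral>t. (\<Sum>c<p. out x u c t * \<alpha> (m + c) t) \<partial>leb_I)"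
      using i2 i3 by (intro arg_cong2[of _ _ _ _ "(+)"] Bochner_Integration.integral_sum[symmetric]) simp_all
    also have "\<dots> = (\<integral>t. (\<Sum>c<m. u c t * \<alpha> c t) + (\<Sum>c<p. out x u c t * \<alpha> (m + c) t) \<partial>leb_I)"
      by (intro Bochner_Integration.integral_add[symmetric] Bochner_Integration.integrable_sum i2 i3) simp
    also have "\<dots> = (\<integral>t. (\<Sum>k<m. u k t * \<psi> k t) - (\<Sum>j<n. vf x u j t * lam j t + x j t * lam' j t) \<partial>leb_I)"
      unfolding G ..
    also have "\<dots> = (\<integral>t. (\<Sum>k<m. u k t * \<psi> k t) \<partial>leb_I) - (\<integral>t. (\<Sum>j<n. vf x u j t * lam j t + x j t * lam' j t) \<partial>leb_I)"
      by (intro Bochner_Integration.integral_diff Bochner_Integration.integrable_sum u\<alpha> \<psi>c i1) auto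
    also have "(\<integral>t. (\<Sum>j<n. vf x u j t * lam j t + x j t * lam' j t) \<partial>leb_I) =
        (\<Sum>j<n. (\<integral>t. vf x u j t * lam j t + x j t * lam' j t \<partial>leb_I))"
      by (rule Bochner_Integration.integral_sum) (use i1 in auto)
    also have "\<dots> = 0" using zero by (intro sum.neutral) auto
    also have "(\<integral>t. (\<Sum>k<m. u k t * \<psi> k t) \<partial>leb_I) = (\<Sum>k<m. \<integral>t. u k t * \<psi> k t \<partial>leb_I)"
      by (rule Bochner_Integration.integral_sum) (use u\<alpha> \<psi>c in auto)
    finally show "(\<Sum>c<m. \<integral>t. u c t * \<alpha> c t \<partial>leb_I) + (\<Sum>c<p. \<integral>t. out x u c t * \<alpha> (m + c) t \<partial>leb_I) =
      (\<Sum>k<m. \<integral>t. u k t * \<psi> k t \<partial>leb_I)" by simp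
  qed
qed

text \<open>For a fixed row and test function, the weak equation of a zero-state response is the
  scalar product of its input with a fixed smooth \<psi>. If \<psi> itself is taken as input, the
  response is smooth, hence a trajectory by the representation, and the scalar product of \<psi>
  with itself vanishes. So \<psi> is zero almost everywhere and the equation holds for every square
  integrable input.\<close>

lemma zero_state_weak_sol:
  assumes u: "\<And>j. j < m \<Longrightarrow> u j \<in> L2" and xc: "\<And>j. j < n \<Longrightarrow> continuous_on {-1..1} (x j)"
    and x: "\<And>i t. i < n \<Longrightarrow> t \<in> {-1..1} \<Longrightarrow> x i t = primitive (vf x u i) t"
  shows "weak_sol m p g R u (out x u)"
  unfolding weak_sol_def
proof (intro conjI allI impI ballI)
  fix k \<phi> assume k: "k < g" and \<phi>: "\<phi> \<in> test_fun"
  obtain \<psi> where \<psi>: "\<And>k. k < m \<Longrightarrow> smooth_on {-1..1} (\<psi> k)"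
    "\<And>u x. (\<And>j. j < m \<Longrightarrow> u j \<in> L2) \<Longrightarrow> (\<And>j. j < n \<Longrightarrow> continuous_on {-1..1} (x j)) \<Longrightarrow>
      (\<And>i t. i < n \<Longrightarrow> t \<in> {-1..1} \<Longrightarrow> x i t = primitive (vf x u i) t) \<Longrightarrow>
      (\<Sum>c<m. \<integral>t. u c t * pdo (R k c) \<phi> t \<partial>leb_I) + (\<Sum>c<p. \<integral>t. out x u c t * pdo (R k (m + c)) \<phi> t \<partial>leb_I) =
      (\<Sum>k<m. \<integral>t. u k t * \<psi> k t \<partial>leb_I)"
    using adjoint_functional[of "\<lambda>c. pdo (R k c) \<phi>", OF pdo_test_fun[OF \<phi>]] by blast
  have bs: "smooth_on {-1..1} (\<lambda>t. \<Sum>j<m. B i j * \<psi> j t)" for i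
    by (intro smooth_on_sum smooth_on_mult smooth_on_const \<psi>) auto
  obtain z where z: "\<And>i. i < n \<Longrightarrow> smooth_on {-1..1} (z i)" "\<And>i. i < n \<Longrightarrow> z i (-1) = 0"
    "\<And>i t. i < n \<Longrightarrow> t \<in> {-1..1} \<Longrightarrow> (z i has_real_derivative vf z \<psi> i t) (at t within {-1..1})"
    using linear_ode_smooth_exists[of n "\<lambda>i t. \<Sum>j<m. B i j * \<psi> j t" "\<lambda>_. 0" A, OF bs] by blast
  have \<psi>L: "\<psi> j \<in> L2" if "j < m" for j using smooth_L2 \<psi>(1) that by blast
  have zc: "continuous_on {-1..1} (z j)" if "j < n" for j using smooth_on_continuous z(1) that by blast
  have "smooth_on {-1..1} (out z \<psi> i)" if "i < p" for i
    by (intro smooth_on_add smooth_on_sum smooth_on_mult smooth_on_const \<psi> z) auto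
  then have "weak_sol m p g R \<psi> (out z \<psi>)"
    using z by (subst iso) (auto simp: smooth_state_sol_def \<psi>(1) intro!: exI[of _ z])
  then have "0 = (\<Sum>c<m. \<integral>t. \<psi> c t * pdo (R k c) \<phi> t \<partial>leb_I) +
      (\<Sum>c<p. \<integral>t. out z \<psi> c t * pdo (R k (m + c)) \<phi> t \<partial>leb_I)"
    using k \<phi> by (simp add: weak_sol_def)
  also have "\<dots> = (\<Sum>k<m. \<integral>t. \<psi> k t * \<psi> k t \<partial>leb_I)"
  proof (rule \<psi>(2)[OF \<psi>L zc])
    show "z i t = primitive (vf z \<psi> i) t" if "i < n" "t \<in> {-1..1}" for i t
      using primitive_of_deriv[OF z(3)[OF that(1)] vf_integrable[OF \<psi>L zc] that(2)] z(2)[OF that(1)] by simp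
  qed auto
  finally have sum0: "(\<Sum>k<m. \<integral>t. \<psi> k t * \<psi> k t \<partial>leb_I) = 0" by simp
  have "AE t in leb_I. \<psi> j t = 0" if j: "j < m" for j
  proof -
    have "(\<integral>t. \<psi> j t * \<psi> j t \<partial>leb_I) = 0"
      using sum0 j by (subst (asm) sum_nonneg_eq_0_iff) auto
    then have "AE t in leb_I. \<psi> j t * \<psi> j t = 0"
      using integral_nonneg_eq_0_iff_AE[OF L2_mult_integrable[OF \<psi>L[OF j] \<psi>L[OF j]]] by simp
    then show ?thesis by eventually_elim simp
  qed
  then have "AE t in leb_I. u j t * \<psi> j t = 0" if "j < m" for j
    by (rule eventually_mono) (use that in auto)
  then have "(\<integral>t. u j t * \<psi> j t \<partial>leb_I) = 0" if "j < m" for j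
    using that by (intro integral_eq_zero_AE) auto
  then show "(\<Sum>c<m. \<integral>t. u c t * pdo (R k c) \<phi> t \<partial>leb_I) +
      (\<Sum>c<p. \<integral>t. out x u c t * pdo (R k (m + c)) \<phi> t \<partial>leb_I) = 0"
    by (subst \<psi>(2)[OF u xc x]) auto
next
  show "out x u i \<in> L2" for i by (rule out_L2[OF u xc])
qed (use u in auto)

text \<open>Derivatives within the closed interval are unique, so every differentiation of the free
  output multiplies its row by A.\<close>

lemma state_derivs:
  assumes S: "smooth_state_sol m p n A B C D (\<lambda>i t. 0) y x" and i: "i < p"
    and F: "\<And>t. t \<in> {-1..1} \<Longrightarrow> F 0 t = y i t"
      "\<And>k t. t \<in> {-1..1} \<Longrightarrow> (F k has_real_derivative F (Suc k) t) (at t within {-1..1})"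
    and t: "t \<in> {-1..1}"
  shows "F k t = (\<Sum>j<n. row_pow n A (C i) k j * x j t)"
  using t
proof (induction k arbitrary: t)
  case 0
  then show ?case using S i F(1) by (simp add: smooth_state_sol_def)
next
  case (Suc k)
  have "((\<lambda>t. \<Sum>j<n. row_pow n A (C i) k j * x j t) has_real_derivative
      (\<Sum>j<n. row_pow n A (C i) k j * (\<Sum>l<n. A j l * x l t))) (at t within {-1..1})"
    using S Suc.prems by (intro DERIV_sum DERIV_cmult) (auto simp: smooth_state_sol_def)
  then have "(F k has_real_derivative (\<Sum>j<n. row_pow n A (C i) k j * (\<Sum>l<n. A j l * x l t))) (at t within {-1..1})"
    by (rule has_field_derivative_transform_within[of _ _ _ _ 1]) (use Suc in auto)
  moreover have "at t within {-1..1} \<noteq> bot"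
    using Suc.prems by (simp add: trivial_limit_within islimpt_Icc)
  ultimately show ?case
    using F(2)[OF Suc.prems, of k] has_field_derivative_unique unfolding row_pow_state by metis
qed

text \<open>The dichotomy is applied to the module generated by the output parts of the rows of
  \<open>R\<close> and to the i-th unit vector. If a nonzero multiple of the unit vector lies in the
  module, component i satisfies a scalar differential equation weakly and is smooth. The other case
  would give a polynomial vector k with nonzero component i that all rows annihilate.\<close>

lemma free_weak_sol_smooth:
  assumes W: "weak_sol m p g R (\<lambda>i t. 0) e" and i: "i < p"
  shows "\<exists>f. smooth_on {-1..1} f \<and> (AE t in leb_I. e i t = f t)"
proof -
  let ?N = "range (\<lambda>Q c. \<Sum>k<g. Q k * R k (m + c))"
  let ?v = "\<lambda>c. if c = i then 1 else 0 :: real poly"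
  have eL: "e c \<in> L2" if "c < p" for c using W that by (simp add: weak_sol_def)
  have "(\<exists>d. d \<noteq> 0 \<and> (\<exists>a\<in>?N. \<forall>c<p. d * ?v c = a c)) \<or>
    (\<exists>k. (\<forall>a\<in>?N. (\<Sum>c<p. a c * k c) = 0) \<and> (\<Sum>c<p. ?v c * k c) \<noteq> 0)"
  proof (rule submodule_separation[where N = ?N and v = ?v and q = p])
    show "(\<lambda>c. 0) \<in> ?N" by (rule range_eqI[of _ _ "\<lambda>k. 0"]) simp
    fix a b r s assume "a \<in> ?N" "b \<in> ?N"
    then obtain Q Q' where "a = (\<lambda>c. \<Sum>k<g. Q k * R k (m + c))" "b = (\<lambda>c. \<Sum>k<g. Q' k * R k (m + c))"
      by blast
    then show "(\<lambda>c. r * a c + s * b c) \<in> ?N"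
      by (intro range_eqI[of _ _ "\<lambda>k. r * Q k + s * Q' k"])
        (simp add: fun_eq_iff sum_distrib_left sum.distrib algebra_simps)
  qed
  then show ?thesis
  proof (elim disjE exE conjE bexE)
    fix d a assume d: "d \<noteq> 0" and a: "a \<in> ?N" "\<forall>c<p. d * ?v c = a c"
    then obtain Q where Q: "a = (\<lambda>c. \<Sum>k<g. Q k * R k (m + c))" by blast
    show ?thesis
    proof (rule weak_ode_smooth[OF eL[OF i] d])
      fix \<psi> assume \<psi>: "\<psi> \<in> test_fun"
      have i1: "integrable leb_I (\<lambda>t. e c t * pdo P (pdo P' \<psi>) t)" if "c < p" for c P P'
        using that \<psi> by (intro L2_test_integrable eL) auto
      \<comment> \<open>Since polynomial operators compose and commute, the multipliers
        \<open>Q k\<close> can be moved onto the test function, which leaves equations of the given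
        rows for the test functions \<open>pdo (Q k) \<psi>\<close>.\<close>
      have ac: "(\<integral>t. e c t * pdo (a c) \<psi> t \<partial>leb_I) =
          (\<Sum>k<g. \<integral>t. e c t * pdo (R k (m + c)) (pdo (Q k) \<psi>) t \<partial>leb_I)" if c: "c < p" for c
      proof -
        have "(\<integral>t. e c t * pdo (a c) \<psi> t \<partial>leb_I) =
            (\<integral>t. (\<Sum>k<g. e c t * pdo (R k (m + c)) (pdo (Q k) \<psi>) t) \<partial>leb_I)"
          by (simp add: Q pdo_sum sum_distrib_left mult.commute[of "Q _"] pdo_mult[OF \<psi>])
        then show ?thesis using i1[OF c] by (simp add: Bochner_Integration.integral_sum)
      qed
      have "(\<Sum>c<p. \<integral>t. e c t * pdo (a c) \<psi> t \<partial>leb_I) = (\<Sum>c<p. if c = i then \<integral>t. e i t * pdo d \<psi> t \<partial>leb_I else 0)"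
      proof (intro sum.cong refl)
        fix c assume "c \<in> {..<p}"
        then have "a c = d * ?v c" using a by simp
        then show "(\<integral>t. e c t * pdo (a c) \<psi> t \<partial>leb_I) = (if c = i then \<integral>t. e i t * pdo d \<psi> t \<partial>leb_I else 0)"
          by simp
      qed
      then have "(\<integral>t. e i t * pdo d \<psi> t \<partial>leb_I) = (\<Sum>c<p. \<integral>t. e c t * pdo (a c) \<psi> t \<partial>leb_I)"
        using i by simp
      also have "\<dots> = (\<Sum>c<p. \<Sum>k<g. \<integral>t. e c t * pdo (R k (m + c)) (pdo (Q k) \<psi>) t \<partial>leb_I)"
        by (intro sum.cong refl ac) simp
      also have "\<dots> = (\<Sum>k<g. \<Sum>c<p. \<integral>t. e c t * pdo (R k (m + c)) (pdo (Q k) \<psi>) t \<partial>leb_I)"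
        by (rule sum.swap)
      also have "\<dots> = 0"
      proof (rule sum.neutral, rule ballI)
        fix k assume "k \<in> {..<g}"
        then show "(\<Sum>c<p. \<integral>t. e c t * pdo (R k (m + c)) (pdo (Q k) \<psi>) t \<partial>leb_I) = 0"
          using W pdo_test_fun[OF \<psi>, of "Q k"] by (simp add: weak_sol_def)
      qed
      finally show "(\<integral>t. e i t * pdo d \<psi> t \<partial>leb_I) = 0" .
    qed
  next
    \<comment> \<open>Otherwise \<open>exp (s t) k(s)\<close> is a trajectory for every \<open>s\<close>, although the output components
      of all free trajectories satisfy a common scalar equation.\<close>
    fix k assume k: "\<forall>a\<in>?N. (\<Sum>c<p. a c * k c) = 0" "(\<Sum>c<p. ?v c * k c) \<noteq> 0"
    have Rk: "(\<Sum>c<p. R r (m + c) * k c) = 0" if "r < g" for r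
    proof -
      have "(\<lambda>c. R r (m + c)) \<in> ?N"
        using that by (intro range_eqI[of _ _ "\<lambda>l. if l = r then 1 else 0"])
          (auto simp: if_distrib[of "\<lambda>c. c * _"] cong: if_cong)
      then show ?thesis by (rule bspec[OF k(1)])
    qed
    have ki: "k i \<noteq> 0"
      using k(2) i by (simp add: if_distrib[of "\<lambda>c. c * _"] cong: if_cong)
    obtain d \<beta> where \<beta>: "\<forall>j<n. row_pow n A (C i) d j = (\<Sum>l<d. \<beta> l * row_pow n A (C i) l j)"
      using first_dependent_vector[of n "row_pow n A (C i)"] by blast
    \<comment> \<open>A monic polynomial such that P(d/dt) annihilates the i-th component of every
      smooth free output, because it annihilates the sequence of rows C_i A^l.\<close>
    define P where "P = monom 1 d - (\<Sum>l<d. monom (\<beta> l) l)"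
    have "coeff P d = 1" by (simp add: P_def coeff_sum)
    then have "P \<noteq> 0" by auto
    have "poly (k i * P) s = 0" for s
    proof -
      define y where "y c t = poly (k c) s * exp (s * t)" for c t
      have ys: "smooth_on {-1..1} (y c)" for c
        unfolding y_def[abs_def] by (intro smooth_on_mult smooth_on_const smooth_on_exp)
      have "weak_sol m p g R (\<lambda>i t. 0) y"
        unfolding weak_sol_def
      proof (intro conjI allI impI ballI)
        fix r \<psi> assume r: "r < g" and \<psi>: "\<psi> \<in> test_fun"
        have "(\<integral>t. y c t * pdo (R r (m + c)) \<psi> t \<partial>leb_I) =
            poly (R r (m + c) * k c) s * (\<integral>t. exp (s * t) * \<psi> t \<partial>leb_I)" for c
          using integral_exp_pdo[OF \<psi>, of s "R r (m + c)"] by (simp add: y_def mult.assoc mult.left_commute)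
        then have "(\<Sum>c<p. \<integral>t. y c t * pdo (R r (m + c)) \<psi> t \<partial>leb_I) =
            poly (\<Sum>c<p. R r (m + c) * k c) s * (\<integral>t. exp (s * t) * \<psi> t \<partial>leb_I)"
          by (simp add: poly_sum sum_distrib_right)
        then show "(\<Sum>c<m. \<integral>t. 0 * pdo (R r c) \<psi> t \<partial>leb_I) + (\<Sum>c<p. \<integral>t. y c t * pdo (R r (m + c)) \<psi> t \<partial>leb_I) = 0"
          using Rk[OF r] by simp
      qed (use smooth_L2[OF ys] in auto)
      then obtain x where x: "smooth_state_sol m p n A B C D (\<lambda>i t. 0) y x"
        using iso[of "\<lambda>i t. 0" y] ys by auto
      have F: "poly (k i) s * s ^ l * exp (s * 0) = (\<Sum>j<n. row_pow n A (C i) l j * x j 0)" for l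
        by (rule state_derivs[OF x i, of "\<lambda>l t. poly (k i) s * s ^ l * exp (s * t)"])
          (auto simp: y_def intro!: derivative_eq_intros)
      have "(\<Sum>j<n. row_pow n A (C i) d j * x j 0) = (\<Sum>l<d. \<beta> l * (\<Sum>j<n. row_pow n A (C i) l j * x j 0))"
        using \<beta> by (simp add: sum_distrib_left sum_distrib_right mult.assoc sum.swap[of _ "{..<n}"])
      then have "poly (k i) s * s ^ d = (\<Sum>l<d. \<beta> l * (poly (k i) s * s ^ l))"
        using F by simp
      then show ?thesis
        by (simp add: P_def poly_monom poly_sum right_diff_distrib sum_distrib_left mult_ac)
    qed
    then have "k i * P = 0" using poly_all_0_iff_0 by blast
    then show ?thesis using ki \<open>P \<noteq> 0\<close> by simp
  qed
qed

theorem weak_sol_state: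
  assumes W: "weak_sol m p g R u y"
  shows "\<exists>x. state_sol m p n A B C D u y x"
proof -
  have u: "u j \<in> L2" if "j < m" for j using W that by (simp add: weak_sol_def)
  have ui: "integrable leb_I (\<lambda>t. \<Sum>j<m. B i j * u j t)" for i
    by (intro Bochner_Integration.integrable_sum integrable_mult_right L2_integrable u) auto
  obtain x where xc: "\<And>i. i < n \<Longrightarrow> continuous_on {-1..1} (x i)"
    and x: "\<And>i t. i < n \<Longrightarrow> t \<in> {-1..1} \<Longrightarrow> x i t = 0 + primitive (vf x u i) t"
    using linear_ode_exists[of n "\<lambda>i t. \<Sum>j<m. B i j * u j t" "\<lambda>_. 0" A, OF ui] by blast
  have "weak_sol m p g R u (out x u)"
    using x by (intro zero_state_weak_sol u xc) auto
  from weak_sol_diff[OF W this]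
  have e: "weak_sol m p g R (\<lambda>i t. 0) (\<lambda>i t. y i t - out x u i t)"
    by (simp only: diff_self)
  then have "\<forall>i. \<exists>f. i < p \<longrightarrow> smooth_on {-1..1} f \<and> (AE t in leb_I. y i t - out x u i t = f t)"
    using free_weak_sol_smooth[OF e] by blast
  from choice[OF this] obtain f where
    "\<forall>i. i < p \<longrightarrow> smooth_on {-1..1} (f i) \<and> (AE t in leb_I. y i t - out x u i t = f i t)" by blast
  then have f: "\<And>i. i < p \<Longrightarrow> smooth_on {-1..1} (f i)"
    "\<And>i. i < p \<Longrightarrow> AE t in leb_I. y i t - out x u i t = f i t" by blast+
  \<comment> \<open>With a smooth representative, the free part falls under the representation,
    which supplies its state.\<close>
  have "weak_sol m p g R (\<lambda>i t. 0) f"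
    by (rule weak_sol_cong_AE[OF e]) (use f smooth_L2 in auto)
  then obtain z where z: "smooth_state_sol m p n A B C D (\<lambda>i t. 0) f z"
    using iso[of "\<lambda>i t. 0" f] f(1) by auto
  have zc: "continuous_on {-1..1} (z i)" if "i < n" for i
    using z that smooth_on_continuous by (auto simp: smooth_state_sol_def)
  have zi: "integrable leb_I (\<lambda>s. \<Sum>j<n. A i j * z j s)" for i
    by (intro continuous_integrable_I continuous_intros zc) auto
  have zp: "z i t = z i (-1) + primitive (\<lambda>s. \<Sum>j<n. A i j * z j s) t" if i: "i < n" and t: "t \<in> {-1..1}" for i t
  proof -
    have "(z i has_real_derivative (\<Sum>j<n. A i j * z j s)) (at s within {-1..1})" if "s \<in> {-1..1}" for s
      using z i that by (auto simp: smooth_state_sol_def)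
    from primitive_of_deriv[OF this zi t] show ?thesis by simp
  qed
  have "state_sol m p n A B C D u y (\<lambda>i t. x i t + z i t)"
    unfolding state_sol_def
  proof (intro conjI allI impI ballI)
    fix i t assume i: "i < n" and t: "t \<in> {-1..(1::real)}"
    have "primitive (\<lambda>s. (\<Sum>j<n. A i j * (x j s + z j s)) + (\<Sum>j<m. B i j * u j s)) t =
        primitive (\<lambda>s. vf x u i s + (\<Sum>j<n. A i j * z j s)) t"
      by (simp add: distrib_left sum.distrib algebra_simps)
    also have "\<dots> = primitive (vf x u i) t + primitive (\<lambda>s. \<Sum>j<n. A i j * z j s) t"
      by (rule primitive_add[OF vf_integrable[OF u xc] zi])
    finally show "x i t + z i t = x i (-1) + z i (-1) +
        primitive (\<lambda>s. (\<Sum>j<n. A i j * (x j s + z j s)) + (\<Sum>j<m. B i j * u j s)) t"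
      using x[OF i t] x[OF i, of "-1"] zp[OF i t] by simp
  next
    fix i assume i: "i < p"
    show "AE t in leb_I. y i t = (\<Sum>j<n. C i j * (x j t + z j t)) + (\<Sum>j<m. D i j * u j t)"
      using f(2)[OF i] AE_space
    proof eventually_elim
      case (elim t)
      then have "f i t = (\<Sum>j<n. C i j * z j t)" using z i by (auto simp: smooth_state_sol_def)
      then show ?case using elim by (simp add: distrib_left sum.distrib)
    qed
  qed (use xc zc in \<open>auto intro!: continuous_intros\<close>)
  then show ?thesis by blast
qed

end

section \<open>Stacked vectors and matrices\<close>

lemma stack_vec_carrier:
  assumes "\<And>j. j < k \<Longrightarrow> f j \<in> carrier_vec d"
  shows "stack_vec f k \<in> carrier_vec (k * d)"
  using assms
proof (induction k)
  case (Suc k)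
  then have "stack_vec f k \<in> carrier_vec (k * d)" "f k \<in> carrier_vec d" by auto
  from append_carrier_vec[OF this] show ?case by (simp add: add.commute)
qed auto

lemma block_index_less: "j < k \<Longrightarrow> i < d \<Longrightarrow> j * d + i < k * (d :: nat)"
  by (metis add.commute add_less_mono1 less_le_trans mult_Suc Suc_leI mult_le_mono1)

lemma append_vec_index:
  assumes "v \<in> carrier_vec r1" "w \<in> carrier_vec r2" "i < r1 + r2"
  shows "(v @\<^sub>v w) $ i = (if i < r1 then v $ i else w $ (i - r1))"
  using assms by auto

lemma stack_vec_index:
  assumes "\<And>j. j < k \<Longrightarrow> f j \<in> carrier_vec d" "j < k" "i < d"
  shows "stack_vec f k $ (j * d + i) = f j $ i"
  using assms
proof (induction k)
  case (Suc k)
  have c: "stack_vec f k \<in> carrier_vec (k * d)" by (rule stack_vec_carrier) (use Suc in auto)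
  have fk: "f k \<in> carrier_vec d" using Suc by auto
  have less: "j * d + i < k * d + d"
    using block_index_less[OF Suc.prems(2,3)] by simp
  show ?case
  proof (cases "j = k")
    case True
    then show ?thesis using append_vec_index[OF c fk less] by simp
  next
    case False
    then have "j < k" using Suc.prems by simp
    then show ?thesis
      using append_vec_index[OF c fk less] Suc block_index_less[OF \<open>j < k\<close> Suc.prems(3)] by simp
  qed
qed simp

lemma append_rows_index:
  assumes "A \<in> carrier_mat r1 nc" "B \<in> carrier_mat r2 nc" "i < r1 + r2" "j < nc"
  shows "(A @\<^sub>r B) $$ (i, j) = (if i < r1 then A $$ (i, j) else B $$ (i - r1, j))"
  using assms by (auto simp: append_rows_def)

lemma stack_mat_carrier:
  assumes "\<And>j. j < k \<Longrightarrow> M j \<in> carrier_mat d nc"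
  shows "stack_mat nc M k \<in> carrier_mat (k * d) nc"
  using assms
proof (induction k)
  case (Suc k)
  then have "stack_mat nc M k \<in> carrier_mat (k * d) nc" "M k \<in> carrier_mat d nc" by auto
  from carrier_append_rows[OF this] show ?case by (simp add: add.commute)
qed simp

lemma stack_mat_index:
  assumes "\<And>j. j < k \<Longrightarrow> M j \<in> carrier_mat d nc" "j < k" "i < d" "c < nc"
  shows "stack_mat nc M k $$ (j * d + i, c) = M j $$ (i, c)"
  using assms
proof (induction k)
  case (Suc k)
  have s: "stack_mat nc M k \<in> carrier_mat (k * d) nc" by (rule stack_mat_carrier) (use Suc in auto)
  have Mk: "M k \<in> carrier_mat d nc" using Suc by auto
  have less: "j * d + i < k * d + d"
    using block_index_less[OF Suc.prems(2,3)] by simp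
  show ?case
  proof (cases "j = k")
    case True
    then show ?thesis
      using append_rows_index[OF s Mk less Suc.prems(4)] by simp
  next
    case False
    then have "j < k" using Suc.prems by simp
    then show ?thesis
      using append_rows_index[OF s Mk less Suc.prems(4)] Suc block_index_less[OF \<open>j < k\<close> Suc.prems(3)] by simp
  qed
qed simp

lemma mult_mat_vec_index:
  assumes "M \<in> carrier_mat nr nc" "v \<in> carrier_vec nc" "i < nr"
  shows "(M *\<^sub>v v) $ i = (\<Sum>j<nc. M $$ (i, j) * v $ j)"
  using assms by (auto simp: scalar_prod_def lessThan_atLeast0 intro!: sum.cong)

section \<open>Column rank\<close>

text \<open>Independence is stated for column indices instead of a set of vectors, so that two equal
  columns count as dependent and all computations are sums over indices.\<close>

definition indep_cols :: "real mat \<Rightarrow> nat set \<Rightarrow> bool" where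
  "indep_cols M J \<longleftrightarrow> J \<subseteq> {..<dim_col M} \<and>
     (\<forall>c. (\<forall>i<dim_row M. (\<Sum>j\<in>J. c j * M $$ (i, j)) = 0) \<longrightarrow> (\<forall>j\<in>J. c j = 0))"

lemma indep_colsD:
  assumes "indep_cols M J" "\<And>i. i < dim_row M \<Longrightarrow> (\<Sum>j\<in>J. c j * M $$ (i, j)) = 0" "j \<in> J"
  shows "c j = 0"
  using assms unfolding indep_cols_def by simp

lemma indep_cols_card_le_rank:
  assumes J: "indep_cols M J"
  shows "card J \<le> mat_rank M"
proof -
  interpret vec_space "TYPE(real)" "dim_row M" .
  have fin: "finite J" and sub: "J \<subseteq> {..<dim_col M}"
    using J finite_subset unfolding indep_cols_def by auto
  have Mc: "M \<in> carrier_mat (dim_row M) (dim_col M)" by simp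
  have inj: "inj_on (col M) J"
  proof (rule inj_onI, rule ccontr)
    fix a b assume ab: "a \<in> J" "b \<in> J" "col M a = col M b" "a \<noteq> b"
    let ?c = "\<lambda>j. if j = a then 1 else if j = b then -1 else (0 :: real)"
    have "(\<Sum>j\<in>J. ?c j * M $$ (i, j)) = 0" if i: "i < dim_row M" for i
    proof -
      have "(\<Sum>j\<in>J. ?c j * M $$ (i, j)) = (\<Sum>j\<in>{a, b}. ?c j * M $$ (i, j))"
        using fin ab by (intro sum.mono_neutral_right) auto
      also have "\<dots> = M $$ (i, a) - M $$ (i, b)" using ab by simp
      also have "\<dots> = col M a $ i - col M b $ i"
        using ab(1,2) sub i by (auto simp: subset_iff)
      finally show ?thesis using ab(3) by simp
    qed
    from indep_colsD[OF J this ab(1)] show False by simp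
  qed
  let ?U = "col M ` J"
  have U: "?U \<subseteq> set (cols M)" using sub by (auto simp: cols_def)
  have Uc: "?U \<subseteq> carrier_vec (dim_row M)" by auto
  have "lin_indpt ?U"
  proof (rule ccontr)
    assume "\<not> lin_indpt ?U"
    then have "lin_dep ?U" by simp
    then obtain a w where a: "lincomb a ?U = 0\<^sub>v (dim_row M)" "w \<in> ?U" "a w \<noteq> 0"
      using finite_lin_dep[OF finite_imageI[OF fin]] Uc by blast
    have "(\<Sum>j\<in>J. a (col M j) * M $$ (i, j)) = 0" if i: "i < dim_row M" for i
    proof -
      have "0 = lincomb a ?U $ i" using a(1) i by simp
      also have "\<dots> = (\<Sum>x\<in>?U. a x * x $ i)" by (rule lincomb_index[OF i Uc])
      also have "\<dots> = (\<Sum>j\<in>J. a (col M j) * col M j $ i)" using inj by (simp add: sum.reindex)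
      also have "\<dots> = (\<Sum>j\<in>J. a (col M j) * M $$ (i, j))"
        using sub i by (intro sum.cong) (auto simp: subset_iff)
      finally show ?thesis by simp
    qed
    then have "a (col M j) = 0" if "j \<in> J" for j
      using indep_colsD[OF J _ that, of "\<lambda>j. a (col M j)"] by blast
    then show False using a by auto
  qed
  from rank_ge_card_indpt[OF Mc U this] show ?thesis
    using inj by (simp add: card_image)
qed

lemma indep_cols_exists:
  obtains J where "indep_cols M J" "card J = mat_rank M"
proof -
  interpret vec_space "TYPE(real)" "dim_row M" .
  have Mc: "M \<in> carrier_mat (dim_row M) (dim_col M)" by simp
  obtain S where S: "maximal S (\<lambda>T. T \<subseteq> set (cols M) \<and> lin_indpt T)"
    using maximal_exists[of "(\<lambda>T. T \<subseteq> set (cols M) \<and> lin_indpt T)" "card (set (cols M))" "{}"]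
    by (meson List.finite_set card_mono empty_iff empty_subsetI finite_lin_indpt2 rev_finite_subset)
  have rk: "mat_rank M = card S" by (rule rank_card_indpt[OF Mc S])
  have S1: "S \<subseteq> set (cols M)" "lin_indpt S" using S by (auto simp: maximal_def)
  have fin: "finite S" using S1(1) finite_subset by blast
  have Sc: "S \<subseteq> carrier_vec (dim_row M)" using S1(1) cols_dim by blast
  have "\<forall>x\<in>S. \<exists>j<dim_col M. col M j = x"
    using S1(1) by (fastforce simp: cols_def)
  then obtain h where h: "\<And>x. x \<in> S \<Longrightarrow> h x < dim_col M" "\<And>x. x \<in> S \<Longrightarrow> col M (h x) = x"
    by metis
  have inj: "inj_on h S" by (rule inj_on_inverseI) (rule h(2))
  have "indep_cols M (h ` S)"
    unfolding indep_cols_def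
  proof (intro conjI allI impI)
    fix c assume c: "\<forall>i<dim_row M. (\<Sum>j\<in>h ` S. c j * M $$ (i, j)) = 0"
    have "lincomb (\<lambda>x. c (h x)) S = 0\<^sub>v (dim_row M)"
    proof (rule eq_vecI)
      fix i assume "i < dim_vec (0\<^sub>v (dim_row M) :: real vec)"
      then have i: "i < dim_row M" by simp
      have "lincomb (\<lambda>x. c (h x)) S $ i = (\<Sum>x\<in>S. c (h x) * x $ i)" by (rule lincomb_index[OF i Sc])
      also have "\<dots> = (\<Sum>x\<in>S. c (h x) * M $$ (i, h x))"
        using h i by (intro sum.cong refl) (metis index_col)
      also have "\<dots> = 0" using c i inj by (simp add: sum.reindex)
      finally show "lincomb (\<lambda>x. c (h x)) S $ i = 0\<^sub>v (dim_row M) $ i" using i by simp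
    qed (use lincomb_dim[OF fin Sc] in simp)
    then have "c (h x) = 0" if "x \<in> S" for x
      using S1(2) lin_dep_crit[OF fin subset_refl _ that, of "\<lambda>x. c (h x)"] by auto
    then show "\<forall>j\<in>h ` S. c j = 0" by auto
  qed (use h in auto)
  then show thesis using that rk inj by (simp add: card_image)
qed

text \<open>The rank is the dimension of the column space. The matrices may have different numbers
  of columns, as observability matrices of representations with different state dimensions
  do.\<close>

lemma rank_cong_image:
  assumes dim: "dim_row M = dim_row M'"
    and im: "{M *\<^sub>v x |x. x \<in> carrier_vec (dim_col M)} = {M' *\<^sub>v x |x. x \<in> carrier_vec (dim_col M')}"
  shows "mat_rank M = mat_rank M'"
proof -
  interpret vec_space "TYPE(real)" "dim_row M" .
  have cs: "span (set (cols K)) = {K *\<^sub>v x |x. x \<in> carrier_vec (dim_col K)}" if K: "dim_row K = dim_row M" for K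
  proof -
    have "K \<in> carrier_mat (dim_row M) (dim_col K)" using K by (intro carrier_matI) auto
    from col_space_eq[OF this]
    have *: "span (set (cols K)) = {y \<in> carrier_vec (dim_row K). \<exists>x\<in>carrier_vec (dim_col K). K *\<^sub>v x = y}"
      unfolding col_space_def .
    have "K *\<^sub>v x \<in> carrier_vec (dim_row K)" for x by (intro carrier_vecI) simp
    then show ?thesis unfolding * by blast
  qed
  have "mat_rank M' = rank M'" by (simp only: dim)
  then show ?thesis
    unfolding rank_def cs[OF refl] cs[OF dim[symmetric]] im by (rule sym)
qed

lemma rank_append_rows_mono:
  assumes "N \<in> carrier_mat r1 nc" "P \<in> carrier_mat r2 nc"
  shows "mat_rank N \<le> mat_rank (N @\<^sub>r P)"
proof -
  obtain J where J: "indep_cols N J" "card J = mat_rank N" by (rule indep_cols_exists)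
  have "indep_cols (N @\<^sub>r P) J"
    unfolding indep_cols_def
  proof (intro conjI allI impI)
    have d: "dim_col (N @\<^sub>r P) = nc" "dim_row (N @\<^sub>r P) = r1 + r2"
      using carrier_append_rows[OF assms] by auto
    show sub: "J \<subseteq> {..<dim_col (N @\<^sub>r P)}" using J(1) assms d by (auto simp: indep_cols_def)
    fix c assume c: "\<forall>i<dim_row (N @\<^sub>r P). (\<Sum>j\<in>J. c j * (N @\<^sub>r P) $$ (i, j)) = 0"
    have "(\<Sum>j\<in>J. c j * N $$ (i, j)) = 0" if i: "i < dim_row N" for i
    proof -
      have "(\<Sum>j\<in>J. c j * N $$ (i, j)) = (\<Sum>j\<in>J. c j * (N @\<^sub>r P) $$ (i, j))"
        using sub i assms d by (intro sum.cong refl) (auto simp: append_rows_index[OF assms])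
      then show ?thesis using c i assms d by simp
    qed
    then show "\<forall>j\<in>J. c j = 0" using indep_colsD[OF J(1)] by blast
  qed
  then show ?thesis using indep_cols_card_le_rank J(2) by metis
qed

text \<open>A basis J of columns of N stays independent in the stacked matrix and, the ranks being
  equal, spans all stacked columns. Every column is thus a combination of those in J with the same
  coefficients in both blocks. For x in the kernel of N, the collected coefficients b vanish by
  independence in N, and therefore x is in the kernel of P.\<close>

lemma rank_append_rows_kernel:
  assumes N: "N \<in> carrier_mat r1 nc" and P: "P \<in> carrier_mat r2 nc"
    and rk: "mat_rank (N @\<^sub>r P) = mat_rank N"
    and x: "\<And>i. i < r1 \<Longrightarrow> (\<Sum>j<nc. N $$ (i, j) * x j) = 0" and i: "i < r2"
  shows "(\<Sum>j<nc. P $$ (i, j) * x j) = 0"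
proof -
  let ?M = "N @\<^sub>r P"
  have d: "dim_col ?M = nc" "dim_row ?M = r1 + r2" using carrier_append_rows[OF N P] by auto
  obtain J where J: "indep_cols N J" "card J = mat_rank N" by (rule indep_cols_exists)
  have sub: "J \<subseteq> {..<nc}" using J(1) N by (simp add: indep_cols_def)
  then have fin: "finite J" by (rule finite_subset) simp
  have MN: "?M $$ (i, j) = N $$ (i, j)" if "i < r1" "j < nc" for i j
    using append_rows_index[OF N P, of i j] that by simp
  have indN: "\<forall>j\<in>J. c j = 0" if "\<And>i. i < r1 \<Longrightarrow> (\<Sum>j\<in>J. c j * N $$ (i, j)) = 0" for c
    using indep_colsD[OF J(1), of c] N that by auto
  have "\<exists>a. \<forall>i<r1 + r2. ?M $$ (i, k) = (\<Sum>j\<in>J. a j * ?M $$ (i, j))" if k: "k < nc" for k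
  proof (cases "k \<in> J")
    case True
    then show ?thesis
      using fin by (intro exI[of _ "\<lambda>j. if j = k then 1 else 0"])
        (auto simp: if_distrib[of "\<lambda>c. c * _"] cong: if_cong)
  next
    case False
    have "\<not> indep_cols ?M (insert k J)"
      using indep_cols_card_le_rank[of ?M "insert k J"] J(2) rk fin False by auto
    then obtain c where c: "\<forall>i<r1 + r2. (\<Sum>j\<in>insert k J. c j * ?M $$ (i, j)) = 0"
        "\<exists>j\<in>insert k J. c j \<noteq> 0"
      using sub k d unfolding indep_cols_def by auto
    have "c k \<noteq> 0"
    proof
      assume ck: "c k = 0"
      have "\<forall>j\<in>J. c j = 0"
      proof (rule indN)
        fix i assume "i < r1"
        then have "(\<Sum>j\<in>J. c j * N $$ (i, j)) = (\<Sum>j\<in>insert k J. c j * ?M $$ (i, j))"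
          using ck fin False sub by (auto intro!: sum.cong simp: MN subset_iff)
        then show "(\<Sum>j\<in>J. c j * N $$ (i, j)) = 0" using c(1) \<open>i < r1\<close> by simp
      qed
      then show False using c(2) ck by auto
    qed
    have "?M $$ (i, k) = (\<Sum>j\<in>J. (- c j / c k) * ?M $$ (i, j))" if "i < r1 + r2" for i
    proof -
      have "c k * ?M $$ (i, k) + (\<Sum>j\<in>J. c j * ?M $$ (i, j)) = 0"
        using c(1) that fin False by simp
      then have "?M $$ (i, k) = - (\<Sum>j\<in>J. c j * ?M $$ (i, j)) / c k"
        using \<open>c k \<noteq> 0\<close> by (simp add: field_simps)
      then show ?thesis by (simp add: sum_divide_distrib sum_negf)
    qed
    then show ?thesis by (intro exI[of _ "\<lambda>j. - c j / c k"]) auto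
  qed
  then obtain a where a: "\<And>k i. k < nc \<Longrightarrow> i < r1 + r2 \<Longrightarrow> ?M $$ (i, k) = (\<Sum>j\<in>J. a k j * ?M $$ (i, j))"
    by metis
  define b where "b j = (\<Sum>k<nc. a k j * x k)" for j
  have M: "(\<Sum>k<nc. ?M $$ (i, k) * x k) = (\<Sum>j\<in>J. b j * ?M $$ (i, j))" if "i < r1 + r2" for i
  proof -
    have "(\<Sum>k<nc. ?M $$ (i, k) * x k) = (\<Sum>k<nc. (\<Sum>j\<in>J. a k j * ?M $$ (i, j)) * x k)"
      using a that by (intro sum.cong refl) auto
    also have "\<dots> = (\<Sum>j\<in>J. b j * ?M $$ (i, j))"
      unfolding b_def sum_distrib_right by (subst sum.swap) (simp add: mult_ac)
    finally show ?thesis .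
  qed
  have b0: "\<forall>j\<in>J. b j = 0"
  proof (rule indN)
    fix i assume "i < r1"
    have "(\<Sum>j\<in>J. b j * N $$ (i, j)) = (\<Sum>j\<in>J. b j * ?M $$ (i, j))"
      using sub \<open>i < r1\<close> by (intro sum.cong refl) (auto simp: MN)
    also have "\<dots> = (\<Sum>k<nc. ?M $$ (i, k) * x k)"
      using M[of i] \<open>i < r1\<close> by simp
    also have "\<dots> = (\<Sum>k<nc. N $$ (i, k) * x k)"
      using \<open>i < r1\<close> by (intro sum.cong refl) (auto simp: MN)
    finally show "(\<Sum>j\<in>J. b j * N $$ (i, j)) = 0"
      using x[OF \<open>i < r1\<close>] by simp
  qed
  have "(\<Sum>j<nc. P $$ (i, j) * x j) = (\<Sum>k<nc. ?M $$ (r1 + i, k) * x k)"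
    using i append_rows_index[OF N P, of "r1 + i"] by (intro sum.cong) auto
  then show ?thesis using M[of "r1 + i"] b0 i by simp
qed

section \<open>The lag\<close>

abbreviation ent :: "real mat \<Rightarrow> nat \<Rightarrow> nat \<Rightarrow> real" where "ent M i j \<equiv> M $$ (i, j)"

lemma mult_mat_index:
  assumes "M \<in> carrier_mat r n" "M' \<in> carrier_mat n c" "i < r" "j < c"
  shows "(M * M') $$ (i, j) = (\<Sum>l<n. M $$ (i, l) * M' $$ (l, j))"
  using assms by (auto simp: scalar_prod_def lessThan_atLeast0 intro!: sum.cong)

lemma pow_row_entry:
  assumes A: "A \<in> carrier_mat n n" and C: "C \<in> carrier_mat p n" and i: "i < p" and j: "j < n"
  shows "(C * A ^\<^sub>m k) $$ (i, j) = row_pow n (ent A) (ent C i) k j"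
  using j
proof (induction k arbitrary: j)
  case 0
  then show ?case using A C i by simp
next
  case (Suc k)
  have CA: "C * A ^\<^sub>m k \<in> carrier_mat p n" using A C by auto
  have "C * A ^\<^sub>m Suc k = (C * A ^\<^sub>m k) * A"
    using A C by (simp add: assoc_mult_mat[of C p n "A ^\<^sub>m k" n A n])
  then have "(C * A ^\<^sub>m Suc k) $$ (i, j) = (\<Sum>l<n. (C * A ^\<^sub>m k) $$ (i, l) * A $$ (l, j))"
    using mult_mat_index[OF CA A i Suc.prems] by simp
  also have "\<dots> = row_pow n (ent A) (ent C i) (Suc k) j"
    using Suc.IH by simp
  finally show ?case .
qed

lemma obs_carrier:
  assumes "A \<in> carrier_mat n n" "C \<in> carrier_mat p n"
  shows "obs_mat n A C k \<in> carrier_mat (k * p) n"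
  unfolding obs_mat_def using assms by (intro stack_mat_carrier) auto

lemma obs_entry:
  assumes "A \<in> carrier_mat n n" "C \<in> carrier_mat p n" "j < k" "i < p" "l < n"
  shows "obs_mat n A C k $$ (j * p + i, l) = row_pow n (ent A) (ent C i) j l"
  unfolding obs_mat_def using assms pow_row_entry[OF assms(1,2,4,5)]
  by (subst stack_mat_index[where d = p]) auto

lemma obs_image:
  assumes "A \<in> carrier_mat n n" "C \<in> carrier_mat p n" "v \<in> carrier_vec n"
  shows "obs_mat n A C k *\<^sub>v v =
    vec (k * p) (\<lambda>r. \<Sum>l<n. row_pow n (ent A) (ent C (r mod p)) (r div p) l * v $ l)"
proof (rule eq_vecI)
  fix r assume "r < dim_vec (vec (k * p) (\<lambda>r. \<Sum>l<n. row_pow n (ent A) (ent C (r mod p)) (r div p) l * v $ l))"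
  then have r: "r < k * p" by simp
  then have p: "p > 0" by (cases p) auto
  have rr: "r = (r div p) * p + r mod p" by simp
  have "r div p < k" using r p by (simp add: less_mult_imp_div_less)
  have "(obs_mat n A C k *\<^sub>v v) $ r = (\<Sum>l<n. obs_mat n A C k $$ (r, l) * v $ l)"
    by (rule mult_mat_vec_index[OF obs_carrier[OF assms(1,2)] assms(3) r])
  also have "\<dots> = (\<Sum>l<n. row_pow n (ent A) (ent C (r mod p)) (r div p) l * v $ l)"
  proof (intro sum.cong refl)
    fix l assume "l \<in> {..<n}"
    then show "obs_mat n A C k $$ (r, l) * v $ l = row_pow n (ent A) (ent C (r mod p)) (r div p) l * v $ l"
      using obs_entry[OF assms(1,2) \<open>r div p < k\<close>, of "r mod p" l] p rr by simp
  qed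
  finally show "(obs_mat n A C k *\<^sub>v v) $ r =
      vec (k * p) (\<lambda>r. \<Sum>l<n. row_pow n (ent A) (ent C (r mod p)) (r div p) l * v $ l) $ r"
    using r by simp
qed (use obs_carrier[OF assms(1,2), of k] in auto)

text \<open>The ranks do not decrease with k and never exceed n, so they cannot grow in each of n +
  1 steps; hence the minimum in the definition exists.\<close>

lemma lag_of_pair_attained:
  assumes A: "A \<in> carrier_mat n n" and C: "C \<in> carrier_mat p n"
  shows "mat_rank (obs_mat n A C (lag_of_pair n A C + 1)) = mat_rank (obs_mat n A C (lag_of_pair n A C))"
proof -
  have step: "obs_mat n A C (Suc k) = obs_mat n A C k @\<^sub>r (C * A ^\<^sub>m k)" for k
    by (simp add: obs_mat_def)
  have CA: "C * A ^\<^sub>m k \<in> carrier_mat p n" for k using A C by auto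
  have "\<exists>k. mat_rank (obs_mat n A C (k + 1)) = mat_rank (obs_mat n A C k)"
  proof (rule ccontr)
    assume neg: "\<not> ?thesis"
    have inc: "mat_rank (obs_mat n A C k) < mat_rank (obs_mat n A C (Suc k))" for k
      using rank_append_rows_mono[OF obs_carrier[OF A C] CA[of k], of k] neg[simplified, rule_format, of k]
      unfolding step by (metis le_neq_implies_less)
    have ge: "mat_rank (obs_mat n A C k) \<ge> k" for k
    proof (induction k)
      case (Suc k)
      then show ?case using inc[of k] by linarith
    qed simp
    have "mat_rank (obs_mat n A C (Suc n)) \<le> n"
    proof -
      interpret vec_space "TYPE(real)" "dim_row (obs_mat n A C (Suc n))" .
      show ?thesis by (rule rank_le_nc) (use obs_carrier[OF A C, of "Suc n"] in auto)
    qed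
    then show False using ge[of "Suc n"] by simp
  qed
  then show ?thesis unfolding lag_of_pair_def by (rule LeastI_ex)
qed

text \<open>At the lag the block row C A^l does not increase the rank, so it vanishes on every state
  that the preceding block rows do not see.\<close>

lemma lag_kernel:
  assumes A: "A \<in> carrier_mat n n" and C: "C \<in> carrier_mat p n" and l: "l = lag_of_pair n A C"
    and x: "\<And>k i. k < l \<Longrightarrow> i < p \<Longrightarrow> (\<Sum>j<n. row_pow n (ent A) (ent C i) k j * x j) = 0" and i: "i < p"
  shows "(\<Sum>j<n. row_pow n (ent A) (ent C i) l j * x j) = 0"
proof -
  have "(\<Sum>j<n. (C * A ^\<^sub>m l) $$ (i, j) * x j) = 0"
  proof (rule rank_append_rows_kernel[OF obs_carrier[OF A C, of l] _ _ _ i])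
    show "C * A ^\<^sub>m l \<in> carrier_mat p n" using A C by auto
    show "mat_rank (obs_mat n A C l @\<^sub>r (C * A ^\<^sub>m l)) = mat_rank (obs_mat n A C l)"
      using lag_of_pair_attained[OF A C] by (simp add: l obs_mat_def)
    fix r assume r: "r < l * p"
    then have p: "p > 0" by (cases p) auto
    have "r div p < l" using r p by (simp add: less_mult_imp_div_less)
    have "(\<Sum>j<n. obs_mat n A C l $$ (r, j) * x j) = (\<Sum>j<n. row_pow n (ent A) (ent C (r mod p)) (r div p) j * x j)"
    proof (intro sum.cong refl)
      fix j assume "j \<in> {..<n}"
      then show "obs_mat n A C l $$ (r, j) * x j = row_pow n (ent A) (ent C (r mod p)) (r div p) j * x j"
        using obs_entry[OF A C \<open>r div p < l\<close>, of "r mod p" j] p by simp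
    qed
    then show "(\<Sum>j<n. obs_mat n A C l $$ (r, j) * x j) = 0"
      using x[OF \<open>r div p < l\<close>, of "r mod p"] p by simp
  qed
  then show ?thesis using pow_row_entry[OF A C i] by simp
qed

context iso_system begin

lemma free_response:
  fixes x0 :: "nat \<Rightarrow> real"
  obtains x y where "smooth_state_sol m p n A B C D (\<lambda>i t. 0) y x" "\<And>i. i < n \<Longrightarrow> x i (-1) = x0 i"
    "\<And>i. smooth_on {-1..1} (y i)" "weak_sol m p g R (\<lambda>i t. 0) y" "\<And>i t. y i t = (\<Sum>j<n. C i j * x j t)"
proof -
  obtain x where x: "\<And>i. i < n \<Longrightarrow> smooth_on {-1..1} (x i)" "\<And>i. i < n \<Longrightarrow> x i (-1) = x0 i"
    "\<And>i t. i < n \<Longrightarrow> t \<in> {-1..1} \<Longrightarrow>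
      (x i has_real_derivative (\<Sum>j<n. A i j * x j t) + 0) (at t within {-1..1})"
    using linear_ode_smooth_exists[of n "\<lambda>i t. 0" x0 A] smooth_on_const by blast
  define y where "y i t = (\<Sum>j<n. C i j * x j t)" for i t
  have ys: "smooth_on {-1..1} (y i)" for i
    unfolding y_def[abs_def] by (intro smooth_on_sum smooth_on_mult smooth_on_const x) auto
  have s: "smooth_state_sol m p n A B C D (\<lambda>i t. 0) y x"
    using x by (auto simp: smooth_state_sol_def y_def)
  have "weak_sol m p g R (\<lambda>i t. 0) y"
    using iso[of "\<lambda>i t. 0" y] ys s by auto
  then show thesis using that[OF s x(2) ys] y_def by blast
qed

text \<open>Both representations describe the same smooth trajectories, so the free output generated
  by \<open>x0\<close> in one of them is generated by some initial state in the other; comparing all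
  derivatives at -1 gives the claim.\<close>

lemma free_response_jets:
  assumes "iso_system m p g n' R A' B' C' D'"
  shows "\<exists>x0'. \<forall>i<p. \<forall>k. (\<Sum>j<n. row_pow n A (C i) k j * x0 j) = (\<Sum>j<n'. row_pow n' A' (C' i) k j * x0' j)"
proof -
  interpret S': iso_system m p g n' R A' B' C' D' by fact
  obtain y x where x: "smooth_state_sol m p n A B C D (\<lambda>i t. 0) y x" "\<And>i. i < n \<Longrightarrow> x i (-1) = x0 i"
    "\<And>i. smooth_on {-1..1} (y i)" "weak_sol m p g R (\<lambda>i t. 0) y" "\<And>i t. y i t = (\<Sum>j<n. C i j * x j t)"
    by (rule free_response[of x0], rule that)
  obtain x' where x': "smooth_state_sol m p n' A' B' C' D' (\<lambda>i t. 0) y x'"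
    using S'.iso[of "\<lambda>i t. 0" y] x by auto
  have "(\<Sum>j<n. row_pow n A (C i) k j * x j (-1)) = (\<Sum>j<n'. row_pow n' A' (C' i) k j * x' j (-1))"
    if i: "i < p" for i k
  proof (rule S'.state_derivs[OF x' i, of "\<lambda>k t. \<Sum>j<n. row_pow n A (C i) k j * x j t"])
    show "(\<Sum>j<n. row_pow n A (C i) 0 j * x j t) = y i t" if "t \<in> {-1..1}" for t
      using x(1) i that by (simp add: smooth_state_sol_def)
    show "((\<lambda>t. \<Sum>j<n. row_pow n A (C i) k j * x j t) has_real_derivative
        (\<Sum>j<n. row_pow n A (C i) (Suc k) j * x j t)) (at t within {-1..1})" if "t \<in> {-1..1}" for k t
      unfolding row_pow_state
      using x(1) that by (intro DERIV_sum DERIV_cmult) (auto simp: smooth_state_sol_def)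
  qed simp
  then show ?thesis using x(2) by (intro exI[of _ "\<lambda>j. x' j (-1)"]) auto
qed

end

section \<open>Passage from matrix representations to coordinates\<close>

definition kernel_rows :: "nat \<Rightarrow> (nat \<Rightarrow> real mat) \<Rightarrow> nat \<Rightarrow> nat \<Rightarrow> real poly" where
  "kernel_rows r R k c = (\<Sum>i\<le>r. monom (R i $$ (k, c)) i)"

lemma sum_lessThan_add: "(\<Sum>c<m + p. f c) = (\<Sum>c<m. f c) + (\<Sum>c<p. f (m + c :: nat) :: 'a :: comm_monoid_add)"
  by (induction p) (auto simp: add.assoc)

lemma L2v_iff: "w \<in> L2v d \<longleftrightarrow> w \<in> unit_ivl \<rightarrow> carrier_vec d \<and> (\<forall>i<d. (\<lambda>t. w t $ i) \<in> L2)"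
  by (auto simp: L2v_def)

lemma kernel_functional:
  assumes R: "\<And>i. i \<le> r \<Longrightarrow> R i \<in> carrier_mat g q" and w: "w \<in> L2v q" and \<phi>: "\<phi> \<in> test_funv g"
  shows "(\<Sum>i\<le>r. (-1) ^ i * (\<integral>t. w t \<bullet> (transpose_mat (R i) *\<^sub>v derivv g i \<phi> t) \<partial>leb_I)) =
    (\<Sum>k<g. \<Sum>c<q. \<integral>t. w t $ c * pdo (kernel_rows r R k c) (\<lambda>s. \<phi> s $ k) t \<partial>leb_I)"
proof -
  let ?\<phi> = "\<lambda>k s. \<phi> s $ k"
  have t\<phi>: "?\<phi> k \<in> test_fun" if "k < g" for k using \<phi> that by (simp add: test_funv_def)
  have int: "integrable leb_I (\<lambda>t. w t $ c * (deriv ^^ i) (?\<phi> k) t)" if "c < q" "k < g" for c k i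
    using w t\<phi>[OF that(2)] that(1) by (intro L2_test_integrable) (auto simp: L2v_iff)
  have 1: "(\<integral>t. w t \<bullet> (transpose_mat (R i) *\<^sub>v derivv g i \<phi> t) \<partial>leb_I) =
      (\<Sum>k<g. \<Sum>c<q. R i $$ (k, c) * (\<integral>t. w t $ c * (deriv ^^ i) (?\<phi> k) t \<partial>leb_I))" if i: "i \<le> r" for i
  proof -
    have "(\<integral>t. w t \<bullet> (transpose_mat (R i) *\<^sub>v derivv g i \<phi> t) \<partial>leb_I) =
       (\<integral>t. (\<Sum>k<g. \<Sum>c<q. R i $$ (k, c) * (w t $ c * (deriv ^^ i) (?\<phi> k) t)) \<partial>leb_I)"
    proof (intro Bochner_Integration.integral_cong refl)
      fix t assume "t \<in> space leb_I"
      then have wt: "w t \<in> carrier_vec q" using w by (auto simp: L2v_iff)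
      have d: "derivv g i \<phi> t \<in> carrier_vec g" by (simp add: derivv_def)
      have "w t \<bullet> (transpose_mat (R i) *\<^sub>v derivv g i \<phi> t) =
          (\<Sum>c<q. w t $ c * (\<Sum>k<g. R i $$ (k, c) * (deriv ^^ i) (?\<phi> k) t))"
        unfolding scalar_prod_def using wt R[OF i]
        by (auto simp: lessThan_atLeast0 scalar_prod_def derivv_def intro!: sum.cong)
      also have "\<dots> = (\<Sum>k<g. \<Sum>c<q. R i $$ (k, c) * (w t $ c * (deriv ^^ i) (?\<phi> k) t))"
        unfolding sum_distrib_left by (subst sum.swap) (simp add: mult_ac)
      finally show "w t \<bullet> (transpose_mat (R i) *\<^sub>v derivv g i \<phi> t) =
          (\<Sum>k<g. \<Sum>c<q. R i $$ (k, c) * (w t $ c * (deriv ^^ i) (?\<phi> k) t))" .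
    qed
    also have "\<dots> = (\<Sum>k<g. \<integral>t. (\<Sum>c<q. R i $$ (k, c) * (w t $ c * (deriv ^^ i) (?\<phi> k) t)) \<partial>leb_I)"
      by (intro Bochner_Integration.integral_sum Bochner_Integration.integrable_sum integrable_mult_right int) auto
    also have "\<dots> = (\<Sum>k<g. \<Sum>c<q. \<integral>t. R i $$ (k, c) * (w t $ c * (deriv ^^ i) (?\<phi> k) t) \<partial>leb_I)"
      by (intro sum.cong refl Bochner_Integration.integral_sum integrable_mult_right int) auto
    finally show ?thesis by simp
  qed
  have 2: "(\<integral>t. w t $ c * pdo (kernel_rows r R k c) (?\<phi> k) t \<partial>leb_I) =
      (\<Sum>i\<le>r. (-1) ^ i * (R i $$ (k, c) * (\<integral>t. w t $ c * (deriv ^^ i) (?\<phi> k) t \<partial>leb_I)))"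
    if "c < q" "k < g" for c k
  proof -
    have "(\<integral>t. w t $ c * pdo (kernel_rows r R k c) (?\<phi> k) t \<partial>leb_I) =
        (\<integral>t. (\<Sum>i\<le>r. ((-1) ^ i * R i $$ (k, c)) * (w t $ c * (deriv ^^ i) (?\<phi> k) t)) \<partial>leb_I)"
      by (simp add: kernel_rows_def pdo_sum pdo_monom sum_distrib_left mult_ac)
    also have "\<dots> = (\<Sum>i\<le>r. \<integral>t. ((-1) ^ i * R i $$ (k, c)) * (w t $ c * (deriv ^^ i) (?\<phi> k) t) \<partial>leb_I)"
      by (intro Bochner_Integration.integral_sum integrable_mult_right int that)
    finally show ?thesis by (simp add: mult.assoc)
  qed
  have "(\<Sum>i\<le>r. (-1) ^ i * (\<integral>t. w t \<bullet> (transpose_mat (R i) *\<^sub>v derivv g i \<phi> t) \<partial>leb_I)) =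
      (\<Sum>i\<le>r. \<Sum>k<g. \<Sum>c<q. (-1) ^ i * (R i $$ (k, c) * (\<integral>t. w t $ c * (deriv ^^ i) (?\<phi> k) t \<partial>leb_I)))"
    by (intro sum.cong refl) (simp add: 1 sum_distrib_left)
  also have "\<dots> = (\<Sum>k<g. \<Sum>c<q. \<Sum>i\<le>r. (-1) ^ i * (R i $$ (k, c) * (\<integral>t. w t $ c * (deriv ^^ i) (?\<phi> k) t \<partial>leb_I)))"
    by (subst sum.swap) (intro sum.cong refl sum.swap)
  also have "\<dots> = (\<Sum>k<g. \<Sum>c<q. \<integral>t. w t $ c * pdo (kernel_rows r R k c) (?\<phi> k) t \<partial>leb_I)"
    by (intro sum.cong refl) (simp add: 2)
  finally show ?thesis .
qed

lemma deriv_pow_zero: "(deriv ^^ i) (\<lambda>t. 0 :: real) = (\<lambda>t. 0)"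
  by (rule deriv_funpow_eq[of "\<lambda>i t. 0"]) simp

text \<open>Vector-valued test functions with a single nonzero component isolate the rows of the
  kernel equations; conversely the vector equation is the sum of its rows.\<close>

lemma kernel_behavior_weak_sol:
  assumes R: "\<And>i. i \<le> r \<Longrightarrow> R i \<in> carrier_mat g (m + p)"
  shows "w \<in> kernel_behavior (m + p) g r R \<longleftrightarrow> w \<in> unit_ivl \<rightarrow> carrier_vec (m + p) \<and>
    weak_sol m p g (kernel_rows r R) (\<lambda>i t. w t $ i) (\<lambda>i t. w t $ (m + i))"
proof -
  have L2: "(w \<in> L2v (m + p)) \<longleftrightarrow> w \<in> unit_ivl \<rightarrow> carrier_vec (m + p) \<and>
      (\<forall>i<m. (\<lambda>t. w t $ i) \<in> L2) \<and> (\<forall>i<p. (\<lambda>t. w t $ (m + i)) \<in> L2)"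
    unfolding L2v_iff
    by (metis add_less_cancel_left le_add_diff_inverse not_less trans_less_add1)
  let ?K = "\<lambda>k \<psi>. \<Sum>c<m + p. \<integral>t. w t $ c * pdo (kernel_rows r R k c) \<psi> t \<partial>leb_I"
  have "(\<forall>\<phi>\<in>test_funv g. (\<Sum>i\<le>r. (-1) ^ i * (\<integral>t. w t \<bullet> (transpose_mat (R i) *\<^sub>v derivv g i \<phi> t) \<partial>leb_I)) = 0)
      \<longleftrightarrow> (\<forall>k<g. \<forall>\<psi>\<in>test_fun. ?K k \<psi> = 0)" if w: "w \<in> L2v (m + p)"
  proof
    assume *: "\<forall>\<phi>\<in>test_funv g. (\<Sum>i\<le>r. (-1) ^ i * (\<integral>t. w t \<bullet> (transpose_mat (R i) *\<^sub>v derivv g i \<phi> t) \<partial>leb_I)) = 0"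
    show "\<forall>k<g. \<forall>\<psi>\<in>test_fun. ?K k \<psi> = 0"
    proof (intro allI impI ballI)
      fix k \<psi> assume k: "k < g" and \<psi>: "\<psi> \<in> test_fun"
      define \<phi> where "\<phi> t = vec g (\<lambda>j. if j = k then \<psi> t else 0)" for t
      have e: "(\<lambda>s. \<phi> s $ j) = (if j = k then \<psi> else (\<lambda>t. 0))" if "j < g" for j
        using that by (auto simp: \<phi>_def)
      have \<phi>: "\<phi> \<in> test_funv g"
        unfolding test_funv_def using \<psi> e by (auto simp: \<phi>_def)
      with * have "(\<Sum>j<g. ?K j (\<lambda>s. \<phi> s $ j)) = 0"
        using kernel_functional[of r R g "m + p", OF R w \<phi>] by simp
      then have "0 = (\<Sum>j<g. ?K j (\<lambda>s. \<phi> s $ j))" by simp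
      also have "\<dots> = (\<Sum>j<g. if j = k then ?K k \<psi> else 0)"
      proof (intro sum.cong refl)
        fix j assume "j \<in> {..<g}"
        then show "?K j (\<lambda>s. \<phi> s $ j) = (if j = k then ?K k \<psi> else 0)"
          using e[of j] by (auto simp: pdo_def deriv_pow_zero)
      qed
      finally show "?K k \<psi> = 0" using k by simp
    qed
  next
    assume *: "\<forall>k<g. \<forall>\<psi>\<in>test_fun. ?K k \<psi> = 0"
    show "\<forall>\<phi>\<in>test_funv g. (\<Sum>i\<le>r. (-1) ^ i * (\<integral>t. w t \<bullet> (transpose_mat (R i) *\<^sub>v derivv g i \<phi> t) \<partial>leb_I)) = 0"
    proof
      fix \<phi> assume \<phi>: "\<phi> \<in> test_funv g"
      then have "?K k (\<lambda>s. \<phi> s $ k) = 0" if "k < g" for k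
        using * that by (auto simp: test_funv_def)
      then show "(\<Sum>i\<le>r. (-1) ^ i * (\<integral>t. w t \<bullet> (transpose_mat (R i) *\<^sub>v derivv g i \<phi> t) \<partial>leb_I)) = 0"
        using kernel_functional[of r R g "m + p", OF R w \<phi>] by simp
    qed
  qed
  then show ?thesis
    unfolding kernel_behavior_def weak_sol_def using L2 by (auto simp: sum_lessThan_add)
qed

lemma weak_sol_cong:
  assumes "\<And>i t. i < m \<Longrightarrow> t \<in> unit_ivl \<Longrightarrow> u i t = u' i t" "\<And>i t. i < p \<Longrightarrow> t \<in> unit_ivl \<Longrightarrow> y i t = y' i t"
  shows "weak_sol m p g R u y \<longleftrightarrow> weak_sol m p g R u' y'"
proof -
  have L2c: "f \<in> L2 \<longleftrightarrow> f' \<in> L2" if "\<And>t. t \<in> unit_ivl \<Longrightarrow> f t = f' t" for f f'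
  proof -
    have "integrable leb_I (\<lambda>t. (f t)\<^sup>2) \<longleftrightarrow> integrable leb_I (\<lambda>t. (f' t)\<^sup>2)"
      by (rule Bochner_Integration.integrable_cong) (auto simp: that)
    then show ?thesis
      unfolding L2_def mem_Collect_eq
      using measurable_lebesgue_cong[of unit_ivl f f' borel] that by simp
  qed
  have ic: "(\<integral>t. f t * h t \<partial>leb_I) = (\<integral>t. f' t * h t \<partial>leb_I)" if "\<And>t. t \<in> unit_ivl \<Longrightarrow> f t = f' t" for f f' h
    by (rule Bochner_Integration.integral_cong) (auto simp: that)
  have "(\<integral>t. u c t * h t \<partial>leb_I) = (\<integral>t. u' c t * h t \<partial>leb_I)" if "c < m" for c h
    by (rule ic) (rule assms(1)[OF that])
  moreover have "(\<integral>t. y c t * h t \<partial>leb_I) = (\<integral>t. y' c t * h t \<partial>leb_I)" if "c < p" for c h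
    by (rule ic) (rule assms(2)[OF that])
  moreover have "u c \<in> L2 \<longleftrightarrow> u' c \<in> L2" if "c < m" for c
    by (rule L2c) (rule assms(1)[OF that])
  moreover have "y c \<in> L2 \<longleftrightarrow> y' c \<in> L2" if "c < p" for c
    by (rule L2c) (rule assms(2)[OF that])
  ultimately show ?thesis unfolding weak_sol_def by simp
qed

definition join :: "nat \<Rightarrow> nat \<Rightarrow> (nat \<Rightarrow> real \<Rightarrow> real) \<Rightarrow> (nat \<Rightarrow> real \<Rightarrow> real) \<Rightarrow> real \<Rightarrow> real vec" where
  "join m p u y t = vec (m + p) (\<lambda>i. if i < m then u i t else y (i - m) t)"

lemma join_index: "i < m \<Longrightarrow> join m p u y t $ i = u i t" "i < p \<Longrightarrow> join m p u y t $ (m + i) = y i t"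
  by (auto simp: join_def)

lemma join_carrier [simp]: "join m p u y t \<in> carrier_vec (m + p)"
  by (simp add: join_def)

lemma kernel_behavior_join:
  assumes R: "\<And>i. i \<le> r \<Longrightarrow> R i \<in> carrier_mat g (m + p)"
  shows "join m p u y \<in> kernel_behavior (m + p) g r R \<longleftrightarrow> weak_sol m p g (kernel_rows r R) u y"
proof -
  have "weak_sol m p g (kernel_rows r R) (\<lambda>i t. join m p u y t $ i) (\<lambda>i t. join m p u y t $ (m + i)) \<longleftrightarrow>
      weak_sol m p g (kernel_rows r R) u y"
    by (rule weak_sol_cong) (auto simp: join_index)
  then show ?thesis using kernel_behavior_weak_sol[OF R] by simp
qed

lemma iso_system_of_representation:
  assumes R: "\<And>i. i \<le> r \<Longrightarrow> R i \<in> carrier_mat g (m + p)"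
    and iso: "iso_representation m p (kernel_behavior (m + p) g r R) n A B C D"
  shows "iso_system m p g n (kernel_rows r R) (ent A) (ent B) (ent C) (ent D)"
proof
  fix u y :: "nat \<Rightarrow> real \<Rightarrow> real"
  assume u: "\<And>i. i < m \<Longrightarrow> smooth_on {-1..1} (u i)" and y: "\<And>i. i < p \<Longrightarrow> smooth_on {-1..1} (y i)"
  let ?w = "join m p u y"
  have c: "A \<in> carrier_mat n n" "B \<in> carrier_mat n m" "C \<in> carrier_mat p n" "D \<in> carrier_mat p m"
    using iso by (auto simp: iso_representation_def)
  have "(\<lambda>t. ?w t $ i) = (if i < m then u i else y (i - m))" if "i < m + p" for i
    using that by (auto simp: join_def)
  then have ws: "?w \<in> smoothv (m + p)"
    using u y by (auto simp: smoothv_def smooth_closed_iff)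
  have inp: "input_part m ?w t \<in> carrier_vec m" "\<And>j. j < m \<Longrightarrow> input_part m ?w t $ j = u j t" for t
    by (auto simp: input_part_def vec_first_def join_index)
  have outp: "output_part p ?w t \<in> carrier_vec p" "\<And>j. j < p \<Longrightarrow> output_part p ?w t $ j = y j t" for t
    by (auto simp: output_part_def vec_last_def join_def)
  have conv: "(\<forall>i<n. ((\<lambda>s. x s $ i) has_real_derivative
              (A *\<^sub>v x t + B *\<^sub>v input_part m ?w t) $ i) (at t within {-1..1})) \<and>
           output_part p ?w t = C *\<^sub>v x t + D *\<^sub>v input_part m ?w t \<longleftrightarrow>
       (\<forall>i<n. ((\<lambda>s. x s $ i) has_real_derivative
          (\<Sum>j<n. ent A i j * x t $ j) + (\<Sum>j<m. ent B i j * u j t)) (at t within {-1..1})) \<and>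
        (\<forall>i<p. y i t = (\<Sum>j<n. ent C i j * x t $ j) + (\<Sum>j<m. ent D i j * u j t))"
    if xt: "x t \<in> carrier_vec n" for x t
  proof -
    have "(A *\<^sub>v x t + B *\<^sub>v input_part m ?w t) $ i = (\<Sum>j<n. ent A i j * x t $ j) + (\<Sum>j<m. ent B i j * u j t)"
      if "i < n" for i
      using c that inp mult_mat_vec_index[OF c(1) xt that] mult_mat_vec_index[OF c(2) inp(1) that]
      by (simp del: index_mult_mat_vec)
    moreover have "(C *\<^sub>v x t + D *\<^sub>v input_part m ?w t) $ i = (\<Sum>j<n. ent C i j * x t $ j) + (\<Sum>j<m. ent D i j * u j t)"
      if "i < p" for i
      using c that inp mult_mat_vec_index[OF c(3) xt that] mult_mat_vec_index[OF c(4) inp(1) that]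
      by (simp del: index_mult_mat_vec)
    moreover have "output_part p ?w t = C *\<^sub>v x t + D *\<^sub>v input_part m ?w t \<longleftrightarrow>
        (\<forall>i<p. output_part p ?w t $ i = (C *\<^sub>v x t + D *\<^sub>v input_part m ?w t) $ i)"
      using outp c by (auto simp: vec_eq_iff carrier_vecD)
    ultimately show ?thesis using outp by auto
  qed
  have "weak_sol m p g (kernel_rows r R) u y \<longleftrightarrow> ?w \<in> kernel_behavior (m + p) g r R"
    using kernel_behavior_join[OF R] by simp
  also have "\<dots> \<longleftrightarrow> (\<exists>x\<in>smoothv n. \<forall>t\<in>{-1..1}.
           (\<forall>i<n. ((\<lambda>s. x s $ i) has_real_derivative
              (A *\<^sub>v x t + B *\<^sub>v input_part m ?w t) $ i) (at t within {-1..1})) \<and>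
           output_part p ?w t = C *\<^sub>v x t + D *\<^sub>v input_part m ?w t)"
    using iso ws unfolding iso_representation_def by blast
  also have "\<dots> \<longleftrightarrow> (\<exists>x\<in>smoothv n. smooth_state_sol m p n (ent A) (ent B) (ent C) (ent D) u y (\<lambda>i t. x t $ i))"
  proof (intro bex_cong refl)
    fix x assume x: "x \<in> smoothv n"
    then have xt: "x t \<in> carrier_vec n" if "t \<in> {-1..1}" for t
      using that by (auto simp: smoothv_def)
    have "\<forall>i<n. smooth_on {-1..1} (\<lambda>t. x t $ i)"
      using x by (auto simp: smoothv_def smooth_closed_iff)
    then show "(\<forall>t\<in>{-1..1}. (\<forall>i<n. ((\<lambda>s. x s $ i) has_real_derivative
              (A *\<^sub>v x t + B *\<^sub>v input_part m ?w t) $ i) (at t within {-1..1})) \<and>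
           output_part p ?w t = C *\<^sub>v x t + D *\<^sub>v input_part m ?w t) \<longleftrightarrow>
        smooth_state_sol m p n (ent A) (ent B) (ent C) (ent D) u y (\<lambda>i t. x t $ i)"
      unfolding smooth_state_sol_def using ball_cong[OF refl conv[where x = x, OF xt], of "{-1..1}"] by simp
  qed
  also have "\<dots> \<longleftrightarrow> (\<exists>x. smooth_state_sol m p n (ent A) (ent B) (ent C) (ent D) u y x)"
  proof
    assume "\<exists>x. smooth_state_sol m p n (ent A) (ent B) (ent C) (ent D) u y x"
    then obtain x where x: "smooth_state_sol m p n (ent A) (ent B) (ent C) (ent D) u y x" by blast
    define x' where "x' t = vec n (\<lambda>i. x i t)" for t
    have e: "(\<lambda>t. x' t $ i) = x i" if "i < n" for i using that by (auto simp: x'_def)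
    have e': "x' t $ i = x i t" if "i < n" for i t using that by (auto simp: x'_def)
    have "x' \<in> smoothv n"
      using x e by (auto simp: smoothv_def smooth_closed_iff smooth_state_sol_def) (simp add: x'_def)
    moreover have "smooth_state_sol m p n (ent A) (ent B) (ent C) (ent D) u y (\<lambda>i t. x' t $ i)"
      using x e e' by (simp add: smooth_state_sol_def)
    ultimately show "\<exists>x\<in>smoothv n. smooth_state_sol m p n (ent A) (ent B) (ent C) (ent D) u y (\<lambda>i t. x t $ i)"
      by blast
  qed blast
  finally show "weak_sol m p g (kernel_rows r R) u y \<longleftrightarrow>
      (\<exists>x. smooth_state_sol m p n (ent A) (ent B) (ent C) (ent D) u y x)" .
qed

text \<open>The image of each observability matrix is the space of derivative jets of free outputs
  at -1, which depends on the behavior alone. Hence all ranks that enter the definition of the lag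
  agree.\<close>

lemma lag_of_pair_unique:
  assumes R: "\<And>i. i \<le> r \<Longrightarrow> R i \<in> carrier_mat g (m + p)"
    and iso: "iso_representation m p (kernel_behavior (m + p) g r R) n A B C D"
    and iso': "iso_representation m p (kernel_behavior (m + p) g r R) n' A' B' C' D'"
  shows "lag_of_pair n A C = lag_of_pair n' A' C'"
proof -
  have c: "A \<in> carrier_mat n n" "C \<in> carrier_mat p n" and c': "A' \<in> carrier_mat n' n'" "C' \<in> carrier_mat p n'"
    using iso iso' by (auto simp: iso_representation_def)
  have sub: "{obs_mat n A C k *\<^sub>v x |x. x \<in> carrier_vec n} \<subseteq> {obs_mat n' A' C' k *\<^sub>v x |x. x \<in> carrier_vec n'}"
    if iso: "iso_representation m p (kernel_behavior (m + p) g r R) n A B C D"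
      and iso': "iso_representation m p (kernel_behavior (m + p) g r R) n' A' B' C' D'"
    for n n' A A' B B' C C' D D' k
  proof -
    have c: "A \<in> carrier_mat n n" "C \<in> carrier_mat p n" and c': "A' \<in> carrier_mat n' n'" "C' \<in> carrier_mat p n'"
      using iso iso' by (auto simp: iso_representation_def)
    interpret iso_system m p g n "kernel_rows r R" "ent A" "ent B" "ent C" "ent D"
      by (rule iso_system_of_representation[OF R iso])
    show ?thesis
    proof clarify
      fix x :: "real vec" assume x: "x \<in> carrier_vec n"
      obtain x0' where x0': "\<forall>i<p. \<forall>k. (\<Sum>j<n. row_pow n (ent A) (ent C i) k j * x $ j) =
          (\<Sum>j<n'. row_pow n' (ent A') (ent C' i) k j * x0' j)"
        using free_response_jets[OF iso_system_of_representation[OF R iso'], of "\<lambda>j. x $ j"] by blast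
      have "obs_mat n A C k *\<^sub>v x = obs_mat n' A' C' k *\<^sub>v vec n' x0'"
        unfolding obs_image[OF c x] obs_image[OF c' vec_carrier]
      proof (rule eq_vecI)
        fix r assume r: "r < dim_vec (vec (k * p) (\<lambda>r. \<Sum>l<n'. row_pow n' (ent A') (ent C' (r mod p)) (r div p) l * vec n' x0' $ l))"
        then have "p > 0" by (cases p) auto
        then show "vec (k * p) (\<lambda>r. \<Sum>l<n. row_pow n (ent A) (ent C (r mod p)) (r div p) l * x $ l) $ r =
            vec (k * p) (\<lambda>r. \<Sum>l<n'. row_pow n' (ent A') (ent C' (r mod p)) (r div p) l * vec n' x0' $ l) $ r"
          using r x0'[rule_format, of "r mod p" "r div p"] by simp
      qed simp
      then show "\<exists>x'. obs_mat n A C k *\<^sub>v x = obs_mat n' A' C' k *\<^sub>v x' \<and> x' \<in> carrier_vec n'"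
        by (intro exI[of _ "vec n' x0'"]) simp
    qed
  qed
  have "mat_rank (obs_mat n A C k) = mat_rank (obs_mat n' A' C' k)" for k
    using sub[OF iso iso', of k] sub[OF iso' iso, of k] obs_carrier[OF c, of k] obs_carrier[OF c', of k]
    by (intro rank_cong_image) auto
  then show ?thesis unfolding lag_of_pair_def by simp
qed

text \<open>The lag is a definite description over all representations; uniqueness allows computing
  it from the representation at hand.\<close>

lemma lag_eq_lag_of_pair:
  assumes R: "\<And>i. i \<le> r \<Longrightarrow> R i \<in> carrier_mat g (m + p)"
    and iso: "iso_representation m p (kernel_behavior (m + p) g r R) n A B C D"
  shows "lag m p (kernel_behavior (m + p) g r R) = lag_of_pair n A C"
  unfolding lag_def
proof (rule the_equality)
  show "\<exists>n' A' B' C' D'. iso_representation m p (kernel_behavior (m + p) g r R) n' A' B' C' D' \<and>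
      lag_of_pair n A C = lag_of_pair n' A' C'"
    using iso by blast
  fix l assume "\<exists>n' A' B' C' D'. iso_representation m p (kernel_behavior (m + p) g r R) n' A' B' C' D' \<and>
      l = lag_of_pair n' A' C'"
  then obtain n' A' B' C' D' where
    iso': "iso_representation m p (kernel_behavior (m + p) g r R) n' A' B' C' D'" and "l = lag_of_pair n' A' C'"
    by blast
  then show "l = lag_of_pair n A C"
    using lag_of_pair_unique[of r R g m p, OF R iso' iso] by simp
qed

section \<open>Weak derivatives\<close>

lemma has_weak_deriv_L2: "has_weak_deriv k f g \<Longrightarrow> g \<in> L2"
  by (simp add: has_weak_deriv_def)

lemma has_weak_derivD:
  "has_weak_deriv k f g \<Longrightarrow> \<phi> \<in> test_fun \<Longrightarrow>
    (\<integral>t. f t * (deriv ^^ k) \<phi> t \<partial>leb_I) = (-1) ^ k * (\<integral>t. g t * \<phi> t \<partial>leb_I)"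
  by (simp add: has_weak_deriv_def)

lemma has_weak_derivI:
  assumes "g \<in> L2" "\<And>\<phi>. \<phi> \<in> test_fun \<Longrightarrow>
    (\<integral>t. f t * (deriv ^^ k) \<phi> t \<partial>leb_I) = (-1) ^ k * (\<integral>t. g t * \<phi> t \<partial>leb_I)"
  shows "has_weak_deriv k f g"
  using assms by (simp add: has_weak_deriv_def)

lemma has_weak_deriv_unique:
  assumes "has_weak_deriv k f g" "has_weak_deriv k f g'"
  shows "AE t in leb_I. g t = g' t"
proof -
  have L: "g \<in> L2" "g' \<in> L2" using assms has_weak_deriv_L2 by auto
  have "AE t in leb_I. g t - g' t = 0"
  proof (rule du_Bois_Reymond)
    show "integrable leb_I (\<lambda>t. g t - g' t)" using L by (intro L2_integrable L2_diff)
    fix \<phi> assume \<phi>: "\<phi> \<in> test_fun"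
    have "(\<integral>t. (g t - g' t) * \<phi> t \<partial>leb_I) = (\<integral>t. g t * \<phi> t \<partial>leb_I) - (\<integral>t. g' t * \<phi> t \<partial>leb_I)"
      unfolding left_diff_distrib
      by (intro Bochner_Integration.integral_diff L2_test_integrable L \<phi>)
    then show "(\<integral>t. (g t - g' t) * \<phi> t \<partial>leb_I) = 0"
      using has_weak_derivD[OF assms(1) \<phi>] has_weak_derivD[OF assms(2) \<phi>] by simp
  qed
  then show ?thesis by eventually_elim simp
qed

lemma has_weak_deriv_weak_deriv: "has_weak_deriv k f g \<Longrightarrow> has_weak_deriv k f (weak_deriv k f)"
  unfolding weak_deriv_def by (rule someI[of "has_weak_deriv k f" g])

lemma weak_deriv_AE: "has_weak_deriv k f g \<Longrightarrow> AE t in leb_I. weak_deriv k f t = g t"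
  by (rule has_weak_deriv_unique[OF has_weak_deriv_weak_deriv])

lemma integral_test_cong_AE:
  assumes "f \<in> L2" "f' \<in> L2" "AE t in leb_I. f t = f' t" "\<psi> \<in> test_fun"
  shows "(\<integral>t. f t * \<psi> t \<partial>leb_I) = (\<integral>t. f' t * \<psi> t \<partial>leb_I)"
proof (rule integral_cong_AE)
  show "AE t in leb_I. f t * \<psi> t = f' t * \<psi> t" using assms(3) by eventually_elim auto
qed (use assms test_fun_L2 in \<open>auto intro!: borel_measurable_times dest: L2_measurable\<close>)

lemma has_weak_deriv_cong_AE:
  assumes "has_weak_deriv k f g" "f \<in> L2" "f' \<in> L2" "g' \<in> L2"
    "AE t in leb_I. f t = f' t" "AE t in leb_I. g t = g' t"
  shows "has_weak_deriv k f' g'"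
proof (rule has_weak_derivI)
  fix \<phi> assume \<phi>: "\<phi> \<in> test_fun"
  have "(\<integral>t. f' t * (deriv ^^ k) \<phi> t \<partial>leb_I) = (\<integral>t. f t * (deriv ^^ k) \<phi> t \<partial>leb_I)"
    using assms \<phi> by (intro integral_test_cong_AE[symmetric]) auto
  moreover have "(\<integral>t. g' t * \<phi> t \<partial>leb_I) = (\<integral>t. g t * \<phi> t \<partial>leb_I)"
    using assms \<phi> has_weak_deriv_L2 by (intro integral_test_cong_AE[symmetric]) auto
  ultimately show "(\<integral>t. f' t * (deriv ^^ k) \<phi> t \<partial>leb_I) = (-1) ^ k * (\<integral>t. g' t * \<phi> t \<partial>leb_I)"
    using has_weak_derivD[OF assms(1) \<phi>] by simp
qed (rule assms)

lemma has_weak_deriv_0: "f \<in> L2 \<Longrightarrow> has_weak_deriv 0 f f"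
  by (simp add: has_weak_deriv_def)

lemma has_weak_deriv_lincomb:
  assumes "\<And>i. i \<in> I \<Longrightarrow> f i \<in> L2" "\<And>i. i \<in> I \<Longrightarrow> has_weak_deriv k (f i) (g i)"
  shows "has_weak_deriv k (\<lambda>t. \<Sum>i\<in>I. c i * f i t) (\<lambda>t. \<Sum>i\<in>I. c i * g i t)"
proof (rule has_weak_derivI)
  have gL: "g i \<in> L2" if "i \<in> I" for i using assms(2)[OF that] by (rule has_weak_deriv_L2)
  show "(\<lambda>t. \<Sum>i\<in>I. c i * g i t) \<in> L2" by (intro L2_sum L2_cmult gL)
  fix \<phi> assume \<phi>: "\<phi> \<in> test_fun"
  have lin: "(\<integral>t. (\<Sum>i\<in>I. c i * h i t) * \<psi> t \<partial>leb_I) = (\<Sum>i\<in>I. c i * (\<integral>t. h i t * \<psi> t \<partial>leb_I))"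
    if h: "\<And>i. i \<in> I \<Longrightarrow> h i \<in> L2" and \<psi>: "\<psi> \<in> test_fun" for h \<psi>
  proof -
    have "(\<integral>t. (\<Sum>i\<in>I. c i * h i t) * \<psi> t \<partial>leb_I) = (\<integral>t. (\<Sum>i\<in>I. c i * (h i t * \<psi> t)) \<partial>leb_I)"
      by (simp add: sum_distrib_right mult.assoc)
    also have "\<dots> = (\<Sum>i\<in>I. \<integral>t. c i * (h i t * \<psi> t) \<partial>leb_I)"
      by (intro Bochner_Integration.integral_sum integrable_mult_right L2_test_integrable h \<psi>)
    finally show ?thesis by simp
  qed
  have "(\<integral>t. (\<Sum>i\<in>I. c i * f i t) * (deriv ^^ k) \<phi> t \<partial>leb_I) =
      (\<Sum>i\<in>I. c i * (\<integral>t. f i t * (deriv ^^ k) \<phi> t \<partial>leb_I))"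
    by (rule lin[OF assms(1)]) (use \<phi> in auto)
  also have "\<dots> = (\<Sum>i\<in>I. c i * ((-1) ^ k * (\<integral>t. g i t * \<phi> t \<partial>leb_I)))"
    by (intro sum.cong refl) (simp add: has_weak_derivD[OF assms(2) \<phi>])
  also have "\<dots> = (-1) ^ k * (\<Sum>i\<in>I. c i * (\<integral>t. g i t * \<phi> t \<partial>leb_I))"
    by (simp add: sum_distrib_left mult.left_commute)
  also have "(\<Sum>i\<in>I. c i * (\<integral>t. g i t * \<phi> t \<partial>leb_I)) = (\<integral>t. (\<Sum>i\<in>I. c i * g i t) * \<phi> t \<partial>leb_I)"
    by (rule lin[OF gL \<phi>, symmetric])
  finally show "(\<integral>t. (\<Sum>i\<in>I. c i * f i t) * (deriv ^^ k) \<phi> t \<partial>leb_I) =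
      (-1) ^ k * (\<integral>t. (\<Sum>i\<in>I. c i * g i t) * \<phi> t \<partial>leb_I)" .
qed

lemma has_weak_deriv_add:
  assumes "f \<in> L2" "f' \<in> L2" "has_weak_deriv k f g" "has_weak_deriv k f' g'"
  shows "has_weak_deriv k (\<lambda>t. f t + f' t) (\<lambda>t. g t + g' t)"
  using has_weak_deriv_lincomb[of "{True, False}" "\<lambda>b. if b then f else f'" k "\<lambda>b. if b then g else g'" "\<lambda>_. 1"] assms
  by simp

text \<open>Testing f with k + j derivatives of \<phi> can be read in two ways, through g and
  through h.\<close>

lemma has_weak_deriv_shift:
  assumes "has_weak_deriv k f g" "has_weak_deriv (k + j) f h"
  shows "has_weak_deriv j g h"
proof (rule has_weak_derivI)
  fix \<phi> assume \<phi>: "\<phi> \<in> test_fun"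
  have "(\<integral>t. f t * (deriv ^^ k) ((deriv ^^ j) \<phi>) t \<partial>leb_I) = (-1) ^ k * (\<integral>t. g t * (deriv ^^ j) \<phi> t \<partial>leb_I)"
    using \<phi> by (intro has_weak_derivD[OF assms(1)]) auto
  moreover have "(\<integral>t. f t * (deriv ^^ (k + j)) \<phi> t \<partial>leb_I) = (-1) ^ (k + j) * (\<integral>t. h t * \<phi> t \<partial>leb_I)"
    by (rule has_weak_derivD[OF assms(2) \<phi>])
  moreover have "(deriv ^^ k) ((deriv ^^ j) \<phi>) = (deriv ^^ (k + j)) \<phi>"
    by (simp add: funpow_add)
  ultimately show "(\<integral>t. g t * (deriv ^^ j) \<phi> t \<partial>leb_I) = (-1) ^ j * (\<integral>t. h t * \<phi> t \<partial>leb_I)"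
    by (simp add: power_add)
qed (use assms(2) has_weak_deriv_L2 in blast)

lemma has_weak_deriv_Suc:
  assumes "has_weak_deriv k f g" "has_weak_deriv 1 g h"
  shows "has_weak_deriv (Suc k) f h"
proof (rule has_weak_derivI)
  fix \<phi> assume \<phi>: "\<phi> \<in> test_fun"
  have "(\<integral>t. f t * (deriv ^^ k) (deriv \<phi>) t \<partial>leb_I) = (-1) ^ k * (\<integral>t. g t * deriv \<phi> t \<partial>leb_I)"
    using \<phi> by (intro has_weak_derivD[OF assms(1)]) auto
  moreover have "(\<integral>t. g t * deriv \<phi> t \<partial>leb_I) = - (\<integral>t. h t * \<phi> t \<partial>leb_I)"
    using has_weak_derivD[OF assms(2) \<phi>] by simp
  ultimately show "(\<integral>t. f t * (deriv ^^ Suc k) \<phi> t \<partial>leb_I) = (-1) ^ Suc k * (\<integral>t. h t * \<phi> t \<partial>leb_I)"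
    unfolding deriv_pow_Suc by simp
qed (use assms(2) has_weak_deriv_L2 in blast)

lemma has_weak_deriv_poly: "has_weak_deriv k (poly P) (poly ((pderiv ^^ k) P))"
  by (intro has_weak_derivI parts_test_fun_poly smooth_L2 smooth_on_poly)

section \<open>Derivatives of states and outputs\<close>

lemma sum_swap3: "(\<Sum>l\<in>J. \<Sum>k\<in>K. \<Sum>i\<in>I. f l k i) = (\<Sum>k\<in>K. \<Sum>i\<in>I. \<Sum>l\<in>J. f l k i)"
  by (subst sum.swap) (intro sum.cong refl sum.swap)

text \<open>Markov parameters \<zeta> A^(k-1-l) B: for l < k, the coefficient of the l-th derivative
  of input j in the k-th derivative of \<zeta> x.\<close>

definition markov :: "nat \<Rightarrow> (nat \<Rightarrow> nat \<Rightarrow> real) \<Rightarrow> (nat \<Rightarrow> nat \<Rightarrow> real) \<Rightarrow> (nat \<Rightarrow> real) \<Rightarrow> nat \<Rightarrow> nat \<Rightarrow> nat \<Rightarrow> real" where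
  "markov n A B \<zeta> k l j = (\<Sum>i<n. row_pow n A \<zeta> (k - 1 - l) i * B i j)"

text \<open>\<open>resp k i\<close> is the \<open>k\<close>-th derivative of output \<open>i\<close> in terms of input derivatives \<open>U\<close>
  and the state \<open>x\<close>.\<close>

definition resp :: "nat \<Rightarrow> nat \<Rightarrow> (nat \<Rightarrow> nat \<Rightarrow> real) \<Rightarrow> (nat \<Rightarrow> nat \<Rightarrow> real) \<Rightarrow> (nat \<Rightarrow> nat \<Rightarrow> real) \<Rightarrow>
    (nat \<Rightarrow> nat \<Rightarrow> real) \<Rightarrow> nat \<Rightarrow> nat \<Rightarrow> (nat \<Rightarrow> nat \<Rightarrow> real) \<Rightarrow> (nat \<Rightarrow> real) \<Rightarrow> real" where
  "resp m n A B C D k i U x = (\<Sum>j<n. row_pow n A (C i) k j * x j) +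
     (\<Sum>l<k. \<Sum>j<m. markov n A B (C i) k l j * U l j) + (\<Sum>j<m. D i j * U k j)"

lemma row_state:
  assumes S: "state_sol m p n A B C D u y x" and u: "\<And>j. j < m \<Longrightarrow> u j \<in> L2" and t: "t \<in> {-1..1}"
  shows "(\<Sum>j<n. \<zeta> j * x j t) = (\<Sum>j<n. \<zeta> j * x j (-1)) +
    primitive (\<lambda>s. (\<Sum>j<n. row_pow n A \<zeta> 1 j * x j s) + (\<Sum>j<m. (\<Sum>i<n. \<zeta> i * B i j) * u j s)) t"
proof -
  let ?v = "\<lambda>i s. (\<Sum>j<n. A i j * x j s) + (\<Sum>j<m. B i j * u j s)"
  have x: "x i t = x i (-1) + primitive (?v i) t" "continuous_on {-1..1} (x i)" if "i < n" for i
    using S t that unfolding state_sol_def by blast+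
  have v: "integrable leb_I (?v i)" for i
    by (intro Bochner_Integration.integrable_add Bochner_Integration.integrable_sum integrable_mult_right
        continuous_integrable_I[OF x(2)] L2_integrable[OF u]) auto
  have "(\<Sum>j<n. \<zeta> j * x j t) = (\<Sum>j<n. \<zeta> j * (x j (-1) + primitive (?v j) t))"
    using x(1) by (intro sum.cong refl) auto
  also have "\<dots> = (\<Sum>j<n. \<zeta> j * x j (-1)) + (\<Sum>j<n. primitive (\<lambda>s. \<zeta> j * ?v j s) t)"
    by (simp only: distrib_left[of _ "x _ _"] sum.distrib primitive_cmult)
  also have "(\<Sum>j<n. primitive (\<lambda>s. \<zeta> j * ?v j s) t) = primitive (\<lambda>s. \<Sum>j<n. \<zeta> j * ?v j s) t"
    by (intro primitive_sum[symmetric] integrable_mult_right v)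
  also have "(\<lambda>s. \<Sum>j<n. \<zeta> j * ?v j s) =
      (\<lambda>s. (\<Sum>j<n. row_pow n A \<zeta> 1 j * x j s) + (\<Sum>j<m. (\<Sum>i<n. \<zeta> i * B i j) * u j s))"
  proof
    fix s
    have 1: "(\<Sum>i<n. \<zeta> i * (\<Sum>j<n. A i j * x j s)) = (\<Sum>j<n. row_pow n A \<zeta> 1 j * x j s)"
      using row_pow_state[of n A \<zeta> 0 "\<lambda>j. x j s"] by simp
    have 2: "(\<Sum>i<n. \<zeta> i * (\<Sum>j<m. B i j * u j s)) = (\<Sum>j<m. (\<Sum>i<n. \<zeta> i * B i j) * u j s)"
      unfolding sum_distrib_left sum_distrib_right by (subst sum.swap) (simp only: mult.assoc)
    show "(\<Sum>j<n. \<zeta> j * ?v j s) = (\<Sum>j<n. row_pow n A \<zeta> 1 j * x j s) + (\<Sum>j<m. (\<Sum>i<n. \<zeta> i * B i j) * u j s)"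
      by (simp only: distrib_left sum.distrib 1 2)
  qed
  finally show ?thesis .
qed

lemma row_pow_Suc_0: "row_pow n A (row_pow n A \<zeta> k) (Suc 0) = row_pow n A \<zeta> (Suc k)"
  by (auto simp: fun_eq_iff)

lemma state_continuous: "state_sol m p n A B C D u y x \<Longrightarrow> i < n \<Longrightarrow> continuous_on {-1..1} (x i)"
  by (simp add: state_sol_def)

lemma state_row_L2:
  assumes "state_sol m p n A B C D u y x"
  shows "(\<lambda>t. \<Sum>j<n. \<zeta> j * x j t) \<in> L2"
  by (intro L2_sum L2_cmult continuous_L2 state_continuous[OF assms]) auto

text \<open>Each differentiation multiplies the row by A and releases one new input term; the
  earlier input terms are shifted to the next derivative. The released term carries the input
  itself, so the state has one weak derivative more than the input, which explains the bound
  \<open>Suc K\<close>.\<close>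

lemma state_weak_deriv:
  assumes S: "state_sol m p n A B C D u y x" and u: "\<And>j. j < m \<Longrightarrow> u j \<in> L2"
    and U: "\<And>k j. k \<le> K \<Longrightarrow> j < m \<Longrightarrow> has_weak_deriv k (u j) (U k j)" and k: "k \<le> Suc K"
  shows "has_weak_deriv k (\<lambda>t. \<Sum>j<n. \<zeta> j * x j t)
    (\<lambda>t. (\<Sum>j<n. row_pow n A \<zeta> k j * x j t) + (\<Sum>l<k. \<Sum>j<m. markov n A B \<zeta> k l j * U l j t))"
  using k
proof (induction k)
  case 0
  then show ?case by (simp add: has_weak_deriv_0[OF state_row_L2[OF S]])
next
  case (Suc k)
  have UL: "U l j \<in> L2" if "l \<le> K" "j < m" for l j using U[OF that] by (rule has_weak_deriv_L2)
  have base: "has_weak_deriv 1 (\<lambda>t. \<Sum>j<n. \<eta> j * x j t)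
      (\<lambda>t. (\<Sum>j<n. row_pow n A \<eta> 1 j * x j t) + (\<Sum>j<m. (\<Sum>i<n. \<eta> i * B i j) * U 0 j t))" for \<eta>
  proof -
    let ?h = "\<lambda>t. (\<Sum>j<n. row_pow n A \<eta> 1 j * x j t) + (\<Sum>j<m. (\<Sum>i<n. \<eta> i * B i j) * u j t)"
    have hL: "?h \<in> L2"
      by (intro L2_add state_row_L2[OF S] L2_sum L2_cmult u) auto
    have 1: "has_weak_deriv 1 (\<lambda>t. \<Sum>j<n. \<eta> j * x j t) ?h"
    proof (rule has_weak_derivI[OF hL])
      fix \<phi> assume \<phi>: "\<phi> \<in> test_fun"
      have "(\<integral>t. (\<Sum>j<n. \<eta> j * x j t) * deriv \<phi> t \<partial>leb_I) = - (\<integral>t. ?h t * \<phi> t \<partial>leb_I)"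
        by (rule parts_test_fun[OF row_state[OF S u] L2_integrable[OF hL] \<phi>]) auto
      then show "(\<integral>t. (\<Sum>j<n. \<eta> j * x j t) * (deriv ^^ 1) \<phi> t \<partial>leb_I) = (-1) ^ 1 * (\<integral>t. ?h t * \<phi> t \<partial>leb_I)"
        by simp
    qed
    have ae: "AE t in leb_I. \<forall>j\<in>{..<m}. u j t = U 0 j t"
    proof (rule AE_finite_allI)
      fix j assume "j \<in> {..<m}"
      then show "AE t in leb_I. u j t = U 0 j t"
        using has_weak_deriv_unique[OF has_weak_deriv_0[OF u] U[of 0 j]] by simp
    qed simp
    show ?thesis
    proof (rule has_weak_deriv_cong_AE[OF 1])
      show "AE t in leb_I. ?h t = (\<Sum>j<n. row_pow n A \<eta> 1 j * x j t) + (\<Sum>j<m. (\<Sum>i<n. \<eta> i * B i j) * U 0 j t)"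
        using ae by eventually_elim simp
      show "(\<lambda>t. (\<Sum>j<n. row_pow n A \<eta> 1 j * x j t) + (\<Sum>j<m. (\<Sum>i<n. \<eta> i * B i j) * U 0 j t)) \<in> L2"
        by (intro L2_add state_row_L2[OF S] L2_sum L2_cmult UL) auto
    qed (auto intro: state_row_L2[OF S])
  qed
  have shift: "has_weak_deriv 1 (U l j) (U (Suc l) j)" if "l < k" "j < m" for l j
  proof (rule has_weak_deriv_shift)
    show "has_weak_deriv l (u j) (U l j)" using that Suc.prems by (intro U) auto
    show "has_weak_deriv (l + 1) (u j) (U (Suc l) j)" using U[of "Suc l" j] that Suc.prems by simp
  qed
  let ?M = "\<lambda>t. \<Sum>l<k. \<Sum>j<m. markov n A B \<zeta> k l j * U l j t"
  let ?N = "\<lambda>t. \<Sum>l<k. \<Sum>j<m. markov n A B \<zeta> k l j * U (Suc l) j t"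
  have "has_weak_deriv 1 (\<lambda>t. \<Sum>(l, j)\<in>{..<k} \<times> {..<m}. markov n A B \<zeta> k l j * U l j t)
      (\<lambda>t. \<Sum>(l, j)\<in>{..<k} \<times> {..<m}. markov n A B \<zeta> k l j * U (Suc l) j t)"
    using has_weak_deriv_lincomb[of "{..<k} \<times> {..<m}" "\<lambda>(l, j). U l j" 1 "\<lambda>(l, j). U (Suc l) j"
        "\<lambda>(l, j). markov n A B \<zeta> k l j"] UL shift Suc.prems
    by (auto simp: split_beta')
  then have hM: "has_weak_deriv 1 ?M ?N"
    by (simp only: sum.cartesian_product)
  have hML: "?M \<in> L2" using UL Suc.prems by (intro L2_sum L2_cmult) auto
  have "has_weak_deriv 1 (\<lambda>t. (\<Sum>j<n. row_pow n A \<zeta> k j * x j t) + ?M t)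
     (\<lambda>t. ((\<Sum>j<n. row_pow n A (row_pow n A \<zeta> k) 1 j * x j t) +
       (\<Sum>j<m. (\<Sum>i<n. row_pow n A \<zeta> k i * B i j) * U 0 j t)) + ?N t)"
    by (rule has_weak_deriv_add[OF state_row_L2[OF S] hML base hM])
  moreover have "((\<Sum>j<n. row_pow n A (row_pow n A \<zeta> k) 1 j * x j t) +
       (\<Sum>j<m. (\<Sum>i<n. row_pow n A \<zeta> k i * B i j) * U 0 j t)) + ?N t =
     (\<Sum>j<n. row_pow n A \<zeta> (Suc k) j * x j t) + (\<Sum>l<Suc k. \<Sum>j<m. markov n A B \<zeta> (Suc k) l j * U l j t)" for t
  proof -
    have "(\<Sum>l<Suc k. \<Sum>j<m. markov n A B \<zeta> (Suc k) l j * U l j t) =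
        (\<Sum>j<m. markov n A B \<zeta> (Suc k) 0 j * U 0 j t) + (\<Sum>l<k. \<Sum>j<m. markov n A B \<zeta> (Suc k) (Suc l) j * U (Suc l) j t)"
      by (rule sum.lessThan_Suc_shift)
    then show ?thesis
      by (simp add: markov_def row_pow_Suc_0 del: row_pow.simps)
  qed
  ultimately have "has_weak_deriv 1 (\<lambda>t. (\<Sum>j<n. row_pow n A \<zeta> k j * x j t) + ?M t)
    (\<lambda>t. (\<Sum>j<n. row_pow n A \<zeta> (Suc k) j * x j t) + (\<Sum>l<Suc k. \<Sum>j<m. markov n A B \<zeta> (Suc k) l j * U l j t))"
    by (simp only:)
  then show ?case
    by (rule has_weak_deriv_Suc[OF Suc.IH[OF Suc_leD[OF Suc.prems]]])
qed

lemma output_weak_deriv: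
  assumes S: "state_sol m p n A B C D u y x" and u: "\<And>j. j < m \<Longrightarrow> u j \<in> L2" and i: "i < p" and y: "y i \<in> L2"
    and U: "\<And>k j. k \<le> K \<Longrightarrow> j < m \<Longrightarrow> has_weak_deriv k (u j) (U k j)" and k: "k \<le> K"
  shows "has_weak_deriv k (y i) (\<lambda>t. resp m n A B C D k i (\<lambda>l j. U l j t) (\<lambda>j. x j t))"
proof -
  have UL: "U l j \<in> L2" if "l \<le> K" "j < m" for l j using U[OF that] by (rule has_weak_deriv_L2)
  have uL: "(\<lambda>t. \<Sum>j<m. D i j * u j t) \<in> L2" by (intro L2_sum L2_cmult u) auto
  have 1: "has_weak_deriv k (\<lambda>t. \<Sum>j<n. C i j * x j t)
    (\<lambda>t. (\<Sum>j<n. row_pow n A (C i) k j * x j t) + (\<Sum>l<k. \<Sum>j<m. markov n A B (C i) k l j * U l j t))"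
    using k by (intro state_weak_deriv[OF S u U]) auto
  have 2: "has_weak_deriv k (\<lambda>t. \<Sum>j<m. D i j * u j t) (\<lambda>t. \<Sum>j<m. D i j * U k j t)"
    using k u U by (intro has_weak_deriv_lincomb) auto
  from has_weak_deriv_add[OF state_row_L2[OF S] uL 1 2]
  have 3: "has_weak_deriv k (\<lambda>t. (\<Sum>j<n. C i j * x j t) + (\<Sum>j<m. D i j * u j t))
      (\<lambda>t. resp m n A B C D k i (\<lambda>l j. U l j t) (\<lambda>j. x j t))"
    by (simp add: resp_def)
  have "AE t in leb_I. y i t = (\<Sum>j<n. C i j * x j t) + (\<Sum>j<m. D i j * u j t)"
    using S i by (simp add: state_sol_def)
  then have ae: "AE t in leb_I. (\<Sum>j<n. C i j * x j t) + (\<Sum>j<m. D i j * u j t) = y i t"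
    by eventually_elim simp
  show ?thesis
    by (rule has_weak_deriv_cong_AE[OF 3 L2_add[OF state_row_L2[OF S] uL] y has_weak_deriv_L2[OF 3] ae]) simp
qed

section \<open>Consequences of controllability\<close>

text \<open>If f were nonzero at a point, it would be nonzero on a nonempty open set, which is not a
  null set.\<close>

lemma continuous_AE_zero:
  fixes f :: "real \<Rightarrow> real"
  assumes cont: "continuous_on {a<..<b} f" and ae: "AE t in leb_I. a < t \<and> t < b \<longrightarrow> f t = 0"
    and ab: "-1 \<le> a" "b \<le> 1" and t: "a < t" "t < b"
  shows "f t = 0"
proof (rule ccontr)
  assume "f t \<noteq> 0"
  let ?S = "{s \<in> {a<..<b}. f s \<in> - {0}}"
  have "open ({a<..<b} \<inter> f -` (- {0}))"
    by (rule continuous_open_preimage[OF cont]) auto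
  moreover have "{a<..<b} \<inter> f -` (- {0}) = ?S" by auto
  ultimately have open_S: "open ?S" by simp
  moreover have "?S \<noteq> {}" using t \<open>f t \<noteq> 0\<close> by auto
  ultimately have non: "\<not> negligible ?S" using open_not_negligible by blast
  have "AE s in lebesgue. s \<in> unit_ivl \<longrightarrow> a < s \<and> s < b \<longrightarrow> f s = 0"
    using ae by (subst (asm) AE_restrict_space_iff) simp_all
  then have "AE s in lebesgue. s \<notin> ?S"
    by eventually_elim (use ab in auto)
  moreover have "?S \<in> sets lebesgue"
    using open_S by (intro sets_completionI_sets) simp
  ultimately have "negligible ?S"
    using AE_iff_null_sets[of ?S lebesgue] by (simp only: negligible_iff_null_sets)
  then show False using non by blast
qed

lemma primitive_const_on:
  assumes e: "integrable leb_I e" and ae: "AE \<tau> in leb_I. a < \<tau> \<and> \<tau> < b \<longrightarrow> e \<tau> = 0"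
    and s: "a < s" "s < b" and t: "a < t" "t < b"
  shows "primitive e s = primitive e t"
  unfolding primitive_def
proof (rule integral_cong_AE)
  show "AE \<tau> in leb_I. indicator {..s} \<tau> * e \<tau> = indicator {..t} \<tau> * e \<tau>"
    using ae by eventually_elim (use s t in \<open>auto simp: indicator_def\<close>)
qed (use indicator_integrable_I[OF e] in auto)

lemma state_sol_diff:
  assumes S: "state_sol m p n A B C D u y x" "state_sol m p n A B C D u' y' x'"
    and u: "\<And>j. j < m \<Longrightarrow> u j \<in> L2" "\<And>j. j < m \<Longrightarrow> u' j \<in> L2"
  shows "state_sol m p n A B C D (\<lambda>i t. u i t - u' i t) (\<lambda>i t. y i t - y' i t) (\<lambda>i t. x i t - x' i t)"
  unfolding state_sol_def
proof (intro conjI allI impI ballI)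
  fix i t assume i: "i < n" and t: "t \<in> {-1..(1::real)}"
  let ?v = "\<lambda>x u s. (\<Sum>j<n. A i j * x j s) + (\<Sum>j<m. B i j * u j s :: real)"
  have v: "integrable leb_I (?v x u)" "integrable leb_I (?v x' u')"
    by (intro Bochner_Integration.integrable_add Bochner_Integration.integrable_sum integrable_mult_right
        continuous_integrable_I[OF state_continuous[OF S(1)]] continuous_integrable_I[OF state_continuous[OF S(2)]]
        L2_integrable u; simp)+
  have "(\<lambda>s. (\<Sum>j<n. A i j * (x j s - x' j s)) + (\<Sum>j<m. B i j * (u j s - u' j s))) =
      (\<lambda>s. ?v x u s + (-1) * ?v x' u' s)"
    by (auto simp: fun_eq_iff right_diff_distrib sum_subtractf)
  moreover have "primitive (\<lambda>s. ?v x u s + (-1) * ?v x' u' s) t = primitive (?v x u) t + (-1) * primitive (?v x' u') t"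
    by (subst primitive_add[OF v(1) integrable_mult_right[OF v(2)]]) (simp only: primitive_cmult)
  moreover have "x i t = x i (-1) + primitive (?v x u) t" "x' i t = x' i (-1) + primitive (?v x' u') t"
    using S i t unfolding state_sol_def by blast+
  ultimately show "x i t - x' i t = x i (-1) - x' i (-1) +
      primitive (\<lambda>s. (\<Sum>j<n. A i j * (x j s - x' j s)) + (\<Sum>j<m. B i j * (u j s - u' j s))) t"
    by simp
next
  fix i assume i: "i < p"
  have "AE t in leb_I. y i t = (\<Sum>j<n. C i j * x j t) + (\<Sum>j<m. D i j * u j t)"
    "AE t in leb_I. y' i t = (\<Sum>j<n. C i j * x' j t) + (\<Sum>j<m. D i j * u' j t)"
    using S i unfolding state_sol_def by blast+
  then show "AE t in leb_I. y i t - y' i t = (\<Sum>j<n. C i j * (x j t - x' j t)) + (\<Sum>j<m. D i j * (u j t - u' j t))"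
    by eventually_elim (simp add: right_diff_distrib sum_subtractf)
qed (use S in \<open>auto simp: state_sol_def intro!: continuous_intros\<close>)

text \<open>Where input and output vanish, C x = 0 by continuity, and repeated differentiation gives
  C A^k x = 0. The input outside the interval enters only through a constant of integration.\<close>

lemma unobservable_on_interval:
  assumes S: "state_sol m p n A B C D u y x" and u: "\<And>j. j < m \<Longrightarrow> u j \<in> L2"
    and ab: "-1 \<le> a" "b \<le> 1"
    and ae: "AE t in leb_I. a < t \<and> t < b \<longrightarrow> (\<forall>j<m. u j t = 0) \<and> (\<forall>i<p. y i t = 0)"
    and i: "i < p" and t: "a < t" "t < b"
  shows "(\<Sum>j<n. row_pow n A (C i) k j * x j t) = 0"
  using t
proof (induction k arbitrary: t)
  case 0
  have "continuous_on {a<..<b} (\<lambda>t. \<Sum>j<n. C i j * x j t)"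
    using ab by (intro continuous_intros continuous_on_subset[OF state_continuous[OF S]]) auto
  moreover have "AE t in leb_I. y i t = (\<Sum>j<n. C i j * x j t) + (\<Sum>j<m. D i j * u j t)"
    using S i by (simp add: state_sol_def)
  then have "AE t in leb_I. a < t \<and> t < b \<longrightarrow> (\<Sum>j<n. C i j * x j t) = 0"
    using ae by eventually_elim (use i in auto)
  ultimately show ?case using continuous_AE_zero[OF _ _ ab] 0 by simp
next
  case (Suc k)
  let ?f = "\<lambda>k t. \<Sum>j<n. row_pow n A (C i) k j * x j t"
  let ?e = "\<lambda>s. \<Sum>j<m. (\<Sum>l<n. row_pow n A (C i) k l * B l j) * u j s"
  have e: "integrable leb_I ?e"
    by (intro Bochner_Integration.integrable_sum integrable_mult_right L2_integrable u) auto
  have fc: "continuous_on {-1..1} (?f (Suc k))"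
    by (intro continuous_intros state_continuous[OF S]) auto
  have eae: "AE \<tau> in leb_I. a < \<tau> \<and> \<tau> < b \<longrightarrow> ?e \<tau> = 0"
    using ae by eventually_elim auto
  \<comment> \<open>The accumulated input integral is constant on (a, b), because the input vanishes
    there; it is frozen at its value at t.\<close>
  define c where "c = ?f k (-1) + primitive ?e t"
  have f: "?f k \<tau> = c + primitive (?f (Suc k)) \<tau>" if "a < \<tau>" "\<tau> < b" for \<tau>
  proof -
    have "\<tau> \<in> {-1..1}" using that ab by auto
    then have "?f k \<tau> = ?f k (-1) + primitive (\<lambda>s. ?f (Suc k) s + ?e s) \<tau>"
      using row_state[OF S u, of \<tau> "row_pow n A (C i) k"] by (simp add: row_pow_Suc_0 del: row_pow.simps)
    also have "primitive (\<lambda>s. ?f (Suc k) s + ?e s) \<tau> = primitive (?f (Suc k)) \<tau> + primitive ?e \<tau>"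
      by (rule primitive_add[OF continuous_integrable_I[OF fc] e])
    also have "primitive ?e \<tau> = primitive ?e t"
      using primitive_const_on[OF e eae that Suc.prems] .
    finally show ?thesis by (simp add: c_def)
  qed
  have tI: "t \<in> {-1<..<1}" using Suc.prems ab by auto
  have "(primitive (?f (Suc k)) has_real_derivative ?f (Suc k) t) (at t within {-1..1})"
    using primitive_deriv[OF fc, of t] tI by auto
  then have "(primitive (?f (Suc k)) has_real_derivative ?f (Suc k) t) (at t)"
    using tI by (simp add: at_within_Icc_at)
  then have "((\<lambda>\<tau>. c + primitive (?f (Suc k)) \<tau>) has_real_derivative ?f (Suc k) t) (at t)"
    by (auto intro!: derivative_eq_intros)
  then have "((\<lambda>\<tau>. 0) has_real_derivative ?f (Suc k) t) (at t)"
    by (rule has_field_derivative_transform_within_open[of _ _ _ "{a<..<b}"])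
      (use Suc f in auto)
  then show ?case using DERIV_unique[OF _ DERIV_const] by blast
qed

lemma row_pow_dependent:
  assumes d: "\<And>j. j < n \<Longrightarrow> row_pow n A \<zeta> d j = (\<Sum>k<d. \<beta> k * row_pow n A \<zeta> k j)" and j: "j < n"
  shows "row_pow n A \<zeta> (d + t) j = (\<Sum>k<d. \<beta> k * row_pow n A \<zeta> (k + t) j)"
  using j
proof (induction t arbitrary: j)
  case (Suc t)
  have "row_pow n A \<zeta> (d + Suc t) j = (\<Sum>l<n. (\<Sum>k<d. \<beta> k * row_pow n A \<zeta> (k + t) l) * A l j)"
    using Suc.IH by simp
  also have "\<dots> = (\<Sum>k<d. \<beta> k * (\<Sum>l<n. row_pow n A \<zeta> (k + t) l * A l j))"
    unfolding sum_distrib_left sum_distrib_right by (subst sum.swap) (simp only: mult.assoc)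
  finally show ?case by simp
qed (use d in simp)

context iso_system begin

text \<open>By the condition on B, no input acts on the functions \<zeta> A^s x. Controllability
  joins the free trajectory from \<open>x0\<close> to the zero trajectory. At late times the state z
  of the joined trajectory satisfies \<zeta> A^s z = 0, and by uniqueness for linear equations then
  at all times. Before time 0 both trajectories have the same input and output, so \<zeta> x =
  \<zeta> z = 0. Both comparisons rest on \<zeta> being a combination of rows C A^k, since input and
  output determine the state only up to its unobservable part.\<close>

lemma controllable_no_uncontrollable_row:
  assumes ctr: "\<And>u0 y0. weak_sol m p g R u0 y0 \<Longrightarrow> \<exists>t1 u y. 0 < t1 \<and> t1 < 1 \<and> weak_sol m p g R u y \<and>
      (AE t in leb_I. t \<le> 0 \<longrightarrow> (\<forall>i<m. u i t = u0 i t) \<and> (\<forall>i<p. y i t = y0 i t)) \<and>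
      (AE t in leb_I. t1 \<le> t \<longrightarrow> (\<forall>i<m. u i t = 0) \<and> (\<forall>i<p. y i t = 0))"
    and \<zeta>: "\<And>j. j < n \<Longrightarrow> \<zeta> j = (\<Sum>k<L. \<Sum>i<p. v k i * row_pow n A (C i) k j)"
    and B0: "\<And>s j. j < m \<Longrightarrow> (\<Sum>i<n. row_pow n A \<zeta> s i * B i j) = 0"
  shows "(\<Sum>j<n. \<zeta> j * x0 j) = 0"
proof -
  obtain x y0 where x0: "smooth_state_sol m p n A B C D (\<lambda>i t. 0) y0 x" "\<And>i. i < n \<Longrightarrow> x i (-1) = x0 i"
    "\<And>i. smooth_on {-1..1} (y0 i)" "weak_sol m p g R (\<lambda>i t. 0) y0" "\<And>i t. y0 i t = (\<Sum>j<n. C i j * x j t)"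
    by (rule free_response[of x0], rule that)
  have Sx: "state_sol m p n A B C D (\<lambda>i t. 0) y0 x"
    unfolding state_sol_def
  proof (intro conjI allI impI ballI)
    fix i assume i: "i < n"
    have xc: "continuous_on {-1..1} (x j)" if "j < n" for j
      using x0(1) that by (auto simp: smooth_state_sol_def intro: smooth_on_continuous)
    show "continuous_on {-1..1} (x i)" by (rule xc[OF i])
    fix t assume t: "t \<in> {-1..(1::real)}"
    have "primitive (\<lambda>s. (\<Sum>j<n. A i j * x j s) + (\<Sum>j<m. B i j * 0)) t = x i t - x i (-1)"
    proof (rule primitive_of_deriv[OF _ _ t])
      show "integrable leb_I (\<lambda>s. (\<Sum>j<n. A i j * x j s) + (\<Sum>j<m. B i j * 0))"
        by (intro continuous_integrable_I continuous_intros xc) auto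
    qed (use x0(1) i in \<open>auto simp: smooth_state_sol_def\<close>)
    then show "x i t = x i (-1) + primitive (\<lambda>s. (\<Sum>j<n. A i j * x j s) + (\<Sum>j<m. B i j * 0)) t" by simp
  qed (simp add: x0(5))
  obtain t1 u y where t1: "0 < t1" "t1 < 1" and W: "weak_sol m p g R u y"
    and early: "AE t in leb_I. t \<le> 0 \<longrightarrow> (\<forall>i<m. u i t = 0) \<and> (\<forall>i<p. y i t = y0 i t)"
    and late: "AE t in leb_I. t1 \<le> t \<longrightarrow> (\<forall>i<m. u i t = 0) \<and> (\<forall>i<p. y i t = 0)"
    using ctr[OF x0(4)] by blast
  have u: "u j \<in> L2" if "j < m" for j using W that by (simp add: weak_sol_def)
  obtain z where Sz: "state_sol m p n A B C D u y z" using weak_sol_state[OF W] by blast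
  have S\<zeta>: "(\<Sum>j<n. row_pow n A \<zeta> s j * f j) = (\<Sum>k<L. \<Sum>i<p. v k i * (\<Sum>j<n. row_pow n A (C i) (k + s) j * f j))"
    for s f
  proof -
    have "row_pow n A \<zeta> s j = (\<Sum>k<L. \<Sum>i<p. v k i * row_pow n A (C i) (k + s) j)" if "j < n" for j
      using that
    proof (induction s arbitrary: j)
      case (Suc s)
      have "row_pow n A \<zeta> (Suc s) j = (\<Sum>l<n. (\<Sum>k<L. \<Sum>i<p. v k i * row_pow n A (C i) (k + s) l) * A l j)"
        using Suc.IH by simp
      also have "\<dots> = (\<Sum>k<L. \<Sum>i<p. v k i * (\<Sum>l<n. row_pow n A (C i) (k + s) l * A l j))"
        unfolding sum_distrib_left sum_distrib_right mult.assoc by (rule sum_swap3)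
      finally show ?case by simp
    qed (simp add: \<zeta>)
    then have "(\<Sum>j<n. row_pow n A \<zeta> s j * f j) =
        (\<Sum>j<n. (\<Sum>k<L. \<Sum>i<p. v k i * row_pow n A (C i) (k + s) j) * f j)"
      by (intro sum.cong refl) simp
    also have "\<dots> = (\<Sum>k<L. \<Sum>i<p. v k i * (\<Sum>j<n. row_pow n A (C i) (k + s) j * f j))"
      unfolding sum_distrib_left sum_distrib_right mult.assoc by (rule sum_swap3)
    finally show ?thesis .
  qed
  \<comment> \<open>Finitely many of the rows \<zeta> A^s determine all later ones, so the functions
    \<zeta> A^s z with s < d form a closed homogeneous system.\<close>
  obtain d \<beta> where \<beta>: "\<forall>j<n. row_pow n A \<zeta> d j = (\<Sum>k<d. \<beta> k * row_pow n A \<zeta> k j)"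
    using first_dependent_vector[of n "row_pow n A \<zeta>"] by blast
  let ?q = "\<lambda>s t. \<Sum>j<n. row_pow n A \<zeta> s j * z j t"
  have qc: "continuous_on {-1..1} (?q s)" for s
    by (intro continuous_intros state_continuous[OF Sz]) auto
  have dq: "(?q s has_real_derivative ?q (Suc s) t) (at t within {-1..1})" if t: "t \<in> {-1..1}" for s t
  proof -
    have eq: "?q s \<tau> = ?q s (-1) + primitive (?q (Suc s)) \<tau>" if "\<tau> \<in> {-1..1}" for \<tau>
      using row_state[OF Sz u that, of "row_pow n A \<zeta> s"] B0
      by (simp add: row_pow_Suc_0 del: row_pow.simps)
    have der: "((\<lambda>\<tau>. ?q s (-1) + primitive (?q (Suc s)) \<tau>) has_real_derivative ?q (Suc s) t) (at t within {-1..1})"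
      using primitive_deriv[OF qc t, of "Suc s"] by (auto intro!: derivative_eq_intros)
    show ?thesis
      by (rule has_field_derivative_transform_within[OF der, where d = 1])
        (use t in \<open>auto simp only: eq zero_less_one\<close>)
  qed
  have qd: "?q d t = (\<Sum>k<d. \<beta> k * ?q k t)" for t
  proof -
    have "?q d t = (\<Sum>j<n. (\<Sum>k<d. \<beta> k * row_pow n A \<zeta> k j) * z j t)"
      using \<beta> by (intro sum.cong refl) simp
    also have "\<dots> = (\<Sum>k<d. \<beta> k * ?q k t)"
      unfolding sum_distrib_left sum_distrib_right mult.assoc by (rule sum.swap)
    finally show ?thesis .
  qed
  define \<tau> where "\<tau> = (t1 + 1) / 2"
  have \<tau>: "t1 < \<tau>" "\<tau> < 1" "\<tau> \<in> {-1..1}" using t1 by (auto simp: \<tau>_def)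
  have late': "AE t in leb_I. t1 < t \<and> t < 1 \<longrightarrow> (\<forall>j<m. u j t = 0) \<and> (\<forall>i<p. y i t = 0)"
    using late by eventually_elim auto
  \<comment> \<open>On (t1, 1) input and output vanish, and the rows \<zeta> A^s are combinations of
    observability rows.\<close>
  have q\<tau>: "?q s \<tau> = 0" for s
    unfolding S\<zeta> using t1 \<tau> by (simp add: unobservable_on_interval[OF Sz u _ _ late'])
  define M where "M i j = (if Suc i = d then \<beta> j else if j = Suc i then 1 else 0)" for i j
  have q0: "?q s t = 0" if s: "s < d" and t: "t \<in> {-1..1}" for s t
  proof (rule linear_ode_zero[of "{..<d}" "-1" 1 ?q M \<tau>])
    fix i t assume i: "i \<in> {..<d}" and t: "t \<in> {-1..(1::real)}"
    have "(\<Sum>j<d. M i j * ?q j t) = ?q (Suc i) t"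
    proof (cases "Suc i = d")
      case True
      then have "M i j = \<beta> j" for j by (simp add: M_def)
      then show ?thesis unfolding True qd[of t] by simp
    next
      case False
      have "(\<Sum>j<d. M i j * ?q j t) = (\<Sum>j<d. if j = Suc i then ?q j t else 0)"
        using False by (intro sum.cong) (auto simp: M_def)
      then show ?thesis using i False by (simp del: row_pow.simps)
    qed
    then show "(?q i has_real_derivative (\<Sum>j\<in>{..<d}. M i j * ?q j t)) (at t within {-1..1})"
      using dq[OF t, of i] by simp
  qed (use s t \<tau> q\<tau> in auto)
  have q00: "?q 0 t = 0" if "t \<in> {-1..1}" for t
    using q0[of 0 t] qd[of t] that by (cases "d = 0") auto
  have early': "AE t in leb_I. -1 < t \<and> t < 0 \<longrightarrow> (\<forall>j<m. u j t - 0 = 0) \<and> (\<forall>i<p. y i t - y0 i t = 0)"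
    using early by eventually_elim auto
  have Sd: "state_sol m p n A B C D (\<lambda>i t. u i t - 0) (\<lambda>i t. y i t - y0 i t) (\<lambda>i t. z i t - x i t)"
    by (rule state_sol_diff[OF Sz Sx u]) auto
  have "(\<Sum>j<n. \<zeta> j * (z j t - x j t)) = 0" if "-1 < t" "t < 0" for t
    using S\<zeta>[of 0 "\<lambda>j. z j t - x j t"] unobservable_on_interval[OF Sd _ _ _ early' _ that] u by simp
  then have e: "(\<Sum>j<n. \<zeta> j * x j t) = 0" if "-1 < t" "t < 0" for t
    using q00[of t] that by (simp add: right_diff_distrib sum_subtractf)
  \<comment> \<open>The identity is known on the open interval (-1, 0) only; the initial state is
    reached as a limit from the right.\<close>
  have "continuous_on {-1..1} (\<lambda>t. \<Sum>j<n. \<zeta> j * x j t)"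
    by (intro continuous_intros state_continuous[OF Sx]) auto
  then have "((\<lambda>t. \<Sum>j<n. \<zeta> j * x j t) \<longlongrightarrow> (\<Sum>j<n. \<zeta> j * x j (-1))) (at_right (-1))"
    by (rule continuous_on_Icc_at_rightD) simp
  moreover have "((\<lambda>t. \<Sum>j<n. \<zeta> j * x j t) \<longlongrightarrow> 0) (at_right (-1))"
    by (rule Lim_transform_eventually[OF tendsto_const])
      (use e in \<open>auto simp: eventually_at_right_field intro!: exI[of _ 0]\<close>)
  ultimately have "(\<Sum>j<n. \<zeta> j * x j (-1)) = 0"
    by (rule tendsto_unique[OF trivial_limit_at_right_real])
  then show ?thesis using x0(2) by simp
qed

end

section \<open>Persistency of excitation\<close>

text \<open>Coefficient of the l-th derivative of input j in \<open>resp\<close>, padded with zeros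
  for l > k so that all orders below L share one range of summation.\<close>

definition resp_input :: "nat \<Rightarrow> (nat \<Rightarrow> nat \<Rightarrow> real) \<Rightarrow> (nat \<Rightarrow> nat \<Rightarrow> real) \<Rightarrow> (nat \<Rightarrow> nat \<Rightarrow> real) \<Rightarrow>
    (nat \<Rightarrow> nat \<Rightarrow> real) \<Rightarrow> nat \<Rightarrow> nat \<Rightarrow> nat \<Rightarrow> nat \<Rightarrow> real" where
  "resp_input n A B C D k i l j =
     (if l < k then markov n A B (C i) k l j else if l = k then D i j else 0)"

lemma resp_expand:
  assumes "k < L"
  shows "resp m n A B C D k i U x =
    (\<Sum>j<n. row_pow n A (C i) k j * x j) + (\<Sum>l<L. \<Sum>j<m. resp_input n A B C D k i l j * U l j)"
proof -
  have "(\<Sum>l<L. \<Sum>j<m. resp_input n A B C D k i l j * U l j) =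
      (\<Sum>l<Suc k. \<Sum>j<m. resp_input n A B C D k i l j * U l j)"
    using assms by (intro sum.mono_neutral_right) (auto simp: resp_input_def)
  also have "\<dots> = (\<Sum>l<k. \<Sum>j<m. resp_input n A B C D k i l j * U l j) + (\<Sum>j<m. resp_input n A B C D k i k j * U k j)"
    by (rule sum.lessThan_Suc)
  also have "(\<Sum>l<k. \<Sum>j<m. resp_input n A B C D k i l j * U l j) = (\<Sum>l<k. \<Sum>j<m. markov n A B (C i) k l j * U l j)"
    by (intro sum.cong refl) (simp add: resp_input_def)
  also have "(\<Sum>j<m. resp_input n A B C D k i k j * U k j) = (\<Sum>j<m. D i j * U k j)"
    by (intro sum.cong refl) (simp add: resp_input_def)
  finally show ?thesis by (simp add: resp_def)
qed

lemma resp_combination: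
  "(\<Sum>k<L. \<Sum>i<p. v k i * resp m n A B C D k i U x) =
    (\<Sum>j<n. (\<Sum>k<L. \<Sum>i<p. v k i * row_pow n A (C i) k j) * x j) +
    (\<Sum>l<L. \<Sum>j<m. (\<Sum>k<L. \<Sum>i<p. v k i * resp_input n A B C D k i l j) * U l j)"
proof -
  have "(\<Sum>k<L. \<Sum>i<p. v k i * resp m n A B C D k i U x) =
     (\<Sum>k<L. \<Sum>i<p. (\<Sum>j<n. v k i * row_pow n A (C i) k j * x j) +
        (\<Sum>l<L. \<Sum>j<m. v k i * resp_input n A B C D k i l j * U l j))"
  proof (intro sum.cong refl)
    fix k i assume "k \<in> {..<L}"
    then show "v k i * resp m n A B C D k i U x = (\<Sum>j<n. v k i * row_pow n A (C i) k j * x j) +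
        (\<Sum>l<L. \<Sum>j<m. v k i * resp_input n A B C D k i l j * U l j)"
      using resp_expand[of k L m n A B C D i U x] by (simp only: lessThan_iff distrib_left sum_distrib_left mult.assoc)
  qed
  also have "\<dots> = (\<Sum>k<L. \<Sum>i<p. \<Sum>j<n. v k i * row_pow n A (C i) k j * x j) +
        (\<Sum>k<L. \<Sum>i<p. \<Sum>l<L. \<Sum>j<m. v k i * resp_input n A B C D k i l j * U l j)"
    by (simp only: sum.distrib)
  also have "(\<Sum>k<L. \<Sum>i<p. \<Sum>j<n. v k i * row_pow n A (C i) k j * x j) =
      (\<Sum>j<n. (\<Sum>k<L. \<Sum>i<p. v k i * row_pow n A (C i) k j) * x j)"
    unfolding sum_distrib_right by (rule sum_swap3[symmetric])
  also have "(\<Sum>k<L. \<Sum>i<p. \<Sum>l<L. \<Sum>j<m. v k i * resp_input n A B C D k i l j * U l j) =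
      (\<Sum>l<L. \<Sum>k<L. \<Sum>i<p. \<Sum>j<m. v k i * resp_input n A B C D k i l j * U l j)"
    by (rule sum_swap3[symmetric])
  also have "\<dots> = (\<Sum>l<L. \<Sum>j<m. (\<Sum>k<L. \<Sum>i<p. v k i * resp_input n A B C D k i l j) * U l j)"
    unfolding sum_distrib_right by (intro sum.cong refl sum_swap3[symmetric])
  finally show ?thesis .
qed

text \<open>Every row from the first dependent one on is a combination of strictly earlier rows, so
  strong induction reduces the claim to the first d rows.\<close>

lemma row_input_vanishes:
  assumes d: "\<And>j. j < n \<Longrightarrow> row_pow n A \<zeta> d j = (\<Sum>k<d. \<beta> k * row_pow n A \<zeta> k j)"
    and 0: "\<And>s. s < d \<Longrightarrow> (\<Sum>i<n. row_pow n A \<zeta> s i * b i) = 0"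
  shows "(\<Sum>i<n. row_pow n A \<zeta> s i * b i) = 0"
proof (induction s rule: less_induct)
  case (less s)
  show ?case
  proof (cases "s < d")
    case False
    then obtain t where t: "s = d + t" using le_Suc_ex by (metis not_less)
    have "(\<Sum>i<n. row_pow n A \<zeta> s i * b i) = (\<Sum>i<n. (\<Sum>k<d. \<beta> k * row_pow n A \<zeta> (k + t) i) * b i)"
      unfolding t by (intro sum.cong refl) (simp add: row_pow_dependent[OF d])
    also have "\<dots> = (\<Sum>k<d. \<beta> k * (\<Sum>i<n. row_pow n A \<zeta> (k + t) i * b i))"
      unfolding sum_distrib_left sum_distrib_right mult.assoc by (rule sum.swap)
    also have "\<dots> = 0" using less t by (intro sum.neutral) auto
    finally show ?thesis .
  qed (rule 0)
qed

text \<open>Differentiating a linear relation between input derivatives and state at most \<open>n\<close> times and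
  combining with an annihilating relation of the rows \<open>\<zeta> A\<^sup>k\<close> eliminates the state, so that the
  persistently exciting input forces all coefficients to vanish.\<close>

lemma exciting_relation:
  assumes S: "state_sol m p n A B C D u y x" and u: "\<And>j. j < m \<Longrightarrow> u j \<in> L2"
    and U: "\<And>k j. k < L + n \<Longrightarrow> j < m \<Longrightarrow> has_weak_deriv k (u j) (U k j)"
    and PE: "\<And>c k i. (AE t in leb_I. (\<Sum>k<L + n. \<Sum>i<m. c k i * U k i t) = 0) \<Longrightarrow> k < L + n \<Longrightarrow> i < m \<Longrightarrow> c k i = 0"
    and L: "L \<ge> 1"
    and rel: "AE t in leb_I. (\<Sum>k<L. \<Sum>i<m. \<eta> k i * U k i t) + (\<Sum>j<n. \<zeta> j * x j t) = 0"
  shows "(\<forall>k<L. \<forall>i<m. \<eta> k i = 0) \<and> (\<forall>s. \<forall>j<m. (\<Sum>i<n. row_pow n A \<zeta> s i * B i j) = 0)"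
proof -
  \<comment> \<open>The bound d \<le> n keeps all input derivatives that arise below the order L + n
    of excitation.\<close>
  obtain d \<beta> where dn: "d \<le> n" and \<beta>: "\<And>j. j < n \<Longrightarrow> row_pow n A \<zeta> d j = (\<Sum>k<d. \<beta> k * row_pow n A \<zeta> k j)"
    using first_dependent_vector[of n "row_pow n A \<zeta>"] by blast
  \<comment> \<open>Coefficients of the monic relation among the rows \<zeta> A^j with j \<le> d,
    which removes the state from the combination of the differentiated relations.\<close>
  define a where "a j = (if j = d then 1 else - \<beta> j)" for j
  have UL: "U k j \<in> L2" if "k < L + n" "j < m" for k j using U[OF that] by (rule has_weak_deriv_L2)
  define F where "F j t = (\<Sum>k<L. \<Sum>i<m. \<eta> k i * U (k + j) i t) +
    ((\<Sum>i<n. row_pow n A \<zeta> j i * x i t) + (\<Sum>l<j. \<Sum>i<m. markov n A B \<zeta> j l i * U l i t))" for j t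
  have F0: "AE t in leb_I. F j t = 0" if j: "j \<le> d" for j
  proof -
    let ?f = "\<lambda>t. \<Sum>k<L. \<Sum>i<m. \<eta> k i * U k i t"
    have f: "has_weak_deriv j ?f (\<lambda>t. \<Sum>k<L. \<Sum>i<m. \<eta> k i * U (k + j) i t)"
    proof -
      have "has_weak_deriv j (\<lambda>t. \<Sum>q\<in>{..<L} \<times> {..<m}. \<eta> (fst q) (snd q) * U (fst q) (snd q) t)
          (\<lambda>t. \<Sum>q\<in>{..<L} \<times> {..<m}. \<eta> (fst q) (snd q) * U (fst q + j) (snd q) t)"
      proof (rule has_weak_deriv_lincomb)
        fix q assume q: "q \<in> {..<L} \<times> {..<m}"
        then have k: "fst q < L" "snd q < m" by auto
        then show "U (fst q) (snd q) \<in> L2" by (intro UL) auto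
        show "has_weak_deriv j (U (fst q) (snd q)) (U (fst q + j) (snd q))"
          by (rule has_weak_deriv_shift[of "fst q" "u (snd q)"]) (use k j dn in \<open>auto intro!: U\<close>)
      qed
      then show ?thesis by (simp only: sum.cartesian_product split_beta')
    qed
    have fL: "?f \<in> L2" by (intro L2_sum L2_cmult UL) auto
    have "has_weak_deriv j (\<lambda>t. \<Sum>i<n. \<zeta> i * x i t)
      (\<lambda>t. (\<Sum>i<n. row_pow n A \<zeta> j i * x i t) + (\<Sum>l<j. \<Sum>i<m. markov n A B \<zeta> j l i * U l i t))"
      by (rule state_weak_deriv[OF S u, where K = "L + n - 1"]) (use U L j dn in auto)
    from has_weak_deriv_add[OF fL state_row_L2[OF S] f this]
    have 1: "has_weak_deriv j (\<lambda>t. ?f t + (\<Sum>i<n. \<zeta> i * x i t)) (F j)"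
      by (simp only: F_def[abs_def])
    have z: "has_weak_deriv j (\<lambda>t. 0) (\<lambda>t. 0)"
      by (simp add: has_weak_deriv_def)
    have "has_weak_deriv j (\<lambda>t. ?f t + (\<Sum>i<n. \<zeta> i * x i t)) (\<lambda>t. 0)"
    proof (rule has_weak_deriv_cong_AE[OF z])
      show "AE t in leb_I. 0 = ?f t + (\<Sum>i<n. \<zeta> i * x i t)"
        using rel by eventually_elim simp
    qed (auto intro: fL state_row_L2[OF S])
    then show ?thesis by (rule has_weak_deriv_unique[OF 1])
  qed
  \<comment> \<open>Coefficient of the r-th input derivative after j differentiations:
    \<open>c1\<close> is the original input part shifted by j, and \<open>c2\<close> collects the
    terms released by the state.\<close>
  define c1 where "c1 j r i = (if j \<le> r \<and> r < L + j then \<eta> (r - j) i else 0)" for j r i :: nat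
  define c2 where "c2 j r i = (if r < j then markov n A B \<zeta> j r i else 0)" for j r i :: nat
  define c where "c r i = (\<Sum>j\<le>d. a j * (c1 j r i + c2 j r i))" for r i
  have F_alt: "F j t = (\<Sum>r<L + n. \<Sum>i<m. (c1 j r i + c2 j r i) * U r i t) + (\<Sum>i<n. row_pow n A \<zeta> j i * x i t)"
    if j: "j \<le> d" for j t
  proof -
    have "(\<Sum>r<L + n. \<Sum>i<m. c1 j r i * U r i t) = (\<Sum>r\<in>{j..<L + j}. \<Sum>i<m. c1 j r i * U r i t)"
      using j dn by (intro sum.mono_neutral_right) (auto simp: c1_def)
    also have "\<dots> = (\<Sum>k<L. \<Sum>i<m. c1 j (k + j) i * U (k + j) i t)"
      using sum.shift_bounds_nat_ivl[of "\<lambda>r. \<Sum>i<m. c1 j r i * U r i t" 0 j L] by (simp add: lessThan_atLeast0)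
    also have "\<dots> = (\<Sum>k<L. \<Sum>i<m. \<eta> k i * U (k + j) i t)"
      by (intro sum.cong refl) (simp add: c1_def)
    finally have 1: "(\<Sum>r<L + n. \<Sum>i<m. c1 j r i * U r i t) = (\<Sum>k<L. \<Sum>i<m. \<eta> k i * U (k + j) i t)" .
    have "(\<Sum>r<L + n. \<Sum>i<m. c2 j r i * U r i t) = (\<Sum>r<j. \<Sum>i<m. c2 j r i * U r i t)"
      using j dn by (intro sum.mono_neutral_right) (auto simp: c2_def)
    also have "\<dots> = (\<Sum>r<j. \<Sum>i<m. markov n A B \<zeta> j r i * U r i t)"
      by (intro sum.cong refl) (simp add: c2_def)
    finally have 2: "(\<Sum>r<L + n. \<Sum>i<m. c2 j r i * U r i t) = (\<Sum>r<j. \<Sum>i<m. markov n A B \<zeta> j r i * U r i t)" .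
    show ?thesis
      unfolding F_def distrib_right sum.distrib 1 2 by simp
  qed
  have ax: "(\<Sum>j\<le>d. a j * (\<Sum>i<n. row_pow n A \<zeta> j i * f i)) = 0" for f
  proof -
    have "(\<Sum>j\<le>d. a j * (\<Sum>i<n. row_pow n A \<zeta> j i * f i)) = (\<Sum>i<n. (\<Sum>j\<le>d. a j * row_pow n A \<zeta> j i) * f i)"
      unfolding sum_distrib_left sum_distrib_right mult.assoc by (rule sum.swap)
    also have "\<dots> = 0"
    proof (intro sum.neutral ballI)
      fix i assume "i \<in> {..<n}"
      have "(\<Sum>j<d. a j * row_pow n A \<zeta> j i) = (\<Sum>j<d. - (\<beta> j * row_pow n A \<zeta> j i))"
        by (intro sum.cong refl) (simp add: a_def)
      then have "(\<Sum>j\<le>d. a j * row_pow n A \<zeta> j i) = 0"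
        using \<beta>[of i] \<open>i \<in> {..<n}\<close> by (simp add: a_def sum_negf flip: lessThan_Suc_atMost)
      then show "(\<Sum>j\<le>d. a j * row_pow n A \<zeta> j i) * f i = 0" by simp
    qed
    finally show ?thesis .
  qed
  have "AE t in leb_I. \<forall>j\<in>{..d}. F j t = 0"
    by (rule AE_finite_allI) (use F0 in auto)
  then have "AE t in leb_I. (\<Sum>r<L + n. \<Sum>i<m. c r i * U r i t) = 0"
  proof eventually_elim
    case (elim t)
    have "0 = (\<Sum>j\<le>d. a j * F j t)" using elim by simp
    also have "\<dots> = (\<Sum>j\<le>d. a j * (\<Sum>r<L + n. \<Sum>i<m. (c1 j r i + c2 j r i) * U r i t))"
      using ax[of "\<lambda>i. x i t"] by (simp add: F_alt distrib_left sum.distrib)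
    also have "\<dots> = (\<Sum>r<L + n. \<Sum>i<m. c r i * U r i t)"
      unfolding c_def sum_distrib_left sum_distrib_right mult.assoc by (rule sum_swap3)
    finally show ?case by simp
  qed
  then have c0: "c r i = 0" if "r < L + n" "i < m" for r i
    using PE that by blast
  \<comment> \<open>Downward induction on k, reading off the coefficient of order k + d: no released
    term reaches order d, and the summands with j < d involve \<eta> at indices above k, where it is
    already known to vanish.\<close>
  have \<eta>0: "\<eta> k i = 0" if "k < L" "i < m" for k i
    using that
  proof (induction "L - k" arbitrary: k rule: less_induct)
    case less
    have IH: "\<eta> k' i = 0" if "k < k'" "k' < L" for k'
      by (rule less.hyps) (use that less.prems in auto)
    have "0 = c (k + d) i" using c0[of "k + d" i] less.prems dn by simp
    also have "\<dots> = (\<Sum>j\<le>d. if j = d then \<eta> k i else 0)"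
      unfolding c_def
    proof (intro sum.cong refl)
      fix j assume j: "j \<in> {..d}"
      have "c2 j (k + d) i = 0" using j by (simp add: c2_def)
      moreover have "c1 j (k + d) i = 0" if "j \<noteq> d"
        using that j IH[of "k + d - j"] by (auto simp: c1_def)
      moreover have "c1 d (k + d) i = \<eta> k i" using less.prems by (simp add: c1_def)
      ultimately show "a j * (c1 j (k + d) i + c2 j (k + d) i) = (if j = d then \<eta> k i else 0)"
        by (auto simp: a_def)
    qed
    finally show ?case by simp
  qed
  \<comment> \<open>With \<eta> gone, the coefficient of order d - 1 - s is \<zeta> A^s B plus terms
    with smaller powers of A, which vanish by induction.\<close>
  have mk: "(\<Sum>l<n. row_pow n A \<zeta> s l * B l i) = 0" if "s < d" "i < m" for s i
    using that
  proof (induction s rule: less_induct)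
    case (less s)
    define r where "r = d - 1 - s"
    have r: "r < d" "d - 1 - r = s" using less.prems by (auto simp: r_def)
    have "0 = c r i" using c0[of r i] r dn less.prems L by simp
    also have "\<dots> = (\<Sum>j\<le>d. if j = d then markov n A B \<zeta> d r i else 0)"
      unfolding c_def
    proof (intro sum.cong refl)
      fix j assume j: "j \<in> {..d}"
      have "c1 j r i = 0" using \<eta>0[of "r - j" i] less.prems by (auto simp: c1_def)
      moreover have "c2 j r i = 0" if "j \<noteq> d"
      proof (cases "r < j")
        case True
        then have "j - 1 - r < s" using that j r by auto
        then show ?thesis using less.IH[of "j - 1 - r"] less.prems True by (simp add: c2_def markov_def)
      qed (simp add: c2_def)
      moreover have "c2 d r i = markov n A B \<zeta> d r i" using r by (simp add: c2_def)
      ultimately show "a j * (c1 j r i + c2 j r i) = (if j = d then markov n A B \<zeta> d r i else 0)"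
        by (auto simp: a_def)
    qed
    also have "\<dots> = (\<Sum>l<n. row_pow n A \<zeta> s l * B l i)"
      using r by (simp add: markov_def)
    finally show ?case by simp
  qed
  have "(\<Sum>l<n. row_pow n A \<zeta> s l * B l i) = 0" if "i < m" for s i
    using row_input_vanishes[of n A \<zeta> d \<beta> "\<lambda>l. B l i", OF \<beta>] mk that by blast
  then show ?thesis using \<eta>0 by blast
qed

text \<open>Inserting the response writes a linear form on jets as \<eta> on input derivatives plus
  \<zeta> on the state. Excitation gives \<eta> = 0 and \<zeta> A^s B = 0 for all s; as \<zeta> is a
  combination of observability rows, controllability makes it vanish on every state. So the form is
  zero on arbitrary compatible jets, not only on those of the data.\<close>

lemma (in iso_system) exciting_annihilator:
  assumes S: "state_sol m p n A B C D u y x" and u: "\<And>j. j < m \<Longrightarrow> u j \<in> L2"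
    and U: "\<And>k j. k < L + n \<Longrightarrow> j < m \<Longrightarrow> has_weak_deriv k (u j) (U k j)"
    and PE: "\<And>c k i. (AE t in leb_I. (\<Sum>k<L + n. \<Sum>i<m. c k i * U k i t) = 0) \<Longrightarrow> k < L + n \<Longrightarrow> i < m \<Longrightarrow> c k i = 0"
    and L: "L \<ge> 1"
    and ctr: "\<And>u0 y0. weak_sol m p g R u0 y0 \<Longrightarrow> \<exists>t1 u y. 0 < t1 \<and> t1 < 1 \<and> weak_sol m p g R u y \<and>
      (AE t in leb_I. t \<le> 0 \<longrightarrow> (\<forall>i<m. u i t = u0 i t) \<and> (\<forall>i<p. y i t = y0 i t)) \<and>
      (AE t in leb_I. t1 \<le> t \<longrightarrow> (\<forall>i<m. u i t = 0) \<and> (\<forall>i<p. y i t = 0))"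
    and rel: "AE t in leb_I. (\<Sum>k<L. \<Sum>i<m. vu k i * U k i t) +
      (\<Sum>k<L. \<Sum>i<p. vy k i * resp m n A B C D k i (\<lambda>l j. U l j t) (\<lambda>j. x j t)) = 0"
  shows "(\<Sum>k<L. \<Sum>i<m. vu k i * V k i) + (\<Sum>k<L. \<Sum>i<p. vy k i * resp m n A B C D k i V z) = 0"
proof -
  define \<zeta> where "\<zeta> j = (\<Sum>k<L. \<Sum>i<p. vy k i * row_pow n A (C i) k j)" for j
  define \<eta> where "\<eta> l j = vu l j + (\<Sum>k<L. \<Sum>i<p. vy k i * resp_input n A B C D k i l j)" for l j
  have eq: "(\<Sum>k<L. \<Sum>i<m. vu k i * V k i) + (\<Sum>k<L. \<Sum>i<p. vy k i * resp m n A B C D k i V z) =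
      (\<Sum>k<L. \<Sum>i<m. \<eta> k i * V k i) + (\<Sum>j<n. \<zeta> j * z j)" for V z
    unfolding resp_combination \<zeta>_def \<eta>_def by (simp only: distrib_right sum.distrib add.assoc add.commute)
  have rel': "AE t in leb_I. (\<Sum>k<L. \<Sum>i<m. \<eta> k i * U k i t) + (\<Sum>j<n. \<zeta> j * x j t) = 0"
    using rel unfolding eq .
  have *: "(\<forall>k<L. \<forall>i<m. \<eta> k i = 0) \<and> (\<forall>s. \<forall>j<m. (\<Sum>i<n. row_pow n A \<zeta> s i * B i j) = 0)"
  proof (rule exciting_relation[OF S u U _ L rel'])
    show "c k i = 0" if "AE t in leb_I. (\<Sum>k<L + n. \<Sum>i<m. c k i * U k i t) = 0" "k < L + n" "i < m" for c k i
      by (rule PE[OF that])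
  qed
  have "(\<Sum>j<n. \<zeta> j * z j) = 0"
    by (rule controllable_no_uncontrollable_row[OF ctr, where \<zeta> = \<zeta> and L = L and v = vy]) (use * in \<open>auto simp: \<zeta>_def\<close>)
  then show ?thesis unfolding eq using * by simp
qed

section \<open>Legendre polynomials\<close>

lemma pderiv_pow_add: "(pderiv ^^ n) (p + q) = (pderiv ^^ n) p + (pderiv ^^ n) (q :: real poly)"
  by (induction n arbitrary: p q) (auto simp: pderiv_add)

lemma pderiv_pow_smult: "(pderiv ^^ n) (Polynomial.smult a p) = Polynomial.smult a ((pderiv ^^ n) (p :: real poly))"
  by (induction n arbitrary: p) (auto simp: pderiv_smult)

lemma pderiv_pow_Suc: "(pderiv ^^ Suc n) p = (pderiv ^^ n) (pderiv (p :: real poly))"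
  by (simp only: funpow_Suc_right comp_apply)

lemma degree_pderiv_pow: "degree ((pderiv ^^ k) (p :: real poly)) = degree p - k"
  by (induction k) (auto simp: degree_pderiv)

lemma legendre_base_degree: "degree ([:-1, 0, 1:] ^ n :: real poly) = 2 * n"
  by (simp add: degree_power_eq)

lemma degree_legendre [simp]: "degree (legendre n) = n"
  by (simp add: legendre_def degree_pderiv_pow legendre_base_degree)

lemma legendre_nonzero: "legendre n \<noteq> 0"
proof (cases n)
  case 0
  then show ?thesis by (simp add: legendre_def)
next
  case (Suc k)
  show ?thesis
  proof
    assume "legendre n = 0"
    then have "degree (legendre n) = 0" by (simp only: degree_0)
    then show False using Suc by simp
  qed
qed

lemma pderiv_base_power: "pderiv ([:-1, 0, 1:] ^ Suc n :: real poly) =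
    Polynomial.smult (2 * real (Suc n)) ([:0, 1:] * [:-1, 0, 1:] ^ n)"
proof -
  have 1: "Polynomial.smult a B * Polynomial.smult 2 X = Polynomial.smult (2 * a) (X * B)" for a :: real and B X
    by (simp add: mult.commute)
  have "pderiv [:-1, 0, 1:] = Polynomial.smult 2 [:0, 1 :: real:]" by (simp add: pderiv_pCons)
  then show ?thesis unfolding pderiv_power_Suc by (simp only: 1)
qed

text \<open>Rodrigues' formula with b = x^2 - 1: the derivative of b^(n+1) is 2 (n+1) x b^n, and
  that of x b^n is (2n+1) b^n + 2n b^(n-1) because x^2 = b + 1. The two terms yield the Legendre
  polynomial of degree n and the derivative of the one of degree n - 1.\<close>

lemma pderiv_legendre_Suc:
  "pderiv (legendre (Suc n)) = Polynomial.smult (real (2 * n + 1)) (legendre n) +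
     (if n = 0 then 0 else pderiv (legendre (n - 1)))"
proof -
  let ?b = "[:-1, 0, 1:] :: real poly"
  have c: "2 * real (Suc n) / (2 ^ Suc n * fact (Suc n)) = 1 / (2 ^ n * fact n)"
    by (simp add: field_simps del: of_nat_Suc)
  have L: "legendre (Suc n) = Polynomial.smult (1 / (2 ^ n * fact n)) ((pderiv ^^ n) ([:0, 1:] * ?b ^ n))"
    unfolding legendre_def pderiv_pow_Suc pderiv_base_power pderiv_pow_smult smult_smult
    using c by (simp add: mult.commute)
  have pd: "pderiv (legendre (Suc n)) =
      Polynomial.smult (1 / (2 ^ n * fact n)) ((pderiv ^^ n) (pderiv ([:0, 1:] * ?b ^ n)))"
    unfolding L pderiv_smult by (simp only: pderiv_pow_Suc[symmetric] funpow.simps comp_apply)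
  show ?thesis
  proof (cases n)
    case 0
    then show ?thesis by (simp add: pd legendre_def pderiv_pCons)
  next
    case (Suc k)
    have x2: "[:0, 1:] * [:0, 1:] = ?b + (1 :: real poly)"
      by (simp add: one_pCons)
    have "pderiv ([:0, 1:] * ?b ^ n) = ?b ^ n + [:0, 1:] * pderiv (?b ^ n)"
      by (simp add: pderiv_mult pderiv_pCons)
    also have "pderiv (?b ^ n) = Polynomial.smult (2 * real n) ([:0, 1:] * ?b ^ k)"
      unfolding Suc by (rule pderiv_base_power)
    also have "[:0, 1:] * Polynomial.smult (2 * real n) ([:0, 1:] * ?b ^ k) =
        Polynomial.smult (2 * real n) (([:0, 1:] * [:0, 1:]) * ?b ^ k)"
      by (simp only: mult_smult_right mult.assoc)
    also have "([:0, 1:] * [:0, 1:]) * ?b ^ k = ?b ^ n + ?b ^ k"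
      unfolding x2 Suc by (simp add: distrib_right)
    finally have "pderiv ([:0, 1:] * ?b ^ n) =
        Polynomial.smult (2 * real n + 1) (?b ^ n) + Polynomial.smult (2 * real n) (?b ^ k)"
      by (simp add: smult_add_right smult_add_left)
    then have "pderiv (legendre (Suc n)) =
        Polynomial.smult (2 * real n + 1) (legendre n) +
        Polynomial.smult (2 * real n / (2 ^ n * fact n)) ((pderiv ^^ n) (?b ^ k))"
      unfolding pd by (simp add: pderiv_pow_add pderiv_pow_smult smult_add_right legendre_def)
    moreover have "Polynomial.smult (2 * real n / (2 ^ n * fact n)) ((pderiv ^^ n) (?b ^ k)) = pderiv (legendre k)"
    proof -
      have "2 * real n / (2 ^ n * fact n) = 1 / (2 ^ k * fact k)"
        unfolding Suc by (simp add: field_simps del: of_nat_Suc)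
      moreover have "(pderiv ^^ n) (?b ^ k) = pderiv ((pderiv ^^ k) (?b ^ k))" by (simp add: Suc)
      ultimately show ?thesis by (simp only: legendre_def pderiv_smult)
    qed
    ultimately show ?thesis by (simp add: Suc)
  qed
qed

text \<open>The recursion is unrolled in steps of two, which produces the parity condition and the
  factors 2i + 1 of the coefficient operator \<open>legendre_D\<close>.\<close>

lemma pderiv_legendre:
  "pderiv (legendre j) = (\<Sum>i | i < j \<and> odd (i + j). Polynomial.smult (real (2 * i + 1)) (legendre i))"
proof (induction j rule: less_induct)
  case (less j)
  show ?case
  proof (cases j)
    case 0
    then show ?thesis by (simp add: legendre_def)
  next
    case (Suc n)
    show ?thesis
    proof (cases n)
      case 0
      then have "{i. i < j \<and> odd (i + j)} = {0}" using Suc by auto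
      then show ?thesis using pderiv_legendre_Suc[of 0] Suc 0 by simp
    next
      case (Suc k)
      have j: "j = Suc (Suc k)" using \<open>j = Suc n\<close> Suc by simp
      have "{i. i < j \<and> odd (i + j)} = insert n {i. i < k \<and> odd (i + k)}"
        unfolding j Suc by (auto simp: less_Suc_eq)
      moreover have "n \<notin> {i. i < k \<and> odd (i + k)}" using Suc by simp
      ultimately show ?thesis
        using pderiv_legendre_Suc[of n] less.IH[of k] j Suc by simp
    qed
  qed
qed

lemma pderiv_power_mult:
  assumes "pderiv p = (1 :: real poly)"
  shows "pderiv (p ^ Suc n * q) = p ^ n * (Polynomial.smult (real (Suc n)) q + p * pderiv q)"
  unfolding pderiv_mult pderiv_power_Suc assms by (simp add: algebra_simps del: of_nat_Suc)

lemma pderiv_linear: "pderiv [:-a, 1:] = (1 :: real poly)"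
  by (simp add: pderiv_pCons one_pCons)

text \<open>At an n-fold root only the term survives in which all n derivatives fall on the linear
  factors.\<close>

lemma poly_pderiv_pow_root:
  fixes q :: "real poly"
  shows "poly ((pderiv ^^ n) ([:-a, 1:] ^ n * q)) a = fact n * poly q a"
proof (induction n arbitrary: q)
  case (Suc n)
  have "pderiv ([:-a, 1:] ^ Suc n * q) = [:-a, 1:] ^ n * (Polynomial.smult (real (Suc n)) q + [:-a, 1:] * pderiv q)"
    by (rule pderiv_power_mult[OF pderiv_linear])
  then have "poly ((pderiv ^^ Suc n) ([:-a, 1:] ^ Suc n * q)) a =
      fact n * poly (Polynomial.smult (real (Suc n)) q + [:-a, 1:] * pderiv q) a"
    by (simp only: pderiv_pow_Suc Suc.IH)
  then show ?case by (simp add: algebra_simps)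
qed simp

lemma base_factor: "[:-1, 0, 1:] ^ n = [:- (-1), 1:] ^ n * ([:-1, 1:] ^ n :: real poly)"
  by (simp flip: power_mult_distrib)

lemma poly_legendre_minus_one: "poly (legendre i) (-1) = (-1) ^ i"
proof -
  have "poly ((pderiv ^^ i) ([:-1, 0, 1:] ^ i)) (-1) = fact i * poly ([:-1, 1:] ^ i) (-1 :: real)"
    unfolding base_factor by (rule poly_pderiv_pow_root)
  also have "\<dots> = fact i * (-2) ^ i" by (simp add: poly_power)
  finally have "poly (legendre i) (-1) = (-2) ^ i / 2 ^ i"
    by (simp add: legendre_def)
  also have "\<dots> = (-1) ^ i" by (simp flip: power_divide)
  finally show ?thesis .
qed

lemma pderiv_pow_dvd:
  "k \<le> n \<Longrightarrow> [:-a, 1:] ^ (n - k) dvd (pderiv ^^ k) ([:-a, 1:] ^ n * (q :: real poly))"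
proof (induction k)
  case (Suc k)
  obtain j where j: "n - k = Suc j" "n - Suc k = j" using Suc.prems
    by (metis Suc_diff_Suc Suc_le_lessD)
  obtain h where "(pderiv ^^ k) ([:-a, 1:] ^ n * q) = [:-a, 1:] ^ Suc j * h"
    using Suc j by (auto elim: dvdE)
  then have "(pderiv ^^ Suc k) ([:-a, 1:] ^ n * q) = [:-a, 1:] ^ j * (Polynomial.smult (real (Suc j)) h + [:-a, 1:] * pderiv h)"
    by (simp only: funpow.simps comp_apply pderiv_power_mult[OF pderiv_linear])
  then show ?case unfolding j(2) by (simp only: dvd_triv_left)
qed simp

lemma base_pderiv_root:
  assumes "k < n"
  shows "poly ((pderiv ^^ k) ([:-1, 0, 1:] ^ n)) 1 = (0 :: real)" "poly ((pderiv ^^ k) ([:-1, 0, 1:] ^ n)) (-1) = (0 :: real)"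
proof -
  have d: "poly ((pderiv ^^ k) ([:-a, 1:] ^ n * q)) a = 0" for a :: real and q
  proof -
    have "[:-a, 1:] dvd [:-a, 1:] ^ (n - k)" using assms by (intro dvd_power) simp
    then show ?thesis
      using pderiv_pow_dvd[of k n a q] assms dvd_trans poly_eq_0_iff_dvd by (metis less_imp_le)
  qed
  show "poly ((pderiv ^^ k) ([:-1, 0, 1:] ^ n)) (-1) = (0 :: real)" unfolding base_factor by (rule d)
  have "[:-1, 0, 1:] ^ n = [:-1, 1:] ^ n * ([:- (-1), 1:] ^ n :: real poly)"
    unfolding base_factor by (rule mult.commute)
  then show "poly ((pderiv ^^ k) ([:-1, 0, 1:] ^ n)) 1 = (0 :: real)" using d[of 1] by simp
qed

lemma integral_poly_pderiv:
  "(\<integral>t. poly (pderiv q) t \<partial>leb_I) = poly q 1 - poly q (-1)"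
proof -
  have "primitive (poly (pderiv q)) 1 = poly q 1 - poly q (-1)"
    by (rule primitive_of_deriv) (auto intro!: DERIV_subset[OF poly_DERIV] continuous_integrable_I continuous_intros)
  then show ?thesis by (simp add: primitive_upper)
qed

lemma poly_integrable [simp]: "integrable leb_I (poly q)"
  by (intro continuous_integrable_I continuous_intros)

text \<open>Repeated integration by parts: a derivative of (x^2 - 1)^n of order below n still
  vanishes at both end points, so no boundary terms arise.\<close>

lemma integral_mult_base_pderiv:
  "k \<le> n \<Longrightarrow> (\<integral>t. poly (q * (pderiv ^^ k) ([:-1, 0, 1:] ^ n)) t \<partial>leb_I) =
    (-1) ^ k * (\<integral>t. poly ((pderiv ^^ k) q * [:-1, 0, 1:] ^ n) t \<partial>leb_I)"
proof (induction k arbitrary: q)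
  case (Suc k)
  let ?f = "(pderiv ^^ k) ([:-1, 0, 1:] ^ n) :: real poly"
  have "(\<integral>t. poly (q * pderiv ?f) t \<partial>leb_I) + (\<integral>t. poly (pderiv q * ?f) t \<partial>leb_I) =
      (\<integral>t. poly (q * pderiv ?f) t + poly (pderiv q * ?f) t \<partial>leb_I)"
    by (intro Bochner_Integration.integral_add[symmetric] poly_integrable)
  also have "\<dots> = (\<integral>t. poly (pderiv (q * ?f)) t \<partial>leb_I)"
    by (simp add: pderiv_mult mult.commute)
  also have "\<dots> = 0"
    unfolding integral_poly_pderiv using base_pderiv_root[of k n] Suc.prems by simp
  finally have "(\<integral>t. poly (q * pderiv ?f) t \<partial>leb_I) = - (\<integral>t. poly (pderiv q * ?f) t \<partial>leb_I)"
    by linarith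
  also have "(\<integral>t. poly (pderiv q * ?f) t \<partial>leb_I) =
      (-1) ^ k * (\<integral>t. poly ((pderiv ^^ k) (pderiv q) * [:-1, 0, 1:] ^ n) t \<partial>leb_I)"
    using Suc by simp
  finally show ?case unfolding pderiv_pow_Suc[of k q] by simp
qed simp

text \<open>All j derivatives of Rodrigues' formula are moved to the other factor, whose degree i is
  smaller than j.\<close>

lemma legendre_orthogonal_less:
  assumes "i < j"
  shows "(\<integral>t. poly (legendre i) t * poly (legendre j) t \<partial>leb_I) = 0"
proof -
  have z: "(pderiv ^^ j) (legendre i) = 0"
  proof -
    obtain r where r: "j = Suc i + r" using assms less_iff_Suc_add by auto
    have "degree ((pderiv ^^ i) (legendre i)) = 0" by (simp add: degree_pderiv_pow)
    then have "(pderiv ^^ Suc i) (legendre i) = 0" by (simp add: pderiv_eq_0_iff)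
    moreover have "(pderiv ^^ r) 0 = (0 :: real poly)" by (induction r) auto
    ultimately show ?thesis unfolding r by (simp only: funpow_add comp_apply add.commute[of "Suc i"])
  qed
  have "(\<integral>t. poly (legendre i) t * poly (legendre j) t \<partial>leb_I) =
      (1 / (2 ^ j * fact j)) * (\<integral>t. poly (legendre i * (pderiv ^^ j) ([:-1, 0, 1:] ^ j)) t \<partial>leb_I)"
    by (simp add: legendre_def[of j] mult.left_commute)
  also have "\<dots> = 0"
    unfolding integral_mult_base_pderiv[OF le_refl] z by (simp add: poly_0[abs_def])
  finally show ?thesis .
qed

lemma legendre_orthogonal:
  assumes "i \<noteq> j"
  shows "(\<integral>t. poly (legendre i) t * poly (legendre j) t \<partial>leb_I) = 0"
proof (cases "i < j")
  case False
  then show ?thesis using legendre_orthogonal_less[of j i] assms by (simp add: mult.commute)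
qed (rule legendre_orthogonal_less)

lemma L2_norm_legendre:
  "(L2_norm (poly (legendre i)))\<^sup>2 = (\<integral>t. poly (legendre i) t * poly (legendre i) t \<partial>leb_I)"
  unfolding L2_norm_def
  by (subst real_sqrt_pow2) (auto intro: integral_nonneg_AE simp: power2_eq_square)

lemma legendre_norm_pos: "(\<integral>t. poly (legendre i) t * poly (legendre i) t \<partial>leb_I) > 0"
proof -
  have nn: "(\<integral>t. poly (legendre i) t * poly (legendre i) t \<partial>leb_I) \<ge> 0"
    by (rule integral_nonneg_AE) auto
  moreover have "(\<integral>t. poly (legendre i) t * poly (legendre i) t \<partial>leb_I) \<noteq> 0"
  proof
    assume "(\<integral>t. poly (legendre i) t * poly (legendre i) t \<partial>leb_I) = 0"
    moreover have "integrable leb_I (\<lambda>t. poly (legendre i) t * poly (legendre i) t)"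
      by (intro continuous_integrable_I continuous_intros)
    ultimately have "AE t in leb_I. poly (legendre i) t * poly (legendre i) t = 0"
      by (subst (asm) integral_nonneg_eq_0_iff_AE) auto
    then have ae: "AE t in leb_I. -1 < t \<and> t < 1 \<longrightarrow> poly (legendre i) t = 0"
      by eventually_elim auto
    have "poly (legendre i) t = 0" if "-1 < t" "t < 1" for t
      by (rule continuous_AE_zero[OF _ ae _ _ that]) (auto intro: continuous_intros)
    then have "{-1<..<1::real} \<subseteq> {t. poly (legendre i) t = 0}" by auto
    then have "finite {-1<..<1::real}"
      using poly_roots_finite[OF legendre_nonzero] finite_subset by blast
    then show False using infinite_Ioo[of "-1::real" 1] by simp
  qed
  ultimately show ?thesis by linarith
qed

section \<open>Legendre expansions\<close>

definition legendre_coeff :: "(real \<Rightarrow> real) \<Rightarrow> nat \<Rightarrow> real" where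
  "legendre_coeff f i = (\<integral>t. f t * poly (legendre i) t \<partial>leb_I) / (\<integral>t. poly (legendre i) t * poly (legendre i) t \<partial>leb_I)"

lemma poly_eq_legendre_sum:
  assumes "\<And>j. j \<ge> N \<Longrightarrow> coeff P j = 0"
  shows "\<exists>c. P = (\<Sum>i<N. Polynomial.smult (c i) (legendre i))"
  using assms
proof (induction N arbitrary: P)
  case 0
  then show ?case by (auto intro: poly_eqI)
next
  case (Suc N)
  define a where "a = coeff P N / coeff (legendre N) N"
  have l: "coeff (legendre N) N \<noteq> 0"
    using legendre_nonzero[of N] leading_coeff_0_iff[of "legendre N"] by simp
  have "\<exists>c. P - Polynomial.smult a (legendre N) = (\<Sum>i<N. Polynomial.smult (c i) (legendre i))"
  proof (rule Suc.IH)
    fix j assume "j \<ge> N"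
    then show "coeff (P - Polynomial.smult a (legendre N)) j = 0"
      using Suc.prems[of j] l by (cases "j = N") (auto simp: a_def coeff_eq_0)
  qed
  then obtain c where "P - Polynomial.smult a (legendre N) = (\<Sum>i<N. Polynomial.smult (c i) (legendre i))" by blast
  then have "P = (\<Sum>i<N. Polynomial.smult (c i) (legendre i)) + Polynomial.smult a (legendre N)"
    by (simp add: algebra_simps)
  then have "P = (\<Sum>i<Suc N. Polynomial.smult ((c(N := a)) i) (legendre i))" by simp
  then show ?case by blast
qed

lemma integral_legendre_sum:
  "(\<integral>t. poly (\<Sum>i<N. Polynomial.smult (c i) (legendre i)) t * poly (legendre j) t \<partial>leb_I) =
    (if j < N then c j * (\<integral>t. poly (legendre j) t * poly (legendre j) t \<partial>leb_I) else 0)"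
proof -
  have "(\<integral>t. poly (\<Sum>i<N. Polynomial.smult (c i) (legendre i)) t * poly (legendre j) t \<partial>leb_I) =
      (\<integral>t. (\<Sum>i<N. c i * (poly (legendre i) t * poly (legendre j) t)) \<partial>leb_I)"
    by (simp add: poly_sum sum_distrib_right mult.assoc)
  also have "\<dots> = (\<Sum>i<N. \<integral>t. c i * (poly (legendre i) t * poly (legendre j) t) \<partial>leb_I)"
    by (intro Bochner_Integration.integral_sum integrable_mult_right continuous_integrable_I continuous_intros)
  also have "\<dots> = (\<Sum>i<N. if i = j then c j * (\<integral>t. poly (legendre j) t * poly (legendre j) t \<partial>leb_I) else 0)"
    by (intro sum.cong refl) (auto simp: legendre_orthogonal)
  finally show ?thesis by simp
qed

lemma legendre_coeff_sum:
  "j < N \<Longrightarrow> legendre_coeff (poly (\<Sum>i<N. Polynomial.smult (c i) (legendre i))) j = c j"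
  unfolding legendre_coeff_def integral_legendre_sum using legendre_norm_pos[of j] by simp

lemma poly_legendre_expansion:
  assumes "\<And>j. j \<ge> N \<Longrightarrow> coeff P j = 0"
  shows "P = (\<Sum>i<N. Polynomial.smult (legendre_coeff (poly P) i) (legendre i))"
proof -
  obtain c where c: "P = (\<Sum>i<N. Polynomial.smult (c i) (legendre i))"
    using poly_eq_legendre_sum[OF assms] by blast
  show ?thesis
    by (subst c) (intro sum.cong refl, simp add: c legendre_coeff_sum)
qed

lemma legendre_parseval:
  "(\<integral>t. (poly (\<Sum>i<N. Polynomial.smult (c i) (legendre i)) t)\<^sup>2 \<partial>leb_I) =
    (\<Sum>i<N. (c i)\<^sup>2 * (L2_norm (poly (legendre i)))\<^sup>2)"
proof -
  let ?P = "\<Sum>i<N. Polynomial.smult (c i) (legendre i)"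
  have "(\<integral>t. (poly ?P t)\<^sup>2 \<partial>leb_I) = (\<integral>t. (\<Sum>j<N. c j * (poly ?P t * poly (legendre j) t)) \<partial>leb_I)"
    by (simp add: power2_eq_square poly_sum[of "\<lambda>i. Polynomial.smult (c i) (legendre i)"] sum_distrib_left mult.left_commute)
  also have "\<dots> = (\<Sum>j<N. \<integral>t. c j * (poly ?P t * poly (legendre j) t) \<partial>leb_I)"
    by (intro Bochner_Integration.integral_sum integrable_mult_right continuous_integrable_I continuous_intros)
  also have "\<dots> = (\<Sum>i<N. (c i)\<^sup>2 * (L2_norm (poly (legendre i)))\<^sup>2)"
    unfolding L2_norm_legendre by (intro sum.cong refl) (simp add: integral_legendre_sum power2_eq_square)
  finally show ?thesis .
qed

lemma pderiv_sum: "pderiv (\<Sum>i\<in>I. f i) = (\<Sum>i\<in>I. pderiv (f i :: real poly))"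
  by (induction I rule: infinite_finite_induct) (auto simp: pderiv_add)

lemma smult_sum_distrib: "Polynomial.smult a (\<Sum>i\<in>I. f i) = (\<Sum>i\<in>I. Polynomial.smult a (f i :: real poly))"
  by (induction I rule: infinite_finite_induct) (auto simp: smult_add_right)

lemma pderiv_legendre_sum:
  "pderiv (\<Sum>j<N. Polynomial.smult (c j) (legendre j)) =
    (\<Sum>i<N. Polynomial.smult (real (2 * i + 1) * (\<Sum>j | j < N \<and> j \<ge> i + 1 \<and> odd (i + j). c j)) (legendre i))"
proof -
  have "pderiv (\<Sum>j<N. Polynomial.smult (c j) (legendre j)) =
      (\<Sum>j<N. \<Sum>i | i < j \<and> odd (i + j). Polynomial.smult (real (2 * i + 1) * c j) (legendre i))"
    by (simp add: pderiv_sum pderiv_smult pderiv_legendre smult_sum_distrib mult.commute)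
  also have "\<dots> = (\<Sum>j<N. \<Sum>i<N. if i < j \<and> odd (i + j) then Polynomial.smult (real (2 * i + 1) * c j) (legendre i) else 0)"
    by (intro sum.cong refl sum.mono_neutral_cong_left) auto
  also have "\<dots> = (\<Sum>i<N. \<Sum>j<N. if i < j \<and> odd (i + j) then Polynomial.smult (real (2 * i + 1) * c j) (legendre i) else 0)"
    by (rule sum.swap)
  also have "\<dots> = (\<Sum>i<N. \<Sum>j | j < N \<and> j \<ge> i + 1 \<and> odd (i + j). Polynomial.smult (real (2 * i + 1) * c j) (legendre i))"
    by (intro sum.cong refl sum.mono_neutral_cong_right) auto
  also have "\<dots> = (\<Sum>i<N. Polynomial.smult (real (2 * i + 1) * (\<Sum>j | j < N \<and> j \<ge> i + 1 \<and> odd (i + j). c j)) (legendre i))"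
    by (intro sum.cong refl) (simp only: sum_distrib_left Polynomial.smult_sum)
  finally show ?thesis .
qed

section \<open>The Gramian of the data\<close>

lemma sum_blocks: "(\<Sum>c<k * d. F c) = (\<Sum>j<k. \<Sum>i<d. F (j * d + i :: nat) :: 'a :: comm_monoid_add)"
  by (induction k) (simp_all add: sum_lessThan_add add.commute[of d])

lemma gram_row_mult:
  assumes f: "\<And>a. a < d \<Longrightarrow> (\<lambda>t. f t $ a) \<in> L2" and a: "h \<in> L2"
  shows "(\<Sum>b<d. (\<integral>t. h t * f t $ b \<partial>leb_I) * v b) = (\<integral>t. h t * (\<Sum>b<d. f t $ b * v b) \<partial>leb_I)"
proof -
  have "(\<integral>t. h t * (\<Sum>b<d. f t $ b * v b) \<partial>leb_I) = (\<integral>t. (\<Sum>b<d. (h t * f t $ b) * v b) \<partial>leb_I)"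
    by (simp only: sum_distrib_left mult.assoc)
  also have "\<dots> = (\<Sum>b<d. \<integral>t. (h t * f t $ b) * v b \<partial>leb_I)"
    by (intro Bochner_Integration.integral_sum integrable_mult_left L2_mult_integrable f a) simp
  finally show ?thesis by simp
qed

lemma gram_quadratic:
  assumes f: "\<And>a. a < d \<Longrightarrow> (\<lambda>t. f t $ a) \<in> L2"
  shows "(\<Sum>a<d. v a * (\<Sum>b<d. gram d f $$ (a, b) * v b)) = (\<integral>t. (\<Sum>a<d. f t $ a * v a)\<^sup>2 \<partial>leb_I)"
proof -
  let ?s = "\<lambda>t. \<Sum>a<d. f t $ a * v a"
  have sL: "?s \<in> L2"
    using f by (intro L2_sum) (auto simp: mult.commute[of _ "v _"])
  have row: "(\<Sum>b<d. gram d f $$ (a, b) * v b) = (\<integral>t. f t $ a * ?s t \<partial>leb_I)" if "a < d" for a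
    using gram_row_mult[of d f "\<lambda>t. f t $ a" v] f that by (simp add: gram_def)
  have "(\<Sum>a<d. v a * (\<Sum>b<d. gram d f $$ (a, b) * v b)) = (\<Sum>a<d. v a * (\<integral>t. f t $ a * ?s t \<partial>leb_I))"
    by (intro sum.cong refl) (simp add: row)
  also have "\<dots> = (\<Sum>a<d. \<integral>t. v a * (f t $ a * ?s t) \<partial>leb_I)"
    by simp
  also have "\<dots> = (\<integral>t. (\<Sum>a<d. v a * (f t $ a * ?s t)) \<partial>leb_I)"
    by (intro Bochner_Integration.integral_sum[symmetric] integrable_mult_right L2_mult_integrable f sL) simp
  also have "\<dots> = (\<integral>t. (?s t)\<^sup>2 \<partial>leb_I)"
    by (simp add: power2_eq_square sum_distrib_right mult.assoc mult.left_commute)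
  finally show ?thesis .
qed

text \<open>The quadratic form of a Gramian is the integral of a square, so its null vectors are the
  linear relations that hold almost everywhere.\<close>

lemma gram_null:
  assumes f: "\<And>a. a < d \<Longrightarrow> (\<lambda>t. f t $ a) \<in> L2"
  shows "(\<Sum>a<d. v a * (\<Sum>b<d. gram d f $$ (a, b) * v b)) = 0 \<longleftrightarrow> (AE t in leb_I. (\<Sum>a<d. f t $ a * v a) = 0)"
proof -
  have sL: "(\<lambda>t. \<Sum>a<d. f t $ a * v a) \<in> L2"
    using f by (intro L2_sum) (auto simp: mult.commute[of _ "v _"])
  then have "integrable leb_I (\<lambda>t. (\<Sum>a<d. f t $ a * v a)\<^sup>2)" by (simp add: L2_def)
  then have "(\<integral>t. (\<Sum>a<d. f t $ a * v a)\<^sup>2 \<partial>leb_I) = 0 \<longleftrightarrow> (AE t in leb_I. (\<Sum>a<d. f t $ a * v a)\<^sup>2 = 0)"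
    by (rule integral_nonneg_eq_0_iff_AE) simp
  then show ?thesis using gram_quadratic[of d f v, OF f] by simp
qed

lemma Lam_index:
  assumes "k < L" "i < d"
  shows "Lam d L f t $ (k * d + i) = weak_deriv k (\<lambda>s. f s $ i) t"
  unfolding Lam_def using assms by (subst stack_vec_index[where d = d]) (auto simp: weak_derivv_def)

lemma Lam_carrier: "Lam d L f t \<in> carrier_vec (L * d)"
  unfolding Lam_def by (rule stack_vec_carrier) (auto simp: weak_derivv_def)

lemma Lam2_index:
  assumes "k < L"
  shows "i < m \<Longrightarrow> Lam2 m p L L u y t $ (k * m + i) = weak_deriv k (\<lambda>s. u s $ i) t"
    and "i < p \<Longrightarrow> Lam2 m p L L u y t $ (L * m + (k * p + i)) = weak_deriv k (\<lambda>s. y s $ i) t"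
proof -
  have c: "Lam m L u t \<in> carrier_vec (L * m)" "Lam p L y t \<in> carrier_vec (L * p)" by (rule Lam_carrier)+
  show "Lam2 m p L L u y t $ (k * m + i) = weak_deriv k (\<lambda>s. u s $ i) t" if i: "i < m"
    using append_vec_index[OF c, of "k * m + i"] block_index_less[OF assms i] Lam_index[OF assms i]
    by (simp add: Lam2_def)
  show "Lam2 m p L L u y t $ (L * m + (k * p + i)) = weak_deriv k (\<lambda>s. y s $ i) t" if i: "i < p"
    using append_vec_index[OF c, of "L * m + (k * p + i)"] block_index_less[OF assms i] Lam_index[OF assms i]
    by (simp add: Lam2_def)
qed

lemma sum_Lam2_blocks:
  "(\<Sum>c<L * m + L * p. F (c :: nat)) = (\<Sum>k<L. \<Sum>i<m. F (k * m + i)) + (\<Sum>k<L. \<Sum>i<p. F (L * m + (k * p + i)) :: real)"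
  using sum_lessThan_add[of F "L * m" "L * p"] sum_blocks[of F L m] sum_blocks[of "\<lambda>c. F (L * m + c)" L p] by simp

lemma block_cases:
  assumes "c < L * m + L * (p :: nat)"
  obtains k i where "k < L" "i < m" "c = k * m + i" | k i where "k < L" "i < p" "c = L * m + (k * p + i)"
proof (cases "c < L * m")
  case True
  then have "m > 0" by (cases m) auto
  show thesis
    by (rule that(1)[of "c div m" "c mod m"]) (use True \<open>m > 0\<close> in \<open>auto simp: less_mult_imp_div_less\<close>)
next
  case False
  define c' where "c' = c - L * m"
  have c': "c = L * m + c'" "c' < L * p" using False assms by (auto simp: c'_def)
  then have "p > 0" by (cases p) auto
  show thesis
    by (rule that(2)[of "c' div p" "c' mod p"]) (use c' \<open>p > 0\<close> in \<open>auto simp: less_mult_imp_div_less\<close>)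
qed

text \<open>A linear relation among the input derivatives is a null vector of their Gramian, and a
  positive definite matrix has none except zero.\<close>

lemma persistently_exciting_independent:
  assumes pe: "persistently_exciting m K f"
    and ae: "AE t in leb_I. (\<Sum>k<K. \<Sum>i<m. c k i * weak_deriv k (\<lambda>s. f s $ i) t) = 0"
    and k: "k < K" and i: "i < m"
  shows "c k i = 0"
proof -
  have pd: "positive_definite (K * m) (gram (K * m) (Lam m K f))"
    and sob: "f \<in> sobolev m (K - 1)"
    using pe by (auto simp: persistently_exciting_def)
  have wd: "has_weak_deriv k (\<lambda>s. f s $ i) (weak_deriv k (\<lambda>s. f s $ i))" if "k < K" "i < m" for k i
  proof -
    have "k \<le> K - 1" using that by simp
    then have "\<exists>h. has_weak_deriv k (\<lambda>s. f s $ i) h"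
      using sob that by (simp add: sobolev_def)
    then obtain h where "has_weak_deriv k (\<lambda>s. f s $ i) h" ..
    then show ?thesis by (rule has_weak_deriv_weak_deriv)
  qed
  have fL: "(\<lambda>t. Lam m K f t $ a) \<in> L2" if "a < K * m" for a
  proof -
    have "m > 0" using that by (cases m) auto
    have d: "a div m < K" using that by (simp add: less_mult_imp_div_less)
    have "(\<lambda>t. Lam m K f t $ a) = weak_deriv (a div m) (\<lambda>s. f s $ (a mod m))"
      using Lam_index[OF d, of "a mod m" m f] \<open>m > 0\<close> by auto
    then show ?thesis using has_weak_deriv_L2[OF wd[OF d]] \<open>m > 0\<close> by simp
  qed
  define v where "v = vec (K * m) (\<lambda>a. c (a div m) (a mod m))"
  have v: "v $ (k * m + i) = c k i" if "k < K" "i < m" for k i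
    using that block_index_less[OF that] by (simp add: v_def)
  let ?G = "gram (K * m) (Lam m K f)"
  have vc: "v \<in> carrier_vec (K * m)" by (simp add: v_def)
  have Gc: "?G \<in> carrier_mat (K * m) (K * m)" by (simp add: gram_def)
  have "(\<Sum>a<K * m. Lam m K f t $ a * v $ a) = (\<Sum>k<K. \<Sum>i<m. c k i * weak_deriv k (\<lambda>s. f s $ i) t)" for t
    unfolding sum_blocks by (intro sum.cong refl) (simp add: Lam_index v)
  then have "AE t in leb_I. (\<Sum>a<K * m. Lam m K f t $ a * v $ a) = 0"
    using ae by simp
  then have "(\<Sum>a<K * m. v $ a * (\<Sum>b<K * m. ?G $$ (a, b) * v $ b)) = 0"
    using gram_null[of "K * m" "Lam m K f" "\<lambda>a. v $ a", OF fL] by blast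
  moreover have "v \<bullet> (?G *\<^sub>v v) = (\<Sum>a<K * m. v $ a * (?G *\<^sub>v v) $ a)"
    using Gc by (simp add: scalar_prod_def lessThan_atLeast0 del: index_mult_mat_vec)
  moreover have "\<dots> = (\<Sum>a<K * m. v $ a * (\<Sum>b<K * m. ?G $$ (a, b) * v $ b))"
    by (intro sum.cong refl) (simp add: mult_mat_vec_index[OF Gc vc] del: index_mult_mat_vec)
  ultimately have "v \<bullet> (?G *\<^sub>v v) = 0" by simp
  then have "v = 0\<^sub>v (K * m)" using pd vc unfolding positive_definite_def by force
  then show ?thesis using v[OF k i] block_index_less[OF k i] by simp
qed

text \<open>The two main assumptions say that the image of \<open>\<Gamma>\<close> is the space of pointwise jets
  \<open>col(u, \<dots>, u\<^sup>(\<^sup>l\<^sup>), y, \<dots>, y\<^sup>(\<^sup>l\<^sup>))\<close> compatible with the state equations.\<close>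

locale data_system =
  fixes m p n l :: nat and A B C D :: "nat \<Rightarrow> nat \<Rightarrow> real" and \<Gamma> :: "real mat"
  assumes \<Gamma>_carrier: "\<Gamma> \<in> carrier_mat ((l + 1) * (m + p)) ((l + 1) * (m + p))"
    and jet_of_image: "\<And>v. v \<in> carrier_vec ((l + 1) * (m + p)) \<Longrightarrow>
      \<exists>z. \<forall>k<l + 1. \<forall>i<p. (Gram_y m p (l + 1) \<Gamma> k *\<^sub>v v) $ i =
        resp m n A B C D k i (\<lambda>h j. (Gram_u m \<Gamma> h *\<^sub>v v) $ j) z"
    and image_of_jet: "\<And>V z. \<exists>v\<in>carrier_vec ((l + 1) * (m + p)). \<forall>k<l + 1.
      (\<forall>i<m. (Gram_u m \<Gamma> k *\<^sub>v v) $ i = V k i) \<and>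
      (\<forall>i<p. (Gram_y m p (l + 1) \<Gamma> k *\<^sub>v v) $ i = resp m n A B C D k i V z)"

section \<open>The image of the Gramian\<close>

lemma resp_integral:
  assumes k: "k < L" and U: "\<And>h j. h < L \<Longrightarrow> j < m \<Longrightarrow> U h j \<in> L2" and x: "\<And>j. j < n \<Longrightarrow> x j \<in> L2" and \<gamma>: "\<gamma> \<in> L2"
  shows "(\<integral>t. resp m n A B C D k i (\<lambda>h j. U h j t) (\<lambda>j. x j t) * \<gamma> t \<partial>leb_I) =
    resp m n A B C D k i (\<lambda>h j. \<integral>t. U h j t * \<gamma> t \<partial>leb_I) (\<lambda>j. \<integral>t. x j t * \<gamma> t \<partial>leb_I)"
proof -
  have ix: "integrable leb_I (\<lambda>t. x j t * \<gamma> t)" if "j < n" for j by (intro L2_mult_integrable x \<gamma> that)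
  have iU: "integrable leb_I (\<lambda>t. U h j t * \<gamma> t)" if "h < L" "j < m" for h j by (intro L2_mult_integrable U \<gamma> that)
  have "(\<integral>t. resp m n A B C D k i (\<lambda>h j. U h j t) (\<lambda>j. x j t) * \<gamma> t \<partial>leb_I) =
     (\<integral>t. (\<Sum>j<n. row_pow n A (C i) k j * (x j t * \<gamma> t)) +
       (\<Sum>h<L. \<Sum>j<m. resp_input n A B C D k i h j * (U h j t * \<gamma> t)) \<partial>leb_I)"
    by (simp only: resp_expand[OF k] distrib_right sum_distrib_right mult.assoc)
  also have "\<dots> = (\<integral>t. (\<Sum>j<n. row_pow n A (C i) k j * (x j t * \<gamma> t)) \<partial>leb_I) +
       (\<integral>t. (\<Sum>h<L. \<Sum>j<m. resp_input n A B C D k i h j * (U h j t * \<gamma> t)) \<partial>leb_I)"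
    by (intro Bochner_Integration.integral_add Bochner_Integration.integrable_sum integrable_mult_right ix iU) auto
  also have "(\<integral>t. (\<Sum>j<n. row_pow n A (C i) k j * (x j t * \<gamma> t)) \<partial>leb_I) =
      (\<Sum>j<n. \<integral>t. row_pow n A (C i) k j * (x j t * \<gamma> t) \<partial>leb_I)"
    by (intro Bochner_Integration.integral_sum integrable_mult_right ix) auto
  also have "(\<integral>t. (\<Sum>h<L. \<Sum>j<m. resp_input n A B C D k i h j * (U h j t * \<gamma> t)) \<partial>leb_I) =
      (\<Sum>h<L. \<integral>t. (\<Sum>j<m. resp_input n A B C D k i h j * (U h j t * \<gamma> t)) \<partial>leb_I)"
    by (intro Bochner_Integration.integral_sum Bochner_Integration.integrable_sum integrable_mult_right iU) auto
  also have "\<dots> = (\<Sum>h<L. \<Sum>j<m. \<integral>t. resp_input n A B C D k i h j * (U h j t * \<gamma> t) \<partial>leb_I)"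
    by (intro sum.cong refl Bochner_Integration.integral_sum integrable_mult_right iU) auto
  finally show ?thesis by (simp only: resp_expand[OF k] integral_mult_right_zero)
qed

lemma row_block_mult_index:
  assumes "M \<in> carrier_mat d d" "v \<in> carrier_vec d" "i < k" "s + i < d"
  shows "(row_block M s k *\<^sub>v v) $ i = (\<Sum>b<d. M $$ (s + i, b) * v $ b)"
proof -
  have "row_block M s k \<in> carrier_mat k d" using assms by (simp add: row_block_def)
  from mult_mat_vec_index[OF this assms(2,3)] show ?thesis
    using assms by (simp add: row_block_def)
qed

text \<open>A vector \<open>\<Gamma> v\<close> is the data jet integrated against the scalar
  function \<gamma> given by the pairing of the jet with v. The response map is linear and commutes
  with this integration, so \<open>\<Gamma> v\<close> is compatible with the integrated state.
  Conversely, a compatible jet outside the image would be separated from it by a functional k with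
  \<open>k \<bullet> \<Gamma> k = 0\<close>. Such a k annihilates the data jets almost everywhere,
  hence by excitation and controllability every compatible jet.\<close>

lemma (in iso_system) data_system_Gramian:
  assumes S: "state_sol m p n A B C D (\<lambda>i t. ubar t $ i) (\<lambda>i t. ybar t $ i) x"
    and uL: "\<And>j. j < m \<Longrightarrow> (\<lambda>t. ubar t $ j) \<in> L2" and yL: "\<And>j. j < p \<Longrightarrow> (\<lambda>t. ybar t $ j) \<in> L2"
    and pe: "persistently_exciting m (l + 1 + n) ubar"
    and ctr: "\<And>u0 y0. weak_sol m p g R u0 y0 \<Longrightarrow> \<exists>t1 u y. 0 < t1 \<and> t1 < 1 \<and> weak_sol m p g R u y \<and>
      (AE t in leb_I. t \<le> 0 \<longrightarrow> (\<forall>i<m. u i t = u0 i t) \<and> (\<forall>i<p. y i t = y0 i t)) \<and>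
      (AE t in leb_I. t1 \<le> t \<longrightarrow> (\<forall>i<m. u i t = 0) \<and> (\<forall>i<p. y i t = 0))"
  shows "data_system m p n l A B C D (Gramian m p (l + 1) (l + 1) ubar ybar)"
proof -
  let ?L = "l + 1"
  let ?d = "?L * m + ?L * p"
  let ?\<Lambda> = "Lam2 m p ?L ?L ubar ybar"
  define G where "G = Gramian m p ?L ?L ubar ybar"
  define U where "U k j = weak_deriv k (\<lambda>s. ubar s $ j)" for k j
  define Y where "Y k j = weak_deriv k (\<lambda>s. ybar s $ j)" for k j
  have d: "(l + 1) * (m + p) = ?d" by (simp add: algebra_simps)
  have Gc: "G \<in> carrier_mat ?d ?d" by (simp add: G_def Gramian_def gram_def)
  have Gab: "G $$ (a, b) = (\<integral>t. ?\<Lambda> t $ a * ?\<Lambda> t $ b \<partial>leb_I)" if "a < ?d" "b < ?d" for a b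
    using that by (simp add: G_def Gramian_def gram_def)
  have U: "has_weak_deriv k (\<lambda>s. ubar s $ j) (U k j)" if "k < ?L + n" "j < m" for k j
  proof -
    have "k \<le> ?L + n - 1" using that by simp
    then have "\<exists>h. has_weak_deriv k (\<lambda>s. ubar s $ j) h"
      using pe that by (simp add: persistently_exciting_def sobolev_def)
    then obtain h where "has_weak_deriv k (\<lambda>s. ubar s $ j) h" ..
    then show ?thesis unfolding U_def by (rule has_weak_deriv_weak_deriv)
  qed
  have UL: "U k j \<in> L2" if "k < ?L" "j < m" for k j using has_weak_deriv_L2[OF U] that by simp
  have xL: "x j \<in> L2" if "j < n" for j using continuous_L2[OF state_continuous[OF S that]] .
  have Yw: "has_weak_deriv k (\<lambda>s. ybar s $ i) (\<lambda>t. resp m n A B C D k i (\<lambda>h j. U h j t) (\<lambda>j. x j t))"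
    if "k < ?L" "i < p" for k i
    by (rule output_weak_deriv[OF S uL that(2) yL[OF that(2)], where K = l]) (use U that in auto)
  have YL: "Y k i \<in> L2" if "k < ?L" "i < p" for k i
    unfolding Y_def using has_weak_deriv_L2[OF has_weak_deriv_weak_deriv[OF Yw[OF that]]] .
  have Yae: "AE t in leb_I. Y k i t = resp m n A B C D k i (\<lambda>h j. U h j t) (\<lambda>j. x j t)" if "k < ?L" "i < p" for k i
    unfolding Y_def by (rule weak_deriv_AE[OF Yw[OF that]])
  have Yall: "AE t in leb_I. \<forall>k\<in>{..<?L}. \<forall>i\<in>{..<p}. Y k i t = resp m n A B C D k i (\<lambda>h j. U h j t) (\<lambda>j. x j t)"
    by (intro AE_finite_allI) (use Yae in auto)
  have \<Lambda>u: "?\<Lambda> t $ (k * m + i) = U k i t" if "k < ?L" "i < m" for k i t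
    using Lam2_index(1)[OF that, of p ubar ybar t] by (simp add: U_def)
  have \<Lambda>y: "?\<Lambda> t $ (?L * m + (k * p + i)) = Y k i t" if "k < ?L" "i < p" for k i t
    using Lam2_index(2)[OF that, of m ubar ybar t] by (simp add: Y_def)
  have \<Lambda>L: "(\<lambda>t. ?\<Lambda> t $ a) \<in> L2" if "a < ?d" for a
    using that
  proof (cases rule: block_cases)
    case (1 k i)
    then have "(\<lambda>t. ?\<Lambda> t $ a) = U k i" using \<Lambda>u by auto
    then show ?thesis using UL 1 by simp
  next
    case (2 k i)
    then have "(\<lambda>t. ?\<Lambda> t $ a) = Y k i" using \<Lambda>y by auto
    then show ?thesis using YL 2 by simp
  qed
  have ku: "k * m + i < ?d" if "k < ?L" "i < m" for k i
    using block_index_less[OF that] by linarith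
  have ky: "?L * m + (k * p + i) < ?d" if "k < ?L" "i < p" for k i
    using block_index_less[OF that] by linarith
  \<comment> \<open>The weight against which the data are integrated: each entry of the Gramian
    applied to v is the integral of a component of the data jet times \<gamma>.\<close>
  define \<gamma> where "\<gamma> v t = (\<Sum>b<?d. ?\<Lambda> t $ b * v b)" for v :: "nat \<Rightarrow> real" and t
  have \<gamma>L: "\<gamma> v \<in> L2" for v
    unfolding \<gamma>_def[abs_def] using \<Lambda>L by (intro L2_sum) (auto simp: mult.commute[of _ "v _"])
  have Grow: "(\<Sum>b<?d. G $$ (a, b) * v b) = (\<integral>t. ?\<Lambda> t $ a * \<gamma> v t \<partial>leb_I)" if a: "a < ?d" for a v
  proof -
    have "(\<Sum>b<?d. G $$ (a, b) * v b) = (\<Sum>b<?d. (\<integral>t. ?\<Lambda> t $ a * ?\<Lambda> t $ b \<partial>leb_I) * v b)"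
      using a by (intro sum.cong refl) (simp add: Gab)
    then show ?thesis unfolding \<gamma>_def using gram_row_mult[OF \<Lambda>L \<Lambda>L[OF a], of ?d v] by simp
  qed
  have Gu: "(Gram_u m G k *\<^sub>v v) $ i = (\<Sum>b<?d. G $$ (k * m + i, b) * v $ b)"
    "(\<Sum>b<?d. G $$ (k * m + i, b) * v $ b) = (\<integral>t. U k i t * \<gamma> (\<lambda>b. v $ b) t \<partial>leb_I)"
    if "k < ?L" "i < m" "v \<in> carrier_vec ?d" for k i v
  proof -
    show "(Gram_u m G k *\<^sub>v v) $ i = (\<Sum>b<?d. G $$ (k * m + i, b) * v $ b)"
      unfolding Gram_u_def by (rule row_block_mult_index[OF Gc that(3,2) ku[OF that(1,2)]])
    show "(\<Sum>b<?d. G $$ (k * m + i, b) * v $ b) = (\<integral>t. U k i t * \<gamma> (\<lambda>b. v $ b) t \<partial>leb_I)"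
      using Grow[OF ku[OF that(1,2)]] \<Lambda>u[OF that(1,2)] by simp
  qed
  have Gy: "(Gram_y m p ?L G k *\<^sub>v v) $ i = (\<Sum>b<?d. G $$ (?L * m + (k * p + i), b) * v $ b)"
    "(\<Sum>b<?d. G $$ (?L * m + (k * p + i), b) * v $ b) = (\<integral>t. Y k i t * \<gamma> (\<lambda>b. v $ b) t \<partial>leb_I)"
    if "k < ?L" "i < p" "v \<in> carrier_vec ?d" for k i v
  proof -
    show "(Gram_y m p ?L G k *\<^sub>v v) $ i = (\<Sum>b<?d. G $$ (?L * m + (k * p + i), b) * v $ b)"
      using row_block_mult_index[OF Gc that(3,2), of "?L * m + k * p"] ky[OF that(1,2)]
      unfolding Gram_y_def by (simp only: add.assoc)
    show "(\<Sum>b<?d. G $$ (?L * m + (k * p + i), b) * v $ b) = (\<integral>t. Y k i t * \<gamma> (\<lambda>b. v $ b) t \<partial>leb_I)"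
      using Grow[OF ky[OF that(1,2)]] \<Lambda>y[OF that(1,2)] by simp
  qed
  have "data_system m p n l A B C D G"
  proof
    show "G \<in> carrier_mat ((l + 1) * (m + p)) ((l + 1) * (m + p))" unfolding d by (rule Gc)
  next
    fix v :: "real vec" assume "v \<in> carrier_vec ((l + 1) * (m + p))"
    then have v: "v \<in> carrier_vec ?d" by (simp only: d)
    let ?\<gamma> = "\<gamma> (\<lambda>b. v $ b)"
    have "(Gram_y m p ?L G k *\<^sub>v v) $ i =
        resp m n A B C D k i (\<lambda>h j. (Gram_u m G h *\<^sub>v v) $ j) (\<lambda>j. \<integral>t. x j t * ?\<gamma> t \<partial>leb_I)"
      if k: "k < ?L" and i: "i < p" for k i
    proof -
      have "(Gram_y m p ?L G k *\<^sub>v v) $ i = (\<integral>t. Y k i t * ?\<gamma> t \<partial>leb_I)"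
        using Gy[OF k i v] by simp
      also have "\<dots> = (\<integral>t. resp m n A B C D k i (\<lambda>h j. U h j t) (\<lambda>j. x j t) * ?\<gamma> t \<partial>leb_I)"
      proof (rule integral_cong_AE)
        show "AE t in leb_I. Y k i t * ?\<gamma> t = resp m n A B C D k i (\<lambda>h j. U h j t) (\<lambda>j. x j t) * ?\<gamma> t"
          using Yae[OF k i] by eventually_elim simp
      qed (use YL[OF k i] has_weak_deriv_L2[OF Yw[OF k i]] \<gamma>L in \<open>auto intro!: borel_measurable_times L2_measurable\<close>)
      also have "\<dots> = resp m n A B C D k i (\<lambda>h j. \<integral>t. U h j t * ?\<gamma> t \<partial>leb_I) (\<lambda>j. \<integral>t. x j t * ?\<gamma> t \<partial>leb_I)"
        by (rule resp_integral[OF k UL xL \<gamma>L])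
      also have "\<dots> = resp m n A B C D k i (\<lambda>h j. (Gram_u m G h *\<^sub>v v) $ j) (\<lambda>j. \<integral>t. x j t * ?\<gamma> t \<partial>leb_I)"
        unfolding resp_expand[OF k]
      proof (intro arg_cong2[of _ _ _ _ "(+)"] refl sum.cong)
        fix h j assume "h \<in> {..<?L}" "j \<in> {..<m}"
        then have "h < ?L" "j < m" by simp_all
        from trans[OF Gu(1)[OF this v] Gu(2)[OF this v]]
        show "resp_input n A B C D k i h j * (\<integral>t. U h j t * ?\<gamma> t \<partial>leb_I) =
            resp_input n A B C D k i h j * (Gram_u m G h *\<^sub>v v) $ j" by simp
      qed
      finally show ?thesis .
    qed
    then show "\<exists>z. \<forall>k<l + 1. \<forall>i<p. (Gram_y m p (l + 1) G k *\<^sub>v v) $ i =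
        resp m n A B C D k i (\<lambda>h j. (Gram_u m G h *\<^sub>v v) $ j) z"
      by (intro exI[of _ "\<lambda>j. \<integral>t. x j t * ?\<gamma> t \<partial>leb_I"]) auto
  next
    fix V z
    define v where "v a = (if a < ?L * m then V (a div m) (a mod m) else
      resp m n A B C D ((a - ?L * m) div p) ((a - ?L * m) mod p) V z)" for a
    have vu: "v (k * m + i) = V k i" if "k < ?L" "i < m" for k i
      using that block_index_less[OF that] by (simp add: v_def)
    have vy: "v (?L * m + (k * p + i)) = resp m n A B C D k i V z" if "k < ?L" "i < p" for k i
      using that by (simp add: v_def)
    let ?N = "range (\<lambda>h a. \<Sum>b<?d. G $$ (a, b) * h b)"
    have "(\<exists>e. e \<noteq> 0 \<and> (\<exists>a\<in>?N. \<forall>i<?d. e * v i = a i)) \<or>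
      (\<exists>k. (\<forall>a\<in>?N. (\<Sum>i<?d. a i * k i) = 0) \<and> (\<Sum>i<?d. v i * k i) \<noteq> 0)"
    proof (rule submodule_separation[where N = ?N and v = v and q = ?d])
      show "(\<lambda>i. 0) \<in> ?N" by (rule range_eqI[of _ _ "\<lambda>b. 0"]) simp
      fix a b r s assume "a \<in> ?N" "b \<in> ?N"
      then obtain h h' where "a = (\<lambda>a. \<Sum>b<?d. G $$ (a, b) * h b)" "b = (\<lambda>a. \<Sum>b<?d. G $$ (a, b) * h' b)"
        by blast
      then show "(\<lambda>i. r * a i + s * b i) \<in> ?N"
        by (intro range_eqI[of _ _ "\<lambda>b. r * h b + s * h' b"])
          (simp add: fun_eq_iff sum_distrib_left sum.distrib distrib_left mult.left_commute)
    qed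
    then show "\<exists>w\<in>carrier_vec ((l + 1) * (m + p)). \<forall>k<l + 1.
      (\<forall>i<m. (Gram_u m G k *\<^sub>v w) $ i = V k i) \<and>
      (\<forall>i<p. (Gram_y m p (l + 1) G k *\<^sub>v w) $ i = resp m n A B C D k i V z)"
    proof (elim disjE exE conjE bexE)
      fix e a assume e: "e \<noteq> 0" and a: "a \<in> ?N" "\<forall>i<?d. e * v i = a i"
      then obtain h where h: "a = (\<lambda>a. \<Sum>b<?d. G $$ (a, b) * h b)" by blast
      define w where "w = vec ?d (\<lambda>b. h b / e)"
      have wc: "w \<in> carrier_vec ?d" by (simp add: w_def)
      have Gw: "(\<Sum>b<?d. G $$ (c, b) * w $ b) = v c" if c: "c < ?d" for c
      proof -
        have "(\<Sum>b<?d. G $$ (c, b) * w $ b) = (\<Sum>b<?d. G $$ (c, b) * h b / e)"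
          by (intro sum.cong refl) (simp add: w_def)
        also have "\<dots> = a c / e" by (simp add: h sum_divide_distrib)
        finally show ?thesis using a(2) c e by (metis nonzero_mult_div_cancel_left)
      qed
      show ?thesis
      proof (intro bexI[of _ w] allI impI conjI)
        show "w \<in> carrier_vec ((l + 1) * (m + p))" unfolding d by (rule wc)
        fix k assume k: "k < l + 1"
        show "(Gram_u m G k *\<^sub>v w) $ i = V k i" if i: "i < m" for i
          unfolding Gu(1)[OF k i wc] Gw[OF ku[OF k i]] by (rule vu[OF k i])
        show "(Gram_y m p (l + 1) G k *\<^sub>v w) $ i = resp m n A B C D k i V z" if i: "i < p" for i
          unfolding Gy(1)[OF k i wc] Gw[OF ky[OF k i]] by (rule vy[OF k i])
      qed
    next
      fix k assume k: "\<forall>a\<in>?N. (\<Sum>i<?d. a i * k i) = 0" "(\<Sum>i<?d. v i * k i) \<noteq> 0"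
      \<comment> \<open>The separating functional is evaluated on the image of its own coefficient
        vector, which gives the quadratic form of the Gramian.\<close>
      have "(\<lambda>a. \<Sum>b<?d. G $$ (a, b) * k b) \<in> ?N" by blast
      then have "(\<Sum>i<?d. (\<Sum>b<?d. G $$ (i, b) * k b) * k i) = 0" by (rule bspec[OF k(1)])
      then have "(\<Sum>i<?d. k i * (\<Sum>b<?d. gram ?d ?\<Lambda> $$ (i, b) * k b)) = 0"
        by (simp add: G_def Gramian_def mult.commute)
      then have ae: "AE t in leb_I. (\<Sum>a<?d. ?\<Lambda> t $ a * k a) = 0"
        using gram_null[of ?d ?\<Lambda> k, OF \<Lambda>L] by blast
      define vu' where "vu' h i = k (h * m + i)" for h i
      define vy' where "vy' h i = k (?L * m + (h * p + i))" for h i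
      have rel: "AE t in leb_I. (\<Sum>h<?L. \<Sum>i<m. vu' h i * U h i t) +
          (\<Sum>h<?L. \<Sum>i<p. vy' h i * resp m n A B C D h i (\<lambda>l j. U l j t) (\<lambda>j. x j t)) = 0"
        using ae Yall
      proof eventually_elim
        case (elim t)
        have "(\<Sum>h<?L. \<Sum>i<m. ?\<Lambda> t $ (h * m + i) * k (h * m + i)) = (\<Sum>h<?L. \<Sum>i<m. vu' h i * U h i t)"
        proof (intro sum.cong refl)
          fix h i assume "h \<in> {..<?L}" "i \<in> {..<m}"
          then show "?\<Lambda> t $ (h * m + i) * k (h * m + i) = vu' h i * U h i t"
            using \<Lambda>u[of h i t] by (simp add: vu'_def)
        qed
        moreover have "(\<Sum>h<?L. \<Sum>i<p. ?\<Lambda> t $ (?L * m + (h * p + i)) * k (?L * m + (h * p + i))) =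
            (\<Sum>h<?L. \<Sum>i<p. vy' h i * resp m n A B C D h i (\<lambda>l j. U l j t) (\<lambda>j. x j t))"
        proof (intro sum.cong refl)
          fix h i assume "h \<in> {..<?L}" "i \<in> {..<p}"
          then show "?\<Lambda> t $ (?L * m + (h * p + i)) * k (?L * m + (h * p + i)) =
              vy' h i * resp m n A B C D h i (\<lambda>l j. U l j t) (\<lambda>j. x j t)"
            using elim(2) \<Lambda>y[of h i t] by (simp add: vy'_def)
        qed
        ultimately show ?case using elim(1) unfolding sum_Lam2_blocks by simp
      qed
      have "(\<Sum>h<?L. \<Sum>i<m. vu' h i * V h i) + (\<Sum>h<?L. \<Sum>i<p. vy' h i * resp m n A B C D h i V z) = 0"
      proof (rule exciting_annihilator[OF S uL U _ _ ctr rel])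
        fix c k i assume "AE t in leb_I. (\<Sum>k<?L + n. \<Sum>i<m. c k i * U k i t) = 0" "k < ?L + n" "i < m"
        then show "c k i = 0" unfolding U_def by (rule persistently_exciting_independent[OF pe])
      qed simp_all
      moreover have "(\<Sum>h<?L. \<Sum>i<m. v (h * m + i) * k (h * m + i)) = (\<Sum>h<?L. \<Sum>i<m. vu' h i * V h i)"
      proof (intro sum.cong refl)
        fix h i assume "h \<in> {..<?L}" "i \<in> {..<m}"
        then show "v (h * m + i) * k (h * m + i) = vu' h i * V h i"
          using vu[of h i] by (simp add: vu'_def)
      qed
      moreover have "(\<Sum>h<?L. \<Sum>i<p. v (?L * m + (h * p + i)) * k (?L * m + (h * p + i))) =
          (\<Sum>h<?L. \<Sum>i<p. vy' h i * resp m n A B C D h i V z)"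
      proof (intro sum.cong refl)
        fix h i assume "h \<in> {..<?L}" "i \<in> {..<p}"
        then show "v (?L * m + (h * p + i)) * k (?L * m + (h * p + i)) = vy' h i * resp m n A B C D h i V z"
          using vy[of h i] by (simp add: vy'_def)
      qed
      ultimately have "(\<Sum>i<?d. v i * k i) = 0"
        unfolding sum_Lam2_blocks by simp
      then show ?thesis using k(2) by contradiction
    qed
  qed
  then show ?thesis by (simp only: G_def)
qed

text \<open>The continuation is taken to be the zero trajectory, whose time shift is again zero;
  both prescribed pieces become almost-everywhere conditions on the whole interval.\<close>

lemma controllable_weak_sol:
  assumes R: "\<And>i. i \<le> r \<Longrightarrow> R i \<in> carrier_mat g (m + p)"
    and ctr: "controllable (kernel_behavior (m + p) g r R)"
    and W: "weak_sol m p g (kernel_rows r R) u0 y0"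
  shows "\<exists>t1 u y. 0 < t1 \<and> t1 < 1 \<and> weak_sol m p g (kernel_rows r R) u y \<and>
      (AE t in leb_I. t \<le> 0 \<longrightarrow> (\<forall>i<m. u i t = u0 i t) \<and> (\<forall>i<p. y i t = y0 i t)) \<and>
      (AE t in leb_I. t1 \<le> t \<longrightarrow> (\<forall>i<m. u i t = 0) \<and> (\<forall>i<p. y i t = 0))"
proof -
  let ?B = "kernel_behavior (m + p) g r R"
  let ?w0 = "join m p u0 y0" and ?w1 = "join m p (\<lambda>i t. 0) (\<lambda>i t. 0)"
  have w0: "?w0 \<in> ?B" using kernel_behavior_join[OF R] W by simp
  have "weak_sol m p g (kernel_rows r R) (\<lambda>i t. 0) (\<lambda>i t. 0)" by (simp add: weak_sol_def)
  then have w1: "?w1 \<in> ?B" using kernel_behavior_join[OF R] by simp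
  obtain t1 w where t1: "t1 \<in> {0<..<1}" and w: "w \<in> ?B"
    and early: "AE t in lebesgue_on {-1<..0}. w t = ?w0 t"
    and late: "AE t in lebesgue_on {t1..<1}. w t = ?w1 (t - t1)"
    using ctr w0 w1 unfolding controllable_def by blast
  have "AE t in lebesgue. t \<in> {-1<..0} \<longrightarrow> w t = ?w0 t"
    using early by (subst (asm) AE_restrict_space_iff) simp_all
  then have "AE t in lebesgue. t \<in> unit_ivl \<longrightarrow> t \<le> 0 \<longrightarrow>
      (\<forall>i<m. w t $ i = u0 i t) \<and> (\<forall>i<p. w t $ (m + i) = y0 i t)"
    by eventually_elim (auto simp: join_index)
  then have 1: "AE t in leb_I. t \<le> 0 \<longrightarrow> (\<forall>i<m. w t $ i = u0 i t) \<and> (\<forall>i<p. w t $ (m + i) = y0 i t)"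
    by (subst AE_restrict_space_iff) simp_all
  have "AE t in lebesgue. t \<in> {t1..<1} \<longrightarrow> w t = ?w1 (t - t1)"
    using late by (subst (asm) AE_restrict_space_iff) simp_all
  then have "AE t in lebesgue. t \<in> unit_ivl \<longrightarrow> t1 \<le> t \<longrightarrow>
      (\<forall>i<m. w t $ i = 0) \<and> (\<forall>i<p. w t $ (m + i) = 0)"
    by eventually_elim (auto simp: join_index)
  then have 2: "AE t in leb_I. t1 \<le> t \<longrightarrow> (\<forall>i<m. w t $ i = 0) \<and> (\<forall>i<p. w t $ (m + i) = 0)"
    by (subst AE_restrict_space_iff) simp_all
  show ?thesis
    by (intro exI[of _ t1] exI[of _ "\<lambda>i t. w t $ i"] exI[of _ "\<lambda>i t. w t $ (m + i)"] conjI 1 2)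
      (use t1 w kernel_behavior_weak_sol[OF R] in auto)
qed

section \<open>Polynomial trajectories\<close>

lemma resp_cong:
  assumes "\<And>h j. h \<le> k \<Longrightarrow> j < m \<Longrightarrow> U h j = U' h j" "\<And>j. j < n \<Longrightarrow> x j = x' j"
  shows "resp m n A B C D k i U x = resp m n A B C D k i U' x'"
  unfolding resp_def using assms by (intro arg_cong2[of _ _ _ _ "(+)"] sum.cong refl) auto

lemma resp_sum:
  "(\<Sum>s\<in>S. resp m n A B C D k i (U s) (x s) * c s) =
    resp m n A B C D k i (\<lambda>h j. \<Sum>s\<in>S. U s h j * c s) (\<lambda>j. \<Sum>s\<in>S. x s j * c s)"
proof -
  have "(\<Sum>s\<in>S. resp m n A B C D k i (U s) (x s) * c s) =
      (\<Sum>s\<in>S. (\<Sum>j<n. row_pow n A (C i) k j * (x s j * c s)) +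
        (\<Sum>h<Suc k. \<Sum>j<m. resp_input n A B C D k i h j * (U s h j * c s)))"
    by (simp only: resp_expand[OF lessI] distrib_right sum_distrib_right mult.assoc)
  also have "\<dots> = (\<Sum>j<n. \<Sum>s\<in>S. row_pow n A (C i) k j * (x s j * c s)) +
      (\<Sum>h<Suc k. \<Sum>j<m. \<Sum>s\<in>S. resp_input n A B C D k i h j * (U s h j * c s))"
    unfolding sum.distrib by (rule arg_cong2[of _ _ _ _ "(+)"], rule sum.swap, rule sum_swap3)
  finally show ?thesis by (simp only: resp_expand[OF lessI] sum_distrib_left)
qed

text \<open>The pointwise counterpart of the weak computation: the term 0 of the new input sum comes
  from B in the state equation, the others are shifted.\<close>

lemma resp_deriv:
  assumes x: "\<And>j. j < n \<Longrightarrow> (x j has_real_derivative (\<Sum>c<n. A j c * x c t) + (\<Sum>c<m. B j c * U 0 c t)) (at t within S)"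
    and U: "\<And>h j. j < m \<Longrightarrow> (U h j has_real_derivative U (Suc h) j t) (at t within S)"
  shows "((\<lambda>t. resp m n A B C D k i (\<lambda>h j. U h j t) (\<lambda>j. x j t)) has_real_derivative
    resp m n A B C D (Suc k) i (\<lambda>h j. U h j t) (\<lambda>j. x j t)) (at t within S)"
proof -
  let ?r = "row_pow n A (C i) k"
  have "((\<lambda>t. resp m n A B C D k i (\<lambda>h j. U h j t) (\<lambda>j. x j t)) has_real_derivative
      (\<Sum>j<n. ?r j * ((\<Sum>c<n. A j c * x c t) + (\<Sum>c<m. B j c * U 0 c t))) +
      (\<Sum>l<k. \<Sum>j<m. markov n A B (C i) k l j * U (Suc l) j t) + (\<Sum>j<m. D i j * U (Suc k) j t)) (at t within S)"
    unfolding resp_def by (intro DERIV_add DERIV_sum DERIV_cmult x U) auto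
  moreover have "(\<Sum>j<n. ?r j * ((\<Sum>c<n. A j c * x c t) + (\<Sum>c<m. B j c * U 0 c t))) =
      (\<Sum>j<n. row_pow n A (C i) (Suc k) j * x j t) + (\<Sum>c<m. markov n A B (C i) (Suc k) 0 c * U 0 c t)"
  proof -
    have "(\<Sum>j<n. ?r j * (\<Sum>c<m. B j c * U 0 c t)) = (\<Sum>c<m. \<Sum>j<n. ?r j * (B j c * U 0 c t))"
      unfolding sum_distrib_left by (rule sum.swap)
    also have "\<dots> = (\<Sum>c<m. markov n A B (C i) (Suc k) 0 c * U 0 c t)"
      by (simp add: markov_def sum_distrib_right mult.assoc)
    finally show ?thesis by (simp only: distrib_left sum.distrib row_pow_state)
  qed
  moreover have "(\<Sum>l<Suc k. \<Sum>j<m. markov n A B (C i) (Suc k) l j * U l j t) =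
      (\<Sum>j<m. markov n A B (C i) (Suc k) 0 j * U 0 j t) + (\<Sum>l<k. \<Sum>j<m. markov n A B (C i) k l j * U (Suc l) j t)"
    unfolding sum.lessThan_Suc_shift by (simp add: markov_def)
  ultimately show ?thesis by (simp only: resp_def add.assoc)
qed

lemma coeff_pderiv_pow_zero:
  assumes "\<And>j. j \<ge> N \<Longrightarrow> coeff P j = (0 :: real)" "j \<ge> N"
  shows "coeff ((pderiv ^^ k) P) j = 0"
  using assms by (induction k arbitrary: j) (auto simp: coeff_pderiv)

text \<open>The dual form of the kernel property: if a row of C A^l were outside the span of the
  rows of C A^k with k < l, some state would be annihilated by all the latter but not by the
  former.\<close>

lemma lag_relation:
  assumes A: "A \<in> carrier_mat n n" and C: "C \<in> carrier_mat p n" and l: "l = lag_of_pair n A C"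
  shows "\<exists>M. \<forall>i<p. \<forall>j<n. row_pow n (ent A) (ent C i) l j =
    (\<Sum>k<l. \<Sum>i'<p. M i k i' * row_pow n (ent A) (ent C i') k j)"
proof -
  let ?r = "\<lambda>i k. row_pow n (ent A) (ent C i) k"
  let ?N = "range (\<lambda>h j. \<Sum>k<l. \<Sum>i'<p. h k i' * ?r i' k j)"
  have "\<exists>h. \<forall>j<n. ?r i l j = (\<Sum>k<l. \<Sum>i'<p. h k i' * ?r i' k j)" if i: "i < p" for i
  proof -
    have "(\<exists>e. e \<noteq> 0 \<and> (\<exists>a\<in>?N. \<forall>j<n. e * ?r i l j = a j)) \<or>
      (\<exists>x. (\<forall>a\<in>?N. (\<Sum>j<n. a j * x j) = 0) \<and> (\<Sum>j<n. ?r i l j * x j) \<noteq> 0)"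
    proof (rule submodule_separation)
      show "(\<lambda>j. 0) \<in> ?N" by (rule range_eqI[of _ _ "\<lambda>k i. 0"]) simp
      fix a b r s assume "a \<in> ?N" "b \<in> ?N"
      then obtain h h' where "a = (\<lambda>j. \<Sum>k<l. \<Sum>i'<p. h k i' * ?r i' k j)"
        "b = (\<lambda>j. \<Sum>k<l. \<Sum>i'<p. h' k i' * ?r i' k j)"
        by blast
      then show "(\<lambda>j. r * a j + s * b j) \<in> ?N"
        by (intro range_eqI[of _ _ "\<lambda>k i. r * h k i + s * h' k i"])
          (simp add: fun_eq_iff sum_distrib_left sum.distrib distrib_right mult.assoc)
    qed
    then show ?thesis
    proof (elim disjE exE conjE bexE)
      fix e a assume e: "e \<noteq> 0" and a: "a \<in> ?N" "\<forall>j<n. e * ?r i l j = a j"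
      then obtain h where h: "a = (\<lambda>j. \<Sum>k<l. \<Sum>i'<p. h k i' * ?r i' k j)" by blast
      have "?r i l j = (\<Sum>k<l. \<Sum>i'<p. h k i' / e * ?r i' k j)" if j: "j < n" for j
      proof -
        have "(\<Sum>k<l. \<Sum>i'<p. h k i' / e * ?r i' k j) = a j / e"
          by (simp add: h sum_divide_distrib)
        also have "\<dots> = ?r i l j"
          using a(2)[rule_format, OF j] e by (metis nonzero_mult_div_cancel_left)
        finally show ?thesis by (rule sym)
      qed
      then show ?thesis by (intro exI[of _ "\<lambda>k i'. h k i' / e"]) blast
    next
      fix x assume x: "\<forall>a\<in>?N. (\<Sum>j<n. a j * x j) = 0" and nz: "(\<Sum>j<n. ?r i l j * x j) \<noteq> 0"
      have "(\<Sum>j<n. ?r i l j * x j) = 0"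
      proof (rule lag_kernel[OF A C l _ i])
        fix k0 i0 assume k0: "k0 < l" and i0: "i0 < p"
        let ?h = "\<lambda>k i'. if k = k0 then if i' = i0 then 1 else 0 else (0 :: real)"
        have "(\<Sum>k<l. \<Sum>i'<p. ?h k i' * ?r i' k j) = ?r i0 k0 j" for j
        proof -
          have "(\<Sum>k<l. \<Sum>i'<p. ?h k i' * ?r i' k j) = (\<Sum>k<l. if k = k0 then ?r i0 k0 j else 0)"
            using i0 by (intro sum.cong refl) (auto simp: if_distrib[of "\<lambda>c. c * _"] cong: if_cong)
          then show ?thesis using k0 by simp
        qed
        then have "?r i0 k0 \<in> ?N" by (intro range_eqI[of _ _ ?h]) auto
        then show "(\<Sum>j<n. ?r i0 k0 j * x j) = 0" by (rule bspec[OF x])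
      qed
      then show ?thesis using nz by contradiction
    qed
  qed
  then have "\<forall>i. \<exists>h. i < p \<longrightarrow> (\<forall>j<n. ?r i l j = (\<Sum>k<l. \<Sum>i'<p. h k i' * ?r i' k j))" by blast
  then obtain M where "\<forall>i. i < p \<longrightarrow> (\<forall>j<n. ?r i l j = (\<Sum>k<l. \<Sum>i'<p. M i k i' * ?r i' k j))"
    using choice[of "\<lambda>i h. i < p \<longrightarrow> (\<forall>j<n. ?r i l j = (\<Sum>k<l. \<Sum>i'<p. h k i' * ?r i' k j))"] by blast
  then show ?thesis by blast
qed

section \<open>Differentiation in Legendre coefficients\<close>

lemma legendre_D_index:
  assumes r: "r < d" and f: "\<And>j. j \<ge> N \<Longrightarrow> f j $ r = 0"
  shows "legendre_D d f i $ r = real (2 * i + 1) * (\<Sum>j | j < N \<and> j \<ge> i + 1 \<and> odd (i + j). f j $ r)"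
proof -
  have "(\<Sum>\<^sub>\<infinity>j | j \<ge> i + 1 \<and> odd (i + j). f j $ r) = (\<Sum>\<^sub>\<infinity>j | j < N \<and> j \<ge> i + 1 \<and> odd (i + j). f j $ r)"
    by (rule infsum_cong_neutral) (auto intro!: f)
  also have "\<dots> = (\<Sum>j | j < N \<and> j \<ge> i + 1 \<and> odd (i + j). f j $ r)"
    by (rule infsum_finite) simp
  finally show ?thesis unfolding legendre_D_def by (simp only: index_vec[OF r])
qed

text \<open>For finitely supported sequences \<open>legendre_D\<close> computes the coefficients of
  the derivative, and coefficients below N are determined by the polynomial. From N on both sides
  vanish, since no index j with i < j < N is left.\<close>

lemma legendre_D_iff:
  assumes f: "\<And>j. f j \<in> carrier_vec d" "\<And>j. j \<ge> N \<Longrightarrow> f j = 0\<^sub>v d"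
    and h: "\<And>j. h j \<in> carrier_vec d" "\<And>j. j \<ge> N \<Longrightarrow> h j = 0\<^sub>v d"
  shows "legendre_D d f = h \<longleftrightarrow> (\<forall>r<d. pderiv (\<Sum>j<N. Polynomial.smult (f j $ r) (legendre j)) =
    (\<Sum>j<N. Polynomial.smult (h j $ r) (legendre j)))"
proof -
  have D: "legendre_D d f i $ r = real (2 * i + 1) * (\<Sum>j | j < N \<and> j \<ge> i + 1 \<and> odd (i + j). f j $ r)" if "r < d" for i r
    using that f by (intro legendre_D_index) auto
  have P: "pderiv (\<Sum>j<N. Polynomial.smult (f j $ r) (legendre j)) =
      (\<Sum>j<N. Polynomial.smult (legendre_D d f j $ r) (legendre j))" if "r < d" for r
    unfolding pderiv_legendre_sum by (simp only: D[OF that])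
  show ?thesis
  proof (intro iffI allI impI)
    fix r assume "legendre_D d f = h" "r < d"
    then show "pderiv (\<Sum>j<N. Polynomial.smult (f j $ r) (legendre j)) = (\<Sum>j<N. Polynomial.smult (h j $ r) (legendre j))"
      using P by simp
  next
    assume eq: "\<forall>r<d. pderiv (\<Sum>j<N. Polynomial.smult (f j $ r) (legendre j)) = (\<Sum>j<N. Polynomial.smult (h j $ r) (legendre j))"
    have "legendre_D d f i $ r = h i $ r" if r: "r < d" for i r
    proof (cases "i < N")
      case True
      have "(\<Sum>j<N. Polynomial.smult (legendre_D d f j $ r) (legendre j)) = (\<Sum>j<N. Polynomial.smult (h j $ r) (legendre j))"
        using P[OF r] eq r by simp
      then show ?thesis
        using legendre_coeff_sum[OF True, of "\<lambda>j. legendre_D d f j $ r"] legendre_coeff_sum[OF True, of "\<lambda>j. h j $ r"]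
        by simp
    next
      case False
      then have "{j. j < N \<and> j \<ge> i + 1 \<and> odd (i + j)} = {}" by auto
      then have "legendre_D d f i $ r = 0" unfolding D[OF r] by (simp only: sum.empty mult_zero_right)
      then show ?thesis using h(2)[of i] False r by simp
    qed
    then have "legendre_D d f i = h i" for i
      using h(1)[of i] by (intro eq_vecI) (auto simp: legendre_D_def)
    then show "legendre_D d f = h" by (rule ext)
  qed
qed

locale driven_system = iso_system m p g n R A B C D + data_system m p n l A B C D \<Gamma>
  for m p g n l :: nat and R :: "nat \<Rightarrow> nat \<Rightarrow> real poly" and A B C D :: "nat \<Rightarrow> nat \<Rightarrow> real" and \<Gamma> :: "real mat" +
  fixes M :: "nat \<Rightarrow> nat \<Rightarrow> nat \<Rightarrow> real"
  assumes lag_rows: "\<And>i j. i < p \<Longrightarrow> j < n \<Longrightarrow>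
    row_pow n A (C i) l j = (\<Sum>k<l. \<Sum>i'<p. M i k i' * row_pow n A (C i') k j)"
begin

text \<open>Candidate for the k-th derivative of input i. That these polynomials are derivatives of
  one another is a constraint and not part of the definition.\<close>

definition usig :: "nat \<Rightarrow> (nat \<Rightarrow> real vec) \<Rightarrow> nat \<Rightarrow> nat \<Rightarrow> real poly" where
  "usig N G k i = (\<Sum>s<N. Polynomial.smult ((Gram_u m \<Gamma> k *\<^sub>v G s) $ i) (legendre s))"

definition ysig :: "nat \<Rightarrow> (nat \<Rightarrow> real vec) \<Rightarrow> nat \<Rightarrow> nat \<Rightarrow> real poly" where
  "ysig N G k i = (\<Sum>s<N. Polynomial.smult ((Gram_y m p (l + 1) \<Gamma> k *\<^sub>v G s) $ i) (legendre s))"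

text \<open>The coefficient sequence describes the polynomials together with their derivatives up to
  order l; the zero tail is the support constraint of the data-driven problem.\<close>

definition coupled :: "nat \<Rightarrow> (nat \<Rightarrow> real poly) \<Rightarrow> (nat \<Rightarrow> real poly) \<Rightarrow> (nat \<Rightarrow> real vec) \<Rightarrow> bool" where
  "coupled N Pu Py G \<longleftrightarrow> (\<forall>s. G s \<in> carrier_vec ((l + 1) * (m + p))) \<and> (\<forall>s\<ge>N. G s = 0\<^sub>v ((l + 1) * (m + p))) \<and>
     (\<forall>k\<le>l. (\<forall>i<m. (pderiv ^^ k) (Pu i) = usig N G k i) \<and> (\<forall>i<p. (pderiv ^^ k) (Py i) = ysig N G k i))"

text \<open>At each index the Legendre coefficients of all derivatives, together with those of the
  state, form a compatible jet, because integration against a Legendre polynomial commutes with the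
  linear response. Such a jet lies in the image of \<open>\<Gamma>\<close>. The state may be any
  continuous function, as only its Legendre coefficients enter.\<close>

lemma coupled_exists:
  assumes W: "weak_sol m p g R (\<lambda>i. poly (Pu i)) (\<lambda>i. poly (Py i))"
    and N: "\<And>i j. i < m \<Longrightarrow> j \<ge> N \<Longrightarrow> coeff (Pu i) j = 0" "\<And>i j. i < p \<Longrightarrow> j \<ge> N \<Longrightarrow> coeff (Py i) j = 0"
  shows "\<exists>G. coupled N Pu Py G"
proof -
  let ?q = "(l + 1) * (m + p)"
  obtain x where S: "state_sol m p n A B C D (\<lambda>i. poly (Pu i)) (\<lambda>i. poly (Py i)) x"
    using weak_sol_state[OF W] by blast
  have pL: "poly P \<in> L2" for P by (intro smooth_L2 smooth_on_poly)
  have xL: "x j \<in> L2" if "j < n" for j using continuous_L2[OF state_continuous[OF S that]] .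
  let ?u = "\<lambda>k i. (pderiv ^^ k) (Pu i)" and ?y = "\<lambda>k i. (pderiv ^^ k) (Py i)"
  have ae: "AE t in leb_I. poly (?y k i) t = resp m n A B C D k i (\<lambda>h j. poly (?u h j) t) (\<lambda>j. x j t)"
    and rL: "(\<lambda>t. resp m n A B C D k i (\<lambda>h j. poly (?u h j) t) (\<lambda>j. x j t)) \<in> L2"
    if k: "k < l + 1" and i: "i < p" for k i
  proof -
    have 1: "has_weak_deriv k (poly (Py i)) (\<lambda>t. resp m n A B C D k i (\<lambda>h j. poly (?u h j) t) (\<lambda>j. x j t))"
      by (rule output_weak_deriv[OF S pL i pL, where K = l]) (use k has_weak_deriv_poly in auto)
    show "AE t in leb_I. poly (?y k i) t = resp m n A B C D k i (\<lambda>h j. poly (?u h j) t) (\<lambda>j. x j t)"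
      by (rule has_weak_deriv_unique[OF has_weak_deriv_poly 1])
    show "(\<lambda>t. resp m n A B C D k i (\<lambda>h j. poly (?u h j) t) (\<lambda>j. x j t)) \<in> L2"
      by (rule has_weak_deriv_L2[OF 1])
  qed
  define \<gamma> where "\<gamma> s = Polynomial.smult (1 / (\<integral>t. poly (legendre s) t * poly (legendre s) t \<partial>leb_I)) (legendre s)" for s
  have coef: "legendre_coeff f s = (\<integral>t. f t * poly (\<gamma> s) t \<partial>leb_I)" for f s
    by (simp add: legendre_coeff_def \<gamma>_def)
  have yc: "legendre_coeff (poly (?y k i)) s =
      resp m n A B C D k i (\<lambda>h j. legendre_coeff (poly (?u h j)) s) (\<lambda>j. legendre_coeff (x j) s)"
    if k: "k < l + 1" and i: "i < p" for k i s
  proof -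
    have "(\<integral>t. poly (?y k i) t * poly (\<gamma> s) t \<partial>leb_I) =
        (\<integral>t. resp m n A B C D k i (\<lambda>h j. poly (?u h j) t) (\<lambda>j. x j t) * poly (\<gamma> s) t \<partial>leb_I)"
    proof (rule integral_cong_AE)
      show "AE t in leb_I. poly (?y k i) t * poly (\<gamma> s) t =
          resp m n A B C D k i (\<lambda>h j. poly (?u h j) t) (\<lambda>j. x j t) * poly (\<gamma> s) t"
        using ae[OF k i] by eventually_elim simp
    qed (use pL rL[OF k i] in \<open>auto intro!: borel_measurable_times L2_measurable\<close>)
    also have "\<dots> = resp m n A B C D k i (\<lambda>h j. \<integral>t. poly (?u h j) t * poly (\<gamma> s) t \<partial>leb_I) (\<lambda>j. \<integral>t. x j t * poly (\<gamma> s) t \<partial>leb_I)"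
      by (rule resp_integral[OF k pL xL pL])
    finally show ?thesis unfolding coef .
  qed
  have "\<exists>v\<in>carrier_vec ?q. \<forall>k<l + 1. (\<forall>i<m. (Gram_u m \<Gamma> k *\<^sub>v v) $ i = legendre_coeff (poly (?u k i)) s) \<and>
      (\<forall>i<p. (Gram_y m p (l + 1) \<Gamma> k *\<^sub>v v) $ i = legendre_coeff (poly (?y k i)) s)" for s
    using image_of_jet[of "\<lambda>h j. legendre_coeff (poly (?u h j)) s" "\<lambda>j. legendre_coeff (x j) s"] yc by simp
  then obtain v where v: "\<And>s. v s \<in> carrier_vec ?q"
    "\<And>s k i. k < l + 1 \<Longrightarrow> i < m \<Longrightarrow> (Gram_u m \<Gamma> k *\<^sub>v v s) $ i = legendre_coeff (poly (?u k i)) s"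
    "\<And>s k i. k < l + 1 \<Longrightarrow> i < p \<Longrightarrow> (Gram_y m p (l + 1) \<Gamma> k *\<^sub>v v s) $ i = legendre_coeff (poly (?y k i)) s"
    by metis
  define G where "G s = (if s < N then v s else 0\<^sub>v ?q)" for s
  have "coupled N Pu Py G"
    unfolding coupled_def
  proof (intro conjI allI impI)
    show "G s \<in> carrier_vec ?q" for s using v(1) by (simp add: G_def)
    show "G s = 0\<^sub>v ?q" if "s \<ge> N" for s using that by (simp add: G_def)
    fix k assume "k \<le> l"
    then have k: "k < l + 1" by simp
    show "?u k i = usig N G k i" if i: "i < m" for i
    proof -
      have "?u k i = (\<Sum>s<N. Polynomial.smult (legendre_coeff (poly (?u k i)) s) (legendre s))"
        using coeff_pderiv_pow_zero[of N "Pu i"] N(1)[OF i] by (intro poly_legendre_expansion) blast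
      also have "\<dots> = usig N G k i"
        unfolding usig_def by (intro sum.cong refl) (simp add: G_def v(2)[OF k i])
      finally show ?thesis .
    qed
    show "?y k i = ysig N G k i" if i: "i < p" for i
    proof -
      have "?y k i = (\<Sum>s<N. Polynomial.smult (legendre_coeff (poly (?y k i)) s) (legendre s))"
        using coeff_pderiv_pow_zero[of N "Py i"] N(2)[OF i] by (intro poly_legendre_expansion) blast
      also have "\<dots> = ysig N G k i"
        unfolding ysig_def using v(3)[OF k i] by (intro sum.cong refl) (simp add: G_def)
      finally show ?thesis .
    qed
  qed
  then show ?thesis by blast
qed

text \<open>Every coefficient vector comes with a state vector explaining its output part; the
  Legendre series of these vectors is a polynomial in the role of the state.\<close>

lemma coupled_resp:
  assumes c: "coupled N Pu Py G"
  shows "\<exists>X :: nat \<Rightarrow> real poly. \<forall>k\<le>l. \<forall>i<p. \<forall>t. poly ((pderiv ^^ k) (Py i)) t =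
    resp m n A B C D k i (\<lambda>h j. poly ((pderiv ^^ h) (Pu j)) t) (\<lambda>j. poly (X j) t)"
proof -
  have Gc: "G s \<in> carrier_vec ((l + 1) * (m + p))" for s using c by (simp add: coupled_def)
  have "\<exists>z. \<forall>k<l + 1. \<forall>i<p. (Gram_y m p (l + 1) \<Gamma> k *\<^sub>v G s) $ i =
        resp m n A B C D k i (\<lambda>h j. (Gram_u m \<Gamma> h *\<^sub>v G s) $ j) z" for s
    by (rule jet_of_image[OF Gc])
  then obtain z where z: "\<And>s k i. k < l + 1 \<Longrightarrow> i < p \<Longrightarrow> (Gram_y m p (l + 1) \<Gamma> k *\<^sub>v G s) $ i =
        resp m n A B C D k i (\<lambda>h j. (Gram_u m \<Gamma> h *\<^sub>v G s) $ j) (z s)" by metis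
  define X where "X j = (\<Sum>s<N. Polynomial.smult (z s j) (legendre s))" for j
  have "poly ((pderiv ^^ k) (Py i)) t =
    resp m n A B C D k i (\<lambda>h j. poly ((pderiv ^^ h) (Pu j)) t) (\<lambda>j. poly (X j) t)"
    if k: "k \<le> l" and i: "i < p" for k i t
  proof -
    have k': "k < l + 1" using k by simp
    have "poly ((pderiv ^^ k) (Py i)) t = poly (ysig N G k i) t"
      using c k i by (simp add: coupled_def)
    also have "\<dots> = (\<Sum>s<N. (Gram_y m p (l + 1) \<Gamma> k *\<^sub>v G s) $ i * poly (legendre s) t)"
      by (simp add: ysig_def poly_sum)
    also have "\<dots> = (\<Sum>s<N. resp m n A B C D k i (\<lambda>h j. (Gram_u m \<Gamma> h *\<^sub>v G s) $ j) (z s) * poly (legendre s) t)"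
      by (simp only: z[OF k' i])
    also have "\<dots> = resp m n A B C D k i (\<lambda>h j. \<Sum>s<N. (Gram_u m \<Gamma> h *\<^sub>v G s) $ j * poly (legendre s) t)
        (\<lambda>j. \<Sum>s<N. z s j * poly (legendre s) t)"
      by (rule resp_sum)
    also have "\<dots> = resp m n A B C D k i (\<lambda>h j. poly ((pderiv ^^ h) (Pu j)) t) (\<lambda>j. poly (X j) t)"
    proof (rule resp_cong)
      fix h j assume "h \<le> k" "j < m"
      then have "(pderiv ^^ h) (Pu j) = usig N G h j" using c k by (simp add: coupled_def)
      then show "(\<Sum>s<N. (Gram_u m \<Gamma> h *\<^sub>v G s) $ j * poly (legendre s) t) = poly ((pderiv ^^ h) (Pu j)) t"
        by (simp add: usig_def poly_sum)
    qed (simp add: X_def poly_sum)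
    finally show ?thesis .
  qed
  then show ?thesis by blast
qed

text \<open>The polynomial state of the preceding lemma need not satisfy the state equation. Its defect
  against the genuine state response is unobservable up to order \<open>l\<close>: the output defects solve
  a homogeneous linear system, which closes up by the definition of the lag.\<close>

lemma coupled_weak_sol:
  assumes c: "coupled N Pu Py G"
  shows "weak_sol m p g R (\<lambda>i. poly (Pu i)) (\<lambda>i. poly (Py i))"
proof -
  let ?U = "\<lambda>h j t. poly ((pderiv ^^ h) (Pu j)) t"
  obtain X where X: "\<And>k i t. k \<le> l \<Longrightarrow> i < p \<Longrightarrow> poly ((pderiv ^^ k) (Py i)) t =
      resp m n A B C D k i (\<lambda>h j. ?U h j t) (\<lambda>j. poly (X j) t)"
    using coupled_resp[OF c] by blast
  \<comment> \<open>Starting the genuine state response at the value of \<open>X\<close> makes all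
    output defects vanish at -1.\<close>
  obtain z where z: "\<And>i. i < n \<Longrightarrow> smooth_on {-1..1} (z i)" "\<And>i. i < n \<Longrightarrow> z i (-1) = poly (X i) (-1)"
    and zd: "\<And>i t. i < n \<Longrightarrow> t \<in> {-1..1} \<Longrightarrow>
      (z i has_real_derivative (\<Sum>j<n. A i j * z j t) + (\<Sum>j<m. B i j * poly (Pu j) t)) (at t within {-1..1})"
    by (rule linear_ode_smooth_exists[of n "\<lambda>i t. \<Sum>j<m. B i j * poly (Pu j) t" "\<lambda>i. poly (X i) (-1)" A],
      intro smooth_on_sum smooth_on_mult smooth_on_const smooth_on_poly, rule that)
  let ?y = "\<lambda>i t. (\<Sum>j<n. C i j * z j t) + (\<Sum>j<m. D i j * poly (Pu j) t)"
  have "smooth_state_sol m p n A B C D (\<lambda>i. poly (Pu i)) ?y z"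
    unfolding smooth_state_sol_def using z zd by blast
  then have W: "weak_sol m p g R (\<lambda>i. poly (Pu i)) ?y"
    by (subst iso) (use z(1) in \<open>auto intro!: smooth_on_add smooth_on_sum smooth_on_mult\<close>)
  define \<delta> where "\<delta> k i t = poly ((pderiv ^^ k) (Py i)) t - resp m n A B C D k i (\<lambda>h j. ?U h j t) (\<lambda>j. z j t)" for k i t
  have \<delta>: "\<delta> k i t = (\<Sum>j<n. row_pow n A (C i) k j * (poly (X j) t - z j t))" if "k \<le> l" "i < p" for k i t
    unfolding \<delta>_def X[OF that] by (simp add: resp_def right_diff_distrib sum_subtractf)
  have \<delta>d: "(\<delta> k i has_real_derivative \<delta> (Suc k) i t) (at t within {-1..1})" if "t \<in> {-1..1}" for k i t
    unfolding \<delta>_def[abs_def]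
  proof (rule DERIV_diff)
    have dp: "(poly ((pderiv ^^ h) P) has_real_derivative poly ((pderiv ^^ Suc h) P) t) (at t within {-1..1})" for h P
      using DERIV_subset[OF poly_DERIV] by simp
    then show "(poly ((pderiv ^^ k) (Py i)) has_real_derivative poly ((pderiv ^^ Suc k) (Py i)) t) (at t within {-1..1})" .
    show "((\<lambda>t. resp m n A B C D k i (\<lambda>h j. ?U h j t) (\<lambda>j. z j t)) has_real_derivative
        resp m n A B C D (Suc k) i (\<lambda>h j. ?U h j t) (\<lambda>j. z j t)) (at t within {-1..1})"
    proof (rule resp_deriv)
      show "(z j has_real_derivative (\<Sum>c<n. A j c * z c t) + (\<Sum>c<m. B j c * ?U 0 c t)) (at t within {-1..1})"
        if "j < n" for j using zd[OF that \<open>t \<in> {-1..1}\<close>] by simp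
    qed (rule dp)
  qed
  \<comment> \<open>The defects of all orders are derivatives of each other, but only up to order l
    are they rows applied to \<open>X\<close> minus \<open>z\<close>; at order l the lag relation
    closes the system.\<close>
  have \<delta>l: "\<delta> l i t = (\<Sum>k<l. \<Sum>i'<p. M i k i' * \<delta> k i' t)" if i: "i < p" for i t
  proof -
    have "\<delta> l i t = (\<Sum>j<n. (\<Sum>k<l. \<Sum>i'<p. M i k i' * row_pow n A (C i') k j) * (poly (X j) t - z j t))"
      unfolding \<delta>[OF order.refl i] by (intro sum.cong refl) (simp add: lag_rows[OF i])
    also have "\<dots> = (\<Sum>j<n. \<Sum>k<l. \<Sum>i'<p. M i k i' * (row_pow n A (C i') k j * (poly (X j) t - z j t)))"
      by (simp only: sum_distrib_right mult.assoc)
    also have "\<dots> = (\<Sum>k<l. \<Sum>i'<p. \<Sum>j<n. M i k i' * (row_pow n A (C i') k j * (poly (X j) t - z j t)))"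
      by (rule sum_swap3)
    also have "\<dots> = (\<Sum>k<l. \<Sum>i'<p. M i k i' * \<delta> k i' t)"
      by (intro sum.cong refl) (simp add: \<delta> sum_distrib_left)
    finally show ?thesis .
  qed
  let ?J = "{..<l} \<times> {..<p}"
  \<comment> \<open>Block companion matrix: the derivative of a defect of order k is the one of
    order k + 1, and for k + 1 = l the lag relation expresses it by lower orders.\<close>
  let ?M = "\<lambda>(k, i) (k', i'). if Suc k < l then if k' = Suc k \<and> i' = i then 1 else 0 else M i k' i'"
  have zero: "(\<lambda>(k, i). \<delta> k i) a t = 0" if a: "a \<in> ?J" and t: "t \<in> {-1..1}" for a t
  proof (rule linear_ode_zero[of ?J _ _ "\<lambda>(k, i). \<delta> k i" ?M "-1", OF _ _ _ _ a t])
    show "finite ?J" by simp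
    show "-1 \<in> {-1..1::real}" by simp
    show "(\<lambda>(k, i). \<delta> k i) a (-1) = 0" if a: "a \<in> ?J" for a
      using a by (cases a) (auto simp: \<delta> z(2))
    fix a and t :: real assume "a \<in> ?J" and t: "t \<in> {-1..1}"
    then obtain k i where a: "a = (k, i)" "k < l" "i < p" by auto
    have "\<delta> (Suc k) i t = (\<Sum>b\<in>?J. ?M (k, i) b * (\<lambda>(k, i). \<delta> k i) b t)"
    proof (cases "Suc k < l")
      case True
      have "(\<Sum>b\<in>?J. ?M (k, i) b * (\<lambda>(k, i). \<delta> k i) b t) = (\<Sum>b\<in>?J. if b = (Suc k, i) then \<delta> (Suc k) i t else 0)"
        using True by (intro sum.cong refl) (auto split: if_splits)
      also have "\<dots> = \<delta> (Suc k) i t" using True a by simp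
      finally show ?thesis by (rule sym)
    next
      case False
      then have k: "Suc k = l" using a by simp
      have "\<delta> l i t = (\<Sum>(k', i')\<in>?J. M i k' i' * \<delta> k' i' t)"
        unfolding \<delta>l[OF a(3)] by (rule sum.cartesian_product)
      then show ?thesis unfolding k using False k by (auto simp: split_beta' cong: sum.cong)
    qed
    then show "((\<lambda>(k, i). \<delta> k i) a has_real_derivative (\<Sum>b\<in>?J. ?M a b * (\<lambda>(k, i). \<delta> k i) b t)) (at t within {-1..1})"
      using \<delta>d[OF t, of k i] unfolding a by simp
  qed
  have "poly (Py i) t = ?y i t" if i: "i < p" and t: "t \<in> unit_ivl" for i t
  proof -
    \<comment> \<open>For l = 0 the system of defects is empty; then the lag relation is an empty
      sum and gives the claim at once.\<close>
    have "\<delta> 0 i t = 0"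
    proof (cases "l = 0")
      case True
      then show ?thesis using \<delta>l[OF i, of t] by simp
    next
      case False
      then show ?thesis using zero[of "(0, i)" t] i t by simp
    qed
    then show ?thesis by (simp add: \<delta>_def resp_def)
  qed
  then show ?thesis
    using W weak_sol_cong[of m "\<lambda>i. poly (Pu i)" "\<lambda>i. poly (Pu i)" p "\<lambda>i. poly (Py i)" ?y g R] by blast
qed

lemma Gram_carrier:
  "Gram_u m \<Gamma> k \<in> carrier_mat m ((l + 1) * (m + p))" "Gram_y m p (l + 1) \<Gamma> k \<in> carrier_mat p ((l + 1) * (m + p))"
  using \<Gamma>_carrier by (auto simp: Gram_u_def Gram_y_def row_block_def)

text \<open>The constraints relate neighbouring derivative orders; induction on the order relates
  each of them to the polynomials of order 0.\<close>

lemma coupled_iff_legendre_D: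
  assumes G: "\<And>s. G s \<in> carrier_vec ((l + 1) * (m + p))" "\<And>s. s \<ge> N \<Longrightarrow> G s = 0\<^sub>v ((l + 1) * (m + p))"
  shows "(\<forall>k\<in>{1..l}. legendre_D m (\<lambda>i. Gram_u m \<Gamma> (k - 1) *\<^sub>v G i) = (\<lambda>i. Gram_u m \<Gamma> k *\<^sub>v G i) \<and>
      legendre_D p (\<lambda>i. Gram_y m p (l + 1) \<Gamma> (k - 1) *\<^sub>v G i) = (\<lambda>i. Gram_y m p (l + 1) \<Gamma> k *\<^sub>v G i)) \<longleftrightarrow>
    coupled N (usig N G 0) (ysig N G 0) G"
proof -
  have c: "Gram_u m \<Gamma> k *\<^sub>v G s \<in> carrier_vec m" "Gram_y m p (l + 1) \<Gamma> k *\<^sub>v G s \<in> carrier_vec p" for k s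
    using Gram_carrier G(1) by (auto intro: mult_mat_vec_carrier)
  have z: "Gram_u m \<Gamma> k *\<^sub>v G s = 0\<^sub>v m" "Gram_y m p (l + 1) \<Gamma> k *\<^sub>v G s = 0\<^sub>v p" if "s \<ge> N" for k s
    unfolding G(2)[OF that] using Gram_carrier[of k] by auto
  have u: "legendre_D m (\<lambda>i. Gram_u m \<Gamma> (k - 1) *\<^sub>v G i) = (\<lambda>i. Gram_u m \<Gamma> k *\<^sub>v G i) \<longleftrightarrow>
      (\<forall>i<m. pderiv (usig N G (k - 1) i) = usig N G k i)" for k
    unfolding usig_def by (rule legendre_D_iff) (use c z in auto)
  have y: "legendre_D p (\<lambda>i. Gram_y m p (l + 1) \<Gamma> (k - 1) *\<^sub>v G i) = (\<lambda>i. Gram_y m p (l + 1) \<Gamma> k *\<^sub>v G i) \<longleftrightarrow>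
      (\<forall>i<p. pderiv (ysig N G (k - 1) i) = ysig N G k i)" for k
    unfolding ysig_def by (rule legendre_D_iff) (use c z in auto)
  have "(\<forall>k\<in>{1..l}. (\<forall>i<m. pderiv (usig N G (k - 1) i) = usig N G k i) \<and>
      (\<forall>i<p. pderiv (ysig N G (k - 1) i) = ysig N G k i)) \<longleftrightarrow>
    (\<forall>k\<le>l. (\<forall>i<m. (pderiv ^^ k) (usig N G 0 i) = usig N G k i) \<and>
      (\<forall>i<p. (pderiv ^^ k) (ysig N G 0 i) = ysig N G k i))" (is "?l \<longleftrightarrow> ?r")
  proof
    assume l: ?l
    show ?r
    proof (intro allI impI)
      fix k show "k \<le> l \<Longrightarrow> (\<forall>i<m. (pderiv ^^ k) (usig N G 0 i) = usig N G k i) \<and>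
        (\<forall>i<p. (pderiv ^^ k) (ysig N G 0 i) = ysig N G k i)"
      proof (induction k)
        case (Suc k)
        then have "Suc k \<in> {1..l}" by simp
        from l[rule_format, OF this] Suc show ?case by simp
      qed simp
    qed
  next
    assume r: ?r
    show ?l
    proof
      fix k assume "k \<in> {1..l}"
      then obtain j where j: "k = Suc j" "j \<le> l" "Suc j \<le> l" by (cases k) auto
      show "(\<forall>i<m. pderiv (usig N G (k - 1) i) = usig N G k i) \<and> (\<forall>i<p. pderiv (ysig N G (k - 1) i) = ysig N G k i)"
        using r[rule_format, OF j(2)] r[rule_format, OF j(3)] unfolding j(1) by simp
    qed
  qed
  then show ?thesis unfolding u y coupled_def using G by simp
qed

lemma coupled_unique:
  assumes "coupled N Pu Py G"
  shows "coupled N (usig N G 0) (ysig N G 0) G" "i < m \<Longrightarrow> Pu i = usig N G 0 i" "i < p \<Longrightarrow> Py i = ysig N G 0 i"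
proof -
  have 0: "Pu i = usig N G 0 i" if "i < m" for i using assms that by (simp add: coupled_def) (metis funpow_0 le0)
  have 1: "Py i = ysig N G 0 i" if "i < p" for i using assms that by (simp add: coupled_def) (metis funpow_0 le0)
  show "i < m \<Longrightarrow> Pu i = usig N G 0 i" "i < p \<Longrightarrow> Py i = ysig N G 0 i" by (fact 0, fact 1)
  show "coupled N (usig N G 0) (ysig N G 0) G"
    using assms unfolding coupled_def by (simp add: 0 1)
qed

end

section \<open>Polynomial signals\<close>

lemma L2_cong:
  assumes "\<And>t. t \<in> unit_ivl \<Longrightarrow> f t = f' t"
  shows "f \<in> L2 \<longleftrightarrow> f' \<in> L2"
proof -
  have "f \<in> borel_measurable leb_I \<longleftrightarrow> f' \<in> borel_measurable leb_I"
    by (rule measurable_cong) (simp add: assms)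
  moreover have "integrable leb_I (\<lambda>t. (f t)\<^sup>2) \<longleftrightarrow> integrable leb_I (\<lambda>t. (f' t)\<^sup>2)"
    by (rule Bochner_Integration.integrable_cong) (simp_all add: assms)
  ultimately show ?thesis by (simp add: L2_def)
qed

lemma L2v_dim:
  assumes "w \<in> L2v d" "t \<in> unit_ivl"
  shows "dim_vec (w t) = d"
proof -
  have "w t \<in> carrier_vec d" using assms by (auto simp: L2v_def)
  then show ?thesis by (rule carrier_vecD)
qed

lemma AE_in_unit_ivl: "AE t in leb_I. t \<in> unit_ivl"
  by (rule AE_I2) simp

lemma has_weak_deriv_poly_AE:
  assumes "f \<in> L2" "AE t in leb_I. f t = poly P t"
  shows "has_weak_deriv k f (poly ((pderiv ^^ k) P))"
proof (rule has_weak_deriv_cong_AE[OF has_weak_deriv_poly])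
  show "AE t in leb_I. poly P t = f t" using assms(2) by eventually_elim simp
  show "AE t in leb_I. poly ((pderiv ^^ k) P) t = poly ((pderiv ^^ k) P) t" by simp
qed (use assms in \<open>auto intro!: smooth_L2 smooth_on_poly\<close>)

lemma weak_derivv_poly:
  assumes f: "\<And>i. i < d \<Longrightarrow> (\<lambda>s. f s $ i) \<in> L2"
    and ae: "\<And>i. i < d \<Longrightarrow> AE t in leb_I. f t $ i = poly (P i) t"
  shows "AE t in leb_I. weak_derivv d k f t = vec d (\<lambda>i. poly ((pderiv ^^ k) (P i)) t)"
proof -
  have "AE t in leb_I. \<forall>i\<in>{..<d}. weak_deriv k (\<lambda>s. f s $ i) t = poly ((pderiv ^^ k) (P i)) t"
    by (intro AE_finite_allI weak_deriv_AE has_weak_deriv_poly_AE) (use f ae in auto)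
  then show ?thesis by eventually_elim (auto simp: weak_derivv_def)
qed

lemma weak_derivv_0:
  assumes f: "\<And>i. i < d \<Longrightarrow> (\<lambda>s. f s $ i) \<in> L2"
  shows "AE t in leb_I. \<forall>i<d. weak_derivv d 0 f t $ i = f t $ i"
proof -
  have "AE t in leb_I. \<forall>i\<in>{..<d}. weak_deriv 0 (\<lambda>s. f s $ i) t = f t $ i"
    by (intro AE_finite_allI weak_deriv_AE has_weak_deriv_0) (use f in auto)
  then show ?thesis by eventually_elim (auto simp: weak_derivv_def)
qed

lemma stack_vec_cong: "(\<And>j. j < k \<Longrightarrow> f j = f' j) \<Longrightarrow> stack_vec f k = stack_vec f' k"
  by (induction k) auto

lemma stack_mat_mult_vec:
  assumes "\<And>j. j < k \<Longrightarrow> M j \<in> carrier_mat d nc" "v \<in> carrier_vec nc"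
  shows "stack_mat nc M k *\<^sub>v v = stack_vec (\<lambda>j. M j *\<^sub>v v) k"
  using assms
proof (induction k)
  case (Suc k)
  have "stack_mat nc M k \<in> carrier_mat (k * d) nc" by (rule stack_mat_carrier) (use Suc in auto)
  then have "stack_mat nc M (Suc k) *\<^sub>v v = (stack_mat nc M k *\<^sub>v v) @\<^sub>v (M k *\<^sub>v v)"
    using mat_mult_append[of "stack_mat nc M k" "k * d" nc "M k" d v] Suc.prems by simp
  then show ?case using Suc by simp
qed (auto intro: eq_vecI)

text \<open>Blocks are ordered by derivative and inside a block by component. For d = m + p this is
  the order of the initial condition in both problems, which differs from the order of the rows of
  \<open>\<Gamma>\<close>.\<close>

definition jet :: "nat \<Rightarrow> nat \<Rightarrow> (nat \<Rightarrow> real poly) \<Rightarrow> real \<Rightarrow> real vec" where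
  "jet d k P t = stack_vec (\<lambda>j. vec d (\<lambda>i. poly ((pderiv ^^ j) (P i)) t)) k"

lemma jet_carrier: "jet d k P t \<in> carrier_vec (k * d)"
  unfolding jet_def by (rule stack_vec_carrier) simp

lemma jet_index: "j < k \<Longrightarrow> i < d \<Longrightarrow> jet d k P t $ (j * d + i) = poly ((pderiv ^^ j) (P i)) t"
  unfolding jet_def by (subst stack_vec_index[where d = d]) auto

lemma vec_eq_blocks:
  assumes "v \<in> carrier_vec (k * d)" "w \<in> carrier_vec (k * d)"
    and eq: "\<And>j i. j < k \<Longrightarrow> i < d \<Longrightarrow> v $ (j * d + i) = w $ (j * d + i)"
  shows "v = w"
proof (rule eq_vecI)
  fix a assume "a < dim_vec w"
  then have a: "a < k * d" using assms by simp
  then have "d > 0" by (cases d) auto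
  then show "v $ a = w $ a"
    using eq[of "a div d" "a mod d"] a by (simp add: less_mult_imp_div_less)
qed (use assms in simp)

lemma jet_continuous: "a < k * d \<Longrightarrow> continuous_on S (\<lambda>t. jet d k P t $ a)"
proof -
  assume a: "a < k * d"
  then have "d > 0" by (cases d) auto
  then have "jet d k P t $ a = poly ((pderiv ^^ (a div d)) (P (a mod d))) t" for t
    using jet_index[of "a div d" k "a mod d" d P t] a by (simp add: less_mult_imp_div_less)
  then show ?thesis by (simp add: continuous_intros)
qed

text \<open>Two continuous functions that agree almost everywhere on the open interval agree
  everywhere on it, and then also at the end point -1 by passing to the closure.\<close>

lemma has_left_value_poly:
  assumes f: "\<And>i. i < d \<Longrightarrow> (\<lambda>s. f s $ i) \<in> L2"
    and ae: "\<And>i. i < d \<Longrightarrow> AE t in leb_I. f t $ i = poly (P i) t"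
  shows "has_left_value (k * d) (Lam d k f) \<xi> \<longleftrightarrow> \<xi> = jet d k P (-1)"
proof -
  have "AE t in leb_I. \<forall>j\<in>{..<k}. weak_derivv d j f t = vec d (\<lambda>i. poly ((pderiv ^^ j) (P i)) t)"
    by (intro AE_finite_allI weak_derivv_poly) (use f ae in auto)
  then have J: "AE t in leb_I. Lam d k f t = jet d k P t"
    by eventually_elim (auto simp: Lam_def jet_def intro!: stack_vec_cong)
  show ?thesis
  proof
    assume "has_left_value (k * d) (Lam d k f) \<xi>"
    then obtain h where h: "\<And>t. t \<in> {-1..1} \<Longrightarrow> h t \<in> carrier_vec (k * d)"
      "\<And>a. a < k * d \<Longrightarrow> continuous_on {-1..1} (\<lambda>t. h t $ a)"
      "AE t in leb_I. Lam d k f t = h t" "h (-1) = \<xi>"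
      unfolding has_left_value_def by blast
    have "h (-1) $ a = jet d k P (-1) $ a" if a: "a < k * d" for a
    proof -
      let ?e = "\<lambda>t. h t $ a - jet d k P t $ a"
      have cont: "continuous_on {-1..1} ?e" by (intro continuous_on_diff h(2) jet_continuous a)
      have ae0: "AE t in leb_I. -1 < t \<and> t < 1 \<longrightarrow> ?e t = 0"
        using h(3) J by eventually_elim simp
      have z: "?e t = 0" if "t \<in> {-1<..<1}" for t
        by (rule continuous_AE_zero[OF continuous_on_subset[OF cont]]) (use that ae0 in auto)
      have "?e (-1) = 0"
      proof (rule continuous_constant_on_closure[of "{-1<..<1}" ?e 0 "-1"])
        show "continuous_on (closure {-1<..<1}) ?e" using cont by simp
      qed (use z in auto)
      then show ?thesis by simp
    qed
    then show "\<xi> = jet d k P (-1)"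
      using h(1)[of "-1"] h(4) jet_carrier[of d k P "-1"] by (intro eq_vecI) auto
  next
    assume "\<xi> = jet d k P (-1)"
    then show "has_left_value (k * d) (Lam d k f) \<xi>"
      unfolding has_left_value_def using J jet_carrier jet_continuous
      by (intro exI[of _ "jet d k P"]) auto
  qed
qed

lemma finsum_legendre:
  assumes "\<And>s. c s \<in> carrier_vec d"
  shows "finsum_vec TYPE(real) d (\<lambda>s. poly (legendre s) t \<cdot>\<^sub>v c s) {..<N} =
    vec d (\<lambda>r. poly (\<Sum>s<N. Polynomial.smult (c s $ r) (legendre s)) t)"
proof (rule eq_vecI)
  have F: "(\<lambda>s. poly (legendre s) t \<cdot>\<^sub>v c s) \<in> {..<N} \<rightarrow> carrier_vec d" using assms by auto
  fix r assume "r < dim_vec (vec d (\<lambda>r. poly (\<Sum>s<N. Polynomial.smult (c s $ r) (legendre s)) t))"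
  then have r: "r < d" by simp
  have "finsum_vec TYPE(real) d (\<lambda>s. poly (legendre s) t \<cdot>\<^sub>v c s) {..<N} $ r =
      (\<Sum>s<N. (poly (legendre s) t \<cdot>\<^sub>v c s) $ r)"
    by (rule index_finsum_vec[OF _ r F]) simp
  also have "\<dots> = (\<Sum>s<N. poly (legendre s) t * c s $ r)"
    using r assms[THEN carrier_vecD] by (intro sum.cong refl) (subst index_smult_vec, simp_all)
  finally show "finsum_vec TYPE(real) d (\<lambda>s. poly (legendre s) t \<cdot>\<^sub>v c s) {..<N} $ r =
      vec d (\<lambda>r. poly (\<Sum>s<N. Polynomial.smult (c s $ r) (legendre s)) t) $ r"
    using r by (simp add: poly_sum mult.commute)
next
  have F: "(\<lambda>s. poly (legendre s) t \<cdot>\<^sub>v c s) \<in> {..<N} \<rightarrow> carrier_vec d" using assms by auto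
  show "dim_vec (finsum_vec TYPE(real) d (\<lambda>s. poly (legendre s) t \<cdot>\<^sub>v c s) {..<N}) =
      dim_vec (vec d (\<lambda>r. poly (\<Sum>s<N. Polynomial.smult (c s $ r) (legendre s)) t))"
    using finsum_vec_closed[OF F] by simp
qed

text \<open>Parseval's identity in each component; exchanging the two sums assembles the Euclidean
  norms of the coefficient vectors.\<close>

lemma L2v_norm_legendre:
  assumes f: "\<And>t. f t \<in> carrier_vec d" "\<And>i. i < d \<Longrightarrow> (\<lambda>t. f t $ i) \<in> L2"
    and c: "\<And>s. c s \<in> carrier_vec d"
    and ae: "AE t in leb_I. f t = vec d (\<lambda>r. poly (\<Sum>s<N. Polynomial.smult (c s $ r) (legendre s)) t)"
  shows "(L2v_norm f)\<^sup>2 = (\<Sum>s<N. (vec_norm2 (c s))\<^sup>2 * (L2_norm (poly (legendre s)))\<^sup>2)"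
proof -
  let ?P = "\<lambda>r. \<Sum>s<N. Polynomial.smult (c s $ r) (legendre s)"
  have sq: "v \<bullet> v = (\<Sum>r<d. (v $ r)\<^sup>2)" if "v \<in> carrier_vec d" for v :: "real vec"
    using that by (simp add: scalar_prod_def lessThan_atLeast0 power2_eq_square)
  have "(L2v_norm f)\<^sup>2 = (\<integral>t. (\<Sum>r<d. (f t $ r)\<^sup>2) \<partial>leb_I)"
    unfolding L2v_norm_def sq[OF f(1)]
    by (rule real_sqrt_pow2) (intro integral_nonneg_AE AE_I2 sum_nonneg zero_le_power2)
  also have "\<dots> = (\<integral>t. (\<Sum>r<d. (poly (?P r) t)\<^sup>2) \<partial>leb_I)"
  proof (rule integral_cong_AE)
    show "AE t in leb_I. (\<Sum>r<d. (f t $ r)\<^sup>2) = (\<Sum>r<d. (poly (?P r) t)\<^sup>2)"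
      using ae by eventually_elim simp
    show "(\<lambda>t. \<Sum>r<d. (f t $ r)\<^sup>2) \<in> borel_measurable leb_I"
      by (intro borel_measurable_sum borel_measurable_power L2_measurable f(2)) simp
    show "(\<lambda>t. \<Sum>r<d. (poly (?P r) t)\<^sup>2) \<in> borel_measurable leb_I"
      by (intro borel_measurable_sum borel_measurable_power L2_measurable smooth_L2 smooth_on_poly)
  qed
  also have "\<dots> = (\<Sum>r<d. \<integral>t. (poly (?P r) t)\<^sup>2 \<partial>leb_I)"
    by (intro Bochner_Integration.integral_sum continuous_integrable_I continuous_intros)
  also have "\<dots> = (\<Sum>r<d. \<Sum>s<N. (c s $ r)\<^sup>2 * (L2_norm (poly (legendre s)))\<^sup>2)"
    by (simp only: legendre_parseval)
  also have "\<dots> = (\<Sum>s<N. (\<Sum>r<d. (c s $ r)\<^sup>2) * (L2_norm (poly (legendre s)))\<^sup>2)"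
    unfolding sum_distrib_right by (rule sum.swap)
  also have "\<dots> = (\<Sum>s<N. (vec_norm2 (c s))\<^sup>2 * (L2_norm (poly (legendre s)))\<^sup>2)"
    by (intro sum.cong refl) (simp add: vec_norm2_def sq[OF c] sum_nonneg)
  finally show ?thesis .
qed

section \<open>Equivalence of the two problems\<close>

locale driven_behavior = driven_system m p g n l R A B C D \<Gamma> M
  for m p g n l :: nat and R :: "nat \<Rightarrow> nat \<Rightarrow> real poly" and A B C D :: "nat \<Rightarrow> nat \<Rightarrow> real"
    and \<Gamma> :: "real mat" and M :: "nat \<Rightarrow> nat \<Rightarrow> nat \<Rightarrow> real" +
  fixes \<B> :: "(real \<Rightarrow> real vec) set"
  assumes behavior: "\<And>w. w \<in> \<B> \<longleftrightarrow> w \<in> unit_ivl \<rightarrow> carrier_vec (m + p) \<and>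
    weak_sol m p g R (\<lambda>i t. w t $ i) (\<lambda>i t. w t $ (m + i))"
begin

abbreviation "Gu \<equiv> Gram_u m \<Gamma>"
abbreviation "Gy \<equiv> Gram_y m p (l + 1) \<Gamma>"

definition sig :: "nat \<Rightarrow> (nat \<Rightarrow> real vec) \<Rightarrow> nat \<Rightarrow> real poly" where
  "sig N G c = (if c < m then usig N G 0 c else ysig N G 0 (c - m))"

abbreviation feasible_coeffs :: "nat \<Rightarrow> (nat \<Rightarrow> real vec) \<Rightarrow> bool" where
  "feasible_coeffs N G \<equiv> coupled N (usig N G 0) (ysig N G 0) G"

text \<open>The equations of the theorem that link a signal to a coefficient sequence. They hold
  almost everywhere because weak derivatives are fixed only up to null sets.\<close>

definition represents :: "nat \<Rightarrow> (real \<Rightarrow> real vec) \<Rightarrow> (nat \<Rightarrow> real vec) \<Rightarrow> bool" where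
  "represents N w G \<longleftrightarrow> (\<forall>k\<le>l.
     (AE t in leb_I. weak_derivv m k (input_part m w) t =
        finsum_vec TYPE(real) m (\<lambda>i. poly (legendre i) t \<cdot>\<^sub>v (Gu k *\<^sub>v G i)) {..<N}) \<and>
     (AE t in leb_I. weak_derivv p k (output_part p w) t =
        finsum_vec TYPE(real) p (\<lambda>i. poly (legendre i) t \<cdot>\<^sub>v (Gy k *\<^sub>v G i)) {..<N}))"

lemma Gram_mult_carrier:
  "G \<in> carrier_vec ((l + 1) * (m + p)) \<Longrightarrow> Gu k *\<^sub>v G \<in> carrier_vec m"
  "G \<in> carrier_vec ((l + 1) * (m + p)) \<Longrightarrow> Gy k *\<^sub>v G \<in> carrier_vec p"
  using Gram_carrier by (auto intro: mult_mat_vec_carrier)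

lemma coupled_carrier: "coupled N Pu Py G \<Longrightarrow> G s \<in> carrier_vec ((l + 1) * (m + p))"
  by (simp add: coupled_def)

lemma parts_L2:
  assumes w: "w \<in> L2v (m + p)"
  shows "i < m \<Longrightarrow> (\<lambda>t. input_part m w t $ i) \<in> L2" "i < p \<Longrightarrow> (\<lambda>t. output_part p w t $ i) \<in> L2"
    "i < m \<Longrightarrow> input_part m w t $ i = w t $ i"
    "i < p \<Longrightarrow> t \<in> unit_ivl \<Longrightarrow> output_part p w t $ i = w t $ (m + i)"
proof -
  have c: "w t \<in> carrier_vec (m + p)" if "t \<in> unit_ivl" for t using w that by (auto simp: L2v_def)
  show 1: "input_part m w t $ i = w t $ i" if "i < m" for i t
    using that by (simp add: input_part_def vec_first_def)
  show 2: "output_part p w t $ i = w t $ (m + i)" if "i < p" "t \<in> unit_ivl" for i t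
    using that(1) c[OF that(2)] by (simp add: output_part_def vec_last_def)
  show "(\<lambda>t. input_part m w t $ i) \<in> L2" if "i < m"
    using w that by (simp add: 1 L2v_def)
  show "(\<lambda>t. output_part p w t $ i) \<in> L2" if i: "i < p"
    using w i L2_cong[of "\<lambda>t. output_part p w t $ i" "\<lambda>t. w t $ (m + i)"] 2[OF i] by (simp add: L2v_def)
qed

text \<open>The Legendre polynomial of degree i takes the value (-1)^i at -1, so the alternating sum
  evaluates the represented signal and its derivatives at the initial time. The remaining
  constraints are those of coupling, and finite support gives membership in the sequence
  space.\<close>

lemma DN_feasible_iff:
  "G \<in> DN_feasible m p \<Gamma> l \<xi> N \<longleftrightarrow> feasible_coeffs N G \<and> \<xi> = jet (m + p) l (sig N G) (-1)"
proof -
  let ?q = "(l + 1) * (m + p)"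
  let ?S = "stack_mat ?q (\<lambda>k. Gu k @\<^sub>r Gy k) l"
  have fin: "finsum_vec TYPE(real) (l * (m + p)) (\<lambda>s. (-1) ^ s \<cdot>\<^sub>v (?S *\<^sub>v G s)) {..<N} = jet (m + p) l (sig N G) (-1)"
    if c: "feasible_coeffs N G"
  proof (rule vec_eq_blocks)
    have Gc: "G s \<in> carrier_vec ?q" for s by (rule coupled_carrier[OF c])
    have SM: "?S *\<^sub>v G s = stack_vec (\<lambda>k. (Gu k *\<^sub>v G s) @\<^sub>v (Gy k *\<^sub>v G s)) l" for s
    proof -
      have "?S *\<^sub>v G s = stack_vec (\<lambda>k. (Gu k @\<^sub>r Gy k) *\<^sub>v G s) l"
        by (rule stack_mat_mult_vec[where d = "m + p", OF _ Gc]) (intro carrier_append_rows Gram_carrier)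
      also have "\<dots> = stack_vec (\<lambda>k. (Gu k *\<^sub>v G s) @\<^sub>v (Gy k *\<^sub>v G s)) l"
        by (intro stack_vec_cong mat_mult_append[OF Gram_carrier Gc])
      finally show ?thesis .
    qed
    have ac: "(Gu k *\<^sub>v G s) @\<^sub>v (Gy k *\<^sub>v G s) \<in> carrier_vec (m + p)" for k s
      using Gram_mult_carrier[OF Gc] by auto
    have Sc: "?S *\<^sub>v G s \<in> carrier_vec (l * (m + p))" for s
      unfolding SM by (rule stack_vec_carrier[OF ac])
    have F: "(\<lambda>s. (-1) ^ s \<cdot>\<^sub>v (?S *\<^sub>v G s)) \<in> {..<N} \<rightarrow> carrier_vec (l * (m + p))"
      by (intro Pi_I smult_carrier_vec[THEN iffD2] Sc)
    show "finsum_vec TYPE(real) (l * (m + p)) (\<lambda>s. (-1) ^ s \<cdot>\<^sub>v (?S *\<^sub>v G s)) {..<N} \<in> carrier_vec (l * (m + p))"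
      by (rule finsum_vec_closed[OF F])
    show "jet (m + p) l (sig N G) (-1) \<in> carrier_vec (l * (m + p))" by (rule jet_carrier)
    fix k a assume k: "k < l" and a: "a < m + p"
    have "finsum_vec TYPE(real) (l * (m + p)) (\<lambda>s. (-1) ^ s \<cdot>\<^sub>v (?S *\<^sub>v G s)) {..<N} $ (k * (m + p) + a) =
        (\<Sum>s<N. ((-1) ^ s \<cdot>\<^sub>v (?S *\<^sub>v G s)) $ (k * (m + p) + a))"
      by (rule index_finsum_vec[OF _ block_index_less[OF k a] F]) simp
    also have "\<dots> = (\<Sum>s<N. (-1) ^ s * ((Gu k *\<^sub>v G s) @\<^sub>v (Gy k *\<^sub>v G s)) $ a)"
    proof (intro sum.cong refl)
      fix s
      have "(?S *\<^sub>v G s) $ (k * (m + p) + a) = ((Gu k *\<^sub>v G s) @\<^sub>v (Gy k *\<^sub>v G s)) $ a"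
        unfolding SM by (rule stack_vec_index[OF ac k a])
      moreover have "((-1) ^ s \<cdot>\<^sub>v (?S *\<^sub>v G s)) $ (k * (m + p) + a) = (-1) ^ s * (?S *\<^sub>v G s) $ (k * (m + p) + a)"
        using Sc[of s] block_index_less[OF k a] by (intro index_smult_vec) (simp only: carrier_vecD)
      ultimately show "((-1) ^ s \<cdot>\<^sub>v (?S *\<^sub>v G s)) $ (k * (m + p) + a) =
          (-1) ^ s * ((Gu k *\<^sub>v G s) @\<^sub>v (Gy k *\<^sub>v G s)) $ a" by simp
    qed
    also have "\<dots> = poly ((pderiv ^^ k) (sig N G a)) (-1)"
    proof (cases "a < m")
      case True
      have "(\<Sum>s<N. (-1) ^ s * ((Gu k *\<^sub>v G s) @\<^sub>v (Gy k *\<^sub>v G s)) $ a) = (\<Sum>s<N. (-1) ^ s * (Gu k *\<^sub>v G s) $ a)"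
        using True a by (intro sum.cong refl) (simp only: append_vec_index[OF Gram_mult_carrier[OF Gc]] if_True)
      also have "\<dots> = poly (usig N G k a) (-1)"
        by (simp add: usig_def poly_sum poly_legendre_minus_one mult.commute)
      also have "usig N G k a = (pderiv ^^ k) (sig N G a)"
        using c k True by (simp add: coupled_def sig_def)
      finally show ?thesis .
    next
      case False
      have "(\<Sum>s<N. (-1) ^ s * ((Gu k *\<^sub>v G s) @\<^sub>v (Gy k *\<^sub>v G s)) $ a) = (\<Sum>s<N. (-1) ^ s * (Gy k *\<^sub>v G s) $ (a - m))"
        using False a by (intro sum.cong refl) (simp only: append_vec_index[OF Gram_mult_carrier[OF Gc]] if_False)
      also have "\<dots> = poly (ysig N G k (a - m)) (-1)"
        by (simp add: ysig_def poly_sum poly_legendre_minus_one mult.commute)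
      also have "ysig N G k (a - m) = (pderiv ^^ k) (sig N G a)"
        using c k False a by (simp add: coupled_def sig_def)
      finally show ?thesis .
    qed
    also have "\<dots> = jet (m + p) l (sig N G) (-1) $ (k * (m + p) + a)"
      by (rule jet_index[OF k a, symmetric])
    finally show "finsum_vec TYPE(real) (l * (m + p)) (\<lambda>s. (-1) ^ s \<cdot>\<^sub>v (?S *\<^sub>v G s)) {..<N} $ (k * (m + p) + a) =
        jet (m + p) l (sig N G) (-1) $ (k * (m + p) + a)" .
  qed
  have ell2: "G \<in> ell2 ?q" if "\<And>s. G s \<in> carrier_vec ?q" "\<And>s. s \<ge> N \<Longrightarrow> G s = 0\<^sub>v ?q"
  proof -
    have "G s \<bullet> G s = 0" if "s \<notin> {..<N}" for s
      using \<open>\<And>s. s \<ge> N \<Longrightarrow> G s = 0\<^sub>v ?q\<close>[of s] that by simp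
    then have "summable (\<lambda>s. G s \<bullet> G s)" by (intro summable_finite[of "{..<N}"]) simp_all
    then show ?thesis using that(1) by (simp add: ell2_def)
  qed
  show ?thesis
  proof
    assume "G \<in> DN_feasible m p \<Gamma> l \<xi> N"
    then have G: "G \<in> ell2 ?q" "\<And>s. s \<ge> N \<Longrightarrow> G s = 0\<^sub>v ?q"
      and D: "\<forall>k\<in>{1..l}. legendre_D m (\<lambda>i. Gu (k - 1) *\<^sub>v G i) = (\<lambda>i. Gu k *\<^sub>v G i) \<and>
        legendre_D p (\<lambda>i. Gy (k - 1) *\<^sub>v G i) = (\<lambda>i. Gy k *\<^sub>v G i)"
      and \<xi>: "\<xi> = finsum_vec TYPE(real) (l * (m + p)) (\<lambda>s. (-1) ^ s \<cdot>\<^sub>v (?S *\<^sub>v G s)) {..<N}"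
      unfolding DN_feasible_def by blast+
    have "\<And>s. G s \<in> carrier_vec ?q" using G(1) by (simp add: ell2_def)
    from coupled_iff_legendre_D[of G N, OF this G(2)] D have "feasible_coeffs N G" by blast
    with fin \<xi> show "feasible_coeffs N G \<and> \<xi> = jet (m + p) l (sig N G) (-1)" by simp
  next
    assume c: "feasible_coeffs N G \<and> \<xi> = jet (m + p) l (sig N G) (-1)"
    then have G: "\<And>s. G s \<in> carrier_vec ?q" "\<And>s. s \<ge> N \<Longrightarrow> G s = 0\<^sub>v ?q"
      unfolding coupled_def by blast+
    from coupled_iff_legendre_D[of G N, OF G] c
    have D: "\<forall>k\<in>{1..l}. legendre_D m (\<lambda>i. Gu (k - 1) *\<^sub>v G i) = (\<lambda>i. Gu k *\<^sub>v G i) \<and>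
        legendre_D p (\<lambda>i. Gy (k - 1) *\<^sub>v G i) = (\<lambda>i. Gy k *\<^sub>v G i)" by blast
    have \<xi>: "\<xi> = finsum_vec TYPE(real) (l * (m + p)) (\<lambda>s. (-1) ^ s \<cdot>\<^sub>v (?S *\<^sub>v G s)) {..<N}"
      using fin c by simp
    show "G \<in> DN_feasible m p \<Gamma> l \<xi> N"
      unfolding DN_feasible_def using ell2[OF G] G(2) D \<xi> by blast
  qed
qed

text \<open>All claims follow from the polynomial form of w: coupling gives its weak derivatives and
  makes it a trajectory, Parseval's identity gives the cost, and evaluation at -1 the initial
  condition.\<close>

lemma trajectory_of_coeffs:
  assumes c: "feasible_coeffs N G" and w: "w \<in> L2v (m + p)"
    and ae: "AE t in leb_I. w t = vec (m + p) (\<lambda>a. poly (sig N G a) t)"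
  shows "represents N w G" "w \<in> \<B> \<inter> poly_signals (m + p) N" "PN_cost m p l w = DN_cost m p \<Gamma> l N G"
    "has_left_value (l * (m + p)) (Lam (m + p) l w) \<xi> \<longleftrightarrow> \<xi> = jet (m + p) l (sig N G) (-1)"
proof -
  note Gc = coupled_carrier[OF c]
  note parts = parts_L2[OF w]
  have aei: "AE t in leb_I. w t $ a = poly (sig N G a) t" if "a < m + p" for a
    using ae by eventually_elim (use that in simp)
  have wL: "(\<lambda>t. w t $ a) \<in> L2" if "a < m + p" for a using w that by (simp add: L2v_def)
  have u: "AE t in leb_I. input_part m w t $ i = poly (usig N G 0 i) t" if i: "i < m" for i
    using aei[OF trans_less_add1[OF i]] by eventually_elim (use i in \<open>simp add: parts sig_def\<close>)
  have y: "AE t in leb_I. output_part p w t $ i = poly (ysig N G 0 i) t" if i: "i < p" for i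
    using aei[OF add_strict_left_mono[OF i]] AE_in_unit_ivl
    by eventually_elim (use i in \<open>simp add: parts sig_def\<close>)
  have pu: "AE t in leb_I. weak_derivv m k (input_part m w) t = vec m (\<lambda>i. poly ((pderiv ^^ k) (usig N G 0 i)) t)"
    and py: "AE t in leb_I. weak_derivv p k (output_part p w) t = vec p (\<lambda>i. poly ((pderiv ^^ k) (ysig N G 0 i)) t)" for k
    by (rule weak_derivv_poly; fact parts u y)+
  have du: "AE t in leb_I. weak_derivv m k (input_part m w) t = vec m (\<lambda>i. poly (usig N G k i) t)" if "k \<le> l" for k
    using pu[of k] by eventually_elim (use c that in \<open>auto simp: coupled_def\<close>)
  have dy: "AE t in leb_I. weak_derivv p k (output_part p w) t = vec p (\<lambda>i. poly (ysig N G k i) t)" if "k \<le> l" for k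
    using py[of k] by eventually_elim (use c that in \<open>auto simp: coupled_def\<close>)
  show "represents N w G"
    unfolding represents_def finsum_legendre[OF Gram_mult_carrier(1)[OF Gc]] finsum_legendre[OF Gram_mult_carrier(2)[OF Gc]]
    using du dy unfolding usig_def ysig_def by blast
  have "weak_sol m p g R (\<lambda>i t. w t $ i) (\<lambda>i t. w t $ (m + i))"
  proof (rule weak_sol_cong_AE[OF coupled_weak_sol[OF c]])
    show "(\<lambda>t. w t $ i) \<in> L2 \<and> (AE t in leb_I. poly (usig N G 0 i) t = w t $ i)" if "i < m" for i
      using wL[of i] aei[of i] that by (auto simp: sig_def eq_commute)
    show "(\<lambda>t. w t $ (m + i)) \<in> L2 \<and> (AE t in leb_I. poly (ysig N G 0 i) t = w t $ (m + i))" if "i < p" for i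
      using wL[of "m + i"] aei[of "m + i"] that by (auto simp: sig_def eq_commute)
  qed
  moreover have "w \<in> unit_ivl \<rightarrow> carrier_vec (m + p)" using w by (simp add: L2v_def)
  ultimately have "w \<in> \<B>" by (simp add: behavior)
  moreover have "coeff (sig N G a) j = 0" if "j \<ge> N" for a j
    using that by (auto simp: sig_def usig_def ysig_def coeff_sum intro!: sum.neutral coeff_eq_0)
  then have "w \<in> poly_signals (m + p) N" using w ae by (auto simp: poly_signals_def)
  ultimately show "w \<in> \<B> \<inter> poly_signals (m + p) N" by simp
  have "(L2v_norm (output_part p w))\<^sup>2 = (\<Sum>s<N. (vec_norm2 (Gy 0 *\<^sub>v G s))\<^sup>2 * (L2_norm (poly (legendre s)))\<^sup>2)"
  proof (rule L2v_norm_legendre)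
    have "AE t in leb_I. \<forall>i\<in>{..<p}. output_part p w t $ i = poly (ysig N G 0 i) t"
      by (intro AE_finite_allI) (use y in auto)
    then show "AE t in leb_I. output_part p w t =
        vec p (\<lambda>r. poly (\<Sum>s<N. Polynomial.smult ((Gy 0 *\<^sub>v G s) $ r) (legendre s)) t)"
      unfolding ysig_def by eventually_elim (auto simp: output_part_def)
  qed (use parts(2) Gram_mult_carrier(2)[OF Gc] in \<open>auto simp: output_part_def\<close>)
  moreover have "(L2v_norm (weak_derivv m l (input_part m w)))\<^sup>2 =
      (\<Sum>s<N. (vec_norm2 (Gu l *\<^sub>v G s))\<^sup>2 * (L2_norm (poly (legendre s)))\<^sup>2)"
  proof (rule L2v_norm_legendre)
    show "AE t in leb_I. weak_derivv m l (input_part m w) t =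
        vec m (\<lambda>r. poly (\<Sum>s<N. Polynomial.smult ((Gu l *\<^sub>v G s) $ r) (legendre s)) t)"
      using du[OF order.refl] by (simp only: usig_def)
    show "(\<lambda>t. weak_derivv m l (input_part m w) t $ i) \<in> L2" if "i < m" for i
      using has_weak_deriv_L2[OF has_weak_deriv_weak_deriv[OF has_weak_deriv_poly_AE[OF parts(1)[OF that] u[OF that], of l]]] that
      by (simp add: weak_derivv_def)
  qed (use Gram_mult_carrier(1)[OF Gc] in \<open>auto simp: weak_derivv_def\<close>)
  ultimately show "PN_cost m p l w = DN_cost m p \<Gamma> l N G"
    by (simp only: PN_cost_def DN_cost_def distrib_right sum.distrib)
  show "has_left_value (l * (m + p)) (Lam (m + p) l w) \<xi> \<longleftrightarrow> \<xi> = jet (m + p) l (sig N G) (-1)"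
    by (rule has_left_value_poly[OF wL aei])
qed

text \<open>The linking equations of order 0 already determine w almost everywhere.\<close>

lemma represents_imp:
  assumes c: "feasible_coeffs N G" and w: "w \<in> L2v (m + p)" and r: "represents N w G"
  shows "AE t in leb_I. w t = vec (m + p) (\<lambda>a. poly (sig N G a) t)"
proof -
  note Gc = coupled_carrier[OF c]
  note parts = parts_L2[OF w]
  have "AE t in leb_I. weak_derivv m 0 (input_part m w) t = vec m (\<lambda>i. poly (usig N G 0 i) t)"
    "AE t in leb_I. weak_derivv p 0 (output_part p w) t = vec p (\<lambda>i. poly (ysig N G 0 i) t)"
    using r unfolding represents_def finsum_legendre[OF Gram_mult_carrier(1)[OF Gc]]
      finsum_legendre[OF Gram_mult_carrier(2)[OF Gc]] usig_def[symmetric] ysig_def[symmetric] by blast+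
  moreover have "AE t in leb_I. \<forall>i<m. weak_derivv m 0 (input_part m w) t $ i = input_part m w t $ i"
    "AE t in leb_I. \<forall>i<p. weak_derivv p 0 (output_part p w) t $ i = output_part p w t $ i"
    by (rule weak_derivv_0; fact parts)+
  ultimately show ?thesis
    using AE_in_unit_ivl
  proof eventually_elim
    case (elim t)
    show ?case
    proof (rule eq_vecI)
      fix a assume "a < dim_vec (vec (m + p) (\<lambda>a. poly (sig N G a) t))"
      then have a: "a < m + p" by simp
      show "w t $ a = vec (m + p) (\<lambda>a. poly (sig N G a) t) $ a"
      proof (cases "a < m")
        case True
        then have "w t $ a = weak_derivv m 0 (input_part m w) t $ a" using elim(3) parts(3) by simp
        then show ?thesis using True a elim(1) by (simp add: sig_def)
      next
        case False
        define i where "i = a - m"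
        have i: "a = m + i" "i < p" using False a by (auto simp: i_def)
        then have "w t $ a = weak_derivv p 0 (output_part p w) t $ i" using elim(4,5) parts(4) by simp
        then show ?thesis using i elim(2) by (simp add: sig_def)
      qed
    next
      show "dim_vec (w t) = dim_vec (vec (m + p) (\<lambda>a. poly (sig N G a) t))"
        using L2v_dim[OF w elim(5)] by simp
    qed
  qed
qed

text \<open>The polynomials behind w form a weak trajectory and so have coefficients; these
  reproduce the same polynomials in the form \<open>sig\<close>, to which the initial condition can
  be transferred.\<close>

lemma PN_feasible_represented:
  assumes "w \<in> PN_feasible m p \<B> l \<xi> N"
  shows "\<exists>G\<in>DN_feasible m p \<Gamma> l \<xi> N. represents N w G"
proof -
  have wB: "w \<in> \<B>" and lv: "has_left_value (l * (m + p)) (Lam (m + p) l w) \<xi>"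
    and wp: "w \<in> poly_signals (m + p) N"
    using assms by (auto simp: PN_feasible_def)
  then obtain P :: "nat \<Rightarrow> real poly" where w: "w \<in> L2v (m + p)"
    and P: "\<And>a j. a < m + p \<Longrightarrow> j \<ge> N \<Longrightarrow> coeff (P a) j = 0"
    and ae: "AE t in leb_I. w t = vec (m + p) (\<lambda>a. poly (P a) t)"
    unfolding poly_signals_def by blast
  have aei: "AE t in leb_I. w t $ a = poly (P a) t" if "a < m + p" for a
    using ae by eventually_elim (use that in simp)
  have pL: "poly Q \<in> L2" for Q by (intro smooth_L2 smooth_on_poly)
  have "weak_sol m p g R (\<lambda>i. poly (P i)) (\<lambda>i. poly (P (m + i)))"
    by (rule weak_sol_cong_AE[of _ _ _ _ "\<lambda>i t. w t $ i" "\<lambda>i t. w t $ (m + i)"])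
      (use wB behavior pL aei in auto)
  from coupled_exists[OF this, of N] P obtain G where G: "coupled N P (\<lambda>i. P (m + i)) G" by auto
  have c: "feasible_coeffs N G" by (rule coupled_unique(1)[OF G])
  have "sig N G a = P a" if "a < m + p" for a
  proof (cases "a < m")
    case True
    then show ?thesis using coupled_unique(2)[OF G] by (simp add: sig_def)
  next
    case False
    then have "a = m + (a - m)" "a - m < p" using that by auto
    then show ?thesis using coupled_unique(3)[OF G, of "a - m"] False by (simp add: sig_def)
  qed
  then have "AE t in leb_I. w t = vec (m + p) (\<lambda>a. poly (sig N G a) t)"
    using ae by (auto elim!: eventually_mono)
  note T = trajectory_of_coeffs[OF c w this]
  show ?thesis
    using T(1) T(4)[of \<xi>] lv c by (intro bexI[of _ G]) (simp_all add: DN_feasible_iff)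
qed

lemma represented_PN_feasible:
  assumes G: "G \<in> DN_feasible m p \<Gamma> l \<xi> N" and w: "w \<in> L2v (m + p)" and r: "represents N w G"
  shows "w \<in> PN_feasible m p \<B> l \<xi> N" "PN_cost m p l w = DN_cost m p \<Gamma> l N G"
proof -
  have c: "feasible_coeffs N G" and \<xi>: "\<xi> = jet (m + p) l (sig N G) (-1)"
    using G by (simp_all add: DN_feasible_iff)
  note T = trajectory_of_coeffs[OF c w represents_imp[OF c w r]]
  show "PN_cost m p l w = DN_cost m p \<Gamma> l N G" by (rule T(3))
  show "w \<in> PN_feasible m p \<B> l \<xi> N" using T(2) T(4)[of \<xi>] \<xi> by (simp add: PN_feasible_def)
qed

lemma DN_feasible_represents:
  assumes G: "G \<in> DN_feasible m p \<Gamma> l \<xi> N"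
  shows "\<exists>w\<in>L2v (m + p). represents N w G"
proof -
  have c: "feasible_coeffs N G" using G by (simp add: DN_feasible_iff)
  let ?w = "\<lambda>t. vec (m + p) (\<lambda>a. poly (sig N G a) t)"
  have "?w \<in> L2v (m + p)" by (auto simp: L2v_def intro!: smooth_L2 smooth_on_poly)
  from trajectory_of_coeffs(1)[OF c this] this show ?thesis by auto
qed

text \<open>Every feasible element of either problem has a feasible partner in the other one, and
  partners have equal cost. Minimizers therefore correspond, and the sets of feasible costs are the
  same whether or not a minimum is attained.\<close>

lemma PN_DN_correspondence:
  shows "w \<in> L2v (m + p) \<Longrightarrow> PN_solution m p \<B> l \<xi> N w \<longleftrightarrow> (\<exists>G. DN_solution m p \<Gamma> l \<xi> N G \<and> represents N w G)"
    and "PN_cost m p l ` PN_feasible m p \<B> l \<xi> N = DN_cost m p \<Gamma> l N ` DN_feasible m p \<Gamma> l \<xi> N"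
proof -
  have PL: "w \<in> L2v (m + p)" if "w \<in> PN_feasible m p \<B> l \<xi> N" for w
    using that by (simp add: PN_feasible_def poly_signals_def)
  have PD: "\<exists>G\<in>DN_feasible m p \<Gamma> l \<xi> N. represents N w G \<and> PN_cost m p l w = DN_cost m p \<Gamma> l N G"
    if "w \<in> PN_feasible m p \<B> l \<xi> N" for w
    using PN_feasible_represented[OF that] represented_PN_feasible(2)[OF _ PL[OF that]] by blast
  have DP: "\<exists>w\<in>PN_feasible m p \<B> l \<xi> N. represents N w G \<and> PN_cost m p l w = DN_cost m p \<Gamma> l N G"
    if "G \<in> DN_feasible m p \<Gamma> l \<xi> N" for G
    using DN_feasible_represents[OF that] represented_PN_feasible[OF that] by blast
  show "PN_cost m p l ` PN_feasible m p \<B> l \<xi> N = DN_cost m p \<Gamma> l N ` DN_feasible m p \<Gamma> l \<xi> N"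
  proof (intro equalityI image_subsetI)
    show "PN_cost m p l w \<in> DN_cost m p \<Gamma> l N ` DN_feasible m p \<Gamma> l \<xi> N" if "w \<in> PN_feasible m p \<B> l \<xi> N" for w
      using PD[OF that] by auto
    show "DN_cost m p \<Gamma> l N G \<in> PN_cost m p l ` PN_feasible m p \<B> l \<xi> N" if "G \<in> DN_feasible m p \<Gamma> l \<xi> N" for G
      using DP[OF that] by (metis image_eqI)
  qed
  assume w: "w \<in> L2v (m + p)"
  show "PN_solution m p \<B> l \<xi> N w \<longleftrightarrow> (\<exists>G. DN_solution m p \<Gamma> l \<xi> N G \<and> represents N w G)"
  proof
    assume "PN_solution m p \<B> l \<xi> N w"
    then have wf: "w \<in> PN_feasible m p \<B> l \<xi> N"
      and min: "\<And>w'. w' \<in> PN_feasible m p \<B> l \<xi> N \<Longrightarrow> \<not> PN_cost m p l w' < PN_cost m p l w"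
      by (auto simp: PN_solution_def is_arg_min_def)
    obtain G where G: "G \<in> DN_feasible m p \<Gamma> l \<xi> N" "represents N w G" "PN_cost m p l w = DN_cost m p \<Gamma> l N G"
      using PD[OF wf] by blast
    have "\<not> DN_cost m p \<Gamma> l N H < DN_cost m p \<Gamma> l N G" if H: "H \<in> DN_feasible m p \<Gamma> l \<xi> N" for H
      using DP[OF H] min G(3) by metis
    then have "DN_solution m p \<Gamma> l \<xi> N G" using G(1) by (auto simp: DN_solution_def is_arg_min_def)
    then show "\<exists>G. DN_solution m p \<Gamma> l \<xi> N G \<and> represents N w G" using G(2) by blast
  next
    assume "\<exists>G. DN_solution m p \<Gamma> l \<xi> N G \<and> represents N w G"
    then obtain G where G: "G \<in> DN_feasible m p \<Gamma> l \<xi> N" "represents N w G"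
      and min: "\<And>H. H \<in> DN_feasible m p \<Gamma> l \<xi> N \<Longrightarrow> \<not> DN_cost m p \<Gamma> l N H < DN_cost m p \<Gamma> l N G"
      by (auto simp: DN_solution_def is_arg_min_def)
    note wf = represented_PN_feasible[OF G(1) w G(2)]
    have "\<not> PN_cost m p l w' < PN_cost m p l w" if w': "w' \<in> PN_feasible m p \<B> l \<xi> N" for w'
      using PD[OF w'] min wf(2) by metis
    then show "PN_solution m p \<B> l \<xi> N w" using wf(1) by (auto simp: PN_solution_def is_arg_min_def)
  qed
qed

end

theorem proposition26:
  fixes m p N l L :: nat
    and \<B> :: "(real \<Rightarrow> real vec) set"
    and ubar ybar :: "real \<Rightarrow> real vec"
    and \<Gamma> :: "real mat" and \<xi> :: "real vec"
  assumes "linear_differential_behavior (m + p) \<B>"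
    and "\<exists>n A B C D. iso_representation m p \<B> n A B C D"
    and "controllable \<B>"
    and "l = lag m p \<B>" and "L = l + 1"
    and "(\<lambda>t. ubar t @\<^sub>v ybar t) \<in> \<B>"
    and "persistently_exciting m (L + McMillan_degree m p \<B>) ubar"
    and "\<Gamma> = Gramian m p L L ubar ybar"
    and "\<xi> \<in> carrier_vec (l * (m + p))"
  shows "(\<forall>w \<in> L2v (m + p).
            PN_solution m p \<B> l \<xi> N w \<longleftrightarrow>
            (\<exists>g. DN_solution m p \<Gamma> l \<xi> N g \<and>
               (\<forall>k\<le>l.
                  (AE t in leb_I. weak_derivv m k (input_part m w) t =
                     finsum_vec TYPE(real) m
                       (\<lambda>i. poly (legendre i) t \<cdot>\<^sub>v (Gram_u m \<Gamma> k *\<^sub>v g i)) {..<N}) \<and>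
                  (AE t in leb_I. weak_derivv p k (output_part p w) t =
                     finsum_vec TYPE(real) p
                       (\<lambda>i. poly (legendre i) t \<cdot>\<^sub>v (Gram_y m p L \<Gamma> k *\<^sub>v g i)) {..<N}))))
       \<and> (INF w \<in> PN_feasible m p \<B> l \<xi> N. ereal (PN_cost m p l w)) =
         (INF g \<in> DN_feasible m p \<Gamma> l \<xi> N. ereal (DN_cost m p \<Gamma> l N g))"
proof -
  obtain g r R where R: "\<And>i. i \<le> r \<Longrightarrow> R i \<in> carrier_mat g (m + p)" and \<B>: "\<B> = kernel_behavior (m + p) g r R"
    using assms(1) unfolding linear_differential_behavior_def by blast
  \<comment> \<open>A representation whose state dimension is the McMillan degree is chosen, so that
    the assumed order of excitation allows n further differentiations.\<close>
  define n where "n = McMillan_degree m p \<B>"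
  have "\<exists>A B C D. iso_representation m p \<B> n A B C D"
    unfolding n_def McMillan_degree_def by (rule LeastI_ex[OF assms(2)])
  then obtain A B C D where rep: "iso_representation m p (kernel_behavior (m + p) g r R) n A B C D"
    unfolding \<B> by blast
  have A: "A \<in> carrier_mat n n" and C: "C \<in> carrier_mat p n" using rep by (auto simp: iso_representation_def)
  interpret iso_system m p g n "kernel_rows r R" "ent A" "ent B" "ent C" "ent D"
    by (rule iso_system_of_representation[OF R rep])
  have l: "l = lag_of_pair n A C"
    unfolding assms(4) \<B> by (rule lag_eq_lag_of_pair[OF R rep])
  obtain M where M: "\<And>i j. i < p \<Longrightarrow> j < n \<Longrightarrow> row_pow n (ent A) (ent C i) l j =
      (\<Sum>k<l. \<Sum>i'<p. M i k i' * row_pow n (ent A) (ent C i') k j)"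
    using lag_relation[OF A C l] by blast
  have beh: "w \<in> \<B> \<longleftrightarrow> w \<in> unit_ivl \<rightarrow> carrier_vec (m + p) \<and>
      weak_sol m p g (kernel_rows r R) (\<lambda>i t. w t $ i) (\<lambda>i t. w t $ (m + i))" for w
    unfolding \<B> by (rule kernel_behavior_weak_sol[OF R])
  let ?w = "\<lambda>t. ubar t @\<^sub>v ybar t"
  have pe: "persistently_exciting m (l + 1 + n) ubar" using assms(7) by (simp add: assms(5) n_def)
  have bar: "?w \<in> unit_ivl \<rightarrow> carrier_vec (m + p)"
    and Wbar: "weak_sol m p g (kernel_rows r R) (\<lambda>i t. ?w t $ i) (\<lambda>i t. ?w t $ (m + i))"
    using beh[of ?w] assms(6) by blast+
  \<comment> \<open>The stacked signal fixes only the total dimension m + p; excitation provides the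
    dimension of \<open>ubar\<close>, which leaves p entries for \<open>ybar\<close>.\<close>
  have "ubar \<in> L2v m" using pe by (simp add: persistently_exciting_def sobolev_def)
  then have uc: "dim_vec (ubar t) = m" if "t \<in> unit_ivl" for t using that by (rule L2v_dim)
  have yc: "dim_vec (ybar t) = p" if "t \<in> unit_ivl" for t
    using carrier_vecD[OF funcset_mem[OF bar that]] uc[OF that] by simp
  have W: "weak_sol m p g (kernel_rows r R) (\<lambda>i t. ubar t $ i) (\<lambda>i t. ybar t $ i)"
  proof -
    have "weak_sol m p g (kernel_rows r R) (\<lambda>i t. ?w t $ i) (\<lambda>i t. ?w t $ (m + i)) \<longleftrightarrow>
        weak_sol m p g (kernel_rows r R) (\<lambda>i t. ubar t $ i) (\<lambda>i t. ybar t $ i)"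
      by (rule weak_sol_cong) (use uc yc in simp_all)
    with Wbar show ?thesis by blast
  qed
  obtain x where S: "state_sol m p n (ent A) (ent B) (ent C) (ent D) (\<lambda>i t. ubar t $ i) (\<lambda>i t. ybar t $ i) x"
    using weak_sol_state[OF W] by blast
  have "data_system m p n l (ent A) (ent B) (ent C) (ent D) (Gramian m p (l + 1) (l + 1) ubar ybar)"
  proof (rule data_system_Gramian[OF S _ _ pe])
    show "\<exists>t1 u y. 0 < t1 \<and> t1 < 1 \<and> weak_sol m p g (kernel_rows r R) u y \<and>
        (AE t in leb_I. t \<le> 0 \<longrightarrow> (\<forall>i<m. u i t = u0 i t) \<and> (\<forall>i<p. y i t = y0 i t)) \<and>
        (AE t in leb_I. t1 \<le> t \<longrightarrow> (\<forall>i<m. u i t = 0) \<and> (\<forall>i<p. y i t = 0))"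
      if "weak_sol m p g (kernel_rows r R) u0 y0" for u0 y0
      by (rule controllable_weak_sol[OF R assms(3)[unfolded \<B>] that])
  qed (use W in \<open>auto simp: weak_sol_def\<close>)
  then interpret data_system m p n l "ent A" "ent B" "ent C" "ent D" \<Gamma> by (simp add: assms(5,8))
  interpret driven_behavior m p g n l "kernel_rows r R" "ent A" "ent B" "ent C" "ent D" \<Gamma> M \<B>
    by unfold_locales (use M beh in auto)
  \<comment> \<open>The infima are those of equal sets of costs; in the extended reals this includes
    the case of empty feasible sets.\<close>
  have "(INF w \<in> PN_feasible m p \<B> l \<xi> N. ereal (PN_cost m p l w)) =
      Inf (ereal ` (PN_cost m p l ` PN_feasible m p \<B> l \<xi> N))" by (simp only: image_image)
  also have "\<dots> = (INF g \<in> DN_feasible m p \<Gamma> l \<xi> N. ereal (DN_cost m p \<Gamma> l N g))"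
    unfolding PN_DN_correspondence(2) by (simp only: image_image)
  finally show ?thesis
    using PN_DN_correspondence(1) unfolding represents_def assms(5) by blast
qed

end
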